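(* Let $\mathbf{A}$ be a commutative ring and let $\mathbf{B}$ be a commutative $\mathbf{A}$-algebra which is a finitely generated projective $\mathbf{A}$-module. Let $\Omega_{\mathbf{B}/\mathbf{A}}$ be the $\mathbf{B}$-module of (Kähler) differentials of $\mathbf{B}/\mathbf{A}$, $\mathrm{N}_{\mathbf{B}/\mathbf{A}}:\mathbf{B}\to\mathbf{A}$ the norm, and $\mathrm{Disc}(\mathbf{B}/\mathbf{A})$ the discriminant ideal of $\mathbf{B}/\mathbf{A}$. 1. The $\mathbf{B}$-module $\Omega_{\mathbf{B}/\mathbf{A}}$ is finitely presented, and for every $b\in\mathcal{F}_0(\Omega_{\mathbf{B}/\mathbf{A}})$ the discriminant of $\mathbf{B}/\mathbf{A}$ divides $\mathrm{N}_{\mathbf{B}/\mathbf{A}}(b)$, i.e. $\mathrm{N}_{\mathbf{B}/\mathbf{A}}(b)\in\mathrm{Disc}(\mathbf{B}/\mathbf{A})$. 2. If $\Omega_{\mathbf{B}/\mathbf{A}}=0$, then the discriminant of $\mathbf{B}/\mathbf{A}$ is invertible, i.e. $\mathrm{Disc}(\mathbf{B}/\mathbf{A})=\mathbf{A}$.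
   Context: For $b\in\mathbf{B}$, $\mathrm{Tr}_{\mathbf{B}/\mathbf{A}}(b)$ and $\mathrm{N}_{\mathbf{B}/\mathbf{A}}(b)$ are the trace and the determinant of the endomorphism "multiplication by $b$" of the finitely generated projective $\mathbf{A}$-module $\mathbf{B}$. For a free algebra of finite rank with basis $(\varepsilon_1,\dots,\varepsilon_n)$ the discriminant is $\det\big((\mathrm{Tr}(\varepsilon_i\varepsilon_j))_{i,j}\big)$, defined up to the square of a unit. In the projective case the discriminant is understood locally: there are elements $s_1,\dots,s_r$ of $\mathbf{A}$ generating the unit ideal such that each $\mathbf{A}_{s_i}\otimes_{\mathbf{A}}\mathbf{B}$ is free of finite rank over $\mathbf{A}_{s_i}=\mathbf{A}[1/s_i]$, and $\mathrm{Disc}(\mathbf{B}/\mathbf{A})$ is the unique ideal of $\mathbf{A}$ whose extension to each $\mathbf{A}_{s_i}$ is the principal ideal generated by the discriminant of a basis of $\mathbf{A}_{s_i}\otimes_{\mathbf{A}}\mathbf{B}$ over $\mathbf{A}_{s_i}$ (it does not depend on the choice of the $s_i$). For a finitely presented module $M$ over a commutative ring, given by $m$ generators and finitely many relations, $\mathcal{F}_0(M)$ is the ideal generated by the $m\times m$ minors of a presentation matrix (the $0$-th Fitting ideal). *)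

theory Defs
  imports "HOL-Algebra.Module" "HOL-Algebra.QuotRing" "HOL-Combinatorics.Permutations"
begin

text \<open>
  Rings and modules are the records and locales of \<^theory>\<open>HOL-Algebra.Module\<close>; a commutative
  algebra \<open>B\<close> over a commutative ring \<open>A\<close> is an instance \<open>algebra A B\<close> of the locale
  \<^locale>\<open>algebra\<close>. The zero ring is allowed for \<open>A\<close> and for \<open>B\<close>.
\<close>

section \<open>Matrices\<close>

text \<open>An \<open>n \<times> n\<close> matrix is a function on pairs of indices, of which only the values at
  indices below \<open>n\<close> matter. The determinant is given by the Leibniz formula.\<close>

definition mat_det :: "('a, 'm) ring_scheme \<Rightarrow> nat \<Rightarrow> (nat \<Rightarrow> nat \<Rightarrow> 'a) \<Rightarrow> 'a" where
  "mat_det R n M =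
    (\<Oplus>\<^bsub>R\<^esub> p \<in> {p. p permutes {..<n}}.
      if evenperm p then (\<Otimes>\<^bsub>R\<^esub> i \<in> {..<n}. M i (p i))
      else \<ominus>\<^bsub>R\<^esub> (\<Otimes>\<^bsub>R\<^esub> i \<in> {..<n}. M i (p i)))"

definition mat_trace :: "('a, 'm) ring_scheme \<Rightarrow> nat \<Rightarrow> (nat \<Rightarrow> nat \<Rightarrow> 'a) \<Rightarrow> 'a" where
  "mat_trace R n M = (\<Oplus>\<^bsub>R\<^esub> i \<in> {..<n}. M i i)"

text \<open>The \<open>m \<times> m\<close> minors of a matrix with \<open>k\<close> rows and \<open>m\<close> columns.\<close>

definition maximal_minors :: "('a, 'm) ring_scheme \<Rightarrow> nat \<Rightarrow> nat \<Rightarrow> (nat \<Rightarrow> nat \<Rightarrow> 'a) \<Rightarrow> 'a set" where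
  "maximal_minors R k m P =
    {mat_det R m (\<lambda>i j. P (r i) j) | r. strict_mono_on {..<m} r \<and> r ` {..<m} \<subseteq> {..<k}}"


section \<open>Modules\<close>

definition linear_map ::
  "('r, 'k) ring_scheme \<Rightarrow> ('r, 'a, 'm) module_scheme \<Rightarrow> ('r, 'b, 'n) module_scheme \<Rightarrow> ('a \<Rightarrow> 'b) \<Rightarrow> bool" where
  "linear_map R M N f \<longleftrightarrow>
    f \<in> carrier M \<rightarrow> carrier N \<and>
    (\<forall>x\<in>carrier M. \<forall>y\<in>carrier M. f (x \<oplus>\<^bsub>M\<^esub> y) = f x \<oplus>\<^bsub>N\<^esub> f y) \<and>
    (\<forall>a\<in>carrier R. \<forall>x\<in>carrier M. f (a \<odot>\<^bsub>M\<^esub> x) = a \<odot>\<^bsub>N\<^esub> f x)"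

text \<open>The multiplicative fields of this record play no role.\<close>

definition free_module :: "('r, 'k) ring_scheme \<Rightarrow> 'x set \<Rightarrow> ('r, 'x \<Rightarrow> 'r) module" where
  "free_module R U =
    \<lparr> carrier = {f. (\<forall>x\<in>U. f x \<in> carrier R) \<and> (\<forall>x. x \<notin> U \<longrightarrow> f x = \<zero>\<^bsub>R\<^esub>) \<and>
                    finite {x. f x \<noteq> \<zero>\<^bsub>R\<^esub>}},
      monoid.mult = undefined, one = undefined,
      zero = (\<lambda>x. \<zero>\<^bsub>R\<^esub>), add = (\<lambda>f g x. f x \<oplus>\<^bsub>R\<^esub> g x),
      smult = (\<lambda>a f x. a \<otimes>\<^bsub>R\<^esub> f x) \<rparr>"

definition free_gen :: "('r, 'k) ring_scheme \<Rightarrow> 'x \<Rightarrow> 'x \<Rightarrow> 'r" where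
  "free_gen R x = (\<lambda>y. if y = x then \<one>\<^bsub>R\<^esub> else \<zero>\<^bsub>R\<^esub>)"

definition span_submodule ::
  "('r, 'k) ring_scheme \<Rightarrow> ('r, 'a, 'm) module_scheme \<Rightarrow> 'a set \<Rightarrow> 'a set" where
  "span_submodule R M S = \<Inter>{N. submodule N R M \<and> S \<subseteq> N}"

text \<open>As in the quotient ring \<^const>\<open>FactRing\<close>, elements are cosets. The multiplicative fields are
  only of interest if \<open>M\<close> is an algebra and \<open>N\<close> an ideal.\<close>

definition quotient_module ::
  "('r, 'a, 'm) module_scheme \<Rightarrow> 'a set \<Rightarrow> ('r, 'a set) module" where
  "quotient_module M N =
    \<lparr> carrier = a_rcosets\<^bsub>M\<^esub> N,
      monoid.mult = rcoset_mult M N, one = N +>\<^bsub>M\<^esub> \<one>\<^bsub>M\<^esub>,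
      zero = N, add = set_add M,
      smult = (\<lambda>a U. \<Union>x\<in>U. N +>\<^bsub>M\<^esub> (a \<odot>\<^bsub>M\<^esub> x)) \<rparr>"

definition module_basis ::
  "('r, 'k) ring_scheme \<Rightarrow> ('r, 'a, 'm) module_scheme \<Rightarrow> nat \<Rightarrow> (nat \<Rightarrow> 'a) \<Rightarrow> bool" where
  "module_basis R M n e \<longleftrightarrow>
    e \<in> {..<n} \<rightarrow> carrier M \<and>
    (\<forall>x\<in>carrier M. \<exists>!c. c \<in> {..<n} \<rightarrow>\<^sub>E carrier R \<and> x = (\<Oplus>\<^bsub>M\<^esub> i \<in> {..<n}. c i \<odot>\<^bsub>M\<^esub> e i))"

text \<open>The map \<open>i\<close> identifies \<open>M\<close> with a direct summand of \<open>R\<^sup>n\<close>, whose complement is the kernel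
  of \<open>p\<close>.\<close>

definition direct_summand ::
  "('r, 'k) ring_scheme \<Rightarrow> ('r, 'a, 'm) module_scheme \<Rightarrow> nat \<Rightarrow> ('a \<Rightarrow> nat \<Rightarrow> 'r) \<Rightarrow> ((nat \<Rightarrow> 'r) \<Rightarrow> 'a) \<Rightarrow> bool" where
  "direct_summand R M n i p \<longleftrightarrow>
    linear_map R M (free_module R {..<n}) i \<and> linear_map R (free_module R {..<n}) M p \<and>
    (\<forall>x\<in>carrier M. p (i x) = x)"

definition fg_projective :: "('r, 'k) ring_scheme \<Rightarrow> ('r, 'a, 'm) module_scheme \<Rightarrow> bool" where
  "fg_projective R M \<longleftrightarrow> module R M \<and> (\<exists>n i p. direct_summand R M n i p)"


section \<open>Trace and determinant\<close>

text \<open>Let \<open>M\<close> be finitely generated projective and \<open>M \<oplus> N \<cong> R\<^sup>n\<close>. The trace and the determinant of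
  an endomorphism \<open>\<phi>\<close> of \<open>M\<close> are those of the endomorphisms \<open>\<phi> \<oplus> 0\<close> and \<open>\<phi> \<oplus> id\<close> of
  \<open>R\<^sup>n\<close>; they do not depend on the choice of \<open>n\<close>, \<open>N\<close> and of the isomorphism. With \<open>i\<close> and \<open>p\<close> as
  in \<^const>\<open>direct_summand\<close>, these endomorphisms are \<open>i \<circ> \<phi> \<circ> p\<close> and \<open>id - i \<circ> p + i \<circ> \<phi> \<circ> p\<close>.\<close>

definition endo_trace ::
  "('r, 'k) ring_scheme \<Rightarrow> ('r, 'a, 'm) module_scheme \<Rightarrow> ('a \<Rightarrow> 'a) \<Rightarrow> 'r" where
  "endo_trace R M \<phi> =
    (THE t. \<exists>n i p. direct_summand R M n i p \<and>
      t = mat_trace R n (\<lambda>k l. i (\<phi> (p (free_gen R l))) k))"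

definition endo_det ::
  "('r, 'k) ring_scheme \<Rightarrow> ('r, 'a, 'm) module_scheme \<Rightarrow> ('a \<Rightarrow> 'a) \<Rightarrow> 'r" where
  "endo_det R M \<phi> =
    (THE d. \<exists>n i p. direct_summand R M n i p \<and>
      d = mat_det R n (\<lambda>k l. (free_gen R l k \<ominus>\<^bsub>R\<^esub> i (p (free_gen R l)) k) \<oplus>\<^bsub>R\<^esub> i (\<phi> (p (free_gen R l))) k))"

definition algebra_trace :: "('a, 'k) ring_scheme \<Rightarrow> ('a, 'b, 'm) module_scheme \<Rightarrow> 'b \<Rightarrow> 'a" where
  "algebra_trace A B b = endo_trace A B (\<lambda>x. b \<otimes>\<^bsub>B\<^esub> x)"

definition algebra_norm :: "('a, 'k) ring_scheme \<Rightarrow> ('a, 'b, 'm) module_scheme \<Rightarrow> 'b \<Rightarrow> 'a" where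
  "algebra_norm A B b = endo_det A B (\<lambda>x. b \<otimes>\<^bsub>B\<^esub> x)"

definition basis_discriminant ::
  "('a, 'k) ring_scheme \<Rightarrow> ('a, 'b, 'm) module_scheme \<Rightarrow> nat \<Rightarrow> (nat \<Rightarrow> 'b) \<Rightarrow> 'a" where
  "basis_discriminant A B n e = mat_det A n (\<lambda>i j. algebra_trace A B (e i \<otimes>\<^bsub>B\<^esub> e j))"


section \<open>The localization \<open>A[1/s]\<close>\<close>

definition fraction_rel :: "('a, 'k) ring_scheme \<Rightarrow> 'a \<Rightarrow> (('a \<times> nat) \<times> ('a \<times> nat)) set" where
  "fraction_rel A s =
    {((x, m), (y, n)) | x m y n. x \<in> carrier A \<and> y \<in> carrier A \<and>
      (\<exists>k::nat. s [^]\<^bsub>A\<^esub> k \<otimes>\<^bsub>A\<^esub> (s [^]\<^bsub>A\<^esub> n \<otimes>\<^bsub>A\<^esub> x) = s [^]\<^bsub>A\<^esub> k \<otimes>\<^bsub>A\<^esub> (s [^]\<^bsub>A\<^esub> m \<otimes>\<^bsub>A\<^esub> y))}"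

text \<open>\<open>fraction A s x m\<close> is the fraction \<open>x / s\<^sup>m\<close>.\<close>

definition fraction :: "('a, 'k) ring_scheme \<Rightarrow> 'a \<Rightarrow> 'a \<Rightarrow> nat \<Rightarrow> ('a \<times> nat) set" where
  "fraction A s x m = fraction_rel A s `` {(x, m)}"

definition localization :: "('a, 'k) ring_scheme \<Rightarrow> 'a \<Rightarrow> ('a, ('a \<times> nat) set) module" where
  "localization A s =
    \<lparr> carrier = (carrier A \<times> UNIV) // fraction_rel A s,
      monoid.mult = (\<lambda>U V. \<Union>(x, m)\<in>U. \<Union>(y, n)\<in>V. fraction A s (x \<otimes>\<^bsub>A\<^esub> y) (m + n)),
      one = fraction A s \<one>\<^bsub>A\<^esub> 0,
      zero = fraction A s \<zero>\<^bsub>A\<^esub> 0,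
      add = (\<lambda>U V. \<Union>(x, m)\<in>U. \<Union>(y, n)\<in>V.
               fraction A s (s [^]\<^bsub>A\<^esub> n \<otimes>\<^bsub>A\<^esub> x \<oplus>\<^bsub>A\<^esub> s [^]\<^bsub>A\<^esub> m \<otimes>\<^bsub>A\<^esub> y) (m + n)),
      smult = (\<lambda>a U. \<Union>(x, m)\<in>U. fraction A s (a \<otimes>\<^bsub>A\<^esub> x) m) \<rparr>"


section \<open>The tensor product of algebras\<close>

text \<open>The \<open>A\<close>-module freely generated by the pairs of elements of \<open>C\<close> and \<open>B\<close>, with the
  multiplication that extends the componentwise product of pairs bilinearly.\<close>

definition formal_tensors ::
  "('a, 'k) ring_scheme \<Rightarrow> ('a, 'c, 'l) module_scheme \<Rightarrow> ('a, 'b, 'm) module_scheme \<Rightarrow>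
   ('a, 'c \<times> 'b \<Rightarrow> 'a) module" where
  "formal_tensors A C B =
    (let F = free_module A (carrier C \<times> carrier B)
     in F \<lparr> monoid.mult := (\<lambda>f g. \<Oplus>\<^bsub>F\<^esub> p \<in> {p. f p \<noteq> \<zero>\<^bsub>A\<^esub>}. \<Oplus>\<^bsub>F\<^esub> q \<in> {q. g q \<noteq> \<zero>\<^bsub>A\<^esub>}.
               (f p \<otimes>\<^bsub>A\<^esub> g q) \<odot>\<^bsub>F\<^esub> free_gen A (fst p \<otimes>\<^bsub>C\<^esub> fst q, snd p \<otimes>\<^bsub>B\<^esub> snd q)),
           one := free_gen A (\<one>\<^bsub>C\<^esub>, \<one>\<^bsub>B\<^esub>) \<rparr>)"

definition tensor_relations ::
  "('a, 'k) ring_scheme \<Rightarrow> ('a, 'c, 'l) module_scheme \<Rightarrow> ('a, 'b, 'm) module_scheme \<Rightarrow>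
   ('c \<times> 'b \<Rightarrow> 'a) set" where
  "tensor_relations A C B =
    (let F = formal_tensors A C B in
      {free_gen A (c \<oplus>\<^bsub>C\<^esub> c', b) \<ominus>\<^bsub>F\<^esub> (free_gen A (c, b) \<oplus>\<^bsub>F\<^esub> free_gen A (c', b)) | c c' b.
         c \<in> carrier C \<and> c' \<in> carrier C \<and> b \<in> carrier B} \<union>
      {free_gen A (c, b \<oplus>\<^bsub>B\<^esub> b') \<ominus>\<^bsub>F\<^esub> (free_gen A (c, b) \<oplus>\<^bsub>F\<^esub> free_gen A (c, b')) | c b b'.
         c \<in> carrier C \<and> b \<in> carrier B \<and> b' \<in> carrier B} \<union>
      {free_gen A (a \<odot>\<^bsub>C\<^esub> c, b) \<ominus>\<^bsub>F\<^esub> a \<odot>\<^bsub>F\<^esub> free_gen A (c, b) | a c b.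
         a \<in> carrier A \<and> c \<in> carrier C \<and> b \<in> carrier B} \<union>
      {free_gen A (c, a \<odot>\<^bsub>B\<^esub> b) \<ominus>\<^bsub>F\<^esub> a \<odot>\<^bsub>F\<^esub> free_gen A (c, b) | a c b.
         a \<in> carrier A \<and> c \<in> carrier C \<and> b \<in> carrier B})"

definition tensor_product ::
  "('a, 'k) ring_scheme \<Rightarrow> ('a, 'c, 'l) module_scheme \<Rightarrow> ('a, 'b, 'm) module_scheme \<Rightarrow>
   ('a, ('c \<times> 'b \<Rightarrow> 'a) set) module" where
  "tensor_product A C B =
    quotient_module (formal_tensors A C B)
      (span_submodule A (formal_tensors A C B) (tensor_relations A C B))"

definition pure_tensor ::
  "('a, 'k) ring_scheme \<Rightarrow> ('a, 'c, 'l) module_scheme \<Rightarrow> ('a, 'b, 'm) module_scheme \<Rightarrow>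
   'c \<Rightarrow> 'b \<Rightarrow> ('c \<times> 'b \<Rightarrow> 'a) set" where
  "pure_tensor A C B c b =
    span_submodule A (formal_tensors A C B) (tensor_relations A C B)
      +>\<^bsub>formal_tensors A C B\<^esub> free_gen A (c, b)"

text \<open>\<open>C \<otimes>\<^sub>A B\<close> as a \<open>C\<close>-algebra.\<close>

definition base_change ::
  "('a, 'k) ring_scheme \<Rightarrow> ('a, 'c, 'l) module_scheme \<Rightarrow> ('a, 'b, 'm) module_scheme \<Rightarrow>
   ('c, ('c \<times> 'b \<Rightarrow> 'a) set) module" where
  "base_change A C B =
    (let T = tensor_product A C B in
     \<lparr> carrier = carrier T, monoid.mult = monoid.mult T, one = one T, zero = zero T, add = add T,
       smult = (\<lambda>c t. pure_tensor A C B c \<one>\<^bsub>B\<^esub> \<otimes>\<^bsub>T\<^esub> t) \<rparr>)"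


section \<open>The discriminant ideal\<close>

definition extended_ideal :: "('a, 'k) ring_scheme \<Rightarrow> 'a \<Rightarrow> 'a set \<Rightarrow> ('a \<times> nat) set set" where
  "extended_ideal A s D = Idl\<^bsub>localization A s\<^esub> ((\<lambda>a. fraction A s a 0) ` D)"

definition discriminant_ideal :: "('a, 'k) ring_scheme \<Rightarrow> ('a, 'b, 'm) module_scheme \<Rightarrow> 'a set" where
  "discriminant_ideal A B =
    (THE D. ideal D A \<and>
      (\<exists>S. finite S \<and> S \<subseteq> carrier A \<and> Idl\<^bsub>A\<^esub> S = carrier A \<and>
        (\<forall>s\<in>S. \<exists>n e. module_basis (localization A s) (base_change A (localization A s) B) n e \<and>
          extended_ideal A s D =
            Idl\<^bsub>localization A s\<^esub>
              {basis_discriminant (localization A s) (base_change A (localization A s) B) n e})))"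


section \<open>Finitely presented modules and the Fitting ideal\<close>

text \<open>The elements \<open>x\<^sub>0, \<dots>, x\<^bsub>m-1\<^esub>\<close> generate \<open>M\<close>, and the \<open>k\<close> rows of \<open>P\<close> generate the module of
  relations between them.\<close>

definition presentation ::
  "('r, 'l) ring_scheme \<Rightarrow> ('r, 'a, 'm) module_scheme \<Rightarrow> nat \<Rightarrow> (nat \<Rightarrow> 'a) \<Rightarrow> nat \<Rightarrow> (nat \<Rightarrow> nat \<Rightarrow> 'r) \<Rightarrow> bool" where
  "presentation R M m x k P \<longleftrightarrow>
    x \<in> {..<m} \<rightarrow> carrier M \<and>
    (\<forall>i<k. \<forall>j<m. P i j \<in> carrier R) \<and>
    (\<forall>y\<in>carrier M. \<exists>c\<in>{..<m} \<rightarrow> carrier R. y = (\<Oplus>\<^bsub>M\<^esub> j \<in> {..<m}. c j \<odot>\<^bsub>M\<^esub> x j)) \<and>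
    (\<forall>c\<in>{..<m} \<rightarrow> carrier R.
      (\<Oplus>\<^bsub>M\<^esub> j \<in> {..<m}. c j \<odot>\<^bsub>M\<^esub> x j) = \<zero>\<^bsub>M\<^esub> \<longleftrightarrow>
      (\<exists>u\<in>{..<k} \<rightarrow> carrier R. \<forall>j<m. c j = (\<Oplus>\<^bsub>R\<^esub> i \<in> {..<k}. u i \<otimes>\<^bsub>R\<^esub> P i j)))"

definition finitely_presented :: "('r, 'l) ring_scheme \<Rightarrow> ('r, 'a, 'm) module_scheme \<Rightarrow> bool" where
  "finitely_presented R M \<longleftrightarrow> module R M \<and> (\<exists>m x k P. presentation R M m x k P)"

text \<open>All presentations of \<open>M\<close> give the same ideal (Fitting's lemma), so that the union is over
  a family with at most one member.\<close>

definition fitting_ideal_0 :: "('r, 'l) ring_scheme \<Rightarrow> ('r, 'a, 'm) module_scheme \<Rightarrow> 'r set" where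
  "fitting_ideal_0 R M =
    \<Union>{Idl\<^bsub>R\<^esub> (maximal_minors R k m P) | m x k P. presentation R M m x k P}"


section \<open>Differentials\<close>

text \<open>The \<open>B\<close>-module generated by symbols \<open>d b\<close>, here \<open>free_gen B b\<close>, with the relations which make
  \<open>d\<close> an \<open>A\<close>-derivation.\<close>

definition kaehler_relations ::
  "('a, 'k) ring_scheme \<Rightarrow> ('a, 'b, 'm) module_scheme \<Rightarrow> ('b \<Rightarrow> 'b) set" where
  "kaehler_relations A B =
    (let F = free_module B (carrier B) in
      {free_gen B (b \<oplus>\<^bsub>B\<^esub> b') \<ominus>\<^bsub>F\<^esub> (free_gen B b \<oplus>\<^bsub>F\<^esub> free_gen B b') | b b'.
         b \<in> carrier B \<and> b' \<in> carrier B} \<union>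
      {free_gen B (b \<otimes>\<^bsub>B\<^esub> b') \<ominus>\<^bsub>F\<^esub> (b \<odot>\<^bsub>F\<^esub> free_gen B b' \<oplus>\<^bsub>F\<^esub> b' \<odot>\<^bsub>F\<^esub> free_gen B b) | b b'.
         b \<in> carrier B \<and> b' \<in> carrier B} \<union>
      {free_gen B (a \<odot>\<^bsub>B\<^esub> \<one>\<^bsub>B\<^esub>) | a. a \<in> carrier A})"

definition kaehler_differentials ::
  "('a, 'k) ring_scheme \<Rightarrow> ('a, 'b, 'm) module_scheme \<Rightarrow> ('b, ('b \<Rightarrow> 'b) set) module" where
  "kaehler_differentials A B =
    quotient_module (free_module B (carrier B))
      (span_submodule B (free_module B (carrier B)) (kaehler_relations A B))"

end

theory Submission
  imports "HOL-Library.Poly_Mapping" "Jordan_Normal_Form.Determinant" Defs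
begin

text \<open>
  Let \<open>e\<^sub>l\<close>, \<open>f\<^sub>l\<close> be a dual basis of \<open>B\<close> over \<open>A\<close> and let \<open>J\<close> be the kernel of the
  multiplication \<open>\<mu> : B \<otimes>\<^sub>A B \<rightarrow> B\<close>, so that \<open>d b \<mapsto> 1 \<otimes> b - b \<otimes> 1\<close> maps \<open>\<Omega>\<close> to \<open>J / J\<^sup>2\<close>. By the
  determinant trick, every maximal minor \<open>b\<close> of a presentation matrix of \<open>\<Omega>\<close> is \<open>\<mu> z\<close> for some \<open>z\<close>
  which annihilates \<open>J\<close> (Fitting ideals lie in the Noether different). Applying \<open>Tr \<otimes> id\<close> to such
  a \<open>z = \<Sum> e\<^sub>l \<otimes> c\<^sub>l\<close> gives \<open>x b = \<Sum>\<^sub>l Tr (x e\<^sub>l) c\<^sub>l\<close> for all \<open>x\<close>. Over a localization with a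
  basis this says that the matrix of the multiplication by \<open>b\<close> is the trace matrix of the basis
  times another matrix, hence the discriminant divides \<open>N b\<close>. If \<open>\<Omega> = 0\<close>, then \<open>b = 1\<close> is the
  minor of the empty presentation.

  For a set \<open>I\<close> of indices let \<open>s\<^sub>I\<close> be the determinant of the matrix whose rows with index in \<open>I\<close>
  are those of the idempotent matrix \<open>p = (f\<^sub>l (e\<^sub>k))\<close> and whose other rows are those of \<open>1 - p\<close>. The
  \<open>s\<^sub>I\<close> sum up to \<open>det (p + (1 - p)) = 1\<close>, and inverting \<open>s\<^sub>I\<close> turns \<open>(e\<^sub>k)\<^sub>k\<^sub>\<in>\<^sub>I\<close> into a basis of \<open>B\<close>.
\<close>

section \<open>Identities between determinants\<close>

text \<open>\<open>discriminant_ideal\<close> is a definite description over all finite covers on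
  which \<open>B\<close> becomes free, so nothing can be said about it before existence and
  uniqueness are settled. This is the longer half of the proof. The obstacle is that two covers, and
  two elements of one cover, live over different rings. Hence every statement over
  \<open>A[1/s]\<close> is rewritten as a statement over \<open>A\<close> that holds up to a power
  of \<open>s\<close>; finiteness of covers and bases allows one exponent for all. Where the ranks
  of two local bases differ, the common localization is zero, and this degenerate case has to be
  carried along.

  The trace formula is global: it comes from a dual basis over \<open>A\<close>, and only its
  consequence for determinants uses a local basis. The formula is linear in \<open>b\<close> whereas
  the norm is not additive, so it is the formula, not the divisibility, that passes from minors to
  the ideal generated by them.

  The determinant trick needs relations that hold in \<open>J\<close>, but \<Omega> yields relations
  modulo \<open>J^2\<close> only. Correcting coefficients by elements of \<open>J\<close> repairs
  this, and \<mu> does not see the correction.\<close>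

locale hom_from_type = R?: cring R for R (structure) +
  fixes h :: "'u::comm_ring_1 \<Rightarrow> 'a"
  assumes hom_closed [simp]: "h x \<in> carrier R"
    and hom_plus: "h (x + y) = h x \<oplus> h y"
    and hom_times: "h (x * y) = h x \<otimes> h y"
    and hom_1: "h 1 = \<one>"
begin

lemma hom_0: "h 0 = \<zero>"
  using hom_plus[of 0 0] by (metis R.add.l_cancel_one' add_0 hom_closed)

lemma hom_uminus: "h (- x) = \<ominus> h x"
  using hom_plus[of "- x" x] by (simp add: R.minus_equality hom_0)

lemma hom_sum: "h (\<Sum>i\<in>I. g i) = (\<Oplus>i\<in>I. h (g i))"
  by (induction I rule: infinite_finite_induct) (auto simp: hom_0 hom_plus)

lemma hom_prod: "finite I \<Longrightarrow> h (\<Prod>i\<in>I. g i) = (\<Otimes>i\<in>I. h (g i))"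
  by (induction I rule: finite_induct) (auto simp: hom_1 hom_times)

text \<open>The bridge between \<open>det\<close>, for matrices over a type of class
  \<open>comm_ring_1\<close>, and \<open>mat_det\<close>, for a ring given by a carrier. Both are
  Leibniz sums, which \<open>h\<close> matches term by term.\<close>

lemma hom_det: "mat_det R n (\<lambda>i j. h (X i j)) = h (det (mat n n (\<lambda>(i, j). X i j)))"
proof -
  have "h (det (mat n n (\<lambda>(i, j). X i j))) =
      h (\<Sum>p | p permutes {..<n}. signof p * (\<Prod>i<n. X i (p i)))"
    unfolding det_def by (auto simp: lessThan_atLeast0 intro!: arg_cong[of _ _ h] sum.cong prod.cong permutes_in_image[THEN iffD2])
  also have "\<dots> = mat_det R n (\<lambda>i j. h (X i j))"
    unfolding hom_sum mat_det_def
    by (intro R.finsum_cong') (auto simp: sign_def hom_prod hom_uminus)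
  finally show ?thesis ..
qed

end

section \<open>Evaluation of integer polynomials in a commutative ring\<close>

context cring
begin

definition monom_value :: "(nat \<Rightarrow> 'a) \<Rightarrow> (nat \<Rightarrow>\<^sub>0 nat) \<Rightarrow> 'a" where
  "monom_value v m = (\<Otimes>x\<in>Poly_Mapping.keys m. v x [^] Poly_Mapping.lookup m x)"

text \<open>Evaluation at the point \<open>v\<close> of a polynomial in countably many variables,
  given by its finitely supported coefficients. Integers act on the ring through
  \<open>add_pow\<close>, whatever its characteristic.\<close>

definition poly_value :: "(nat \<Rightarrow> 'a) \<Rightarrow> ((nat \<Rightarrow>\<^sub>0 nat) \<Rightarrow>\<^sub>0 int) \<Rightarrow> 'a" where
  "poly_value v p = (\<Oplus>m\<in>Poly_Mapping.keys p. add_pow R (Poly_Mapping.lookup p m) (monom_value v m))"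

lemma add_pow_zero: "add_pow R (0::int) x = \<zero>"
  by (simp add: add_pow_def)

text \<open>Two monomials and their product have different supports. Over a common finite set,
  filled up with trivial factors, multiplicativity becomes a termwise matter.\<close>

lemma monom_value_superset:
  assumes "\<And>x. v x \<in> carrier R" "finite S" "Poly_Mapping.keys m \<subseteq> S"
  shows "monom_value v m = (\<Otimes>x\<in>S. v x [^] Poly_Mapping.lookup m x)"
  unfolding monom_value_def
  by (rule finprod_mono_neutral_cong) (use assms in \<open>auto simp: not_in_keys_iff_lookup_eq_zero add_pow_zero\<close>)

lemma monom_value_closed [simp]: "(\<And>x. v x \<in> carrier R) \<Longrightarrow> monom_value v m \<in> carrier R"
  unfolding monom_value_def by auto

lemma monom_value_plus:
  assumes v: "\<And>x. v x \<in> carrier R"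
  shows "monom_value v (m + m') = monom_value v m \<otimes> monom_value v m'"
proof -
  let ?S = "Poly_Mapping.keys m \<union> Poly_Mapping.keys m'"
  have "monom_value v (m + m') = (\<Otimes>x\<in>?S. v x [^] Poly_Mapping.lookup (m + m') x)"
    by (intro monom_value_superset v) (use keys_add[of m m'] in auto)
  also have "\<dots> = (\<Otimes>x\<in>?S. v x [^] Poly_Mapping.lookup m x \<otimes> v x [^] Poly_Mapping.lookup m' x)"
    by (intro finprod_cong') (auto simp: lookup_add nat_pow_mult v)
  also have "\<dots> = (\<Otimes>x\<in>?S. v x [^] Poly_Mapping.lookup m x) \<otimes> (\<Otimes>x\<in>?S. v x [^] Poly_Mapping.lookup m' x)"
    by (intro finprod_multf) (auto simp: v)
  finally show ?thesis
    by (simp add: monom_value_superset[OF v, of ?S])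
qed

lemma poly_value_superset:
  assumes "\<And>x. v x \<in> carrier R" "finite S" "Poly_Mapping.keys p \<subseteq> S"
  shows "poly_value v p = (\<Oplus>m\<in>S. add_pow R (Poly_Mapping.lookup p m) (monom_value v m))"
  unfolding poly_value_def
  by (rule add.finprod_mono_neutral_cong) (use assms in \<open>auto simp: not_in_keys_iff_lookup_eq_zero add_pow_zero\<close>)

lemma poly_value_closed [simp]: "(\<And>x. v x \<in> carrier R) \<Longrightarrow> poly_value v p \<in> carrier R"
  unfolding poly_value_def by auto

lemma poly_value_plus:
  assumes v: "\<And>x. v x \<in> carrier R"
  shows "poly_value v (p + q) = poly_value v p \<oplus> poly_value v q"
proof -
  let ?S = "Poly_Mapping.keys p \<union> Poly_Mapping.keys q"
  let ?t = "\<lambda>p m. add_pow R (Poly_Mapping.lookup p m) (monom_value v m)"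
  have "poly_value v (p + q) = (\<Oplus>m\<in>?S. ?t (p + q) m)"
    by (intro poly_value_superset v) (use keys_add[of p q] in auto)
  also have "\<dots> = (\<Oplus>m\<in>?S. ?t p m \<oplus> ?t q m)"
    by (intro finsum_cong') (auto simp: lookup_add add.int_pow_mult v)
  also have "\<dots> = (\<Oplus>m\<in>?S. ?t p m) \<oplus> (\<Oplus>m\<in>?S. ?t q m)"
    by (intro finsum_addf) (auto simp: v)
  finally show ?thesis
    by (simp add: poly_value_superset[OF v, of ?S])
qed

lemma poly_value_single:
  assumes v: "\<And>x. v x \<in> carrier R"
  shows "poly_value v (Poly_Mapping.single m c) = add_pow R c (monom_value v m)"
  by (subst poly_value_superset[of v "{m}"]) (auto simp: v)

text \<open>Multiplicativity of the evaluation is additive in each factor, so this induction,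
  applied to both factors, leaves only products of two single terms.\<close>

lemma poly_mapping_additive_induct:
  fixes p :: "'m \<Rightarrow>\<^sub>0 int"
  assumes "P 0" "\<And>m c. P (Poly_Mapping.single m c)" "\<And>p q. P p \<Longrightarrow> P q \<Longrightarrow> P (p + q)"
  shows "P p"
proof -
  have "P (\<Sum>m\<in>S. Poly_Mapping.single m (Poly_Mapping.lookup p m))" if "finite S" for S
    using that by induction (auto intro: assms)
  moreover have "p = (\<Sum>m\<in>Poly_Mapping.keys p. Poly_Mapping.single m (Poly_Mapping.lookup p m))"
    by (rule poly_mapping_eqI) (auto simp: lookup_sum lookup_single when_def sum.delta' in_keys_iff)
  ultimately show ?thesis
    by (metis finite_keys)
qed

lemma poly_value_times:
  assumes v: "\<And>x. v x \<in> carrier R"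
  shows "poly_value v (p * q) = poly_value v p \<otimes> poly_value v q"
proof -
  have z: "poly_value v 0 = \<zero>"
    by (simp add: poly_value_def)
  have single: "poly_value v (Poly_Mapping.single m c * q) = poly_value v (Poly_Mapping.single m c) \<otimes> poly_value v q"
    for m c
  proof (induction q rule: poly_mapping_additive_induct)
    case (2 m' c')
    show ?case
      by (simp add: mult_single poly_value_single v monom_value_plus add_pow_ldistr_int add_pow_rdistr_int
          add.int_pow_pow mult.commute m_comm)
  qed (auto simp: z v distrib_left poly_value_plus r_distr)
  show ?thesis
    by (induction p rule: poly_mapping_additive_induct)
      (auto simp: z v single distrib_right poly_value_plus l_distr)
qed

lemma poly_value_one: "(\<And>x. v x \<in> carrier R) \<Longrightarrow> poly_value v 1 = \<one>"
  by (simp add: poly_value_single monom_value_def flip: single_one)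

text \<open>Finitely many elements of a commutative ring lie in the image of a polynomial ring over the
  integers, which is an integral domain: polynomial identities between matrices can be proved there.\<close>

lemma exists_hom_from_poly_ring:
  assumes "finite F" "F \<subseteq> carrier R"
  obtains h :: "((nat \<Rightarrow>\<^sub>0 nat) \<Rightarrow>\<^sub>0 int) \<Rightarrow> 'a" where "hom_from_type R h" "F \<subseteq> range h"
proof -
  obtain g :: "nat \<Rightarrow> 'a" and N where g: "F = g ` {i. i < N}"
    using finite_imp_nat_seg_image_inj_on[OF assms(1)] by blast
  \<comment> \<open>The evaluation is a homomorphism only if all coordinates of the point lie in the
    carrier, also those beyond the finitely many that are prescribed.\<close>
  define v where "v i = (if i < N then g i else \<zero>)" for i
  have v: "v i \<in> carrier R" for i
    using assms(2) g by (auto simp: v_def)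
  have "hom_from_type R (poly_value v)"
    by unfold_locales (auto simp: v poly_value_plus poly_value_times poly_value_one)
  moreover have "poly_value v (Poly_Mapping.single (Poly_Mapping.single i 1) 1) = v i" for i
    by (simp add: poly_value_single v monom_value_def)
  then have "F \<subseteq> range (poly_value v)"
    unfolding g v_def by (smt (verit, best) image_subset_iff mem_Collect_eq rangeI)
  ultimately show thesis
    by (rule that)
qed

end

section \<open>Determinants over integral domains\<close>

abbreviation square_mat :: "nat \<Rightarrow> (nat \<Rightarrow> nat \<Rightarrow> 'a) \<Rightarrow> 'a mat" where
  "square_mat n X \<equiv> mat n n (\<lambda>(i, j). X i j)"

text \<open>Sylvester's identity. The block matrix \<open>M\<close> is multiplied from the right by
  two unitriangular matrices: \<open>L\<close> makes it upper triangular with \<open>1 + X V\<close>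
  in the corner, \<open>U\<close> makes it lower triangular with \<open>1 + V X\<close>. Both
  products have the determinant of \<open>M\<close>.\<close>

lemma det_one_plus_mult_commute:
  fixes X :: "'a::idom mat"
  assumes X: "X \<in> carrier_mat n r" and V: "V \<in> carrier_mat r n"
  shows "det (1\<^sub>m n + X * V) = det (1\<^sub>m r + V * X)"
proof -
  let ?M = "four_block_mat (1\<^sub>m n) (- X) V (1\<^sub>m r)"
  let ?L = "four_block_mat (1\<^sub>m n) (0\<^sub>m n r) (- V) (1\<^sub>m r)"
  let ?U = "four_block_mat (1\<^sub>m n) X (0\<^sub>m r n) (1\<^sub>m r)"
  have M: "?M \<in> carrier_mat (n + r) (n + r)" and L: "?L \<in> carrier_mat (n + r) (n + r)"
    and U: "?U \<in> carrier_mat (n + r) (n + r)"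
    using X V by auto
  have neg: "- X * - V = X * V"
    using X V by simp
  have "?M * ?L = four_block_mat (1\<^sub>m n + X * V) (- X) (0\<^sub>m r n) (1\<^sub>m r)"
    using X V
    by (subst mult_four_block_mat[of _ n n _ r _ r _ _ n _ r]) (auto simp: neg intro!: cong_four_block_mat)
  then have "det ?M * det ?L = det (1\<^sub>m n + X * V)"
    using X V by (subst det_mult[OF M L, symmetric]) (auto simp: det_four_block_mat_lower_left_zero[of _ n _ r])
  moreover have "det ?L = 1"
    using V by (subst det_four_block_mat_upper_right_zero[of _ n _ r]) auto
  moreover have "?M * ?U = four_block_mat (1\<^sub>m n) (0\<^sub>m n r) V (1\<^sub>m r + V * X)"
    using X V
    by (subst mult_four_block_mat[of _ n n _ r _ r _ _ n _ r])
      (auto simp: comm_add_mat[of _ r r] intro!: cong_four_block_mat eq_matI)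
  then have "det ?M * det ?U = det (1\<^sub>m r + V * X)"
    using X V by (subst det_mult[OF M U, symmetric]) (auto simp: det_four_block_mat_upper_right_zero[of _ n _ r])
  moreover have "det ?U = 1"
    using X by (subst det_four_block_mat_lower_left_zero[of _ n _ r]) auto
  ultimately show ?thesis
    by simp
qed

lemma det_square_mat:
  "det (square_mat n X) = (\<Sum>p | p permutes {..<n}. signof p * (\<Prod>i<n. X i (p i)))"
  unfolding det_def
  by (auto simp: lessThan_atLeast0 intro!: sum.cong prod.cong permutes_in_image[THEN iffD2])

lemma det_zero_column:
  assumes "m < n" "\<And>i. X i m = 0"
  shows "det (square_mat n X) = 0"
  unfolding det_square_mat
proof (intro sum.neutral ballI)
  fix p assume "p \<in> {p. p permutes {..<n}}"
  then have p: "p permutes {..<n}" by simp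
  then have "inv_into UNIV p m \<in> {..<n}" "p (inv_into UNIV p m) = m"
    using assms(1) permutes_inverses(1)[OF p] permutes_in_image[OF permutes_inv[OF p]] by auto
  then have "(\<Prod>i<n. X i (p i)) = 0"
    using assms(2) by (intro prod_zero bexI[of _ "inv_into UNIV p m"]) auto
  then show "signof p * (\<Prod>i<n. X i (p i)) = 0"
    by simp
qed

text \<open>Multilinearity in all rows at once: for each permutation the product of the sums is
  expanded over the set \<open>I\<close> of the rows from which the first summand is taken.\<close>

lemma det_rows_plus:
  "det (square_mat n (\<lambda>i j. X i j + Y i j)) =
    (\<Sum>I\<in>Pow {..<n}. det (square_mat n (\<lambda>i j. if i \<in> I then X i j else Y i j)))"
proof -
  have "(\<Prod>i<n. X i (p i) + Y i (p i)) = (\<Sum>I\<in>Pow {..<n}. \<Prod>i<n. if i \<in> I then X i (p i) else Y i (p i))" for p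
  proof (subst prod_add, simp, intro sum.cong refl)
    fix I assume "I \<in> Pow {..<n}"
    then have I: "{..<n} \<inter> I = I" "{..<n} \<inter> - I = {..<n} - I" by auto
    show "(\<Prod>i\<in>I. X i (p i)) * (\<Prod>i\<in>{..<n} - I. Y i (p i)) = (\<Prod>i<n. if i \<in> I then X i (p i) else Y i (p i))"
      by (subst prod.If_cases) (simp_all add: I)
  qed
  then show ?thesis
    unfolding det_square_mat by (subst sum.swap) (simp add: sum_distrib_left)
qed

section \<open>Determinant identities over a commutative ring\<close>

context cring
begin

lemma mat_det_cong:
  assumes "\<And>i j. i < n \<Longrightarrow> j < n \<Longrightarrow> X i j = Y i j" "\<And>i j. i < n \<Longrightarrow> j < n \<Longrightarrow> Y i j \<in> carrier R"
  shows "mat_det R n X = mat_det R n Y"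
proof -
  have *: "(\<Otimes>i\<in>{..<n}. X i (p i)) = (\<Otimes>i\<in>{..<n}. Y i (p i))" "(\<Otimes>i\<in>{..<n}. Y i (p i)) \<in> carrier R"
    if "p permutes {..<n}" for p
    using permutes_in_image[OF that] assms by (auto intro!: finprod_cong')
  show ?thesis
    unfolding mat_det_def by (rule finsum_cong') (auto simp: *)
qed

lemma mat_det_closed:
  assumes "\<And>i j. i < n \<Longrightarrow> j < n \<Longrightarrow> X i j \<in> carrier R"
  shows "mat_det R n X \<in> carrier R"
proof -
  have "(\<Otimes>i\<in>{..<n}. X i (p i)) \<in> carrier R" if "p permutes {..<n}" for p
    using permutes_in_image[OF that] assms by (auto intro!: finprod_closed)
  then show ?thesis
    unfolding mat_det_def by (auto intro!: finsum_closed)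
qed

lemma mat_det_0 [simp]: "mat_det R 0 X = \<one>"
proof -
  have "{p. p permutes ({..<0}::nat set)} = {id}"
    by auto
  then show ?thesis
    by (simp add: mat_det_def)
qed

text \<open>An identity between \<open>X\<close> and \<open>Y\<close> can only be transferred if
  both are images under one and the same \<open>h\<close>, so their entries are lifted
  together.\<close>

lemma lift_matrices:
  fixes n m n' m' :: nat
  assumes "\<And>i j. i < n \<Longrightarrow> j < m \<Longrightarrow> X i j \<in> carrier R"
    and "\<And>i j. i < n' \<Longrightarrow> j < m' \<Longrightarrow> Y i j \<in> carrier R"
  obtains h :: "((nat \<Rightarrow>\<^sub>0 nat) \<Rightarrow>\<^sub>0 int) \<Rightarrow> 'a" and X' Y' where "hom_from_type R h"
    "\<And>i j. i < n \<Longrightarrow> j < m \<Longrightarrow> X i j = h (X' i j)"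
    "\<And>i j. i < n' \<Longrightarrow> j < m' \<Longrightarrow> Y i j = h (Y' i j)"
proof -
  let ?F = "(\<lambda>(i, j). X i j) ` ({..<n} \<times> {..<m}) \<union> (\<lambda>(i, j). Y i j) ` ({..<n'} \<times> {..<m'})"
  have "finite ?F"
    by (intro finite_UnI finite_imageI finite_cartesian_product) auto
  then obtain h :: "((nat \<Rightarrow>\<^sub>0 nat) \<Rightarrow>\<^sub>0 int) \<Rightarrow> 'a" where h: "hom_from_type R h" "?F \<subseteq> range h"
    by (rule exists_hom_from_poly_ring[of ?F]) (use assms in auto)
  show thesis
  proof (rule that[OF h(1)])
    show "X i j = h (inv_into UNIV h (X i j))" if "i < n" "j < m" for i j
      using h(2) that by (auto simp: f_inv_into_f image_subset_iff)
    show "Y i j = h (inv_into UNIV h (Y i j))" if "i < n'" "j < m'" for i j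
      using h(2) that by (auto simp: f_inv_into_f image_subset_iff)
  qed
qed

lemma lift_matrix:
  fixes n m :: nat
  assumes "\<And>i j. i < n \<Longrightarrow> j < m \<Longrightarrow> X i j \<in> carrier R"
  obtains h :: "((nat \<Rightarrow>\<^sub>0 nat) \<Rightarrow>\<^sub>0 int) \<Rightarrow> 'a" and X' where "hom_from_type R h"
    "\<And>i j. i < n \<Longrightarrow> j < m \<Longrightarrow> X i j = h (X' i j)"
  using lift_matrices[of n m X n m X] assms by metis

lemma mat_det_mult:
  assumes X: "\<And>i j. i < n \<Longrightarrow> j < n \<Longrightarrow> X i j \<in> carrier R"
    and Y: "\<And>i j. i < n \<Longrightarrow> j < n \<Longrightarrow> Y i j \<in> carrier R"
  shows "mat_det R n (\<lambda>i j. \<Oplus>k\<in>{..<n}. X i k \<otimes> Y k j) = mat_det R n X \<otimes> mat_det R n Y"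
proof -
  obtain h :: "((nat \<Rightarrow>\<^sub>0 nat) \<Rightarrow>\<^sub>0 int) \<Rightarrow> 'a" and X' Y' where h: "hom_from_type R h"
    and XY: "\<And>i j. i < n \<Longrightarrow> j < n \<Longrightarrow> X i j = h (X' i j)" "\<And>i j. i < n \<Longrightarrow> j < n \<Longrightarrow> Y i j = h (Y' i j)"
    using lift_matrices[of n n X n n Y] X Y by metis
  interpret h: hom_from_type R h by fact
  have "mat_det R n (\<lambda>i j. \<Oplus>k\<in>{..<n}. X i k \<otimes> Y k j) = mat_det R n (\<lambda>i j. h (\<Sum>k<n. X' i k * Y' k j))"
    by (intro mat_det_cong) (auto simp: h.hom_sum h.hom_times XY intro!: finsum_cong')
  also have "\<dots> = h (det (square_mat n X' * square_mat n Y'))"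
    unfolding h.hom_det by (intro arg_cong[of _ _ h] arg_cong[of _ _ det] eq_matI)
      (auto simp: scalar_prod_def lessThan_atLeast0)
  also have "\<dots> = h (det (square_mat n X')) \<otimes> h (det (square_mat n Y'))"
    by (subst det_mult[of _ n]) (auto simp: h.hom_times)
  also have "\<dots> = mat_det R n X \<otimes> mat_det R n Y"
    unfolding h.hom_det[symmetric] by (intro arg_cong2[of _ _ _ _ "(\<otimes>)"] mat_det_cong) (auto simp: XY)
  finally show ?thesis .
qed

text \<open>For the comparison of ranks: a matrix that factors through fewer than \<open>n\<close>
  coordinates is a product of square matrices, the first of which has a zero column.\<close>

lemma mat_det_low_rank:
  assumes X: "\<And>i j. i < n \<Longrightarrow> j < m \<Longrightarrow> X i j \<in> carrier R"
    and Y: "\<And>i j. i < m \<Longrightarrow> j < n \<Longrightarrow> Y i j \<in> carrier R" and "m < n"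
  shows "mat_det R n (\<lambda>i j. \<Oplus>k\<in>{..<m}. X i k \<otimes> Y k j) = \<zero>"
proof -
  obtain h :: "((nat \<Rightarrow>\<^sub>0 nat) \<Rightarrow>\<^sub>0 int) \<Rightarrow> 'a" and X' Y' where h: "hom_from_type R h"
    and XY: "\<And>i j. i < n \<Longrightarrow> j < m \<Longrightarrow> X i j = h (X' i j)" "\<And>i j. i < m \<Longrightarrow> j < n \<Longrightarrow> Y i j = h (Y' i j)"
    using lift_matrices[of n m X m n Y] X Y by metis
  interpret h: hom_from_type R h by fact
  \<comment> \<open>Padding by zero columns. The rows of \<open>Y'\<close> from \<open>m\<close> on
    are arbitrary values, but they only meet these zeros.\<close>
  define X0 where "X0 i k = (if k < m then X' i k else 0)" for i k
  have "mat_det R n (\<lambda>i j. \<Oplus>k\<in>{..<m}. X i k \<otimes> Y k j) = mat_det R n (\<lambda>i j. h (\<Sum>k<n. X0 i k * Y' k j))"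
  proof (rule mat_det_cong)
    fix i j assume ij: "i < n" "j < n"
    have "(\<Sum>k<n. X0 i k * Y' k j) = (\<Sum>k<m. X' i k * Y' k j)"
      using \<open>m < n\<close> by (intro sum.mono_neutral_cong_right) (auto simp: X0_def)
    then show "(\<Oplus>k\<in>{..<m}. X i k \<otimes> Y k j) = h (\<Sum>k<n. X0 i k * Y' k j)"
      using ij by (auto simp: h.hom_sum h.hom_times XY intro!: finsum_cong')
  qed auto
  also have "\<dots> = h (det (square_mat n X0 * square_mat n Y'))"
    unfolding h.hom_det by (intro arg_cong[of _ _ h] arg_cong[of _ _ det] eq_matI)
      (auto simp: scalar_prod_def lessThan_atLeast0)
  also have "\<dots> = h (det (square_mat n X0)) \<otimes> h (det (square_mat n Y'))"
    by (subst det_mult[of _ n]) (auto simp: h.hom_times)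
  also have "det (square_mat n X0) = 0"
    using \<open>m < n\<close> by (intro det_zero_column[of m]) (auto simp: X0_def)
  finally show ?thesis
    by (simp add: h.hom_0)
qed

lemma mat_det_transpose:
  assumes X: "\<And>i j. i < n \<Longrightarrow> j < n \<Longrightarrow> X i j \<in> carrier R"
  shows "mat_det R n (\<lambda>i j. X j i) = mat_det R n X"
proof -
  obtain h :: "((nat \<Rightarrow>\<^sub>0 nat) \<Rightarrow>\<^sub>0 int) \<Rightarrow> 'a" and X' where h: "hom_from_type R h"
    and X': "\<And>i j. i < n \<Longrightarrow> j < n \<Longrightarrow> X i j = h (X' i j)"
    using lift_matrix[of n n X] X by metis
  interpret h: hom_from_type R h by fact
  have "mat_det R n (\<lambda>i j. X j i) = mat_det R n (\<lambda>i j. h (X' j i))"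
    by (intro mat_det_cong) (auto simp: X')
  also have "\<dots> = h (det (transpose_mat (square_mat n X')))"
    unfolding h.hom_det by (intro arg_cong[of _ _ h] arg_cong[of _ _ det] eq_matI) auto
  also have "\<dots> = mat_det R n (\<lambda>i j. h (X' i j))"
    unfolding h.hom_det by (subst det_transpose[of _ n]) auto
  also have "\<dots> = mat_det R n X"
    by (intro mat_det_cong) (auto simp: X')
  finally show ?thesis .
qed

lemma mat_det_smult:
  assumes X: "\<And>i j. i < n \<Longrightarrow> j < n \<Longrightarrow> X i j \<in> carrier R" and c: "c \<in> carrier R"
  shows "mat_det R n (\<lambda>i j. c \<otimes> X i j) = c [^] n \<otimes> mat_det R n X"
proof -
  have p: "(\<Otimes>i\<in>{..<n}. c \<otimes> X i (p i)) = c [^] n \<otimes> (\<Otimes>i\<in>{..<n}. X i (p i))"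
    "(\<Otimes>i\<in>{..<n}. X i (p i)) \<in> carrier R" if "p permutes {..<n}" for p
    using permutes_in_image[OF that] X c
    by (auto simp: Pi_def finprod_multf finprod_const)
  have "mat_det R n (\<lambda>i j. c \<otimes> X i j) =
      (\<Oplus>p\<in>{p. p permutes {..<n}}. c [^] n \<otimes> (if evenperm p then (\<Otimes>i\<in>{..<n}. X i (p i))
        else \<ominus> (\<Otimes>i\<in>{..<n}. X i (p i))))"
    unfolding mat_det_def by (intro finsum_cong') (auto simp: p c r_minus)
  also have "\<dots> = c [^] n \<otimes> mat_det R n X"
    unfolding mat_det_def using c finite_permutations[of "{..<n}"]
    by (intro finsum_rdistr[symmetric]) (auto simp: p)
  finally show ?thesis .
qed

text \<open>The adjugate on both sides: \<open>Z X = det X\<close> is the determinant trick (a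
  column killed by \<open>X\<close> is killed by its determinant) and gives spanning in
  \<open>local_basis_minor\<close>; \<open>X Z = det X\<close> gives independence there.\<close>

lemma mat_det_adjugate:
  assumes X: "\<And>i j. i < n \<Longrightarrow> j < n \<Longrightarrow> X i j \<in> carrier R"
  obtains Z where "\<And>i j. Z i j \<in> carrier R"
    "\<And>i j. i < n \<Longrightarrow> j < n \<Longrightarrow>
      (\<Oplus>k\<in>{..<n}. Z i k \<otimes> X k j) = (if i = j then mat_det R n X else \<zero>)"
    "\<And>i j. i < n \<Longrightarrow> j < n \<Longrightarrow>
      (\<Oplus>k\<in>{..<n}. X i k \<otimes> Z k j) = (if i = j then mat_det R n X else \<zero>)"
proof -
  obtain h :: "((nat \<Rightarrow>\<^sub>0 nat) \<Rightarrow>\<^sub>0 int) \<Rightarrow> 'a" and X' where h: "hom_from_type R h"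
    and X': "\<And>i j. i < n \<Longrightarrow> j < n \<Longrightarrow> X i j = h (X' i j)"
    using lift_matrix[of n n X] X by metis
  interpret h: hom_from_type R h by fact
  define Z where "Z = adj_mat (square_mat n X')"
  have Z: "Z \<in> carrier_mat n n" "square_mat n X' * Z = det (square_mat n X') \<cdot>\<^sub>m 1\<^sub>m n"
    "Z * square_mat n X' = det (square_mat n X') \<cdot>\<^sub>m 1\<^sub>m n"
    using adj_mat[of "square_mat n X'" n] by (auto simp: Z_def)
  have det: "mat_det R n X = h (det (square_mat n X'))"
    unfolding h.hom_det[symmetric] by (intro mat_det_cong) (auto simp: X')
  show thesis
  proof (rule that[of "\<lambda>i j. h (Z $$ (i, j))"])
    fix i j assume ij: "i < n" "j < n"
    have "(\<Oplus>k\<in>{..<n}. h (Z $$ (i, k)) \<otimes> X k j) = h (\<Sum>k<n. Z $$ (i, k) * X' k j)"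
      by (auto simp: h.hom_sum h.hom_times X' ij intro!: finsum_cong')
    also have "(\<Sum>k<n. Z $$ (i, k) * X' k j) = (Z * square_mat n X') $$ (i, j)"
      using Z(1) ij by (auto simp: scalar_prod_def lessThan_atLeast0)
    finally show "(\<Oplus>k\<in>{..<n}. h (Z $$ (i, k)) \<otimes> X k j) = (if i = j then mat_det R n X else \<zero>)"
      using ij by (auto simp: Z(3) det h.hom_0)
    have "(\<Oplus>k\<in>{..<n}. X i k \<otimes> h (Z $$ (k, j))) = h (\<Sum>k<n. X' i k * Z $$ (k, j))"
      by (auto simp: h.hom_sum h.hom_times X' ij intro!: finsum_cong')
    also have "(\<Sum>k<n. X' i k * Z $$ (k, j)) = (square_mat n X' * Z) $$ (i, j)"
      using Z(1) ij by (auto simp: scalar_prod_def lessThan_atLeast0)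
    finally show "(\<Oplus>k\<in>{..<n}. X i k \<otimes> h (Z $$ (k, j))) = (if i = j then mat_det R n X else \<zero>)"
      using ij by (auto simp: Z(2) det h.hom_0)
  qed auto
qed

text \<open>Allowing rectangular factors is the point: it identifies the determinants computed in
  two dual bases of different lengths.\<close>

lemma mat_det_one_plus_mult_commute:
  assumes X: "\<And>i j. i < n \<Longrightarrow> j < r \<Longrightarrow> X i j \<in> carrier R"
    and Y: "\<And>i j. i < r \<Longrightarrow> j < n \<Longrightarrow> Y i j \<in> carrier R"
  shows "mat_det R n (\<lambda>i j. (if i = j then \<one> else \<zero>) \<oplus> (\<Oplus>k\<in>{..<r}. X i k \<otimes> Y k j)) =
    mat_det R r (\<lambda>i j. (if i = j then \<one> else \<zero>) \<oplus> (\<Oplus>k\<in>{..<n}. Y i k \<otimes> X k j))"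
proof -
  obtain h :: "((nat \<Rightarrow>\<^sub>0 nat) \<Rightarrow>\<^sub>0 int) \<Rightarrow> 'a" and X' Y' where h: "hom_from_type R h"
    and XY: "\<And>i j. i < n \<Longrightarrow> j < r \<Longrightarrow> X i j = h (X' i j)" "\<And>i j. i < r \<Longrightarrow> j < n \<Longrightarrow> Y i j = h (Y' i j)"
    using lift_matrices[of n r X r n Y] X Y by metis
  interpret h: hom_from_type R h by fact
  have one: "(if i = j then \<one> else \<zero>) = h (if i = j then 1 else 0)" for i j :: nat
    by (auto simp: h.hom_1 h.hom_0)
  let ?X = "mat n r (\<lambda>(i, j). X' i j)" and ?Y = "mat r n (\<lambda>(i, j). Y' i j)"
  have "mat_det R n (\<lambda>i j. (if i = j then \<one> else \<zero>) \<oplus> (\<Oplus>k\<in>{..<r}. X i k \<otimes> Y k j)) =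
      mat_det R n (\<lambda>i j. h ((if i = j then 1 else 0) + (\<Sum>k<r. X' i k * Y' k j)))"
    unfolding one by (intro mat_det_cong)
      (auto simp: h.hom_plus h.hom_sum h.hom_times XY intro!: arg_cong2[of _ _ _ _ "(\<oplus>)"] finsum_cong')
  also have "\<dots> = h (det (1\<^sub>m n + ?X * ?Y))"
    unfolding h.hom_det by (intro arg_cong[of _ _ h] arg_cong[of _ _ det] eq_matI)
      (auto simp: scalar_prod_def lessThan_atLeast0)
  also have "\<dots> = h (det (1\<^sub>m r + ?Y * ?X))"
    by (subst det_one_plus_mult_commute[of _ n r]) auto
  also have "\<dots> = mat_det R r (\<lambda>i j. h ((if i = j then 1 else 0) + (\<Sum>k<n. Y' i k * X' k j)))"
    unfolding h.hom_det by (intro arg_cong[of _ _ h] arg_cong[of _ _ det] eq_matI)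
      (auto simp: scalar_prod_def lessThan_atLeast0)
  also have "\<dots> = mat_det R r (\<lambda>i j. (if i = j then \<one> else \<zero>) \<oplus> (\<Oplus>k\<in>{..<n}. Y i k \<otimes> X k j))"
    unfolding one by (intro mat_det_cong)
      (auto simp: h.hom_plus h.hom_sum h.hom_times XY intro!: arg_cong2[of _ _ _ _ "(\<oplus>)"] finsum_cong' add.m_closed finsum_closed)
  finally show ?thesis .
qed

lemma mat_det_unit_block:
  assumes X: "\<And>i j. i < m + n \<Longrightarrow> j < m + n \<Longrightarrow> X i j \<in> carrier R"
    and zero: "\<And>i j. i < m \<Longrightarrow> m \<le> j \<Longrightarrow> j < m + n \<Longrightarrow> X i j = \<zero>"
    and one: "\<And>i j. m \<le> i \<Longrightarrow> i < m + n \<Longrightarrow> m \<le> j \<Longrightarrow> j < m + n \<Longrightarrow> X i j = (if i = j then \<one> else \<zero>)"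
  shows "mat_det R (m + n) X = mat_det R m X"
proof -
  obtain h :: "((nat \<Rightarrow>\<^sub>0 nat) \<Rightarrow>\<^sub>0 int) \<Rightarrow> 'a" and X' where h: "hom_from_type R h"
    and X': "\<And>i j. i < m + n \<Longrightarrow> j < m + n \<Longrightarrow> X i j = h (X' i j)"
    using lift_matrix[of "m + n" "m + n" X] X by metis
  interpret h: hom_from_type R h by fact
  \<comment> \<open>As \<open>h\<close> need not be injective, the lifts of the entries \<zero> and
    \<one> need not be 0 and 1. \<open>Y\<close> puts the exact values there, so that the block
    shape is present in the polynomial ring.\<close>
  define Y where "Y i j = (if j < m then X' i j else if i = j then 1 else 0)" for i j
  have Y: "X i j = h (Y i j)" if "i < m + n" "j < m + n" for i j
    using that zero[of i j] one[of i j] by (cases "i < m") (auto simp: Y_def X' h.hom_1 h.hom_0)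
  have "mat_det R (m + n) X = mat_det R (m + n) (\<lambda>i j. h (Y i j))"
    by (intro mat_det_cong) (auto simp: Y)
  also have "square_mat (m + n) Y =
      four_block_mat (square_mat m Y) (0\<^sub>m m n) (mat n m (\<lambda>(i, j). Y (i + m) j)) (1\<^sub>m n)"
    by (intro eq_matI) (auto simp: Y_def)
  then have "mat_det R (m + n) (\<lambda>i j. h (Y i j)) = h (det (square_mat m Y))"
    unfolding h.hom_det by (simp add: det_four_block_mat_upper_right_zero[of _ m _ n])
  also have "\<dots> = mat_det R m X"
    unfolding h.hom_det[symmetric] by (intro mat_det_cong) (auto simp: Y)
  finally show ?thesis .
qed

lemma mat_det_rows_plus:
  assumes X: "\<And>i j. i < n \<Longrightarrow> j < n \<Longrightarrow> X i j \<in> carrier R"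
    and Y: "\<And>i j. i < n \<Longrightarrow> j < n \<Longrightarrow> Y i j \<in> carrier R"
  shows "mat_det R n (\<lambda>i j. X i j \<oplus> Y i j) =
    (\<Oplus>I\<in>Pow {..<n}. mat_det R n (\<lambda>i j. if i \<in> I then X i j else Y i j))"
proof -
  obtain h :: "((nat \<Rightarrow>\<^sub>0 nat) \<Rightarrow>\<^sub>0 int) \<Rightarrow> 'a" and X' Y' where h: "hom_from_type R h"
    and XY: "\<And>i j. i < n \<Longrightarrow> j < n \<Longrightarrow> X i j = h (X' i j)" "\<And>i j. i < n \<Longrightarrow> j < n \<Longrightarrow> Y i j = h (Y' i j)"
    using lift_matrices[of n n X n n Y] X Y by metis
  interpret h: hom_from_type R h by fact
  have "mat_det R n (\<lambda>i j. X i j \<oplus> Y i j) = mat_det R n (\<lambda>i j. h (X' i j + Y' i j))"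
    by (intro mat_det_cong) (auto simp: h.hom_plus XY)
  also have "\<dots> = (\<Oplus>I\<in>Pow {..<n}. mat_det R n (\<lambda>i j. h (if i \<in> I then X' i j else Y' i j)))"
    unfolding h.hom_det det_rows_plus h.hom_sum ..
  also have "\<dots> = (\<Oplus>I\<in>Pow {..<n}. mat_det R n (\<lambda>i j. if i \<in> I then X i j else Y i j))"
    using X Y by (intro finsum_cong' mat_det_cong mat_det_closed Pi_I refl) (auto simp: XY)
  finally show ?thesis .
qed

lemma mat_det_identity: "mat_det R n (\<lambda>i j. if i = j then \<one> else \<zero>) = \<one>"
  using mat_det_unit_block[of 0 n "\<lambda>i j. if i = j then \<one> else \<zero>"] by auto

end

section \<open>Linear maps, free modules and quotients\<close>

lemma additive_zero:
  assumes "abelian_group G" "abelian_group H" "f \<in> carrier G \<rightarrow> carrier H"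
    and "\<And>x y. x \<in> carrier G \<Longrightarrow> y \<in> carrier G \<Longrightarrow> f (x \<oplus>\<^bsub>G\<^esub> y) = f x \<oplus>\<^bsub>H\<^esub> f y"
  shows "f \<zero>\<^bsub>G\<^esub> = \<zero>\<^bsub>H\<^esub>"
proof -
  interpret G: abelian_group G by fact
  interpret H: abelian_group H by fact
  have "f \<zero>\<^bsub>G\<^esub> \<in> carrier H"
    using assms(3) by auto
  moreover have "f \<zero>\<^bsub>G\<^esub> = f \<zero>\<^bsub>G\<^esub> \<oplus>\<^bsub>H\<^esub> f \<zero>\<^bsub>G\<^esub>"
    using assms(4)[of "\<zero>\<^bsub>G\<^esub>" "\<zero>\<^bsub>G\<^esub>"] by simp
  ultimately show ?thesis
    by (metis H.add.l_cancel_one')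
qed

text \<open>Only additivity is asked for, since the lemma also serves for coordinate functions with
  values in the ring record and for maps from \<open>B\<close> to a \<open>B\<close>-module that are
  linear over \<open>A\<close> alone.\<close>

lemma additive_finsum:
  assumes "abelian_group G" "abelian_group H" "f \<in> carrier G \<rightarrow> carrier H"
    and "\<And>x y. x \<in> carrier G \<Longrightarrow> y \<in> carrier G \<Longrightarrow> f (x \<oplus>\<^bsub>G\<^esub> y) = f x \<oplus>\<^bsub>H\<^esub> f y"
    and "g \<in> I \<rightarrow> carrier G"
  shows "f (\<Oplus>\<^bsub>G\<^esub> i \<in> I. g i) = (\<Oplus>\<^bsub>H\<^esub> i \<in> I. f (g i))"
proof -
  interpret G: abelian_group G by fact
  interpret H: abelian_group H by fact
  note zero = additive_zero[OF assms(1-4)]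
  show ?thesis
    using assms(5)
  proof (induction I rule: infinite_finite_induct)
    case (insert i I)
    then show ?case
      using assms(3) by (subst G.finsum_insert, simp_all) (subst H.finsum_insert, auto simp: Pi_iff assms(4))
  qed (simp_all add: zero)
qed

lemma (in abelian_group) diff_eq_zero_iff:
  "a \<in> carrier G \<Longrightarrow> b \<in> carrier G \<Longrightarrow> a \<ominus> b = \<zero> \<longleftrightarrow> a = b"
  by (metis a_inv_closed minus_equality minus_eq minus_minus r_neg)

lemma (in abelian_group) diff_zero [simp]: "a \<in> carrier G \<Longrightarrow> a \<ominus> \<zero> = a"
  by (metis l_zero minus_equality minus_eq r_zero zero_closed)

lemma (in abelian_monoid) finsum_swap:
  assumes "finite I" "finite J" "\<And>i j. i \<in> I \<Longrightarrow> j \<in> J \<Longrightarrow> g i j \<in> carrier G"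
  shows "(\<Oplus>i\<in>I. \<Oplus>j\<in>J. g i j) = (\<Oplus>j\<in>J. \<Oplus>i\<in>I. g i j)"
  using assms(1,3)
proof (induction I rule: finite_induct)
  case (insert i I)
  have "(\<Oplus>j\<in>J. \<Oplus>i\<in>insert i I. g i j) = (\<Oplus>j\<in>J. g i j \<oplus> (\<Oplus>i\<in>I. g i j))"
    using insert by (intro finsum_cong') (auto simp: Pi_iff)
  also have "\<dots> = (\<Oplus>j\<in>J. g i j) \<oplus> (\<Oplus>j\<in>J. \<Oplus>i\<in>I. g i j)"
    using insert by (intro finsum_addf) (auto simp: Pi_iff)
  finally show ?case
    using insert by (subst finsum_insert) (auto simp: Pi_iff)
qed (simp add: finsum_zero)

context module
begin

lemma abelian_groups: "abelian_group R" "abelian_group M"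
  by (simp_all add: R.abelian_group_axioms M.abelian_group_axioms)

lemma finsum_smult_rdistr:
  assumes "x \<in> carrier M" "a \<in> I \<rightarrow> carrier R"
  shows "(\<Oplus>i\<in>I. a i) \<odot>\<^bsub>M\<^esub> x = (\<Oplus>\<^bsub>M\<^esub> i\<in>I. a i \<odot>\<^bsub>M\<^esub> x)"
  by (rule additive_finsum[of R M "\<lambda>a. a \<odot>\<^bsub>M\<^esub> x"])
    (use assms in \<open>auto simp: smult_l_distr abelian_groups\<close>)

lemma smult_finsum:
  assumes "a \<in> carrier R" "x \<in> I \<rightarrow> carrier M"
  shows "a \<odot>\<^bsub>M\<^esub> (\<Oplus>\<^bsub>M\<^esub> i\<in>I. x i) = (\<Oplus>\<^bsub>M\<^esub> i\<in>I. a \<odot>\<^bsub>M\<^esub> x i)"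
  by (rule additive_finsum[of M M "\<lambda>x. a \<odot>\<^bsub>M\<^esub> x"])
    (use assms in \<open>auto simp: smult_r_distr abelian_groups\<close>)

text \<open>Associativity \<open>a (P x) = (a P) x\<close> of matrix products, with a column
  \<open>x\<close> of module elements. \<open>finsum_mult_assoc\<close> is the version with a column
  of ring elements.\<close>

lemma lin_comb_assoc:
  assumes "finite I" "finite J" "a \<in> I \<rightarrow> carrier R" "x \<in> J \<rightarrow> carrier M"
    and P: "\<And>i j. i \<in> I \<Longrightarrow> j \<in> J \<Longrightarrow> P i j \<in> carrier R"
  shows "(\<Oplus>\<^bsub>M\<^esub> i\<in>I. a i \<odot>\<^bsub>M\<^esub> (\<Oplus>\<^bsub>M\<^esub> j\<in>J. P i j \<odot>\<^bsub>M\<^esub> x j)) =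
    (\<Oplus>\<^bsub>M\<^esub> j\<in>J. (\<Oplus>i\<in>I. a i \<otimes> P i j) \<odot>\<^bsub>M\<^esub> x j)"
proof -
  have "(\<Oplus>\<^bsub>M\<^esub> i\<in>I. a i \<odot>\<^bsub>M\<^esub> (\<Oplus>\<^bsub>M\<^esub> j\<in>J. P i j \<odot>\<^bsub>M\<^esub> x j)) =
      (\<Oplus>\<^bsub>M\<^esub> i\<in>I. \<Oplus>\<^bsub>M\<^esub> j\<in>J. (a i \<otimes> P i j) \<odot>\<^bsub>M\<^esub> x j)"
    using assms by (intro M.finsum_cong' refl) (auto simp: Pi_iff smult_finsum smult_assoc1 intro!: M.finsum_cong')
  also have "\<dots> = (\<Oplus>\<^bsub>M\<^esub> j\<in>J. \<Oplus>\<^bsub>M\<^esub> i\<in>I. (a i \<otimes> P i j) \<odot>\<^bsub>M\<^esub> x j)"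
    using assms by (intro M.finsum_swap) (auto simp: Pi_iff)
  also have "\<dots> = (\<Oplus>\<^bsub>M\<^esub> j\<in>J. (\<Oplus>i\<in>I. a i \<otimes> P i j) \<odot>\<^bsub>M\<^esub> x j)"
    using assms by (intro M.finsum_cong' refl) (auto simp: Pi_iff finsum_smult_rdistr)
  finally show ?thesis .
qed

lemma smult_lin_comb:
  assumes "a \<in> carrier R" "c \<in> J \<rightarrow> carrier R" "x \<in> J \<rightarrow> carrier M"
  shows "a \<odot>\<^bsub>M\<^esub> (\<Oplus>\<^bsub>M\<^esub> j\<in>J. c j \<odot>\<^bsub>M\<^esub> x j) = (\<Oplus>\<^bsub>M\<^esub> j\<in>J. (a \<otimes> c j) \<odot>\<^bsub>M\<^esub> x j)"
  using assms by (subst smult_finsum) (auto simp: Pi_iff smult_assoc1 intro!: M.finsum_cong')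

lemma add_lin_comb:
  assumes "c \<in> J \<rightarrow> carrier R" "d \<in> J \<rightarrow> carrier R" "x \<in> J \<rightarrow> carrier M"
  shows "(\<Oplus>\<^bsub>M\<^esub> j\<in>J. c j \<odot>\<^bsub>M\<^esub> x j) \<oplus>\<^bsub>M\<^esub> (\<Oplus>\<^bsub>M\<^esub> j\<in>J. d j \<odot>\<^bsub>M\<^esub> x j) =
    (\<Oplus>\<^bsub>M\<^esub> j\<in>J. (c j \<oplus> d j) \<odot>\<^bsub>M\<^esub> x j)"
proof -
  have "(\<Oplus>\<^bsub>M\<^esub> j\<in>J. (c j \<oplus> d j) \<odot>\<^bsub>M\<^esub> x j) = (\<Oplus>\<^bsub>M\<^esub> j\<in>J. c j \<odot>\<^bsub>M\<^esub> x j \<oplus>\<^bsub>M\<^esub> d j \<odot>\<^bsub>M\<^esub> x j)"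
    using assms by (intro M.finsum_cong' refl) (auto simp: Pi_iff smult_l_distr)
  also have "\<dots> = (\<Oplus>\<^bsub>M\<^esub> j\<in>J. c j \<odot>\<^bsub>M\<^esub> x j) \<oplus>\<^bsub>M\<^esub> (\<Oplus>\<^bsub>M\<^esub> j\<in>J. d j \<odot>\<^bsub>M\<^esub> x j)"
    using assms by (intro M.finsum_addf) (auto simp: Pi_iff)
  finally show ?thesis ..
qed

end

section \<open>Linear maps and free modules\<close>

lemma linear_mapD:
  assumes "linear_map R M N f"
  shows "x \<in> carrier M \<Longrightarrow> f x \<in> carrier N"
    and "x \<in> carrier M \<Longrightarrow> y \<in> carrier M \<Longrightarrow> f (x \<oplus>\<^bsub>M\<^esub> y) = f x \<oplus>\<^bsub>N\<^esub> f y"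
    and "a \<in> carrier R \<Longrightarrow> x \<in> carrier M \<Longrightarrow> f (a \<odot>\<^bsub>M\<^esub> x) = a \<odot>\<^bsub>N\<^esub> f x"
  using assms unfolding linear_map_def by auto

lemma linear_map_finsum:
  assumes "module R M" "module R N" "linear_map R M N f" "g \<in> I \<rightarrow> carrier M"
  shows "f (\<Oplus>\<^bsub>M\<^esub> i \<in> I. g i) = (\<Oplus>\<^bsub>N\<^esub> i \<in> I. f (g i))"
  by (rule additive_finsum[of M N f])
    (use assms(4) linear_mapD[OF assms(3)] module.abelian_groups(2)[OF assms(1)] module.abelian_groups(2)[OF assms(2)] in auto)

lemma linear_map_zero:
  assumes "module R M" "module R N" "linear_map R M N f"
  shows "f \<zero>\<^bsub>M\<^esub> = \<zero>\<^bsub>N\<^esub>"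
  by (rule additive_zero[of M N f])
    (use linear_mapD[OF assms(3)] module.abelian_groups(2)[OF assms(1)] module.abelian_groups(2)[OF assms(2)] in auto)

lemma linear_map_minus:
  assumes "module R M" "module R N" "linear_map R M N f" "x \<in> carrier M" "y \<in> carrier M"
  shows "f (x \<ominus>\<^bsub>M\<^esub> y) = f x \<ominus>\<^bsub>N\<^esub> f y"
proof -
  interpret M: module R M by fact
  interpret N: module R N by fact
  note f = linear_mapD[OF assms(3)]
  have "f (\<ominus>\<^bsub>M\<^esub> y) \<oplus>\<^bsub>N\<^esub> f y = \<zero>\<^bsub>N\<^esub>"
    using f(2)[of "\<ominus>\<^bsub>M\<^esub> y" y] assms linear_map_zero[OF assms(1-3)] by (simp add: M.l_neg)
  then have "f (\<ominus>\<^bsub>M\<^esub> y) = \<ominus>\<^bsub>N\<^esub> f y"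
    using f(1) assms by (metis M.a_inv_closed N.minus_equality)
  then show ?thesis
    using f assms by (simp add: a_minus_def)
qed

text \<open>The linear extension of \<open>g\<close> from the generators of a free module. Summing
  over the support of \<open>f\<close> keeps the index set out of the definition.\<close>

definition free_ext ::
  "('r, 'k) ring_scheme \<Rightarrow> ('r, 'b, 'n) module_scheme \<Rightarrow> ('x \<Rightarrow> 'b) \<Rightarrow> ('x \<Rightarrow> 'r) \<Rightarrow> 'b" where
  "free_ext R M g f = (\<Oplus>\<^bsub>M\<^esub> x \<in> {x. f x \<noteq> \<zero>\<^bsub>R\<^esub>}. f x \<odot>\<^bsub>M\<^esub> g x)"

lemma free_module_simps [simp]:
  "zero (free_module R U) = (\<lambda>x. \<zero>\<^bsub>R\<^esub>)"
  "add (free_module R U) = (\<lambda>f g x. f x \<oplus>\<^bsub>R\<^esub> g x)"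
  "module.smult (free_module R U) = (\<lambda>a f x. a \<otimes>\<^bsub>R\<^esub> f x)"
  by (simp_all add: free_module_def)

context cring
begin

lemma free_module_carrier:
  "f \<in> carrier (free_module R U) \<longleftrightarrow>
    (\<forall>x. f x \<in> carrier R) \<and> (\<forall>x. x \<notin> U \<longrightarrow> f x = \<zero>) \<and> finite {x. f x \<noteq> \<zero>}"
  by (auto simp: free_module_def)

lemma free_module_carrier_finite:
  "finite U \<Longrightarrow> f \<in> carrier (free_module R U) \<longleftrightarrow> (\<forall>x. f x \<in> carrier R) \<and> (\<forall>x. x \<notin> U \<longrightarrow> f x = \<zero>)"
  unfolding free_module_carrier by (metis (mono_tags, lifting) finite_subset mem_Collect_eq subsetI)

lemma free_module_is_module: "module R (free_module R U)"
proof (rule moduleI)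
  let ?F = "free_module R U"
  show "abelian_group ?F"
  proof (rule abelian_groupI)
    fix f g assume fg: "f \<in> carrier ?F" "g \<in> carrier ?F"
    have "{x. f x \<oplus> g x \<noteq> \<zero>} \<subseteq> {x. f x \<noteq> \<zero>} \<union> {x. g x \<noteq> \<zero>}"
      by auto
    then show "f \<oplus>\<^bsub>?F\<^esub> g \<in> carrier ?F"
      using fg by (auto simp: free_module_carrier intro: finite_subset)
    show "f \<oplus>\<^bsub>?F\<^esub> g = g \<oplus>\<^bsub>?F\<^esub> f"
      using fg by (auto simp: free_module_carrier a_comm)
    have "{x. \<ominus> f x \<noteq> \<zero>} \<subseteq> {x. f x \<noteq> \<zero>}"
      by auto
    then have "(\<lambda>x. \<ominus> f x) \<in> carrier ?F"
      using fg by (auto simp: free_module_carrier intro: finite_subset)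
    then show "\<exists>g\<in>carrier ?F. g \<oplus>\<^bsub>?F\<^esub> f = \<zero>\<^bsub>?F\<^esub>"
      by (intro bexI[of _ "\<lambda>x. \<ominus> f x"]) (use fg in \<open>auto simp: free_module_carrier l_neg\<close>)
  qed (auto simp: free_module_carrier a_assoc)
  fix a f assume "a \<in> carrier R" "f \<in> carrier ?F"
  moreover have "{x. a \<otimes> f x \<noteq> \<zero>} \<subseteq> {x. f x \<noteq> \<zero>}"
    using \<open>a \<in> carrier R\<close> by auto
  ultimately show "a \<odot>\<^bsub>?F\<^esub> f \<in> carrier ?F"
    by (auto simp: free_module_carrier intro: finite_subset)
qed (auto simp: free_module_carrier l_distr r_distr m_assoc is_cring)

lemma free_gen_closed [simp]: "x \<in> U \<Longrightarrow> free_gen R x \<in> carrier (free_module R U)"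
  by (auto simp: free_module_carrier free_gen_def)

lemma free_module_finsum_apply:
  assumes "g \<in> I \<rightarrow> carrier (free_module R U)"
  shows "(\<Oplus>\<^bsub>free_module R U\<^esub> i\<in>I. g i) y = (\<Oplus>i\<in>I. g i y)"
proof -
  interpret F: module R "free_module R U"
    by (rule free_module_is_module)
  show ?thesis
    by (rule additive_finsum[of "free_module R U" R "\<lambda>f. f y"])
      (use assms in \<open>auto simp: F.abelian_groups free_module_carrier\<close>)
qed

lemma free_module_decomp:
  assumes "f \<in> carrier (free_module R U)"
  shows "f = (\<Oplus>\<^bsub>free_module R U\<^esub> x\<in>{x. f x \<noteq> \<zero>}. f x \<odot>\<^bsub>free_module R U\<^esub> free_gen R x)"
proof
  interpret F: module R "free_module R U"
    by (rule free_module_is_module)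
  fix y
  have *: "x \<in> U" if "f x \<noteq> \<zero>" for x
    using assms that by (auto simp: free_module_carrier)
  have "(\<Oplus>\<^bsub>free_module R U\<^esub> x\<in>{x. f x \<noteq> \<zero>}. f x \<odot>\<^bsub>free_module R U\<^esub> free_gen R x) y =
      (\<Oplus>x\<in>{x. f x \<noteq> \<zero>}. f x \<otimes> (if y = x then \<one> else \<zero>))"
    by (subst free_module_finsum_apply)
      (use assms * F.smult_closed in \<open>auto simp: free_module_carrier free_gen_def simp del: free_module_simps\<close>,
        use assms * in \<open>auto simp: free_module_carrier free_gen_def\<close>)
  also have "\<dots> = (\<Oplus>x\<in>{x. f x \<noteq> \<zero>}. if y = x then f x else \<zero>)"
    using assms by (intro finsum_cong') (auto simp: free_module_carrier)
  also have "\<dots> = f y"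
  proof (cases "f y = \<zero>")
    case True
    then have "(\<Oplus>x\<in>{x. f x \<noteq> \<zero>}. if y = x then f x else \<zero>) = (\<Oplus>x\<in>{x. f x \<noteq> \<zero>}. \<zero>)"
      by (intro finsum_cong') auto
    then show ?thesis
      using True by (simp add: finsum_zero)
  next
    case False
    then show ?thesis
      using assms by (intro finsum_singleton) (auto simp: free_module_carrier)
  qed
  finally show "f y = (\<Oplus>\<^bsub>free_module R U\<^esub> x\<in>{x. f x \<noteq> \<zero>}. f x \<odot>\<^bsub>free_module R U\<^esub> free_gen R x) y" ..
qed

end

context module
begin

lemma submodule_finsum:
  assumes N: "submodule N R M" and "g \<in> I \<rightarrow> N"
  shows "(\<Oplus>\<^bsub>M\<^esub> i\<in>I. g i) \<in> N"
proof -
  note N' = submoduleE[OF N]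
  have "\<zero>\<^bsub>M\<^esub> \<in> N"
    using N' smult_l_null by (metis R.zero_closed ex_in_conv subsetD)
  then show ?thesis
    using assms(2)
  proof (induction I rule: infinite_finite_induct)
    case (insert x F)
    then show ?case
      using N'(1,5) by (subst M.finsum_insert) (auto simp: Pi_iff)
  qed simp_all
qed

lemma submodule_zero: "submodule N R M \<Longrightarrow> \<zero>\<^bsub>M\<^esub> \<in> N"
  using submodule_finsum[of N undefined "{}"] by simp

lemma submoduleI':
  assumes "H \<subseteq> carrier M" "\<zero>\<^bsub>M\<^esub> \<in> H" "\<And>x y. x \<in> H \<Longrightarrow> y \<in> H \<Longrightarrow> x \<oplus>\<^bsub>M\<^esub> y \<in> H"
    and smult: "\<And>a x. a \<in> carrier R \<Longrightarrow> x \<in> H \<Longrightarrow> a \<odot>\<^bsub>M\<^esub> x \<in> H"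
  shows "submodule H R M"
proof (rule submoduleI)
  fix x assume "x \<in> H"
  then show "\<ominus>\<^bsub>M\<^esub> x \<in> H"
    using smult[of "\<ominus> \<one>" x] assms(1) by (auto simp: smult_l_minus)
qed (use assms in auto)

lemma vimage_submodule:
  assumes "module R P" "linear_map R M P f" "submodule N R P"
  shows "submodule {x \<in> carrier M. f x \<in> N} R M"
proof -
  interpret P: module R P by fact
  note f = linear_mapD[OF assms(2)] and zero = linear_map_zero[OF module_axioms assms(1,2)]
  note N = P.submoduleE[OF assms(3)] P.submodule_zero[OF assms(3)]
  show ?thesis
    by (rule submoduleI') (auto simp: f zero N)
qed

lemma zero_submodule: "submodule {\<zero>\<^bsub>M\<^esub>} R M"
  by (rule submoduleI') auto

lemma span_submodule:
  assumes "S \<subseteq> carrier M"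
  shows "submodule (span_submodule R M S) R M"
proof (rule submoduleI)
  show "span_submodule R M S \<subseteq> carrier M"
    using assms carrier_is_submodule by (auto simp: span_submodule_def)
qed (auto simp: span_submodule_def submodule_zero submoduleE)

lemma span_submodule_base: "x \<in> S \<Longrightarrow> x \<in> span_submodule R M S"
  by (auto simp: span_submodule_def)

lemma span_submodule_least: "submodule N R M \<Longrightarrow> S \<subseteq> N \<Longrightarrow> span_submodule R M S \<subseteq> N"
  by (auto simp: span_submodule_def)

text \<open>Applied to preimages of submodules: a condition of the form \<open>F x \<in> N\<close>
  with \<open>F\<close> linear needs to be checked on the generators only.\<close>

lemma free_module_spanned:
  assumes N: "submodule N R (free_module R U)" and "\<And>x. x \<in> U \<Longrightarrow> free_gen R x \<in> N"
  shows "N = carrier (free_module R U)"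
proof
  interpret F: module R "free_module R U"
    by (rule R.free_module_is_module)
  show "N \<subseteq> carrier (free_module R U)"
    using F.submoduleE[OF N] by blast
  show "carrier (free_module R U) \<subseteq> N"
  proof
    fix f assume f: "f \<in> carrier (free_module R U)"
    have supp: "x \<in> U" if "f x \<noteq> \<zero>" for x
      using f that by (auto simp: R.free_module_carrier)
    have "f x \<in> carrier R" for x
      using f by (auto simp: R.free_module_carrier)
    then have "(\<Oplus>\<^bsub>free_module R U\<^esub> x\<in>{x. f x \<noteq> \<zero>}. f x \<odot>\<^bsub>free_module R U\<^esub> free_gen R x) \<in> N"
      using supp assms(2) F.submoduleE(4)[OF N]
      by (intro F.submodule_finsum[OF N]) (auto simp del: free_module_simps)
    then show "f \<in> N"
      using R.free_module_decomp[OF f] by simp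
  qed
qed

lemma free_ext_superset:
  assumes "f \<in> carrier (free_module R U)" "g \<in> U \<rightarrow> carrier M" "finite S" "{x. f x \<noteq> \<zero>} \<subseteq> S" "S \<subseteq> U"
  shows "free_ext R M g f = (\<Oplus>\<^bsub>M\<^esub> x\<in>S. f x \<odot>\<^bsub>M\<^esub> g x)"
proof -
  have "f x \<in> carrier R" for x
    using assms by (auto simp: R.free_module_carrier)
  moreover have "g x \<in> carrier M" if "x \<in> S" for x
    using assms that by auto
  ultimately show ?thesis
    unfolding free_ext_def
    by (intro M.add.finprod_mono_neutral_cong_left) (use assms(3,4) in auto)
qed

lemma free_ext_linear:
  fixes U :: "'x set"
  assumes g: "g \<in> U \<rightarrow> carrier M"
  shows "linear_map R (free_module R U) M (free_ext R M g)"
proof -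
  interpret F: module R "free_module R U"
    by (rule R.free_module_is_module)
  have supp: "{x. f x \<noteq> \<zero>} \<subseteq> U" "finite {x. f x \<noteq> \<zero>}" "f x \<in> carrier R"
    if "f \<in> carrier (free_module R U)" for f :: "'x \<Rightarrow> 'a" and x
    using that by (auto simp: R.free_module_carrier)
  have closed: "free_ext R M g f \<in> carrier M" if "f \<in> carrier (free_module R U)" for f
    unfolding free_ext_def using supp[OF that] g by (intro M.finsum_closed) auto
  show ?thesis
    unfolding linear_map_def
  proof (intro conjI ballI Pi_I)
    fix f h assume fh: "f \<in> carrier (free_module R U)" "h \<in> carrier (free_module R U)"
    let ?S = "{x. f x \<noteq> \<zero>} \<union> {x. h x \<noteq> \<zero>}"
    have S: "finite ?S" "?S \<subseteq> U"
      using supp[OF fh(1)] supp[OF fh(2)] by auto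
    have "f \<oplus>\<^bsub>free_module R U\<^esub> h \<in> carrier (free_module R U)"
      using fh by (rule F.add.m_closed)
    then have "free_ext R M g (f \<oplus>\<^bsub>free_module R U\<^esub> h) =
        (\<Oplus>\<^bsub>M\<^esub> x\<in>?S. (f \<oplus>\<^bsub>free_module R U\<^esub> h) x \<odot>\<^bsub>M\<^esub> g x)"
      using g S by (intro free_ext_superset) auto
    also have "\<dots> = (\<Oplus>\<^bsub>M\<^esub> x\<in>?S. f x \<odot>\<^bsub>M\<^esub> g x) \<oplus>\<^bsub>M\<^esub> (\<Oplus>\<^bsub>M\<^esub> x\<in>?S. h x \<odot>\<^bsub>M\<^esub> g x)"
      using supp(3)[OF fh(1)] supp(3)[OF fh(2)] g S(2)
      by (subst add_lin_comb) auto
    also have "\<dots> = free_ext R M g f \<oplus>\<^bsub>M\<^esub> free_ext R M g h"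
      using fh g S by (subst (1 2) free_ext_superset[of _ U g ?S]) auto
    finally show "free_ext R M g (f \<oplus>\<^bsub>free_module R U\<^esub> h) = free_ext R M g f \<oplus>\<^bsub>M\<^esub> free_ext R M g h" .
  next
    fix a f assume af: "a \<in> carrier R" "f \<in> carrier (free_module R U)"
    let ?S = "{x. f x \<noteq> \<zero>}"
    have "a \<odot>\<^bsub>free_module R U\<^esub> f \<in> carrier (free_module R U)"
      using af by (rule F.smult_closed)
    then have "free_ext R M g (a \<odot>\<^bsub>free_module R U\<^esub> f) = (\<Oplus>\<^bsub>M\<^esub> x\<in>?S. (a \<otimes> f x) \<odot>\<^bsub>M\<^esub> g x)"
      using g supp[OF af(2)] af by (subst free_ext_superset[of _ U g ?S]) auto
    also have "\<dots> = a \<odot>\<^bsub>M\<^esub> free_ext R M g f"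
      unfolding free_ext_def using supp[OF af(2)] af g by (subst smult_lin_comb) auto
    finally show "free_ext R M g (a \<odot>\<^bsub>free_module R U\<^esub> f) = a \<odot>\<^bsub>M\<^esub> free_ext R M g f" .
  qed (rule closed)
qed

lemma free_ext_gen:
  assumes "g \<in> U \<rightarrow> carrier M" "x \<in> U"
  shows "free_ext R M g (free_gen R x) = g x"
proof -
  have "{y. free_gen R x y \<noteq> \<zero>} \<subseteq> {x}"
    by (auto simp: free_gen_def)
  then have "free_ext R M g (free_gen R x) = (\<Oplus>\<^bsub>M\<^esub> y\<in>{x}. free_gen R x y \<odot>\<^bsub>M\<^esub> g y)"
    using assms by (intro free_ext_superset) auto
  moreover have "free_gen R x x = \<one>" "g x \<in> carrier M"
    using assms by (auto simp: free_gen_def)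
  ultimately show ?thesis
    by simp
qed

end

section \<open>Quotient modules\<close>

definition quot_ext :: "('a \<Rightarrow> 'b) \<Rightarrow> 'a set \<Rightarrow> 'b" where
  "quot_ext f U = f (SOME x. x \<in> U)"

locale module_quotient = module + 
  fixes N
  assumes N: "submodule N R M"
begin

abbreviation "Q \<equiv> quotient_module M N"

lemma abelian_subgroup: "abelian_subgroup N M"
  by (rule abelian_subgroupI3)
    (use N in \<open>auto simp: additive_subgroup_def submodule_def M.abelian_group_axioms\<close>)

sublocale N: abelian_subgroup N M
  by (rule abelian_subgroup)

lemma coset_eq_iff:
  assumes "x \<in> carrier M" "y \<in> carrier M"
  shows "N +>\<^bsub>M\<^esub> x = N +>\<^bsub>M\<^esub> y \<longleftrightarrow> x \<ominus>\<^bsub>M\<^esub> y \<in> N"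
proof
  assume "N +>\<^bsub>M\<^esub> x = N +>\<^bsub>M\<^esub> y"
  then have "x \<in> N +>\<^bsub>M\<^esub> y"
    using N.a_rcos_self[of x] assms by auto
  then show "x \<ominus>\<^bsub>M\<^esub> y \<in> N"
    using N.a_rcos_module[of y x] assms by (simp add: a_minus_def)
next
  assume "x \<ominus>\<^bsub>M\<^esub> y \<in> N"
  then have "x \<in> N +>\<^bsub>M\<^esub> y"
    using N.a_rcos_module[of y x] assms by (simp add: a_minus_def)
  then show "N +>\<^bsub>M\<^esub> x = N +>\<^bsub>M\<^esub> y"
    using N.a_repr_independence'[of x y] assms by simp
qed

lemma coset_eqI: "x \<in> carrier M \<Longrightarrow> y \<in> carrier M \<Longrightarrow> x \<ominus>\<^bsub>M\<^esub> y \<in> N \<Longrightarrow> N +>\<^bsub>M\<^esub> x = N +>\<^bsub>M\<^esub> y"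
  by (simp add: coset_eq_iff)

lemma quotient_elem:
  assumes "U \<in> carrier Q"
  obtains x where "x \<in> carrier M" "U = N +>\<^bsub>M\<^esub> x"
  using assms by (auto simp: quotient_module_def A_RCOSETS_def')

lemma coset_closed: "x \<in> carrier M \<Longrightarrow> N +>\<^bsub>M\<^esub> x \<in> carrier Q"
  by (auto simp: quotient_module_def A_RCOSETS_def')

lemma coset_add:
  "x \<in> carrier M \<Longrightarrow> y \<in> carrier M \<Longrightarrow> (N +>\<^bsub>M\<^esub> x) \<oplus>\<^bsub>Q\<^esub> (N +>\<^bsub>M\<^esub> y) = N +>\<^bsub>M\<^esub> (x \<oplus>\<^bsub>M\<^esub> y)"
  by (simp add: quotient_module_def N.a_rcos_sum)

lemma coset_zero: "\<zero>\<^bsub>Q\<^esub> = N +>\<^bsub>M\<^esub> \<zero>\<^bsub>M\<^esub>"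
  using N.a_subset by (simp add: quotient_module_def)

lemma coset_members:
  assumes "x \<in> carrier M" "y \<in> N +>\<^bsub>M\<^esub> x"
  shows "y \<in> carrier M" "N +>\<^bsub>M\<^esub> y = N +>\<^bsub>M\<^esub> x"
proof -
  show y: "y \<in> carrier M"
    using assms N.a_elemrcos_carrier by blast
  show "N +>\<^bsub>M\<^esub> y = N +>\<^bsub>M\<^esub> x"
    using N.a_repr_independence'[of y x] assms by simp
qed

text \<open>The scalar multiple of a coset is defined as a union over its members; all of them yield
  the same coset because \<open>N\<close> is closed under scalars.\<close>

lemma coset_smult:
  assumes "a \<in> carrier R" "x \<in> carrier M"
  shows "a \<odot>\<^bsub>Q\<^esub> (N +>\<^bsub>M\<^esub> x) = N +>\<^bsub>M\<^esub> (a \<odot>\<^bsub>M\<^esub> x)"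
proof -
  have "N +>\<^bsub>M\<^esub> (a \<odot>\<^bsub>M\<^esub> y) = N +>\<^bsub>M\<^esub> (a \<odot>\<^bsub>M\<^esub> x)" if "y \<in> N +>\<^bsub>M\<^esub> x" for y
  proof -
    note y = coset_members[OF assms(2) that]
    then have "y \<ominus>\<^bsub>M\<^esub> x \<in> N"
      using assms coset_eq_iff by blast
    then have "a \<odot>\<^bsub>M\<^esub> (y \<ominus>\<^bsub>M\<^esub> x) \<in> N"
      using N assms submoduleE(4) by blast
    then have "a \<odot>\<^bsub>M\<^esub> y \<ominus>\<^bsub>M\<^esub> a \<odot>\<^bsub>M\<^esub> x \<in> N"
      using assms y by (simp add: a_minus_def smult_r_distr smult_r_minus)
    then show ?thesis
      using assms y by (intro coset_eqI) auto
  qed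
  then have "(\<Union>y\<in>N +>\<^bsub>M\<^esub> x. N +>\<^bsub>M\<^esub> (a \<odot>\<^bsub>M\<^esub> y)) = N +>\<^bsub>M\<^esub> (a \<odot>\<^bsub>M\<^esub> x)"
    using N.a_rcos_self[OF assms(2)] by blast
  then show ?thesis
    by (simp add: quotient_module_def)
qed

lemmas coset_simps = coset_closed coset_add coset_smult

lemma quotient_is_module: "module R Q"
proof (rule moduleI)
  show "abelian_group Q"
  proof (rule abelian_groupI)
    fix U assume "U \<in> carrier Q"
    then obtain x where x: "x \<in> carrier M" "U = N +>\<^bsub>M\<^esub> x"
      by (rule quotient_elem)
    then show "\<exists>V\<in>carrier Q. V \<oplus>\<^bsub>Q\<^esub> U = \<zero>\<^bsub>Q\<^esub>"
      by (intro bexI[of _ "N +>\<^bsub>M\<^esub> (\<ominus>\<^bsub>M\<^esub> x)"]) (simp_all add: coset_simps coset_zero M.l_neg)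
  qed (auto elim!: quotient_elem simp: coset_simps coset_zero M.a_ac)
qed (auto elim!: quotient_elem simp: coset_simps R.is_cring smult_l_distr smult_r_distr smult_assoc1)

lemma coset_linear: "linear_map R M Q (\<lambda>x. N +>\<^bsub>M\<^esub> x)"
  by (auto simp: linear_map_def coset_simps)

lemma coset_eq_zero_iff: "x \<in> carrier M \<Longrightarrow> N +>\<^bsub>M\<^esub> x = \<zero>\<^bsub>Q\<^esub> \<longleftrightarrow> x \<in> N"
  by (simp add: coset_zero coset_eq_iff)

text \<open>Two members of a coset differ by an element of \<open>N\<close>, which \<open>f\<close>
  kills; hence the choice of a representative in \<open>quot_ext\<close> does not matter.\<close>

lemma quot_ext:
  assumes "module R P" "linear_map R M P f" and zero: "\<And>x. x \<in> N \<Longrightarrow> f x = \<zero>\<^bsub>P\<^esub>"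
  shows quot_ext_coset: "\<And>x. x \<in> carrier M \<Longrightarrow> quot_ext f (N +>\<^bsub>M\<^esub> x) = f x"
    and quot_ext_linear: "linear_map R Q P (quot_ext f)"
proof -
  interpret P: module R P by fact
  note f = linear_mapD[OF assms(2)]
  show *: "quot_ext f (N +>\<^bsub>M\<^esub> x) = f x" if x: "x \<in> carrier M" for x
  proof -
    define y where "y = (SOME y. y \<in> N +>\<^bsub>M\<^esub> x)"
    have "y \<in> N +>\<^bsub>M\<^esub> x"
      unfolding y_def using N.a_rcos_self[OF x] by (rule someI)
    note y = coset_members[OF x this]
    then have "f (y \<ominus>\<^bsub>M\<^esub> x) = \<zero>\<^bsub>P\<^esub>"
      using coset_eq_iff x zero by blast
    then have "f y \<ominus>\<^bsub>P\<^esub> f x = \<zero>\<^bsub>P\<^esub>"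
      using linear_map_minus[OF module_axioms assms(1,2)] x y by simp
    then show ?thesis
      using f(1) x y by (simp add: quot_ext_def P.diff_eq_zero_iff flip: y_def)
  qed
  show "linear_map R Q P (quot_ext f)"
    unfolding linear_map_def by (auto elim!: quotient_elem simp: coset_add coset_smult * f)
qed

end

section \<open>Tensor products of algebras\<close>

lemma module_update_mult: 
  assumes "module R M"
  shows "module R (M\<lparr>monoid.mult := m, one := u\<rparr>)" (is "module R ?M")
proof -
  interpret module R M by fact
  show ?thesis
    by (intro moduleI abelian_groupI)
      (auto simp: R.is_cring smult_l_distr smult_r_distr smult_assoc1 M.a_ac intro!: bexI[of _ "\<ominus>\<^bsub>M\<^esub> _"] M.l_neg)
qed

text \<open>\<open>base_change\<close> alters only the scalar multiplication of the tensor product;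
  this carries over the ring structure.\<close>

lemma cring_cong:
  assumes "cring R" and "carrier S = carrier R" "monoid.mult S = monoid.mult R" "one S = one R"
    "add S = add R" "zero S = zero R"
  shows "cring S"
proof -
  interpret cring R by fact
  show ?thesis
    by (intro cringI abelian_groupI comm_monoidI)
      (auto simp: assms a_ac m_ac l_distr r_distr intro!: bexI[of _ "\<ominus>\<^bsub>R\<^esub> _"] l_neg)
qed

text \<open>The free module and the formal tensors have the same additive structure, and so have the
  tensor product and \<open>base_change\<close>; sums may be moved from one record to the
  other.\<close>

lemma finsum_cong_ring:
  assumes "carrier S = carrier R" "add S = add R" "zero S = zero R"
  shows "finsum S f I = finsum R f I"
  by (simp add: finsum_def finprod_def assms)

section \<open>The ring of formal tensors\<close>

locale two_algebras = C: algebra A C + B: algebra A B for A (structure) and C and B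
begin

abbreviation "pairs \<equiv> carrier C \<times> carrier B"
abbreviation "Free \<equiv> free_module A pairs"
abbreviation "F \<equiv> formal_tensors A C B"
abbreviation "Rel \<equiv> span_submodule A F (tensor_relations A C B)"
abbreviation "T \<equiv> tensor_product A C B"
abbreviation "pure \<equiv> pure_tensor A C B"

definition pair_mult where
  "pair_mult p q = (fst p \<otimes>\<^bsub>C\<^esub> fst q, snd p \<otimes>\<^bsub>B\<^esub> snd q)"

lemma pair_mult_closed [simp]: "p \<in> pairs \<Longrightarrow> q \<in> pairs \<Longrightarrow> pair_mult p q \<in> pairs"
  by (auto simp: pair_mult_def)

lemma formal_tensors_simps:
  "carrier F = carrier Free" "add F = add Free" "zero F = zero Free" "module.smult F = module.smult Free"
  by (simp_all add: formal_tensors_def Let_def)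

lemma Free_module: "module A Free"
  by (rule C.R.free_module_is_module)

lemma F_module: "module A F"
  unfolding formal_tensors_def Let_def by (rule module_update_mult) (rule Free_module)

sublocale Free: module A Free
  by (rule Free_module)

sublocale F: module A F
  by (rule F_module)

lemma linear_map_F: "linear_map A F P f \<longleftrightarrow> linear_map A Free P f"
  by (simp add: linear_map_def formal_tensors_simps)

lemma finsum_F: "finsum F g I = finsum Free g I"
  by (rule finsum_cong_ring) (simp_all add: formal_tensors_simps)

lemma F_gen [simp]: "c \<in> carrier C \<Longrightarrow> b \<in> carrier B \<Longrightarrow> free_gen A (c, b) \<in> carrier F"
  using C.R.free_gen_closed[of "(c, b)" pairs] by (simp add: formal_tensors_simps)

lemma F_support:
  assumes "h \<in> carrier F"
  shows "h p \<in> carrier A" "h p \<noteq> \<zero> \<Longrightarrow> p \<in> pairs"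
  using assms C.R.free_module_carrier[of h pairs] unfolding formal_tensors_simps by blast+

lemma F_finite_support: "h \<in> carrier F \<Longrightarrow> finite {p. h p \<noteq> \<zero>}"
  using C.R.free_module_carrier[of h pairs] unfolding formal_tensors_simps by blast

lemma submodule_F: "submodule H A F \<longleftrightarrow> submodule H A Free"
  by (simp add: submodule_def submodule_axioms_def formal_tensors_simps)

text \<open>As a nested linear extension the product inherits linearity in the left factor from
  \<open>free_ext_linear\<close>; linearity in the right factor then follows from
  commutativity.\<close>

lemma F_mult:
  assumes "f \<in> carrier F" "g \<in> carrier F"
  shows "f \<otimes>\<^bsub>F\<^esub> g = free_ext A Free (\<lambda>p. free_ext A Free (\<lambda>q. free_gen A (pair_mult p q)) g) f"
proof -
  note supp = F_support
  have "f \<otimes>\<^bsub>F\<^esub> g = (\<Oplus>\<^bsub>Free\<^esub> p\<in>{p. f p \<noteq> \<zero>}. \<Oplus>\<^bsub>Free\<^esub> q\<in>{q. g q \<noteq> \<zero>}.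
      (f p \<otimes> g q) \<odot>\<^bsub>Free\<^esub> free_gen A (pair_mult p q))"
    by (simp add: formal_tensors_def Let_def pair_mult_def)
  also have "\<dots> = (\<Oplus>\<^bsub>Free\<^esub> p\<in>{p. f p \<noteq> \<zero>}. f p \<odot>\<^bsub>Free\<^esub>
      (\<Oplus>\<^bsub>Free\<^esub> q\<in>{q. g q \<noteq> \<zero>}. g q \<odot>\<^bsub>Free\<^esub> free_gen A (pair_mult p q)))"
    using supp[OF assms(1)] supp[OF assms(2)]
    by (intro Free.M.finsum_cong' refl Free.smult_lin_comb[symmetric])
      (auto simp del: free_module_simps intro!: Free.smult_closed Free.M.finsum_closed C.R.free_gen_closed pair_mult_closed)
  finally show ?thesis
    by (simp add: free_ext_def)
qed

lemma gen_mult_right: "p \<in> pairs \<Longrightarrow> (\<lambda>q. free_gen A (pair_mult p q)) \<in> pairs \<rightarrow> carrier Free"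
  by (intro Pi_I C.R.free_gen_closed pair_mult_closed)

lemma free_ext_gen_mult_closed:
  assumes "g \<in> carrier F"
  shows "(\<lambda>p. free_ext A Free (\<lambda>q. free_gen A (pair_mult p q)) g) \<in> pairs \<rightarrow> carrier Free"
  using linear_mapD(1)[OF Free.free_ext_linear[OF gen_mult_right]] assms by (simp add: formal_tensors_simps)

lemma F_mult_linear:
  assumes "g \<in> carrier F"
  shows "linear_map A F F (\<lambda>f. f \<otimes>\<^bsub>F\<^esub> g)"
proof -
  have "linear_map A Free Free (free_ext A Free (\<lambda>p. free_ext A Free (\<lambda>q. free_gen A (pair_mult p q)) g))"
    by (intro Free.free_ext_linear free_ext_gen_mult_closed assms)
  note * = linear_mapD[OF this]
  note closed = Free.M.a_closed Free.smult_closed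
  show ?thesis
    unfolding linear_map_def formal_tensors_simps
    using * assms closed by (auto simp: F_mult formal_tensors_simps simp del: free_module_simps)
qed

lemma F_mult_comm:
  assumes "f \<in> carrier F" "g \<in> carrier F"
  shows "f \<otimes>\<^bsub>F\<^esub> g = g \<otimes>\<^bsub>F\<^esub> f"
proof -
  note supp = F_support
  have "f \<otimes>\<^bsub>F\<^esub> g = (\<Oplus>\<^bsub>Free\<^esub> p\<in>{p. f p \<noteq> \<zero>}. \<Oplus>\<^bsub>Free\<^esub> q\<in>{q. g q \<noteq> \<zero>}.
      (f p \<otimes> g q) \<odot>\<^bsub>Free\<^esub> free_gen A (pair_mult p q))"
    by (simp add: formal_tensors_def Let_def pair_mult_def)
  also have "\<dots> = (\<Oplus>\<^bsub>Free\<^esub> q\<in>{q. g q \<noteq> \<zero>}. \<Oplus>\<^bsub>Free\<^esub> p\<in>{p. f p \<noteq> \<zero>}.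
      (f p \<otimes> g q) \<odot>\<^bsub>Free\<^esub> free_gen A (pair_mult p q))"
    using supp[OF assms(1)] supp[OF assms(2)] assms F_finite_support
    by (intro Free.M.finsum_swap Free.smult_closed C.R.free_gen_closed pair_mult_closed) auto
  also have "\<dots> = (\<Oplus>\<^bsub>Free\<^esub> q\<in>{q. g q \<noteq> \<zero>}. \<Oplus>\<^bsub>Free\<^esub> p\<in>{p. f p \<noteq> \<zero>}.
      (g q \<otimes> f p) \<odot>\<^bsub>Free\<^esub> free_gen A (pair_mult q p))"
  proof (intro Free.M.finsum_cong' refl Pi_I Free.M.finsum_closed Free.smult_closed C.R.free_gen_closed pair_mult_closed)
    fix p q assume "p \<in> {p. f p \<noteq> \<zero>}" "q \<in> {q. g q \<noteq> \<zero>}"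
    then show "(f p \<otimes> g q) \<odot>\<^bsub>Free\<^esub> free_gen A (pair_mult p q) = (g q \<otimes> f p) \<odot>\<^bsub>Free\<^esub> free_gen A (pair_mult q p)"
      using supp[OF assms(1), of p] supp[OF assms(2), of q]
      by (auto simp: pair_mult_def C.R.m_comm C.m_comm B.m_comm simp del: free_module_simps)
  qed (use supp[OF assms(1)] supp[OF assms(2)] in auto)
  also have "\<dots> = g \<otimes>\<^bsub>F\<^esub> f"
    by (simp add: formal_tensors_def Let_def pair_mult_def)
  finally show ?thesis .
qed

lemma F_mult_gen:
  assumes "c \<in> carrier C" "b \<in> carrier B" "c' \<in> carrier C" "b' \<in> carrier B"
  shows "free_gen A (c, b) \<otimes>\<^bsub>F\<^esub> free_gen A (c', b') = free_gen A (c \<otimes>\<^bsub>C\<^esub> c', b \<otimes>\<^bsub>B\<^esub> b')"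
proof -
  have "free_gen A (c, b) \<otimes>\<^bsub>F\<^esub> free_gen A (c', b') =
      free_ext A Free (\<lambda>q. free_gen A (pair_mult (c, b) q)) (free_gen A (c', b'))"
    using assms by (simp add: F_mult Free.free_ext_gen[OF free_ext_gen_mult_closed])
  also have "\<dots> = free_gen A (c \<otimes>\<^bsub>C\<^esub> c', b \<otimes>\<^bsub>B\<^esub> b')"
    using assms by (subst Free.free_ext_gen[OF gen_mult_right]) (auto simp: pair_mult_def)
  finally show ?thesis .
qed

lemmas F_mult_closed = linear_mapD(1)[OF F_mult_linear]
lemmas F_mult_add_left = linear_mapD(2)[OF F_mult_linear]
lemmas F_mult_smult_left = linear_mapD(3)[OF F_mult_linear]
lemmas F_mult_diff_left = linear_map_minus[OF F_module F_module F_mult_linear]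

lemma F_mult_linear_right:
  assumes "f \<in> carrier F"
  shows "linear_map A F F (\<lambda>g. f \<otimes>\<^bsub>F\<^esub> g)"
  unfolding linear_map_def
  using assms by (auto simp: F_mult_comm[OF assms] F_mult_closed F_mult_add_left F_mult_smult_left)

section \<open>The ideal of tensor relations\<close>

lemma tensor_relations_carrier: "tensor_relations A C B \<subseteq> carrier F"
  unfolding tensor_relations_def Let_def
  by (intro Un_least subsetI; clarify)
    (intro F.M.minus_closed F.M.a_closed F.smult_closed F_gen; simp)+

lemma tensor_relationsI:
  "c \<in> carrier C \<Longrightarrow> c' \<in> carrier C \<Longrightarrow> b \<in> carrier B \<Longrightarrow>
    free_gen A (c \<oplus>\<^bsub>C\<^esub> c', b) \<ominus>\<^bsub>F\<^esub> (free_gen A (c, b) \<oplus>\<^bsub>F\<^esub> free_gen A (c', b)) \<in> tensor_relations A C B"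
  "c \<in> carrier C \<Longrightarrow> b \<in> carrier B \<Longrightarrow> b' \<in> carrier B \<Longrightarrow>
    free_gen A (c, b \<oplus>\<^bsub>B\<^esub> b') \<ominus>\<^bsub>F\<^esub> (free_gen A (c, b) \<oplus>\<^bsub>F\<^esub> free_gen A (c, b')) \<in> tensor_relations A C B"
  "a \<in> carrier A \<Longrightarrow> c \<in> carrier C \<Longrightarrow> b \<in> carrier B \<Longrightarrow>
    free_gen A (a \<odot>\<^bsub>C\<^esub> c, b) \<ominus>\<^bsub>F\<^esub> a \<odot>\<^bsub>F\<^esub> free_gen A (c, b) \<in> tensor_relations A C B"
  "a \<in> carrier A \<Longrightarrow> c \<in> carrier C \<Longrightarrow> b \<in> carrier B \<Longrightarrow>
    free_gen A (c, a \<odot>\<^bsub>B\<^esub> b) \<ominus>\<^bsub>F\<^esub> a \<odot>\<^bsub>F\<^esub> free_gen A (c, b) \<in> tensor_relations A C B"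
  unfolding tensor_relations_def Let_def by blast+

lemma Rel_submodule: "submodule Rel A F"
  by (rule F.span_submodule) (rule tensor_relations_carrier)

lemma tensor_relations_induct [consumes 1, case_names add_left add_right smult_left smult_right]:
  assumes "r \<in> tensor_relations A C B"
    and "\<And>c c' b. c \<in> carrier C \<Longrightarrow> c' \<in> carrier C \<Longrightarrow> b \<in> carrier B \<Longrightarrow>
      P (free_gen A (c \<oplus>\<^bsub>C\<^esub> c', b) \<ominus>\<^bsub>F\<^esub> (free_gen A (c, b) \<oplus>\<^bsub>F\<^esub> free_gen A (c', b)))"
    and "\<And>c b b'. c \<in> carrier C \<Longrightarrow> b \<in> carrier B \<Longrightarrow> b' \<in> carrier B \<Longrightarrow>
      P (free_gen A (c, b \<oplus>\<^bsub>B\<^esub> b') \<ominus>\<^bsub>F\<^esub> (free_gen A (c, b) \<oplus>\<^bsub>F\<^esub> free_gen A (c, b')))"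
    and "\<And>a c b. a \<in> carrier A \<Longrightarrow> c \<in> carrier C \<Longrightarrow> b \<in> carrier B \<Longrightarrow>
      P (free_gen A (a \<odot>\<^bsub>C\<^esub> c, b) \<ominus>\<^bsub>F\<^esub> a \<odot>\<^bsub>F\<^esub> free_gen A (c, b))"
    and "\<And>a c b. a \<in> carrier A \<Longrightarrow> c \<in> carrier C \<Longrightarrow> b \<in> carrier B \<Longrightarrow>
      P (free_gen A (c, a \<odot>\<^bsub>B\<^esub> b) \<ominus>\<^bsub>F\<^esub> a \<odot>\<^bsub>F\<^esub> free_gen A (c, b))"
  shows "P r"
  using assms(1) unfolding tensor_relations_def Let_def
  by (elim UnE CollectE exE conjE; simp only: assms(2-5))

text \<open>Multiplication by a fixed pair is linear in each component, so it turns every relation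
  into a relation of the same kind.\<close>

lemma relation_mult_gen:
  assumes "r \<in> tensor_relations A C B" "c0 \<in> carrier C" "b0 \<in> carrier B"
  shows "r \<otimes>\<^bsub>F\<^esub> free_gen A (c0, b0) \<in> tensor_relations A C B"
proof -
  note simps = assms(2,3) F_gen F.M.a_closed F.smult_closed F_mult_diff_left F_mult_add_left F_mult_smult_left
    F_mult_gen C.l_distr B.l_distr C.smult_assoc2 B.smult_assoc2 tensor_relationsI
  show ?thesis
    using assms(1) by (induction rule: tensor_relations_induct) (simp_all add: simps)
qed

text \<open>\<open>Rel\<close> is defined as a submodule; this makes it an ideal. The two factors
  are freed one after the other: for a fixed relation the admissible \<open>g\<close> form a
  submodule that contains the generators, and for fixed \<open>g\<close> the admissible
  \<open>x\<close> form a submodule that contains the relations.\<close>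

lemma Rel_mult:
  assumes "x \<in> Rel" "g \<in> carrier F"
  shows "x \<otimes>\<^bsub>F\<^esub> g \<in> Rel"
proof -
  have "r \<otimes>\<^bsub>F\<^esub> g \<in> Rel" if r: "r \<in> tensor_relations A C B" for r
  proof -
    have rF: "r \<in> carrier F"
      using r tensor_relations_carrier by auto
    have "submodule {g \<in> carrier F. r \<otimes>\<^bsub>F\<^esub> g \<in> Rel} A Free"
      using F.vimage_submodule[OF F_module F_mult_linear_right[OF rF] Rel_submodule]
      by (simp add: submodule_F)
    then have "{g \<in> carrier F. r \<otimes>\<^bsub>F\<^esub> g \<in> Rel} = carrier Free"
      by (rule Free.free_module_spanned)
        (use relation_mult_gen[OF r] F.span_submodule_base in auto)
    then show ?thesis
      using assms(2) by (auto simp: formal_tensors_simps)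
  qed
  then have "Rel \<subseteq> {x \<in> carrier F. x \<otimes>\<^bsub>F\<^esub> g \<in> Rel}"
    using tensor_relations_carrier
    by (intro F.span_submodule_least F.vimage_submodule[OF F_module F_mult_linear Rel_submodule] assms) auto
  then show ?thesis
    using assms(1) by auto
qed

section \<open>The tensor product as a quotient ring\<close>

lemma quotient_locale: "module_quotient A F Rel"
  by (rule module_quotient.intro[OF F_module]) (rule module_quotient_axioms.intro, rule Rel_submodule)

sublocale Q: module_quotient A F Rel
  rewrites "quotient_module F Rel \<equiv> T"
  by (rule quotient_locale) (simp add: tensor_product_def)

lemma tensor_module: "module A T"
  by (rule Q.quotient_is_module)

sublocale T: module A T
  by (rule tensor_module)

lemma pure_coset: "pure c b = Rel +>\<^bsub>F\<^esub> free_gen A (c, b)"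
  by (simp add: pure_tensor_def)

lemma pure_closed [simp, intro]: "c \<in> carrier C \<Longrightarrow> b \<in> carrier B \<Longrightarrow> pure c b \<in> carrier T"
  by (simp add: pure_coset Q.coset_closed)

lemma pure_add_left:
  "c \<in> carrier C \<Longrightarrow> c' \<in> carrier C \<Longrightarrow> b \<in> carrier B \<Longrightarrow> pure (c \<oplus>\<^bsub>C\<^esub> c') b = pure c b \<oplus>\<^bsub>T\<^esub> pure c' b"
  by (simp add: pure_coset Q.coset_add Q.coset_eqI tensor_relationsI(1) F.span_submodule_base)

lemma pure_add_right:
  "c \<in> carrier C \<Longrightarrow> b \<in> carrier B \<Longrightarrow> b' \<in> carrier B \<Longrightarrow> pure c (b \<oplus>\<^bsub>B\<^esub> b') = pure c b \<oplus>\<^bsub>T\<^esub> pure c b'"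
  by (simp add: pure_coset Q.coset_add Q.coset_eqI tensor_relationsI(2) F.span_submodule_base)

lemma pure_smult_left:
  "a \<in> carrier A \<Longrightarrow> c \<in> carrier C \<Longrightarrow> b \<in> carrier B \<Longrightarrow> pure (a \<odot>\<^bsub>C\<^esub> c) b = a \<odot>\<^bsub>T\<^esub> pure c b"
  by (simp add: pure_coset Q.coset_smult Q.coset_eqI tensor_relationsI(3) F.span_submodule_base)

lemma pure_smult_right:
  "a \<in> carrier A \<Longrightarrow> c \<in> carrier C \<Longrightarrow> b \<in> carrier B \<Longrightarrow> pure c (a \<odot>\<^bsub>B\<^esub> b) = a \<odot>\<^bsub>T\<^esub> pure c b"
  by (simp add: pure_coset Q.coset_smult Q.coset_eqI tensor_relationsI(4) F.span_submodule_base)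

lemma pure_zero [simp]: "b \<in> carrier B \<Longrightarrow> pure \<zero>\<^bsub>C\<^esub> b = \<zero>\<^bsub>T\<^esub>"
  using pure_smult_left[of \<zero> "\<zero>\<^bsub>C\<^esub>" b] by simp

text \<open>No cases for zero and for scalars: zero is a pure tensor, and a coefficient can be
  absorbed into the left component.\<close>

lemma tensor_induct [consumes 1, case_names pure add]:
  assumes "t \<in> carrier T" and pure: "\<And>c b. c \<in> carrier C \<Longrightarrow> b \<in> carrier B \<Longrightarrow> P (pure c b)"
    and add: "\<And>t u. t \<in> carrier T \<Longrightarrow> u \<in> carrier T \<Longrightarrow> P t \<Longrightarrow> P u \<Longrightarrow> P (t \<oplus>\<^bsub>T\<^esub> u)"
  shows "P t"
proof -
  have zero: "P \<zero>\<^bsub>T\<^esub>"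
    using pure[of "\<zero>\<^bsub>C\<^esub>" "\<zero>\<^bsub>B\<^esub>"] by simp
  obtain f where f: "f \<in> carrier F" "t = Rel +>\<^bsub>F\<^esub> f"
    using assms(1) by (rule Q.quotient_elem)
  note supp = F_support[OF f(1)]
  have sum: "P (\<Oplus>\<^bsub>T\<^esub> p\<in>S. f p \<odot>\<^bsub>T\<^esub> pure (fst p) (snd p))"
    if "finite S" "S \<subseteq> {p. f p \<noteq> \<zero>}" for S
    using that
  proof (induction S rule: finite_induct)
    case (insert p S)
    have closed: "(\<lambda>p. f p \<odot>\<^bsub>T\<^esub> pure (fst p) (snd p)) \<in> S \<rightarrow> carrier T"
      using insert.prems supp by (force intro!: T.smult_closed pure_closed)
    have p: "f p \<in> carrier A" "fst p \<in> carrier C" "snd p \<in> carrier B"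
      using insert.prems supp(1)[of p] supp(2)[of p] by auto
    then have "P (f p \<odot>\<^bsub>T\<^esub> pure (fst p) (snd p))"
      using pure[of "f p \<odot>\<^bsub>C\<^esub> fst p" "snd p"] by (simp add: pure_smult_left)
    then show ?case
      using insert closed p by (simp add: add)
  qed (simp add: zero)
  have "f = (\<Oplus>\<^bsub>F\<^esub> p\<in>{p. f p \<noteq> \<zero>}. f p \<odot>\<^bsub>F\<^esub> free_gen A p)"
    using C.R.free_module_decomp[of f pairs] f(1) by (simp only: finsum_F formal_tensors_simps)
  then have "t = Rel +>\<^bsub>F\<^esub> (\<Oplus>\<^bsub>F\<^esub> p\<in>{p. f p \<noteq> \<zero>}. f p \<odot>\<^bsub>F\<^esub> free_gen A p)"
    using f(2) by simp
  also have "\<dots> = (\<Oplus>\<^bsub>T\<^esub> p\<in>{p. f p \<noteq> \<zero>}. Rel +>\<^bsub>F\<^esub> (f p \<odot>\<^bsub>F\<^esub> free_gen A p))"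
    using supp by (intro linear_map_finsum[OF F_module tensor_module Q.coset_linear]) (force intro!: F.smult_closed F_gen)
  also have "\<dots> = (\<Oplus>\<^bsub>T\<^esub> p\<in>{p. f p \<noteq> \<zero>}. f p \<odot>\<^bsub>T\<^esub> pure (fst p) (snd p))"
  proof (intro T.M.finsum_cong' refl Pi_I)
    fix p assume "p \<in> {p. f p \<noteq> \<zero>}"
    then have p: "f p \<in> carrier A" "fst p \<in> carrier C" "snd p \<in> carrier B"
      using supp(1)[of p] supp(2)[of p] by auto
    then show "f p \<odot>\<^bsub>T\<^esub> pure (fst p) (snd p) \<in> carrier T"
      by (intro T.smult_closed pure_closed)
    show "Rel +>\<^bsub>F\<^esub> (f p \<odot>\<^bsub>F\<^esub> free_gen A p) = f p \<odot>\<^bsub>T\<^esub> pure (fst p) (snd p)"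
      using p F_gen[OF p(2,3)] by (simp add: pure_coset Q.coset_smult)
  qed
  finally show ?thesis
    using sum F_finite_support[OF f(1)] by simp
qed

text \<open>The product of cosets is a union over representatives of both. They are exchanged one at
  a time, each change staying in the coset since \<open>Rel\<close> is an ideal.\<close>

lemma tensor_mult_coset:
  assumes "f \<in> carrier F" "g \<in> carrier F"
  shows "(Rel +>\<^bsub>F\<^esub> f) \<otimes>\<^bsub>T\<^esub> (Rel +>\<^bsub>F\<^esub> g) = Rel +>\<^bsub>F\<^esub> (f \<otimes>\<^bsub>F\<^esub> g)"
proof -
  have "Rel +>\<^bsub>F\<^esub> (f' \<otimes>\<^bsub>F\<^esub> g') = Rel +>\<^bsub>F\<^esub> (f \<otimes>\<^bsub>F\<^esub> g)"
    if "f' \<in> Rel +>\<^bsub>F\<^esub> f" "g' \<in> Rel +>\<^bsub>F\<^esub> g" for f' g'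
  proof -
    note f' = Q.coset_members[OF assms(1) that(1)] and g' = Q.coset_members[OF assms(2) that(2)]
    have step: "Rel +>\<^bsub>F\<^esub> (x \<otimes>\<^bsub>F\<^esub> z) = Rel +>\<^bsub>F\<^esub> (y \<otimes>\<^bsub>F\<^esub> z)"
      if "x \<in> carrier F" "y \<in> carrier F" "z \<in> carrier F" "Rel +>\<^bsub>F\<^esub> x = Rel +>\<^bsub>F\<^esub> y" for x y z
      using that by (intro Q.coset_eqI)
        (auto simp: F_mult_closed Q.coset_eq_iff Rel_mult simp flip: F_mult_diff_left)
    show ?thesis
      using step[OF f'(1) assms(1) g'(1) f'(2)] step[OF g'(1) assms(2) assms(1) g'(2)]
      by (simp add: F_mult_comm[OF assms(1)] assms g'(1))
  qed
  moreover have "f \<in> Rel +>\<^bsub>F\<^esub> f" "g \<in> Rel +>\<^bsub>F\<^esub> g"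
    using Q.N.a_rcos_self assms by auto
  ultimately have "(\<Union>f'\<in>Rel +>\<^bsub>F\<^esub> f. \<Union>g'\<in>Rel +>\<^bsub>F\<^esub> g. Rel +>\<^bsub>F\<^esub> (f' \<otimes>\<^bsub>F\<^esub> g')) = Rel +>\<^bsub>F\<^esub> (f \<otimes>\<^bsub>F\<^esub> g)"
    by blast
  then show ?thesis
    by (simp add: tensor_product_def quotient_module_def rcoset_mult_def)
qed

lemma pure_mult:
  "c \<in> carrier C \<Longrightarrow> b \<in> carrier B \<Longrightarrow> c' \<in> carrier C \<Longrightarrow> b' \<in> carrier B \<Longrightarrow>
    pure c b \<otimes>\<^bsub>T\<^esub> pure c' b' = pure (c \<otimes>\<^bsub>C\<^esub> c') (b \<otimes>\<^bsub>B\<^esub> b')"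
  by (simp add: pure_coset tensor_mult_coset F_mult_gen)

lemma tensor_one: "\<one>\<^bsub>T\<^esub> = pure \<one>\<^bsub>C\<^esub> \<one>\<^bsub>B\<^esub>"
  by (simp add: tensor_product_def quotient_module_def pure_coset formal_tensors_def Let_def)

lemma tensor_mult_comm: "t \<in> carrier T \<Longrightarrow> u \<in> carrier T \<Longrightarrow> t \<otimes>\<^bsub>T\<^esub> u = u \<otimes>\<^bsub>T\<^esub> t"
  by (elim Q.quotient_elem) (simp add: tensor_mult_coset F_mult_comm)

lemma tensor_mult_closed: "t \<in> carrier T \<Longrightarrow> u \<in> carrier T \<Longrightarrow> t \<otimes>\<^bsub>T\<^esub> u \<in> carrier T"
  by (elim Q.quotient_elem) (simp add: tensor_mult_coset F_mult_closed Q.coset_closed)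

lemma tensor_l_distr:
  "t \<in> carrier T \<Longrightarrow> t' \<in> carrier T \<Longrightarrow> u \<in> carrier T \<Longrightarrow> (t \<oplus>\<^bsub>T\<^esub> t') \<otimes>\<^bsub>T\<^esub> u = t \<otimes>\<^bsub>T\<^esub> u \<oplus>\<^bsub>T\<^esub> t' \<otimes>\<^bsub>T\<^esub> u"
  by (elim Q.quotient_elem) (simp add: tensor_mult_coset F_mult_closed Q.coset_add F_mult_add_left)

lemma tensor_r_distr:
  "t \<in> carrier T \<Longrightarrow> t' \<in> carrier T \<Longrightarrow> u \<in> carrier T \<Longrightarrow> u \<otimes>\<^bsub>T\<^esub> (t \<oplus>\<^bsub>T\<^esub> t') = u \<otimes>\<^bsub>T\<^esub> t \<oplus>\<^bsub>T\<^esub> u \<otimes>\<^bsub>T\<^esub> t'"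
  by (simp add: tensor_mult_comm[of u] tensor_l_distr)

lemma tensor_cring: "cring T"
proof (intro cringI comm_monoidI T.M.abelian_group_axioms)
  fix t u v assume tuv: "t \<in> carrier T" "u \<in> carrier T" "v \<in> carrier T"
  then show "t \<otimes>\<^bsub>T\<^esub> u \<otimes>\<^bsub>T\<^esub> v = t \<otimes>\<^bsub>T\<^esub> (u \<otimes>\<^bsub>T\<^esub> v)"
  proof (induction t rule: tensor_induct)
    case (pure c b)
    from pure(3,4,1,2) show ?case
    proof (induction u rule: tensor_induct)
      case (pure c' b')
      from pure(3,1,2,4,5) show ?case
        by (induction v rule: tensor_induct)
          (simp_all add: pure_mult C.m_assoc B.m_assoc tensor_r_distr tensor_mult_closed)
    qed (simp_all add: tensor_l_distr tensor_r_distr tensor_mult_closed)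
  qed (simp_all add: tensor_l_distr tensor_mult_closed)
next
  fix t assume "t \<in> carrier T"
  then show "\<one>\<^bsub>T\<^esub> \<otimes>\<^bsub>T\<^esub> t = t"
    by (induction rule: tensor_induct) (simp_all add: tensor_one pure_mult tensor_r_distr)
qed (simp_all add: tensor_mult_closed tensor_mult_comm tensor_l_distr tensor_r_distr tensor_one)

sublocale Tr: cring T
  by (rule tensor_cring)

text \<open>The linear extension of \<beta> to formal tensors kills each relation by one of the four
  bilinearity conditions and therefore factors through \<open>Rel\<close>.\<close>

lemma tensor_lift:
  assumes P: "module A P" and closed: "\<And>c b. c \<in> carrier C \<Longrightarrow> b \<in> carrier B \<Longrightarrow> \<beta> c b \<in> carrier P"
    and add_left: "\<And>c c' b. c \<in> carrier C \<Longrightarrow> c' \<in> carrier C \<Longrightarrow> b \<in> carrier B \<Longrightarrow> \<beta> (c \<oplus>\<^bsub>C\<^esub> c') b = \<beta> c b \<oplus>\<^bsub>P\<^esub> \<beta> c' b"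
    and add_right: "\<And>c b b'. c \<in> carrier C \<Longrightarrow> b \<in> carrier B \<Longrightarrow> b' \<in> carrier B \<Longrightarrow> \<beta> c (b \<oplus>\<^bsub>B\<^esub> b') = \<beta> c b \<oplus>\<^bsub>P\<^esub> \<beta> c b'"
    and smult_left: "\<And>a c b. a \<in> carrier A \<Longrightarrow> c \<in> carrier C \<Longrightarrow> b \<in> carrier B \<Longrightarrow> \<beta> (a \<odot>\<^bsub>C\<^esub> c) b = a \<odot>\<^bsub>P\<^esub> \<beta> c b"
    and smult_right: "\<And>a c b. a \<in> carrier A \<Longrightarrow> c \<in> carrier C \<Longrightarrow> b \<in> carrier B \<Longrightarrow> \<beta> c (a \<odot>\<^bsub>B\<^esub> b) = a \<odot>\<^bsub>P\<^esub> \<beta> c b"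
  obtains L where "linear_map A T P L" "\<And>c b. c \<in> carrier C \<Longrightarrow> b \<in> carrier B \<Longrightarrow> L (pure c b) = \<beta> c b"
proof -
  interpret P: module A P by fact
  define l where "l = free_ext A P (\<lambda>(c, b). \<beta> c b)"
  have \<beta>: "(\<lambda>(c, b). \<beta> c b) \<in> pairs \<rightarrow> carrier P"
    using closed by auto
  have lin: "linear_map A F P l"
    unfolding l_def linear_map_F by (rule P.free_ext_linear[OF \<beta>])
  have gen: "l (free_gen A (c, b)) = \<beta> c b" if "c \<in> carrier C" "b \<in> carrier B" for c b
    unfolding l_def using that by (subst P.free_ext_gen[OF \<beta>]) auto
  note simps = linear_map_minus[OF F_module P lin] linear_mapD[OF lin] gen F.smult_closed F.M.a_closed
    closed add_left add_right smult_left smult_right P.M.diff_eq_zero_iff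
  have "l r = \<zero>\<^bsub>P\<^esub>" if "r \<in> tensor_relations A C B" for r
    using that by (induction rule: tensor_relations_induct) (simp_all add: simps)
  then have "Rel \<subseteq> {x \<in> carrier F. l x \<in> {\<zero>\<^bsub>P\<^esub>}}"
    using tensor_relations_carrier
    by (intro F.span_submodule_least F.vimage_submodule[OF P lin] P.zero_submodule) auto
  then have zero: "l x = \<zero>\<^bsub>P\<^esub>" if "x \<in> Rel" for x
    using that by auto
  show thesis
  proof (rule that)
    show "linear_map A T P (quot_ext l)"
      using Q.quot_ext_linear[OF P lin zero] .
    show "quot_ext l (pure c b) = \<beta> c b" if "c \<in> carrier C" "b \<in> carrier B" for c b
      unfolding pure_coset using that by (simp add: Q.quot_ext_coset[OF P lin zero] gen)
  qed
qed

section \<open>Base change of an algebra\<close>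

abbreviation "E \<equiv> base_change A C B"

lemma base_change_simps:
  "carrier E = carrier T" "monoid.mult E = monoid.mult T" "one E = one T" "zero E = zero T" "add E = add T"
  "c \<odot>\<^bsub>E\<^esub> t = pure c \<one>\<^bsub>B\<^esub> \<otimes>\<^bsub>T\<^esub> t"
  by (simp_all add: base_change_def Let_def)

lemma base_change_algebra: "algebra C E"
proof (rule algebraI)
  show "cring E"
    by (rule cring_cong[OF tensor_cring]) (simp_all add: base_change_simps)
next
  fix c c' t assume "c \<in> carrier C" "c' \<in> carrier C" "t \<in> carrier E"
  moreover from this have "pure (c \<otimes>\<^bsub>C\<^esub> c') \<one>\<^bsub>B\<^esub> = pure c \<one>\<^bsub>B\<^esub> \<otimes>\<^bsub>T\<^esub> pure c' \<one>\<^bsub>B\<^esub>"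
    by (simp add: pure_mult)
  ultimately show "(c \<otimes>\<^bsub>C\<^esub> c') \<odot>\<^bsub>E\<^esub> t = c \<odot>\<^bsub>E\<^esub> (c' \<odot>\<^bsub>E\<^esub> t)"
    by (simp add: base_change_simps Tr.m_assoc)
next
  fix t assume "t \<in> carrier E"
  then show "\<one>\<^bsub>C\<^esub> \<odot>\<^bsub>E\<^esub> t = t"
    by (simp add: base_change_simps flip: tensor_one)
qed (simp_all add: C.M_cring base_change_simps pure_add_left Tr.l_distr Tr.r_distr Tr.m_assoc)

end

section \<open>Trace and determinant in terms of a dual basis\<close>

lemma mat_det_ring_hom:
  assumes "ring_hom_cring R S h" and X: "\<And>i j. i < n \<Longrightarrow> j < n \<Longrightarrow> X i j \<in> carrier R"
  shows "h (mat_det R n X) = mat_det S n (\<lambda>i j. h (X i j))"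
proof -
  interpret ring_hom_cring R S h by fact
  have p: "(\<lambda>i. X i (p i)) \<in> {..<n} \<rightarrow> carrier R" if "p permutes {..<n}" for p
    using permutes_in_image[OF that] X by auto
  have q: "(\<Otimes>\<^bsub>S\<^esub>i\<in>{..<n}. h (X i (p i))) \<in> carrier S" if "p permutes {..<n}" for p
    using p[OF that] by (intro S.finprod_closed) auto
  have closed: "(\<lambda>p. if evenperm p then (\<Otimes>\<^bsub>R\<^esub>i\<in>{..<n}. X i (p i)) else \<ominus>\<^bsub>R\<^esub> (\<Otimes>\<^bsub>R\<^esub>i\<in>{..<n}. X i (p i)))
      \<in> {p. p permutes {..<n}} \<rightarrow> carrier R"
    using p by auto
  show ?thesis
    unfolding mat_det_def hom_finsum[OF closed]
    by (rule S.finsum_cong') (use q R.finprod_closed[OF p] hom_finprod[OF p] in \<open>auto simp: o_def\<close>)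
qed

text \<open>A linear map into the ring itself. The predicate \<open>linear_map\<close> does not
  cover it, as the record \<open>R\<close> has no scalar multiplication.\<close>

definition linear_form :: "('r, 'k) ring_scheme \<Rightarrow> ('r, 'a, 'm) module_scheme \<Rightarrow> ('a \<Rightarrow> 'r) \<Rightarrow> bool" where
  "linear_form R M f \<longleftrightarrow>
    f \<in> carrier M \<rightarrow> carrier R \<and>
    (\<forall>x\<in>carrier M. \<forall>y\<in>carrier M. f (x \<oplus>\<^bsub>M\<^esub> y) = f x \<oplus>\<^bsub>R\<^esub> f y) \<and>
    (\<forall>a\<in>carrier R. \<forall>x\<in>carrier M. f (a \<odot>\<^bsub>M\<^esub> x) = a \<otimes>\<^bsub>R\<^esub> f x)"

lemma linear_formD:
  assumes "linear_form R M f"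
  shows "x \<in> carrier M \<Longrightarrow> f x \<in> carrier R"
    and "x \<in> carrier M \<Longrightarrow> y \<in> carrier M \<Longrightarrow> f (x \<oplus>\<^bsub>M\<^esub> y) = f x \<oplus>\<^bsub>R\<^esub> f y"
    and "a \<in> carrier R \<Longrightarrow> x \<in> carrier M \<Longrightarrow> f (a \<odot>\<^bsub>M\<^esub> x) = a \<otimes>\<^bsub>R\<^esub> f x"
  using assms unfolding linear_form_def by auto

text \<open>Equivalent to \<open>direct_summand\<close>, with the \<open>f_l\<close> as components
  of the embedding and \<open>e\<close> as images of the unit vectors. Coordinates need not be
  unique, so a basis is the special case
  \<open>f_k (e_l) = (if k = l then 1 else 0)\<close>.\<close>

definition dual_basis ::
  "('r, 'k) ring_scheme \<Rightarrow> ('r, 'a, 'm) module_scheme \<Rightarrow> nat \<Rightarrow> (nat \<Rightarrow> 'a) \<Rightarrow> (nat \<Rightarrow> 'a \<Rightarrow> 'r) \<Rightarrow> bool" where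
  "dual_basis R M n e f \<longleftrightarrow>
    e \<in> {..<n} \<rightarrow> carrier M \<and> (\<forall>l<n. linear_form R M (f l)) \<and>
    (\<forall>x\<in>carrier M. x = (\<Oplus>\<^bsub>M\<^esub> l\<in>{..<n}. f l x \<odot>\<^bsub>M\<^esub> e l))"

lemma dual_basisD:
  assumes "dual_basis R M n e f"
  shows "l < n \<Longrightarrow> e l \<in> carrier M" "l < n \<Longrightarrow> linear_form R M (f l)"
    and "l < n \<Longrightarrow> x \<in> carrier M \<Longrightarrow> f l x \<in> carrier R"
    and "x \<in> carrier M \<Longrightarrow> (\<Oplus>\<^bsub>M\<^esub> l\<in>{..<n}. f l x \<odot>\<^bsub>M\<^esub> e l) = x"
proof -
  show e: "e l \<in> carrier M" if "l < n" for l
    using assms that unfolding dual_basis_def by auto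
  show f: "linear_form R M (f l)" if "l < n" for l
    using assms that unfolding dual_basis_def by blast
  show "f l x \<in> carrier R" if "l < n" "x \<in> carrier M" for l x
    using linear_formD(1)[OF f] that by blast
  show "(\<Oplus>\<^bsub>M\<^esub> l\<in>{..<n}. f l x \<odot>\<^bsub>M\<^esub> e l) = x" if "x \<in> carrier M" for x
    using assms that unfolding dual_basis_def by simp
qed

section \<open>Dual bases of finitely generated projective modules\<close>

context module
begin

lemma linear_form_lin_comb:
  assumes f: "linear_form R M f" and "a \<in> I \<rightarrow> carrier R" "x \<in> I \<rightarrow> carrier M"
  shows "f (\<Oplus>\<^bsub>M\<^esub> i\<in>I. a i \<odot>\<^bsub>M\<^esub> x i) = (\<Oplus>i\<in>I. a i \<otimes> f (x i))"
proof -
  note f' = linear_formD[OF f]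
  have "f (\<Oplus>\<^bsub>M\<^esub> i\<in>I. a i \<odot>\<^bsub>M\<^esub> x i) = (\<Oplus>i\<in>I. f (a i \<odot>\<^bsub>M\<^esub> x i))"
    using assms by (intro additive_finsum) (auto simp: abelian_groups f' Pi_iff)
  also have "\<dots> = (\<Oplus>i\<in>I. a i \<otimes> f (x i))"
    using assms by (intro R.finsum_cong') (auto simp: f' Pi_iff)
  finally show ?thesis .
qed

lemma linear_map_lin_comb:
  assumes P: "module R P" and f: "linear_map R M P f" and "a \<in> I \<rightarrow> carrier R" "x \<in> I \<rightarrow> carrier M"
  shows "f (\<Oplus>\<^bsub>M\<^esub> i\<in>I. a i \<odot>\<^bsub>M\<^esub> x i) = (\<Oplus>\<^bsub>P\<^esub> i\<in>I. a i \<odot>\<^bsub>P\<^esub> f (x i))"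
proof -
  interpret P: module R P by fact
  note f' = linear_mapD[OF f]
  have "f (\<Oplus>\<^bsub>M\<^esub> i\<in>I. a i \<odot>\<^bsub>M\<^esub> x i) = (\<Oplus>\<^bsub>P\<^esub> i\<in>I. f (a i \<odot>\<^bsub>M\<^esub> x i))"
    using assms by (intro linear_map_finsum[OF module_axioms P f]) (auto simp: Pi_iff)
  also have "\<dots> = (\<Oplus>\<^bsub>P\<^esub> i\<in>I. a i \<odot>\<^bsub>P\<^esub> f (x i))"
    using assms by (intro P.M.finsum_cong') (auto simp: f' Pi_iff)
  finally show ?thesis .
qed

lemma linear_form_diff:
  assumes f: "linear_form R M f" and "x \<in> carrier M" "y \<in> carrier M"
  shows "f (x \<ominus>\<^bsub>M\<^esub> y) = f x \<ominus> f y"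
proof -
  note f' = linear_formD[OF f]
  have "f (x \<ominus>\<^bsub>M\<^esub> y) = f (x \<oplus>\<^bsub>M\<^esub> (\<ominus> \<one>) \<odot>\<^bsub>M\<^esub> y)"
    using assms by (simp add: smult_l_minus M.minus_eq)
  also have "\<dots> = f x \<ominus> f y"
    using assms by (simp add: f' R.l_minus R.minus_eq)
  finally show ?thesis .
qed

lemma direct_summand_dual_basis:
  assumes "direct_summand R M n i p"
  shows "dual_basis R M n (\<lambda>l. p (free_gen R l)) (\<lambda>l x. i x l)"
proof -
  let ?F = "free_module R {..<n}"
  interpret F: module R ?F
    by (rule R.free_module_is_module)
  have i: "linear_map R M ?F i" and p: "linear_map R ?F M p" and pi: "\<And>x. x \<in> carrier M \<Longrightarrow> p (i x) = x"
    using assms by (auto simp: direct_summand_def)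
  note i' = linear_mapD[OF i] and p' = linear_mapD[OF p]
  have gen: "free_gen R l \<in> carrier ?F" if "l < n" for l
    using that by simp
  have ic: "i x l \<in> carrier R" if "x \<in> carrier M" for x l
    using i'(1)[OF that] by (auto simp: R.free_module_carrier)
  have "(\<Oplus>\<^bsub>M\<^esub> l\<in>{..<n}. i x l \<odot>\<^bsub>M\<^esub> p (free_gen R l)) = x" if x: "x \<in> carrier M" for x
  proof -
    have "i x = free_ext R ?F (free_gen R) (i x)"
      using R.free_module_decomp[OF i'(1)[OF x]] by (simp add: free_ext_def)
    also have "\<dots> = (\<Oplus>\<^bsub>?F\<^esub> l\<in>{..<n}. i x l \<odot>\<^bsub>?F\<^esub> free_gen R l)"
    proof (intro F.free_ext_superset)
      show "{l. i x l \<noteq> \<zero>} \<subseteq> {..<n}"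
        using i'(1)[OF x] unfolding R.free_module_carrier by blast
    qed (use i'(1)[OF x] in auto)
    finally have "p (i x) = (\<Oplus>\<^bsub>M\<^esub> l\<in>{..<n}. i x l \<odot>\<^bsub>M\<^esub> p (free_gen R l))"
      using F.linear_map_lin_comb[OF module_axioms p, of "i x" "{..<n}" "free_gen R"] ic[OF x] gen
      by (metis (no_types, lifting) Pi_I lessThan_iff)
    then show ?thesis
      using pi[OF x] by simp
  qed
  then show ?thesis
    unfolding dual_basis_def linear_form_def
    using gen p'(1) ic i'(2,3) by auto
qed

lemma dual_basis_direct_summand:
  assumes "dual_basis R M n e f"
  shows "direct_summand R M n (\<lambda>x l. if l < n then f l x else \<zero>) (free_ext R M e)"
proof -
  note b = dual_basisD[OF assms] and f = linear_formD[OF dual_basisD(2)[OF assms]]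
  let ?i = "\<lambda>x l. if l < n then f l x else \<zero>"
  have e: "e \<in> {..<n} \<rightarrow> carrier M"
    using b(1) by auto
  have i: "?i x \<in> carrier (free_module R {..<n})" if "x \<in> carrier M" for x
    using that b(3) by (auto simp: R.free_module_carrier_finite)
  have "free_ext R M e (?i x) = x" if "x \<in> carrier M" for x
  proof -
    have "free_ext R M e (?i x) = (\<Oplus>\<^bsub>M\<^esub> l\<in>{..<n}. ?i x l \<odot>\<^bsub>M\<^esub> e l)"
      by (intro free_ext_superset[of _ "{..<n}"] i e that) auto
    also have "\<dots> = (\<Oplus>\<^bsub>M\<^esub> l\<in>{..<n}. f l x \<odot>\<^bsub>M\<^esub> e l)"
      using b that by (intro M.finsum_cong') auto
    finally show ?thesis
      using b(4)[OF that] by simp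
  qed
  then show ?thesis
    unfolding direct_summand_def
    using free_ext_linear[OF e] i f by (auto simp: linear_map_def)
qed

text \<open>Both traces equal the double sum of \<open>f'_k (\<phi> (e_l)) f_l (e'_k)\<close>: one
  expands \<open>\<phi> (e_l)\<close> in the second dual basis, or \<open>e'_k\<close> in the
  first.\<close>

lemma dual_basis_trace_unique:
  assumes "dual_basis R M n e f" "dual_basis R M m e' f'" and \<phi>: "linear_map R M M \<phi>"
  shows "(\<Oplus>l\<in>{..<n}. f l (\<phi> (e l))) = (\<Oplus>k\<in>{..<m}. f' k (\<phi> (e' k)))"
proof -
  note b = dual_basisD[OF assms(1)] and b' = dual_basisD[OF assms(2)] and \<phi>' = linear_mapD[OF \<phi>]
  have "(\<Oplus>l\<in>{..<n}. f l (\<phi> (e l))) = (\<Oplus>l\<in>{..<n}. \<Oplus>k\<in>{..<m}. f' k (\<phi> (e l)) \<otimes> f l (e' k))"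
  proof (intro R.finsum_cong' refl)
    fix l assume l: "l \<in> {..<n}"
    then have "f l (\<phi> (e l)) = f l (\<Oplus>\<^bsub>M\<^esub> k\<in>{..<m}. f' k (\<phi> (e l)) \<odot>\<^bsub>M\<^esub> e' k)"
      using b(1) \<phi>'(1) by (simp add: b'(4))
    also have "\<dots> = (\<Oplus>k\<in>{..<m}. f' k (\<phi> (e l)) \<otimes> f l (e' k))"
      using b b' \<phi>'(1) l by (intro linear_form_lin_comb) auto
    finally show "f l (\<phi> (e l)) = (\<Oplus>k\<in>{..<m}. f' k (\<phi> (e l)) \<otimes> f l (e' k))" .
  qed (use b b' \<phi>'(1) in auto)
  also have "\<dots> = (\<Oplus>k\<in>{..<m}. \<Oplus>l\<in>{..<n}. f' k (\<phi> (e l)) \<otimes> f l (e' k))"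
    using b b' \<phi>'(1) by (intro R.finsum_swap) auto
  also have "\<dots> = (\<Oplus>k\<in>{..<m}. f' k (\<phi> (e' k)))"
  proof (intro R.finsum_cong' refl)
    fix k assume k: "k \<in> {..<m}"
    then have "\<phi> (e' k) = \<phi> (\<Oplus>\<^bsub>M\<^esub> l\<in>{..<n}. f l (e' k) \<odot>\<^bsub>M\<^esub> e l)"
      using b'(1) by (simp add: b(4))
    also have "\<dots> = (\<Oplus>\<^bsub>M\<^esub> l\<in>{..<n}. f l (e' k) \<odot>\<^bsub>M\<^esub> \<phi> (e l))"
      using b b' k by (intro linear_map_lin_comb[OF module_axioms \<phi>]) auto
    finally have "f' k (\<phi> (e' k)) = (\<Oplus>l\<in>{..<n}. f l (e' k) \<otimes> f' k (\<phi> (e l)))"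
      using b b' k \<phi>'(1) by (simp add: linear_form_lin_comb[OF b'(2)] Pi_iff)
    also have "\<dots> = (\<Oplus>l\<in>{..<n}. f' k (\<phi> (e l)) \<otimes> f l (e' k))"
      using b b' k \<phi>'(1) by (intro R.finsum_cong') (auto simp: R.m_comm)
    finally show "(\<Oplus>l\<in>{..<n}. f' k (\<phi> (e l)) \<otimes> f l (e' k)) = f' k (\<phi> (e' k))" ..
  qed (use b' \<phi>'(1) in auto)
  finally show ?thesis .
qed

lemma endo_trace_eq:
  assumes "dual_basis R M n e f" and \<phi>: "linear_map R M M \<phi>"
  shows "endo_trace R M \<phi> = (\<Oplus>l\<in>{..<n}. f l (\<phi> (e l)))"
  unfolding endo_trace_def
proof (rule the_equality)
  note b = dual_basisD[OF assms(1)] and \<phi>' = linear_mapD[OF \<phi>]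
  have e: "e \<in> {..<n} \<rightarrow> carrier M"
    using b(1) by auto
  show "\<exists>n' i p. direct_summand R M n' i p \<and>
      (\<Oplus>l\<in>{..<n}. f l (\<phi> (e l))) = mat_trace R n' (\<lambda>k l. i (\<phi> (p (free_gen R l))) k)"
    by (intro exI[of _ n] exI conjI, rule dual_basis_direct_summand[OF assms(1)])
      (use b \<phi>'(1) free_ext_gen[OF e] in \<open>auto simp: mat_trace_def intro!: R.finsum_cong'\<close>)
  fix t assume "\<exists>n i p. direct_summand R M n i p \<and> t = mat_trace R n (\<lambda>k l. i (\<phi> (p (free_gen R l))) k)"
  then show "t = (\<Oplus>l\<in>{..<n}. f l (\<phi> (e l)))"
    using dual_basis_trace_unique[OF direct_summand_dual_basis assms(1) \<phi>] by (auto simp: mat_trace_def)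
qed

text \<open>With \<open>\<psi> = \<phi> - id\<close> the two matrices are
  \<open>1 + (f_k (\<psi> (e_l)))\<close> and \<open>1 + (f'_k (\<psi> (e'_l)))\<close>. The first
  is \<open>1 + X Y\<close> for \<open>X = (f_k (e'_j))\<close> and
  \<open>Y = (f'_j (\<psi> (e_l)))\<close>, the second is \<open>1 + Y X\<close>; Sylvester's
  identity applies.\<close>

lemma dual_basis_det_unique:
  assumes "dual_basis R M n e f" "dual_basis R M m e' f'" and \<phi>: "linear_map R M M \<phi>"
  shows "mat_det R n (\<lambda>k l. (free_gen R l k \<ominus> f k (e l)) \<oplus> f k (\<phi> (e l))) =
    mat_det R m (\<lambda>k l. (free_gen R l k \<ominus> f' k (e' l)) \<oplus> f' k (\<phi> (e' l)))"
proof -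
  note \<phi>' = linear_mapD[OF \<phi>]
  define \<psi> where "\<psi> x = \<phi> x \<ominus>\<^bsub>M\<^esub> x" for x
  have \<psi>: "linear_map R M M \<psi>"
    unfolding linear_map_def \<psi>_def
    using \<phi>' by (auto simp: M.minus_eq M.minus_add M.a_ac smult_r_distr smult_r_minus)
  note \<psi>' = linear_mapD[OF \<psi>]
  have entry: "(free_gen R l k \<ominus> f k (e l)) \<oplus> f k (\<phi> (e l)) = (if k = l then \<one> else \<zero>) \<oplus> f k (\<psi> (e l))"
    if "dual_basis R M n e f" "k < n" "l < n" for k l :: nat and n e f
  proof -
    note b = dual_basisD[OF that(1)]
    show ?thesis
      using that b \<phi>' by (auto simp: \<psi>_def linear_form_diff free_gen_def R.minus_eq R.a_ac)
  qed
  have expand: "f k (\<psi> x) = (\<Oplus>j\<in>{..<m}. f k (e' j) \<otimes> f' j (\<psi> x))"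
    if "dual_basis R M m e' f'" "linear_form R M (f k)" "x \<in> carrier M" for m e' f' f x and k :: nat
  proof -
    note b' = dual_basisD[OF that(1)]
    have "f k (\<psi> x) = f k (\<Oplus>\<^bsub>M\<^esub> j\<in>{..<m}. f' j (\<psi> x) \<odot>\<^bsub>M\<^esub> e' j)"
      using \<psi>'(1) that by (simp add: b'(4))
    also have "\<dots> = (\<Oplus>j\<in>{..<m}. f' j (\<psi> x) \<otimes> f k (e' j))"
      using b' \<psi>'(1) that by (intro linear_form_lin_comb) auto
    also have "\<dots> = (\<Oplus>j\<in>{..<m}. f k (e' j) \<otimes> f' j (\<psi> x))"
      using b' \<psi>'(1) that linear_formD(1)[OF that(2)] by (intro R.finsum_cong') (auto simp: R.m_comm)
    finally show ?thesis .
  qed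
  note b = dual_basisD[OF assms(1)] and b' = dual_basisD[OF assms(2)]
  have contract: "(\<Oplus>l\<in>{..<n}. f' j (\<psi> (e l)) \<otimes> f l (e' q)) = f' j (\<psi> (e' q))" if "j < m" "q < m" for j q
  proof -
    have "\<psi> (e' q) = \<psi> (\<Oplus>\<^bsub>M\<^esub> l\<in>{..<n}. f l (e' q) \<odot>\<^bsub>M\<^esub> e l)"
      using b'(1) that by (simp add: b(4))
    also have "\<dots> = (\<Oplus>\<^bsub>M\<^esub> l\<in>{..<n}. f l (e' q) \<odot>\<^bsub>M\<^esub> \<psi> (e l))"
      using b b' that by (intro linear_map_lin_comb[OF module_axioms \<psi>]) auto
    finally have "f' j (\<psi> (e' q)) = (\<Oplus>l\<in>{..<n}. f l (e' q) \<otimes> f' j (\<psi> (e l)))"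
      using b b' that \<psi>'(1) by (simp add: linear_form_lin_comb[OF b'(2)] Pi_iff)
    also have "\<dots> = (\<Oplus>l\<in>{..<n}. f' j (\<psi> (e l)) \<otimes> f l (e' q))"
      using b b' that \<psi>'(1) by (intro R.finsum_cong') (auto simp: R.m_comm)
    finally show ?thesis ..
  qed
  have "mat_det R n (\<lambda>k l. (free_gen R l k \<ominus> f k (e l)) \<oplus> f k (\<phi> (e l))) =
      mat_det R n (\<lambda>k l. (if k = l then \<one> else \<zero>) \<oplus> (\<Oplus>j\<in>{..<m}. f k (e' j) \<otimes> f' j (\<psi> (e l))))"
    using b b' \<psi>'(1) expand[OF assms(2)]
    by (intro R.mat_det_cong) (auto simp: entry[OF assms(1)] intro!: R.add.m_closed R.finsum_closed)
  also have "\<dots> = mat_det R m (\<lambda>j q. (if j = q then \<one> else \<zero>) \<oplus> (\<Oplus>l\<in>{..<n}. f' j (\<psi> (e l)) \<otimes> f l (e' q)))"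
    using b b' \<psi>'(1) by (intro R.mat_det_one_plus_mult_commute) auto
  also have "\<dots> = mat_det R m (\<lambda>k l. (free_gen R l k \<ominus> f' k (e' l)) \<oplus> f' k (\<phi> (e' l)))"
    using b b' \<psi>'(1) \<phi>'(1)
    by (intro R.mat_det_cong) (auto simp: entry[OF assms(2)] contract)
  finally show ?thesis .
qed

lemma endo_det_eq:
  assumes "dual_basis R M n e f" and \<phi>: "linear_map R M M \<phi>"
  shows "endo_det R M \<phi> = mat_det R n (\<lambda>k l. (free_gen R l k \<ominus> f k (e l)) \<oplus> f k (\<phi> (e l)))"
  unfolding endo_det_def
proof (rule the_equality)
  note b = dual_basisD[OF assms(1)] and \<phi>' = linear_mapD[OF \<phi>]
  have e: "e \<in> {..<n} \<rightarrow> carrier M"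
    using b(1) by auto
  show "\<exists>n' i p. direct_summand R M n' i p \<and>
      mat_det R n (\<lambda>k l. (free_gen R l k \<ominus> f k (e l)) \<oplus> f k (\<phi> (e l))) =
      mat_det R n' (\<lambda>k l. (free_gen R l k \<ominus> i (p (free_gen R l)) k) \<oplus> i (\<phi> (p (free_gen R l))) k)"
    by (intro exI[of _ n] exI conjI, rule dual_basis_direct_summand[OF assms(1)])
      (use b \<phi>'(1) free_ext_gen[OF e] in \<open>auto simp: free_gen_def intro!: R.mat_det_cong\<close>)
  fix t assume "\<exists>n i p. direct_summand R M n i p \<and>
      t = mat_det R n (\<lambda>k l. (free_gen R l k \<ominus> i (p (free_gen R l)) k) \<oplus> i (\<phi> (p (free_gen R l))) k)"
  then show "t = mat_det R n (\<lambda>k l. (free_gen R l k \<ominus> f k (e l)) \<oplus> f k (\<phi> (e l)))"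
    using dual_basis_det_unique[OF direct_summand_dual_basis assms(1) \<phi>] by auto
qed

end

lemma (in algebra) mult_linear:
  assumes "b \<in> carrier M"
  shows "linear_map R M M (\<lambda>x. b \<otimes>\<^bsub>M\<^esub> x)"
  unfolding linear_map_def using assms
  by (auto simp: r_distr smult_assoc2 m_comm[of b])

section \<open>Base change of dual bases, traces and norms\<close>

context two_algebras
begin

lemma additive_pure: "c \<in> carrier C \<Longrightarrow> g \<in> I \<rightarrow> carrier B \<Longrightarrow> pure c (\<Oplus>\<^bsub>B\<^esub> i\<in>I. g i) = (\<Oplus>\<^bsub>T\<^esub> i\<in>I. pure c (g i))"
  by (rule additive_finsum) (auto simp: B.abelian_groups T.abelian_groups pure_add_right)

text \<open>The new forms are \<open>id \<otimes> f_l\<close>. Their values on pure tensors are part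
  of the conclusion, because traces and norms over \<open>C\<close> are compared with those over
  \<open>A\<close> entry by entry.\<close>

lemma base_change_dual_basis:
  assumes "dual_basis A B n e f"
  obtains f' where "dual_basis C E n (\<lambda>l. pure \<one>\<^bsub>C\<^esub> (e l)) f'"
    "\<And>l c b. l < n \<Longrightarrow> c \<in> carrier C \<Longrightarrow> b \<in> carrier B \<Longrightarrow> f' l (pure c b) = f l b \<odot>\<^bsub>C\<^esub> c"
proof -
  note b = dual_basisD[OF assms] and f = linear_formD[OF dual_basisD(2)[OF assms]]
  interpret E: algebra C E
    by (rule base_change_algebra)
  have "\<exists>L. linear_map A T C L \<and> (\<forall>c\<in>carrier C. \<forall>b\<in>carrier B. L (pure c b) = f l b \<odot>\<^bsub>C\<^esub> c)" if l: "l < n" for l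
  proof -
    obtain L where "linear_map A T C L" "\<And>c b. c \<in> carrier C \<Longrightarrow> b \<in> carrier B \<Longrightarrow> L (pure c b) = f l b \<odot>\<^bsub>C\<^esub> c"
      by (rule tensor_lift[where P = C and \<beta> = "\<lambda>c b. f l b \<odot>\<^bsub>C\<^esub> c"])
        (use l in \<open>auto simp: f C.module_axioms C.smult_l_distr C.smult_r_distr C.R.m_comm simp flip: C.smult_assoc1\<close>)
    then show ?thesis
      by blast
  qed
  then obtain f' where f'_lin: "\<And>l. l < n \<Longrightarrow> linear_map A T C (f' l)"
    and f'_pure: "\<And>l c b. l < n \<Longrightarrow> c \<in> carrier C \<Longrightarrow> b \<in> carrier B \<Longrightarrow> f' l (pure c b) = f l b \<odot>\<^bsub>C\<^esub> c"
    by metis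
  note f' = linear_mapD[OF f'_lin]
  \<comment> \<open>The lift is only known to be \<open>A\<close>-linear; linearity over
    \<open>C\<close> is seen on pure tensors.\<close>
  have smult: "f' l (pure c \<one>\<^bsub>B\<^esub> \<otimes>\<^bsub>T\<^esub> t) = c \<otimes>\<^bsub>C\<^esub> f' l t" if "l < n" "c \<in> carrier C" "t \<in> carrier T" for l c t
    using that(3)
    by (induction rule: tensor_induct)
      (use that f in \<open>simp_all add: f' f'_pure pure_mult tensor_r_distr tensor_mult_closed C.r_distr
        C.smult_assoc2 C.m_comm[of c]\<close>)
  have rec: "(\<Oplus>\<^bsub>E\<^esub> l\<in>{..<n}. f' l t \<odot>\<^bsub>E\<^esub> pure \<one>\<^bsub>C\<^esub> (e l)) = t" if "t \<in> carrier T" for t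
    using that
  proof (induction rule: tensor_induct)
    case (pure c x)
    have "(\<Oplus>\<^bsub>E\<^esub> l\<in>{..<n}. f' l (pure c x) \<odot>\<^bsub>E\<^esub> pure \<one>\<^bsub>C\<^esub> (e l)) =
        (\<Oplus>\<^bsub>T\<^esub> l\<in>{..<n}. f' l (pure c x) \<odot>\<^bsub>E\<^esub> pure \<one>\<^bsub>C\<^esub> (e l))"
      by (rule finsum_cong_ring) (simp_all add: base_change_simps)
    also have "\<dots> = (\<Oplus>\<^bsub>T\<^esub> l\<in>{..<n}. pure c (f l x \<odot>\<^bsub>B\<^esub> e l))"
      using pure b by (intro T.M.finsum_cong')
        (auto simp: f'_pure base_change_simps pure_mult pure_smult_right simp flip: pure_smult_left)
    also have "\<dots> = pure c (\<Oplus>\<^bsub>B\<^esub> l\<in>{..<n}. f l x \<odot>\<^bsub>B\<^esub> e l)"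
      using pure b by (subst additive_pure) auto
    finally show ?case
      using pure b(4) by simp
  next
    case (add t u)
    have "(\<Oplus>\<^bsub>E\<^esub> l\<in>{..<n}. f' l (t \<oplus>\<^bsub>T\<^esub> u) \<odot>\<^bsub>E\<^esub> pure \<one>\<^bsub>C\<^esub> (e l)) =
        (\<Oplus>\<^bsub>E\<^esub> l\<in>{..<n}. (f' l t \<oplus>\<^bsub>C\<^esub> f' l u) \<odot>\<^bsub>E\<^esub> pure \<one>\<^bsub>C\<^esub> (e l))"
      using add(1,2) b(1) by (intro E.M.finsum_cong') (auto simp: f' base_change_simps tensor_mult_closed)
    also have "\<dots> = (\<Oplus>\<^bsub>E\<^esub> l\<in>{..<n}. f' l t \<odot>\<^bsub>E\<^esub> pure \<one>\<^bsub>C\<^esub> (e l)) \<oplus>\<^bsub>E\<^esub> (\<Oplus>\<^bsub>E\<^esub> l\<in>{..<n}. f' l u \<odot>\<^bsub>E\<^esub> pure \<one>\<^bsub>C\<^esub> (e l))"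
      using add(1,2) b(1) by (intro E.add_lin_comb[symmetric]) (auto simp: f' base_change_simps(1))
    finally show ?case
      using add by (simp add: base_change_simps(5))
  qed
  show thesis
  proof (rule that)
    show "dual_basis C E n (\<lambda>l. pure \<one>\<^bsub>C\<^esub> (e l)) f'"
      unfolding dual_basis_def linear_form_def
      using b(1) f' smult rec by (auto simp: base_change_simps)
  qed (rule f'_pure)
qed

lemma structure_map_hom: "ring_hom_cring A C (\<lambda>a. a \<odot>\<^bsub>C\<^esub> \<one>\<^bsub>C\<^esub>)"
proof (intro ring_hom_cring.intro ring_hom_cring_axioms.intro)
  show "(\<lambda>a. a \<odot>\<^bsub>C\<^esub> \<one>\<^bsub>C\<^esub>) \<in> ring_hom A C"
    by (rule ring_hom_memI) (auto simp: C.smult_l_distr C.smult_assoc1 C.smult_assoc2)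
qed (rule C.R_cring C.M_cring)+

lemma base_change_trace:
  assumes "dual_basis A B n e f" "c \<in> carrier C" "b \<in> carrier B"
  shows "algebra_trace C E (pure c b) = algebra_trace A B b \<odot>\<^bsub>C\<^esub> c"
proof -
  interpret E: algebra C E
    by (rule base_change_algebra)
  note b = dual_basisD[OF assms(1)]
  obtain f' where f': "dual_basis C E n (\<lambda>l. pure \<one>\<^bsub>C\<^esub> (e l)) f'"
    "\<And>l c b. l < n \<Longrightarrow> c \<in> carrier C \<Longrightarrow> b \<in> carrier B \<Longrightarrow> f' l (pure c b) = f l b \<odot>\<^bsub>C\<^esub> c"
    using base_change_dual_basis[OF assms(1)] by blast
  have "pure c b \<in> carrier E"
    using assms by (simp add: base_change_simps)
  then have "algebra_trace C E (pure c b) = (\<Oplus>\<^bsub>C\<^esub> l\<in>{..<n}. f' l (pure c b \<otimes>\<^bsub>E\<^esub> pure \<one>\<^bsub>C\<^esub> (e l)))"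
    unfolding algebra_trace_def by (intro E.endo_trace_eq[OF f'(1)] E.mult_linear)
  also have "\<dots> = (\<Oplus>\<^bsub>C\<^esub> l\<in>{..<n}. f l (b \<otimes>\<^bsub>B\<^esub> e l) \<odot>\<^bsub>C\<^esub> c)"
    using assms b by (intro C.M.finsum_cong') (auto simp: base_change_simps pure_mult f'(2))
  also have "\<dots> = algebra_trace A B b \<odot>\<^bsub>C\<^esub> c"
    unfolding algebra_trace_def B.endo_trace_eq[OF assms(1) B.mult_linear[OF assms(3)]]
    using assms b by (intro C.finsum_smult_rdistr[symmetric]) auto
  finally show ?thesis .
qed

lemma base_change_norm:
  assumes "dual_basis A B n e f" "b \<in> carrier B"
  shows "algebra_norm C E (pure \<one>\<^bsub>C\<^esub> b) = algebra_norm A B b \<odot>\<^bsub>C\<^esub> \<one>\<^bsub>C\<^esub>"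
proof -
  interpret E: algebra C E
    by (rule base_change_algebra)
  interpret h: ring_hom_cring A C "\<lambda>a. a \<odot>\<^bsub>C\<^esub> \<one>\<^bsub>C\<^esub>"
    by (rule structure_map_hom)
  note b = dual_basisD[OF assms(1)]
  obtain f' where f': "dual_basis C E n (\<lambda>l. pure \<one>\<^bsub>C\<^esub> (e l)) f'"
    "\<And>l c b. l < n \<Longrightarrow> c \<in> carrier C \<Longrightarrow> b \<in> carrier B \<Longrightarrow> f' l (pure c b) = f l b \<odot>\<^bsub>C\<^esub> c"
    using base_change_dual_basis[OF assms(1)] by blast
  have "pure \<one>\<^bsub>C\<^esub> b \<in> carrier E"
    using assms by (simp add: base_change_simps)
  then have "algebra_norm C E (pure \<one>\<^bsub>C\<^esub> b) = mat_det C n (\<lambda>k l. (free_gen C l k \<ominus>\<^bsub>C\<^esub> f' k (pure \<one>\<^bsub>C\<^esub> (e l))) \<oplus>\<^bsub>C\<^esub>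
      f' k (pure \<one>\<^bsub>C\<^esub> b \<otimes>\<^bsub>E\<^esub> pure \<one>\<^bsub>C\<^esub> (e l)))"
    unfolding algebra_norm_def by (intro E.endo_det_eq[OF f'(1)] E.mult_linear)
  also have "\<dots> = mat_det C n (\<lambda>k l. ((free_gen A l k \<ominus> f k (e l)) \<oplus> f k (b \<otimes>\<^bsub>B\<^esub> e l)) \<odot>\<^bsub>C\<^esub> \<one>\<^bsub>C\<^esub>)"
    using assms b h.hom_one by (intro cring.mat_det_cong[OF C.M_cring])
      (auto simp: base_change_simps pure_mult f'(2) free_gen_def C.R.minus_eq C.M.minus_eq C.smult_l_distr C.smult_l_minus)
  also have "\<dots> = algebra_norm A B b \<odot>\<^bsub>C\<^esub> \<one>\<^bsub>C\<^esub>"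
    unfolding algebra_norm_def B.endo_det_eq[OF assms(1) B.mult_linear[OF assms(2)]]
    using assms b by (intro mat_det_ring_hom[OF structure_map_hom, symmetric]) (auto simp: free_gen_def)
  finally show ?thesis .
qed

end

section \<open>Ideals and localization\<close>

context cring
begin

lemma idealI':
  assumes "I \<subseteq> carrier R" "\<zero> \<in> I" "\<And>x y. x \<in> I \<Longrightarrow> y \<in> I \<Longrightarrow> x \<oplus> y \<in> I"
    and mult: "\<And>r x. r \<in> carrier R \<Longrightarrow> x \<in> I \<Longrightarrow> r \<otimes> x \<in> I"
  shows "ideal I R"
proof (rule idealI)
  show "subgroup I (add_monoid R)"
  proof (rule add.subgroupI)
    fix x assume "x \<in> I"
    then show "\<ominus> x \<in> I"
      using mult[of "\<ominus> \<one>" x] assms(1) by (auto simp: l_minus)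
  qed (use assms in auto)
  fix x r assume "x \<in> I" "r \<in> carrier R"
  then show "x \<otimes> r \<in> I"
    using mult[of r x] assms(1) by (auto simp: m_comm)
qed (use assms ring_axioms in auto)

lemma idealD:
  assumes "ideal I R"
  shows "x \<in> I \<Longrightarrow> x \<in> carrier R" "\<zero> \<in> I" "x \<in> I \<Longrightarrow> y \<in> I \<Longrightarrow> x \<oplus> y \<in> I"
    "r \<in> carrier R \<Longrightarrow> x \<in> I \<Longrightarrow> r \<otimes> x \<in> I"
  using ideal.Icarr[OF assms] additive_subgroup.zero_closed[OF ideal.axioms(1)[OF assms]]
    additive_subgroup.a_closed[OF ideal.axioms(1)[OF assms]] ideal.I_l_closed[OF assms] by blast+

text \<open>Closure under addition is the only point. The claim is generalized to
  \<open>(x + y)^m x^a y^b\<close> with \<open>m + a + b\<close> large enough; the induction on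
  \<open>m\<close> moves one factor \<open>x + y\<close> into \<open>x\<close> or \<open>y\<close>
  and takes the place of the binomial formula.\<close>

lemma radical_ideal:
  assumes I: "ideal I R"
  shows "ideal {x \<in> carrier R. \<exists>k::nat. x [^] k \<in> I} R"
proof (rule idealI')
  note I' = idealD[OF I]
  fix x y assume "x \<in> {x \<in> carrier R. \<exists>k::nat. x [^] k \<in> I}" "y \<in> {x \<in> carrier R. \<exists>k::nat. x [^] k \<in> I}"
  then obtain k l :: nat where x: "x \<in> carrier R" "x [^] k \<in> I" and y: "y \<in> carrier R" "y [^] l \<in> I"
    by auto
  have "(x \<oplus> y) [^] m \<otimes> (x [^] a \<otimes> y [^] b) \<in> I" if "k + l \<le> m + a + b" for m a b :: nat
    using that
  proof (induction m arbitrary: a b)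
    case 0
    show ?case
    proof (cases "k \<le> a")
      case True
      then have "x [^] a = x [^] (a - k) \<otimes> x [^] k"
        using x by (simp add: nat_pow_mult)
      then show ?thesis
        using I'(4)[of "y [^] b \<otimes> x [^] (a - k)" "x [^] k"] x y by (simp add: m_ac)
    next
      case False
      then have "y [^] b = y [^] (b - l) \<otimes> y [^] l"
        using y 0 by (simp add: nat_pow_mult)
      then show ?thesis
        using I'(4)[of "x [^] a \<otimes> y [^] (b - l)" "y [^] l"] x y by (simp add: m_ac)
    qed
  next
    case (Suc m)
    have "(x \<oplus> y) [^] Suc m \<otimes> (x [^] a \<otimes> y [^] b) =
        (x \<oplus> y) [^] m \<otimes> (x [^] Suc a \<otimes> y [^] b) \<oplus> (x \<oplus> y) [^] m \<otimes> (x [^] a \<otimes> y [^] Suc b)"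
      using x y by (simp add: l_distr r_distr m_ac)
    then show ?case
      using Suc.IH[of "Suc a" b] Suc.IH[of a "Suc b"] Suc.prems I'(3) by simp
  qed
  from this[of "k + l" 0 0] show "x \<oplus> y \<in> {x \<in> carrier R. \<exists>k::nat. x [^] k \<in> I}"
    using x y by auto
next
  fix r x assume "r \<in> carrier R" "x \<in> {x \<in> carrier R. \<exists>k::nat. x [^] k \<in> I}"
  then show "r \<otimes> x \<in> {x \<in> carrier R. \<exists>k::nat. x [^] k \<in> I}"
    by (auto simp: nat_pow_distrib intro: idealD(4)[OF I])
qed (auto intro!: exI[of _ "1::nat"] idealD(2)[OF I])

text \<open>The elements that multiply \<open>a\<close> into \<open>I\<close> form an ideal. Its
  radical contains \<open>S\<close> by hypothesis, hence contains 1, and powers of 1 are 1.\<close>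

lemma ideal_local_global:
  assumes I: "ideal I R" and S: "S \<subseteq> carrier R" "Idl S = carrier R" and "a \<in> carrier R"
    and loc: "\<And>s. s \<in> S \<Longrightarrow> \<exists>k::nat. s [^] k \<otimes> a \<in> I"
  shows "a \<in> I"
proof -
  note I' = idealD[OF I]
  let ?J = "{x \<in> carrier R. x \<otimes> a \<in> I}"
  have J: "ideal ?J R"
    by (rule idealI') (use assms(4) I' in \<open>auto simp: l_distr m_assoc\<close>)
  have "S \<subseteq> {x \<in> carrier R. \<exists>k::nat. x [^] k \<in> ?J}"
    using S(1) loc by auto
  then have "Idl S \<subseteq> {x \<in> carrier R. \<exists>k::nat. x [^] k \<in> ?J}"
    by (intro genideal_minimal radical_ideal[OF J])
  then have "\<one> \<in> {x \<in> carrier R. \<exists>k::nat. x [^] k \<in> ?J}"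
    using one_closed S(2) by blast
  then show ?thesis
    using assms(4) by auto
qed

lemma genideal_singleton: "d \<in> carrier R \<Longrightarrow> x \<in> Idl {d} \<longleftrightarrow> (\<exists>c\<in>carrier R. x = c \<otimes> d)"
  by (simp add: cgenideal_eq_genideal[symmetric] cgenideal_def) blast

end

section \<open>The ring A[1/s]\<close>

locale localized_ring = cring A for A (structure) +
  fixes s
  assumes s [simp]: "s \<in> carrier A"
begin

abbreviation "L \<equiv> localization A s"
abbreviation "fr \<equiv> fraction A s"

lemma pow_mult_assoc: "x \<in> carrier A \<Longrightarrow> s [^] (m + n) \<otimes> x = s [^] m \<otimes> (s [^] n \<otimes> x)" for m n :: nat
  by (simp add: m_assoc flip: nat_pow_mult)

lemma equiv_fraction_rel: "equiv (carrier A \<times> UNIV) (fraction_rel A s)"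
proof (rule equivI)
  show "fraction_rel A s \<subseteq> (carrier A \<times> UNIV) \<times> (carrier A \<times> UNIV)"
    by (auto simp: fraction_rel_def)
  show "refl_on (carrier A \<times> UNIV) (fraction_rel A s)"
    by (auto simp: refl_on_def fraction_rel_def)
  show "sym (fraction_rel A s)"
    by (auto simp: sym_def fraction_rel_def intro: sym)
  show "trans (fraction_rel A s)"
  proof (rule transI)
    fix u v w assume "(u, v) \<in> fraction_rel A s" "(v, w) \<in> fraction_rel A s"
    then obtain x m y n z p and k l :: nat where uvw: "u = (x, m)" "v = (y, n)" "w = (z, p)"
      and c: "x \<in> carrier A" "y \<in> carrier A" "z \<in> carrier A"
      and k: "s [^] k \<otimes> (s [^] n \<otimes> x) = s [^] k \<otimes> (s [^] m \<otimes> y)"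
      and l: "s [^] l \<otimes> (s [^] p \<otimes> y) = s [^] l \<otimes> (s [^] n \<otimes> z)"
      by (auto simp: fraction_rel_def)
    have "s [^] (k + l + n) \<otimes> (s [^] p \<otimes> x) = s [^] l \<otimes> (s [^] p \<otimes> (s [^] k \<otimes> (s [^] n \<otimes> x)))"
      using c by (simp add: m_ac flip: nat_pow_mult)
    also have "\<dots> = s [^] k \<otimes> (s [^] m \<otimes> (s [^] l \<otimes> (s [^] p \<otimes> y)))"
      unfolding k using c by (simp add: m_ac)
    also have "\<dots> = s [^] (k + l + n) \<otimes> (s [^] m \<otimes> z)"
      unfolding l using c by (simp add: m_ac flip: nat_pow_mult)
    finally show "(u, w) \<in> fraction_rel A s"
      using c uvw by (auto simp: fraction_rel_def)
  qed
qed

lemma frac_eq_iff: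
  assumes "x \<in> carrier A" "y \<in> carrier A"
  shows "fr x m = fr y n \<longleftrightarrow> (\<exists>k::nat. s [^] k \<otimes> (s [^] n \<otimes> x) = s [^] k \<otimes> (s [^] m \<otimes> y))"
  using eq_equiv_class_iff[OF equiv_fraction_rel, of "(x, m)" "(y, n)"] assms
  by (auto simp: fraction_def) (auto simp: fraction_rel_def)

lemma frac_members:
  assumes "x \<in> carrier A" "(y, n) \<in> fr x m"
  shows "y \<in> carrier A" "fr y n = fr x m"
proof -
  have "((x, m), (y, n)) \<in> fraction_rel A s"
    using assms(2) by (simp add: fraction_def)
  then show "y \<in> carrier A" "fr y n = fr x m"
    using equiv_class_eq[OF equiv_fraction_rel] by (auto simp: fraction_def) (auto simp: fraction_rel_def)
qed

lemma frac_self: "x \<in> carrier A \<Longrightarrow> (x, m) \<in> fr x m"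
  by (auto simp: fraction_def fraction_rel_def)

lemma frac_closed [simp, intro]: "x \<in> carrier A \<Longrightarrow> fr x m \<in> carrier L"
  by (auto simp: localization_def fraction_def intro: quotientI)

lemma localization_elem:
  assumes "U \<in> carrier L"
  obtains x m where "x \<in> carrier A" "U = fr x m"
  using assms by (auto simp: localization_def fraction_def elim!: quotientE)

text \<open>The operations of \<open>localization\<close> are unions over all representatives of
  both arguments. This reduces them to one representative each, once the result is independent of
  the choice.\<close>

lemma frac_binop:
  assumes "x \<in> carrier A" "y \<in> carrier A"
    and "\<And>x' m' y' n'. x' \<in> carrier A \<Longrightarrow> y' \<in> carrier A \<Longrightarrow> fr x' m' = fr x m \<Longrightarrow> fr y' n' = fr y n \<Longrightarrow>
      g x' m' y' n' = g x m y n"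
  shows "(\<Union>(x, m)\<in>fr x m. \<Union>(y, n)\<in>fr y n. g x m y n) = g x m y n"
proof (rule UN_constant_eq[OF frac_self[OF assms(1)]], clarify)
  fix x' m' assume x': "(x', m') \<in> fr x m"
  show "(\<Union>(y, n)\<in>fr y n. g x' m' y n) = g x m y n"
  proof (rule UN_constant_eq[OF frac_self[OF assms(2)]], clarify)
    fix y' n' assume y': "(y', n') \<in> fr y n"
    show "g x' m' y' n' = g x m y n"
      by (rule assms(3)[OF frac_members(1)[OF assms(1) x'] frac_members(1)[OF assms(2) y']
            frac_members(2)[OF assms(1) x'] frac_members(2)[OF assms(2) y']])
  qed
qed

lemma frac_add:
  assumes "x \<in> carrier A" "y \<in> carrier A"
  shows "fr x m \<oplus>\<^bsub>L\<^esub> fr y n = fr (s [^] n \<otimes> x \<oplus> s [^] m \<otimes> y) (m + n)"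
proof -
  have "(\<Union>(x, m)\<in>fr x m. \<Union>(y, n)\<in>fr y n. fr (s [^] n \<otimes> x \<oplus> s [^] m \<otimes> y) (m + n)) =
      fr (s [^] n \<otimes> x \<oplus> s [^] m \<otimes> y) (m + n)"
  proof (rule frac_binop[OF assms])
    fix x' m' y' n' assume *: "x' \<in> carrier A" "y' \<in> carrier A" "fr x' m' = fr x m" "fr y' n' = fr y n"
    then obtain k l :: nat where k: "s [^] k \<otimes> (s [^] m \<otimes> x') = s [^] k \<otimes> (s [^] m' \<otimes> x)"
      and l: "s [^] l \<otimes> (s [^] n \<otimes> y') = s [^] l \<otimes> (s [^] n' \<otimes> y)"
      using assms by (auto simp: frac_eq_iff)
    have "s [^] (k + l) \<otimes> (s [^] (m + n) \<otimes> (s [^] n' \<otimes> x' \<oplus> s [^] m' \<otimes> y')) =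
        s [^] l \<otimes> (s [^] n \<otimes> (s [^] n' \<otimes> (s [^] k \<otimes> (s [^] m \<otimes> x')))) \<oplus>
        s [^] k \<otimes> (s [^] m \<otimes> (s [^] m' \<otimes> (s [^] l \<otimes> (s [^] n \<otimes> y'))))"
      using * by (simp add: r_distr m_ac flip: nat_pow_mult)
    also have "\<dots> = s [^] (k + l) \<otimes> (s [^] (m' + n') \<otimes> (s [^] n \<otimes> x \<oplus> s [^] m \<otimes> y))"
      unfolding k l using assms by (simp add: r_distr m_ac flip: nat_pow_mult)
    finally show "fr (s [^] n' \<otimes> x' \<oplus> s [^] m' \<otimes> y') (m' + n') = fr (s [^] n \<otimes> x \<oplus> s [^] m \<otimes> y) (m + n)"
      using * assms by (subst frac_eq_iff) auto
  qed
  then show ?thesis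
    by (simp add: localization_def)
qed

lemma frac_mult:
  assumes "x \<in> carrier A" "y \<in> carrier A"
  shows "fr x m \<otimes>\<^bsub>L\<^esub> fr y n = fr (x \<otimes> y) (m + n)"
proof -
  have "(\<Union>(x, m)\<in>fr x m. \<Union>(y, n)\<in>fr y n. fr (x \<otimes> y) (m + n)) = fr (x \<otimes> y) (m + n)"
  proof (rule frac_binop[OF assms])
    fix x' m' y' n' assume *: "x' \<in> carrier A" "y' \<in> carrier A" "fr x' m' = fr x m" "fr y' n' = fr y n"
    then obtain k l :: nat where k: "s [^] k \<otimes> (s [^] m \<otimes> x') = s [^] k \<otimes> (s [^] m' \<otimes> x)"
      and l: "s [^] l \<otimes> (s [^] n \<otimes> y') = s [^] l \<otimes> (s [^] n' \<otimes> y)"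
      using assms by (auto simp: frac_eq_iff)
    have "s [^] (k + l) \<otimes> (s [^] (m + n) \<otimes> (x' \<otimes> y')) =
        (s [^] k \<otimes> (s [^] m \<otimes> x')) \<otimes> (s [^] l \<otimes> (s [^] n \<otimes> y'))"
      using * by (simp add: m_ac flip: nat_pow_mult)
    also have "\<dots> = s [^] (k + l) \<otimes> (s [^] (m' + n') \<otimes> (x \<otimes> y))"
      unfolding k l using assms by (simp add: m_ac flip: nat_pow_mult)
    finally show "fr (x' \<otimes> y') (m' + n') = fr (x \<otimes> y) (m + n)"
      using * assms by (subst frac_eq_iff) auto
  qed
  then show ?thesis
    by (simp add: localization_def)
qed

lemma frac_smult:
  assumes "a \<in> carrier A" "x \<in> carrier A"
  shows "a \<odot>\<^bsub>L\<^esub> fr x m = fr (a \<otimes> x) m"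
proof -
  have "fr (a \<otimes> x') m' = fr (a \<otimes> x) m" if "(x', m') \<in> fr x m" for x' m'
  proof -
    note * = frac_members[OF assms(2) that]
    then obtain k :: nat where k: "s [^] k \<otimes> (s [^] m \<otimes> x') = s [^] k \<otimes> (s [^] m' \<otimes> x)"
      using assms by (auto simp: frac_eq_iff)
    have "s [^] k \<otimes> (s [^] m \<otimes> (a \<otimes> x')) = a \<otimes> (s [^] k \<otimes> (s [^] m \<otimes> x'))"
      using * assms by (simp add: m_ac)
    also have "\<dots> = s [^] k \<otimes> (s [^] m' \<otimes> (a \<otimes> x))"
      unfolding k using assms by (simp add: m_ac)
    finally show ?thesis
      using * assms by (subst frac_eq_iff) auto
  qed
  then have "(\<Union>(x, m)\<in>fr x m. fr (a \<otimes> x) m) = fr (a \<otimes> x) m"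
    by (intro UN_constant_eq[OF frac_self[OF assms(2)]]) auto
  then show ?thesis
    by (simp add: localization_def)
qed

lemma frac_expand: "x \<in> carrier A \<Longrightarrow> fr (s [^] k \<otimes> x) (k + m) = fr x m"
  by (subst frac_eq_iff) (auto simp: m_ac simp flip: nat_pow_mult)

lemma frac_expand_right: "x \<in> carrier A \<Longrightarrow> fr (s [^] k \<otimes> x) (m + k) = fr x m"
  using frac_expand[of x k m] by (simp add: add.commute)

lemma localization_zero: "\<zero>\<^bsub>L\<^esub> = fr \<zero> m"
  using frac_expand[of \<zero> m 0] by (simp add: localization_def)

lemma localization_one: "\<one>\<^bsub>L\<^esub> = fr \<one> 0"
  by (simp add: localization_def)

lemma frac_add_same:
  "x \<in> carrier A \<Longrightarrow> y \<in> carrier A \<Longrightarrow> fr x m \<oplus>\<^bsub>L\<^esub> fr y m = fr (x \<oplus> y) m"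
  using frac_expand[of "x \<oplus> y" m m] by (simp add: frac_add r_distr)

text \<open>Over one denominator fractions are added by adding numerators, so the ring axioms of
  \<open>L\<close> become those of \<open>A\<close>.\<close>

lemma common_denominator:
  assumes "U \<in> carrier L" "V \<in> carrier L"
  obtains x y m where "x \<in> carrier A" "y \<in> carrier A" "U = fr x m" "V = fr y m"
proof -
  obtain x m y n where "x \<in> carrier A" "U = fr x m" "y \<in> carrier A" "V = fr y n"
    using assms by (elim localization_elem)
  then show thesis
    using that[of "s [^] n \<otimes> x" "s [^] m \<otimes> y" "m + n"] frac_expand_right[of x n m] frac_expand[of y m n] by simp
qed

lemma common_denominator3:
  assumes "U \<in> carrier L" "V \<in> carrier L" "W \<in> carrier L"
  obtains x y z m where "x \<in> carrier A" "y \<in> carrier A" "z \<in> carrier A" "U = fr x m" "V = fr y m" "W = fr z m"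
proof -
  obtain x y m where "x \<in> carrier A" "y \<in> carrier A" "U = fr x m" "V = fr y m"
    using common_denominator[OF assms(1,2)] .
  moreover obtain z n where "z \<in> carrier A" "W = fr z n"
    using assms(3) by (rule localization_elem)
  ultimately show thesis
    using that[of "s [^] n \<otimes> x" "s [^] n \<otimes> y" "s [^] m \<otimes> z" "m + n"]
      frac_expand_right[of x n m] frac_expand_right[of y n m] frac_expand[of z m n] by simp
qed

lemma localization_algebra: "algebra A L"
proof (rule algebraI)
  show "cring L"
  proof (intro cringI abelian_groupI comm_monoidI)
    fix U V W assume UVW: "U \<in> carrier L" "V \<in> carrier L" "W \<in> carrier L"
    show "U \<oplus>\<^bsub>L\<^esub> V \<oplus>\<^bsub>L\<^esub> W = U \<oplus>\<^bsub>L\<^esub> (V \<oplus>\<^bsub>L\<^esub> W)"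
      by (rule common_denominator3[OF UVW]) (simp add: frac_add_same a_assoc)
    show "U \<otimes>\<^bsub>L\<^esub> V \<otimes>\<^bsub>L\<^esub> W = U \<otimes>\<^bsub>L\<^esub> (V \<otimes>\<^bsub>L\<^esub> W)"
      by (rule common_denominator3[OF UVW]) (simp add: frac_mult m_assoc add.assoc)
    show "(U \<oplus>\<^bsub>L\<^esub> V) \<otimes>\<^bsub>L\<^esub> W = U \<otimes>\<^bsub>L\<^esub> W \<oplus>\<^bsub>L\<^esub> V \<otimes>\<^bsub>L\<^esub> W"
      by (rule common_denominator3[OF UVW]) (simp add: frac_mult frac_add_same l_distr)
  next
    fix U V assume UV: "U \<in> carrier L" "V \<in> carrier L"
    show "U \<oplus>\<^bsub>L\<^esub> V \<in> carrier L" "U \<oplus>\<^bsub>L\<^esub> V = V \<oplus>\<^bsub>L\<^esub> U"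
      by (rule common_denominator[OF UV]; simp add: frac_add_same a_comm)+
    show "U \<otimes>\<^bsub>L\<^esub> V \<in> carrier L" "U \<otimes>\<^bsub>L\<^esub> V = V \<otimes>\<^bsub>L\<^esub> U"
      by (rule common_denominator[OF UV]; simp add: frac_mult m_comm)+
  next
    fix U assume "U \<in> carrier L"
    then obtain x m where x: "x \<in> carrier A" "U = fr x m"
      by (rule localization_elem)
    show "\<zero>\<^bsub>L\<^esub> \<oplus>\<^bsub>L\<^esub> U = U"
      using x by (simp add: localization_zero[of m] frac_add_same)
    show "\<one>\<^bsub>L\<^esub> \<otimes>\<^bsub>L\<^esub> U = U"
      using x by (simp add: localization_one frac_mult)
    show "\<exists>V\<in>carrier L. V \<oplus>\<^bsub>L\<^esub> U = \<zero>\<^bsub>L\<^esub>"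
      using x by (intro bexI[of _ "fr (\<ominus> x) m"]) (simp_all add: frac_add_same l_neg localization_zero[of m])
  qed (simp_all add: localization_zero[of 0] localization_one)
next
  fix a b U assume "a \<in> carrier A" "b \<in> carrier A" "U \<in> carrier L"
  then show "(a \<oplus> b) \<odot>\<^bsub>L\<^esub> U = a \<odot>\<^bsub>L\<^esub> U \<oplus>\<^bsub>L\<^esub> b \<odot>\<^bsub>L\<^esub> U" "(a \<otimes> b) \<odot>\<^bsub>L\<^esub> U = a \<odot>\<^bsub>L\<^esub> (b \<odot>\<^bsub>L\<^esub> U)"
    by (auto elim!: localization_elem simp: frac_smult frac_add_same l_distr m_assoc)
next
  fix a U V assume a: "a \<in> carrier A" and UV: "U \<in> carrier L" "V \<in> carrier L"
  show "a \<odot>\<^bsub>L\<^esub> (U \<oplus>\<^bsub>L\<^esub> V) = a \<odot>\<^bsub>L\<^esub> U \<oplus>\<^bsub>L\<^esub> a \<odot>\<^bsub>L\<^esub> V"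
    by (rule common_denominator[OF UV]) (use a in \<open>simp add: frac_smult frac_add_same r_distr\<close>)
  show "a \<odot>\<^bsub>L\<^esub> U \<otimes>\<^bsub>L\<^esub> V = a \<odot>\<^bsub>L\<^esub> (U \<otimes>\<^bsub>L\<^esub> V)"
    by (rule common_denominator[OF UV]) (use a in \<open>simp add: frac_smult frac_mult m_assoc\<close>)
qed (auto elim!: localization_elem simp: frac_smult is_cring)

sublocale L: algebra A L
  by (rule localization_algebra)

lemma L_cring: "cring L"
  by (rule L.M_cring)

lemma structure_map: "a \<in> carrier A \<Longrightarrow> a \<odot>\<^bsub>L\<^esub> \<one>\<^bsub>L\<^esub> = fr a 0"
  by (simp add: localization_one frac_smult)

lemma frac_eq_zero_iff: "x \<in> carrier A \<Longrightarrow> fr x m = \<zero>\<^bsub>L\<^esub> \<longleftrightarrow> (\<exists>k::nat. s [^] k \<otimes> x = \<zero>)"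
  by (simp add: localization_zero[of 0] frac_eq_iff)

text \<open>The contraction to \<open>A\<close> of the principal ideal of \<open>A[1/s]\<close>
  generated by \<open>d\<close>, as \<open>frac_in_principal_ideal\<close> shows.\<close>

definition local_multiples :: "'a \<Rightarrow> 'a set" where
  "local_multiples d = {a \<in> carrier A. \<exists>k::nat. \<exists>c\<in>carrier A. s [^] k \<otimes> a = c \<otimes> d}"

lemma frac_in_principal_ideal:
  assumes "a \<in> carrier A" "d \<in> carrier A"
  shows "fr a m \<in> Idl\<^bsub>L\<^esub> {fr d j} \<longleftrightarrow> a \<in> local_multiples d"
proof
  assume "fr a m \<in> Idl\<^bsub>L\<^esub> {fr d j}"
  then obtain V where "V \<in> carrier L" "fr a m = V \<otimes>\<^bsub>L\<^esub> fr d j"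
    using cring.genideal_singleton[OF L_cring] assms by auto
  then obtain c n where c: "c \<in> carrier A" "fr a m = fr (c \<otimes> d) (n + j)"
    by (auto elim!: localization_elem simp: frac_mult assms)
  then obtain k :: nat where "s [^] k \<otimes> (s [^] (n + j) \<otimes> a) = s [^] k \<otimes> (s [^] m \<otimes> (c \<otimes> d))"
    using assms by (auto simp: frac_eq_iff)
  then have "s [^] (k + (n + j)) \<otimes> a = (s [^] k \<otimes> s [^] m \<otimes> c) \<otimes> d"
    using assms c by (simp add: pow_mult_assoc) (simp add: m_ac)
  then show "a \<in> local_multiples d"
    using assms c unfolding local_multiples_def
    by (auto intro!: exI[of _ "k + (n + j)"] bexI[of _ "s [^] k \<otimes> s [^] m \<otimes> c"])
next
  assume "a \<in> local_multiples d"
  then obtain k :: nat and c where c: "c \<in> carrier A" "s [^] k \<otimes> a = c \<otimes> d"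
    by (auto simp: local_multiples_def)
  have "fr a m = fr (s [^] j \<otimes> (s [^] k \<otimes> a)) (j + (k + m))"
    using assms by (simp add: frac_expand)
  also have "\<dots> = fr (s [^] j \<otimes> c) (k + m) \<otimes>\<^bsub>L\<^esub> fr d j"
    using assms c by (simp add: frac_mult m_ac add.commute)
  finally show "fr a m \<in> Idl\<^bsub>L\<^esub> {fr d j}"
    using cring.genideal_singleton[OF L_cring] assms c by auto
qed

lemma frac_in_extended_ideal:
  assumes D: "ideal D A" and "a \<in> carrier A"
  shows "fr a m \<in> extended_ideal A s D \<longleftrightarrow> (\<exists>k::nat. s [^] k \<otimes> a \<in> D)"
proof
  note D' = idealD[OF D]
  \<comment> \<open>The fractions with numerator in \<open>D\<close> are already closed under sums
    and multiples, so every element of the extended ideal has this simple shape.\<close>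
  let ?J = "{fr x n | x n. x \<in> D}"
  have "ideal ?J L"
  proof (rule cring.idealI'[OF L_cring])
    show "\<zero>\<^bsub>L\<^esub> \<in> ?J"
      using D'(2) localization_zero by auto
    fix U V assume "U \<in> ?J" "V \<in> ?J"
    then obtain x m y n where xy: "U = fr x m" "V = fr y n" "x \<in> D" "y \<in> D"
      by auto
    then have "U \<oplus>\<^bsub>L\<^esub> V = fr (s [^] n \<otimes> x \<oplus> s [^] m \<otimes> y) (m + n)"
      by (simp add: frac_add D'(1))
    moreover have "s [^] n \<otimes> x \<oplus> s [^] m \<otimes> y \<in> D"
      using xy by (intro D' nat_pow_closed s)
    ultimately show "U \<oplus>\<^bsub>L\<^esub> V \<in> ?J"
      by blast
  next
    fix V U assume V: "V \<in> carrier L" and "U \<in> ?J"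
    then obtain x m where x: "U = fr x m" "x \<in> D"
      by auto
    obtain y n where y: "y \<in> carrier A" "V = fr y n"
      using V by (rule localization_elem)
    then have "V \<otimes>\<^bsub>L\<^esub> U = fr (y \<otimes> x) (n + m)" "y \<otimes> x \<in> D"
      using x by (simp_all add: frac_mult D')
    then show "V \<otimes>\<^bsub>L\<^esub> U \<in> ?J"
      by blast
  qed (use D'(1) in auto)
  then have "extended_ideal A s D \<subseteq> ?J"
    unfolding extended_ideal_def by (intro ring.genideal_minimal cring.axioms(1) L_cring) auto
  moreover assume "fr a m \<in> extended_ideal A s D"
  ultimately obtain x n where x: "fr a m = fr x n" "x \<in> D"
    by auto
  then obtain k :: nat where k: "s [^] k \<otimes> (s [^] n \<otimes> a) = s [^] k \<otimes> (s [^] m \<otimes> x)"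
    using assms D'(1) by (auto simp: frac_eq_iff)
  have "s [^] (k + n) \<otimes> a \<in> D"
    using x assms by (simp add: pow_mult_assoc k D')
  then show "\<exists>k::nat. s [^] k \<otimes> a \<in> D"
    by blast
next
  assume "\<exists>k::nat. s [^] k \<otimes> a \<in> D"
  then obtain k :: nat where k: "s [^] k \<otimes> a \<in> D"
    by blast
  have sub: "(\<lambda>a. fr a 0) ` D \<subseteq> carrier L"
    using idealD(1)[OF D] by auto
  note E = ring.genideal_ideal[OF cring.axioms(1)[OF L_cring] sub] ring.genideal_self[OF cring.axioms(1)[OF L_cring] sub]
  have "fr \<one> (k + m) \<otimes>\<^bsub>L\<^esub> fr (s [^] k \<otimes> a) 0 \<in> extended_ideal A s D"
    unfolding extended_ideal_def
    by (intro cring.idealD(4)[OF L_cring E(1)] subsetD[OF E(2)]) (use k in auto)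
  then show "fr a m \<in> extended_ideal A s D"
    using assms by (simp add: frac_mult frac_expand)
qed

text \<open>Powers of \<open>s\<close> are units in \<open>A[1/s]\<close>, so an ideal there is
  determined by the numerators it contains, and the exponent \<open>j\<close> has no influence. The
  two conditions on the right are the two inclusions. In this form the requirement in
  \<open>discriminant_ideal\<close> becomes a statement about \<open>A\<close>.\<close>

lemma extended_ideal_principal_iff:
  assumes D: "ideal D A" and d: "d \<in> carrier A"
  shows "extended_ideal A s D = Idl\<^bsub>L\<^esub> {fr d j} \<longleftrightarrow> D \<subseteq> local_multiples d \<and> (\<exists>k::nat. s [^] k \<otimes> d \<in> D)"
proof -
  have sub: "(\<lambda>a. fr a 0) ` D \<subseteq> carrier L"
    using idealD(1)[OF D] by auto
  note R = cring.axioms(1)[OF L_cring]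
  have carr: "extended_ideal A s D \<subseteq> carrier L" "Idl\<^bsub>L\<^esub> {fr d j} \<subseteq> carrier L"
    using ring.genideal_ideal[OF R sub] ring.genideal_ideal[OF R, of "{fr d j}"] d
    by (auto simp: extended_ideal_def dest: ideal.Icarr)
  have "extended_ideal A s D = Idl\<^bsub>L\<^esub> {fr d j} \<longleftrightarrow>
      (\<forall>a\<in>carrier A. \<forall>m. fr a m \<in> extended_ideal A s D \<longleftrightarrow> fr a m \<in> Idl\<^bsub>L\<^esub> {fr d j})"
    using carr by (auto elim!: localization_elem)
  also have "\<dots> \<longleftrightarrow> (\<forall>a\<in>carrier A. (\<exists>k::nat. s [^] k \<otimes> a \<in> D) \<longleftrightarrow> a \<in> local_multiples d)"
    by (simp add: frac_in_extended_ideal D frac_in_principal_ideal d)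
  also have "\<dots> \<longleftrightarrow> D \<subseteq> local_multiples d \<and> (\<exists>k::nat. s [^] k \<otimes> d \<in> D)"
  proof safe
    fix a assume *: "\<forall>a\<in>carrier A. (\<exists>k::nat. s [^] k \<otimes> a \<in> D) \<longleftrightarrow> a \<in> local_multiples d" "a \<in> D"
    then have "s [^] (0::nat) \<otimes> a \<in> D"
      using idealD(1)[OF D] by simp
    then show "a \<in> local_multiples d"
      using * idealD(1)[OF D] by blast
  next
    assume *: "\<forall>a\<in>carrier A. (\<exists>k::nat. s [^] k \<otimes> a \<in> D) \<longleftrightarrow> a \<in> local_multiples d"
    have "d \<in> local_multiples d"
      using d by (auto simp: local_multiples_def intro!: exI[of _ "0::nat"] bexI[of _ \<one>])
    then show "\<exists>k::nat. s [^] k \<otimes> d \<in> D"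
      using * d by blast
  next
    fix a and k :: nat assume *: "D \<subseteq> local_multiples d" "a \<in> carrier A" "s [^] k \<otimes> a \<in> D"
    then obtain l :: nat and c where "c \<in> carrier A" "s [^] l \<otimes> (s [^] k \<otimes> a) = c \<otimes> d"
      by (auto simp: local_multiples_def)
    then show "a \<in> local_multiples d"
      using *(2) by (auto simp: local_multiples_def simp flip: pow_mult_assoc)
  next
    fix a and k :: nat assume *: "s [^] k \<otimes> d \<in> D" "a \<in> local_multiples d"
    then obtain l :: nat and c where c: "a \<in> carrier A" "c \<in> carrier A" "s [^] l \<otimes> a = c \<otimes> d"
      by (auto simp: local_multiples_def)
    then have "s [^] (k + l) \<otimes> a = s [^] k \<otimes> (c \<otimes> d)"
      by (simp add: pow_mult_assoc)
    also have "\<dots> = c \<otimes> (s [^] k \<otimes> d)"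
      using c d by (simp add: m_lcomm)
    finally have "s [^] (k + l) \<otimes> a = c \<otimes> (s [^] k \<otimes> d)" .
    then show "\<exists>k::nat. s [^] k \<otimes> a \<in> D"
      using idealD(4)[OF D] * c by metis
  qed
  finally show ?thesis .
qed

end

section \<open>Local bases of a projective algebra\<close>

text \<open>The standard device for statements that hold up to a power of \<open>s\<close>: finitely
  many exponents are replaced by their sum, as larger exponents remain admissible.\<close>

lemma uniform_exponent:
  assumes "finite J" "\<And>j. j \<in> J \<Longrightarrow> \<exists>k::nat. P k j" "\<And>k l j. j \<in> J \<Longrightarrow> P k j \<Longrightarrow> P (k + l) j"
  shows "\<exists>K. \<forall>j\<in>J. P K j"
  using assms
proof (induction J rule: finite_induct)
  case (insert i J)
  then obtain K k where K: "\<forall>j\<in>J. P K j" "P k i"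
    by (metis insert_iff)
  then have "\<forall>j\<in>insert i J. P (K + k) j"
    using insert.prems(2)[of i k K] insert.prems(2)[of _ K k] by (auto simp: add.commute)
  then show ?case
    by blast
qed simp

section \<open>Coordinates in a basis\<close>

context module
begin

lemma module_basis_dual_basis:
  assumes "module_basis R M r e"
  obtains f where "dual_basis R M r e f"
    "\<And>k l. k < r \<Longrightarrow> l < r \<Longrightarrow> f k (e l) = (if k = l then \<one> else \<zero>)"
proof -
  have e: "e \<in> {..<r} \<rightarrow> carrier M"
    and ex1: "\<And>x. x \<in> carrier M \<Longrightarrow> \<exists>!c. c \<in> {..<r} \<rightarrow>\<^sub>E carrier R \<and> x = (\<Oplus>\<^bsub>M\<^esub> i\<in>{..<r}. c i \<odot>\<^bsub>M\<^esub> e i)"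
    using assms unfolding module_basis_def by auto
  have ec: "e i \<in> carrier M" if "i < r" for i
    using e that by auto
  obtain c where c: "\<And>x. x \<in> carrier M \<Longrightarrow> c x \<in> {..<r} \<rightarrow>\<^sub>E carrier R"
    "\<And>x. x \<in> carrier M \<Longrightarrow> x = (\<Oplus>\<^bsub>M\<^esub> i\<in>{..<r}. c x i \<odot>\<^bsub>M\<^esub> e i)"
    using ex1 by metis
  have cc: "c x i \<in> carrier R" if "x \<in> carrier M" "i < r" for x i
    using c(1)[OF that(1)] that(2) by auto
  \<comment> \<open>\<open>module_basis\<close> asserts uniqueness among extensional functions only;
    an arbitrary family \<open>d\<close> is restricted to the index set before it is
    compared.\<close>
  have uniq: "c x i = d i" if "d \<in> {..<r} \<rightarrow> carrier R" "x = (\<Oplus>\<^bsub>M\<^esub> i\<in>{..<r}. d i \<odot>\<^bsub>M\<^esub> e i)" "i < r" for x d i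
  proof -
    have x: "x \<in> carrier M"
      unfolding that(2) using that(1) e by (intro M.finsum_closed) auto
    have "(\<Oplus>\<^bsub>M\<^esub> i\<in>{..<r}. restrict d {..<r} i \<odot>\<^bsub>M\<^esub> e i) = x"
      unfolding that(2) using that(1) e by (intro M.finsum_cong') auto
    moreover have "restrict d {..<r} \<in> {..<r} \<rightarrow>\<^sub>E carrier R"
      using that(1) by auto
    moreover obtain u where u: "\<forall>c. c \<in> {..<r} \<rightarrow>\<^sub>E carrier R \<and> x = (\<Oplus>\<^bsub>M\<^esub> i\<in>{..<r}. c i \<odot>\<^bsub>M\<^esub> e i) \<longrightarrow> c = u"
      using ex1[OF x] by (elim ex1E)
    ultimately have "restrict d {..<r} = u" "c x = u"
      using c(1,2)[OF x] u[rule_format, of "c x"] u[rule_format, of "restrict d {..<r}"] by simp_all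
    then have "c x = restrict d {..<r}"
      by simp
    then show ?thesis
      using that(3) by simp
  qed
  show thesis
  proof (rule that[of "\<lambda>l x. c x l"])
    show "dual_basis R M r e (\<lambda>l x. c x l)"
      unfolding dual_basis_def linear_form_def
    proof (intro conjI allI impI ballI Pi_I e cc c(2))
      fix l x y assume "l < r" and xy: "x \<in> carrier M" "y \<in> carrier M"
      then have "x \<oplus>\<^bsub>M\<^esub> y = (\<Oplus>\<^bsub>M\<^esub> i\<in>{..<r}. (c x i \<oplus> c y i) \<odot>\<^bsub>M\<^esub> e i)"
        using c(2)[OF xy(1)] c(2)[OF xy(2)] cc e
          add_lin_comb[of "c x" "{..<r}" "c y" e] by simp
      then show "c (x \<oplus>\<^bsub>M\<^esub> y) l = c x l \<oplus> c y l"
        using xy cc \<open>l < r\<close> by (intro uniq) auto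
    next
      fix l a x assume "l < r" and a: "a \<in> carrier R" and x: "x \<in> carrier M"
      then have "a \<odot>\<^bsub>M\<^esub> x = (\<Oplus>\<^bsub>M\<^esub> i\<in>{..<r}. (a \<otimes> c x i) \<odot>\<^bsub>M\<^esub> e i)"
        using c(2)[OF x] cc e smult_lin_comb[of a "c x" "{..<r}" e] by simp
      then show "c (a \<odot>\<^bsub>M\<^esub> x) l = a \<otimes> c x l"
        using a x cc \<open>l < r\<close> by (intro uniq) auto
    qed (use e in auto)
    fix k l assume kl: "k < r" "l < r"
    have "(\<Oplus>\<^bsub>M\<^esub> i\<in>{..<r}. (if i = l then \<one> else \<zero>) \<odot>\<^bsub>M\<^esub> e i) = (\<Oplus>\<^bsub>M\<^esub> i\<in>{..<r}. if l = i then e i else \<zero>\<^bsub>M\<^esub>)"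
      using ec by (intro M.finsum_cong') auto
    also have "\<dots> = e l"
      using e kl by (intro M.finsum_singleton) auto
    finally show "c (e l) k = (if k = l then \<one> else \<zero>)"
      using kl by (intro uniq) auto
  qed
qed

end

context algebra
begin

lemma trace_eq:
  assumes "dual_basis R M n e f" "x \<in> carrier M"
  shows "algebra_trace R M x = (\<Oplus>l\<in>{..<n}. f l (x \<otimes>\<^bsub>M\<^esub> e l))"
  unfolding algebra_trace_def by (intro endo_trace_eq mult_linear assms)

lemma trace_linear:
  assumes "dual_basis R M n e f"
  shows "linear_form R M (algebra_trace R M)"
  unfolding linear_form_def
proof (intro conjI ballI Pi_I)
  note b = dual_basisD[OF assms] and f = linear_formD[OF dual_basisD(2)[OF assms]]
    and tr = trace_eq[OF assms]
  fix x assume x: "x \<in> carrier M"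
  show "algebra_trace R M x \<in> carrier R"
    using x b unfolding tr[OF x] by (intro R.finsum_closed) auto
  fix y assume y: "y \<in> carrier M"
  have xy: "x \<oplus>\<^bsub>M\<^esub> y \<in> carrier M"
    using x y by simp
  have "algebra_trace R M (x \<oplus>\<^bsub>M\<^esub> y) = (\<Oplus>l\<in>{..<n}. f l (x \<otimes>\<^bsub>M\<^esub> e l) \<oplus> f l (y \<otimes>\<^bsub>M\<^esub> e l))"
    unfolding tr[OF xy] using x y b by (intro R.finsum_cong') (auto simp: l_distr f)
  also have "\<dots> = algebra_trace R M x \<oplus> algebra_trace R M y"
    unfolding tr[OF x] tr[OF y] using x y b by (intro R.finsum_addf) auto
  finally show "algebra_trace R M (x \<oplus>\<^bsub>M\<^esub> y) = algebra_trace R M x \<oplus> algebra_trace R M y" .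
next
  note b = dual_basisD[OF assms] and f = linear_formD[OF dual_basisD(2)[OF assms]]
    and tr = trace_eq[OF assms]
  fix a x assume a: "a \<in> carrier R" and x: "x \<in> carrier M"
  have ax: "a \<odot>\<^bsub>M\<^esub> x \<in> carrier M"
    using a x by simp
  have "algebra_trace R M (a \<odot>\<^bsub>M\<^esub> x) = (\<Oplus>l\<in>{..<n}. a \<otimes> f l (x \<otimes>\<^bsub>M\<^esub> e l))"
    unfolding tr[OF ax] using a x b by (intro R.finsum_cong') (auto simp: smult_assoc2 f)
  also have "\<dots> = a \<otimes> algebra_trace R M x"
    unfolding tr[OF x] using a x b by (intro R.finsum_rdistr[symmetric]) auto
  finally show "algebra_trace R M (a \<odot>\<^bsub>M\<^esub> x) = a \<otimes> algebra_trace R M x" .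
qed

text \<open>If \<open>t \<beta>\<close> depends on \<open>t\<close> only through traces, then the matrix of \<open>\<beta>\<close> in a basis factors through
  the matrix of the trace form.\<close>

lemma norm_multiple_of_discriminant:
  fixes n :: nat
  assumes basis: "module_basis R M r b" and \<beta>: "\<beta> \<in> carrier M"
    and \<epsilon>: "\<epsilon> \<in> {..<n} \<rightarrow> carrier M" and \<gamma>: "\<gamma> \<in> {..<n} \<rightarrow> carrier M"
    and trace: "\<And>t. t \<in> carrier M \<Longrightarrow>
      t \<otimes>\<^bsub>M\<^esub> \<beta> = (\<Oplus>\<^bsub>M\<^esub> l\<in>{..<n}. algebra_trace R M (t \<otimes>\<^bsub>M\<^esub> \<epsilon> l) \<odot>\<^bsub>M\<^esub> \<gamma> l)"
  shows "\<exists>z\<in>carrier R. algebra_norm R M \<beta> = z \<otimes> basis_discriminant R M r b"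
proof -
  obtain f where f: "dual_basis R M r b f"
    "\<And>k l. k < r \<Longrightarrow> l < r \<Longrightarrow> f k (b l) = (if k = l then \<one> else \<zero>)"
    using module_basis_dual_basis[OF basis] by blast
  note fD = dual_basisD[OF f(1)]
  note trD = linear_formD[OF trace_linear[OF f(1)]]
  have tr_closed: "algebra_trace R M x \<in> carrier R" if "x \<in> carrier M" for x
    using that by (rule trD(1))
  define T where "T i j = algebra_trace R M (b i \<otimes>\<^bsub>M\<^esub> b j)" for i j
  \<comment> \<open>Expanding the \<epsilon> in the basis turns the hypothesis into \<open>b_i
    \<beta> = \<Sum>_j T_ij (\<Sum>_l f_j (\<epsilon>_l) \<gamma>_l)\<close>; \<open>Z_jm\<close> is
    the \<open>m\<close>-th coordinate of the inner sum.\<close>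
  define Z where "Z j m = (\<Oplus>l\<in>{..<n}. f j (\<epsilon> l) \<otimes> f m (\<gamma> l))" for j m
  have T: "T i j \<in> carrier R" if "i < r" "j < r" for i j
    unfolding T_def using that fD by (intro tr_closed) auto
  have Z: "Z j m \<in> carrier R" if "j < r" "m < r" for j m
    unfolding Z_def using that fD \<epsilon> \<gamma> by (intro R.finsum_closed) (auto simp: Pi_iff)
  have entry: "f m (\<beta> \<otimes>\<^bsub>M\<^esub> b i) = (\<Oplus>j\<in>{..<r}. T i j \<otimes> Z j m)" if im: "i < r" "m < r" for i m
  proof -
    have tr_\<epsilon>: "algebra_trace R M (b i \<otimes>\<^bsub>M\<^esub> \<epsilon> l) = (\<Oplus>j\<in>{..<r}. f j (\<epsilon> l) \<otimes> T i j)" if "l < n" for l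
    proof -
      have \<epsilon>l: "\<epsilon> l \<in> carrier M"
        using \<epsilon> that by auto
      have lin: "linear_form R M (\<lambda>x. algebra_trace R M (b i \<otimes>\<^bsub>M\<^esub> x))"
        using trD linear_mapD[OF mult_linear[OF fD(1)[OF im(1)]]] by (auto simp: linear_form_def)
      have "algebra_trace R M (b i \<otimes>\<^bsub>M\<^esub> \<epsilon> l) =
          algebra_trace R M (b i \<otimes>\<^bsub>M\<^esub> (\<Oplus>\<^bsub>M\<^esub> j\<in>{..<r}. f j (\<epsilon> l) \<odot>\<^bsub>M\<^esub> b j))"
        by (simp add: fD(4) \<epsilon>l)
      also have "\<dots> = (\<Oplus>j\<in>{..<r}. f j (\<epsilon> l) \<otimes> T i j)"
        unfolding T_def using fD \<epsilon>l by (intro linear_form_lin_comb[OF lin]) auto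
      finally show ?thesis .
    qed
    have "\<beta> \<otimes>\<^bsub>M\<^esub> b i = b i \<otimes>\<^bsub>M\<^esub> \<beta>"
      using im fD \<beta> by (simp add: m_comm)
    also have "\<dots> = (\<Oplus>\<^bsub>M\<^esub> l\<in>{..<n}. algebra_trace R M (b i \<otimes>\<^bsub>M\<^esub> \<epsilon> l) \<odot>\<^bsub>M\<^esub> \<gamma> l)"
      using im fD by (intro trace) auto
    finally have "f m (\<beta> \<otimes>\<^bsub>M\<^esub> b i) = (\<Oplus>l\<in>{..<n}. algebra_trace R M (b i \<otimes>\<^bsub>M\<^esub> \<epsilon> l) \<otimes> f m (\<gamma> l))"
      using im fD \<epsilon> \<gamma> tr_closed by (simp add: linear_form_lin_comb[OF fD(2)] Pi_iff)
    also have "\<dots> = (\<Oplus>l\<in>{..<n}. \<Oplus>j\<in>{..<r}. T i j \<otimes> (f j (\<epsilon> l) \<otimes> f m (\<gamma> l)))"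
    proof (intro R.finsum_cong' refl)
      fix l assume l: "l \<in> {..<n}"
      then have c: "\<epsilon> l \<in> carrier M" "\<gamma> l \<in> carrier M"
        using \<epsilon> \<gamma> by auto
      have "algebra_trace R M (b i \<otimes>\<^bsub>M\<^esub> \<epsilon> l) \<otimes> f m (\<gamma> l) = (\<Oplus>j\<in>{..<r}. (f j (\<epsilon> l) \<otimes> T i j) \<otimes> f m (\<gamma> l))"
        using im fD c T l by (simp add: tr_\<epsilon> R.finsum_ldistr Pi_iff)
      also have "\<dots> = (\<Oplus>j\<in>{..<r}. T i j \<otimes> (f j (\<epsilon> l) \<otimes> f m (\<gamma> l)))"
        using im fD c T by (intro R.finsum_cong') (auto simp: R.m_ac)
      finally show "algebra_trace R M (b i \<otimes>\<^bsub>M\<^esub> \<epsilon> l) \<otimes> f m (\<gamma> l) =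
          (\<Oplus>j\<in>{..<r}. T i j \<otimes> (f j (\<epsilon> l) \<otimes> f m (\<gamma> l)))" .
    qed (use im fD \<epsilon> \<gamma> T in \<open>auto simp: Pi_iff\<close>)
    also have "\<dots> = (\<Oplus>j\<in>{..<r}. \<Oplus>l\<in>{..<n}. T i j \<otimes> (f j (\<epsilon> l) \<otimes> f m (\<gamma> l)))"
      using im fD \<epsilon> \<gamma> T by (intro R.finsum_swap) (auto simp: Pi_iff)
    also have "\<dots> = (\<Oplus>j\<in>{..<r}. T i j \<otimes> Z j m)"
      unfolding Z_def using im fD \<epsilon> \<gamma> T
      by (intro R.finsum_cong') (auto simp: R.finsum_rdistr Pi_iff)
    finally show ?thesis .
  qed
  have "algebra_norm R M \<beta> = mat_det R r (\<lambda>k l. (free_gen R l k \<ominus> f k (b l)) \<oplus> f k (\<beta> \<otimes>\<^bsub>M\<^esub> b l))"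
    unfolding algebra_norm_def by (rule endo_det_eq[OF f(1) mult_linear[OF \<beta>]])
  also have "\<dots> = mat_det R r (\<lambda>k l. (\<Oplus>j\<in>{..<r}. T l j \<otimes> Z j k))"
    using T Z by (intro R.mat_det_cong) (auto simp: f(2) free_gen_def entry Pi_iff R.minus_eq R.r_neg)
  \<comment> \<open>The matrix of an endomorphism has the images of the basis as columns, whereas
    \<open>entry\<close> describes the image of \<open>b_i\<close> by row \<open>i\<close> of
    \<open>T Z\<close>.\<close>
  also have "\<dots> = mat_det R r (\<lambda>l k. (\<Oplus>j\<in>{..<r}. T l j \<otimes> Z j k))"
    using T Z by (intro R.mat_det_transpose) auto
  also have "\<dots> = mat_det R r T \<otimes> mat_det R r Z"
    using T Z by (intro R.mat_det_mult)
  finally have "algebra_norm R M \<beta> = mat_det R r Z \<otimes> basis_discriminant R M r b"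
    using T Z R.mat_det_closed[of r T] R.mat_det_closed[of r Z]
    by (simp add: basis_discriminant_def T_def[symmetric] R.m_comm)
  then show ?thesis
    using Z R.mat_det_closed by blast
qed

end

section \<open>Projective algebras and bases up to a power of s\<close>

locale projective_algebra = algebra A B for A (structure) and B +
  fixes n e f
  assumes db: "dual_basis A B n e f"
begin

lemmas dbD = dual_basisD[OF db]

abbreviation "Tr \<equiv> algebra_trace A B"

text \<open>Formed over \<open>A\<close> for any family in \<open>B\<close>, basis or not: it is the
  numerator of the discriminant that the family has over a localization.\<close>

definition "disc r b = mat_det A r (\<lambda>i j. Tr (b i \<otimes>\<^bsub>B\<^esub> b j))"

lemmas traceD = linear_formD[OF trace_linear[OF db]]

lemma norm_closed: "x \<in> carrier B \<Longrightarrow> algebra_norm A B x \<in> carrier A"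
  unfolding algebra_norm_def using dbD
  by (subst endo_det_eq[OF db]) (auto simp: free_gen_def intro!: mult_linear R.mat_det_closed)

lemma disc_closed: "b \<in> {..<r} \<rightarrow> carrier B \<Longrightarrow> disc r b \<in> carrier A"
  unfolding disc_def by (intro R.mat_det_closed traceD) auto

text \<open>The \<open>b\<^sub>j\<close> become a basis after inverting \<open>s\<close>; stated without fractions.\<close>

definition local_basis :: "'a \<Rightarrow> nat \<Rightarrow> (nat \<Rightarrow> 'c) \<Rightarrow> bool" where
  "local_basis s r b \<longleftrightarrow> b \<in> {..<r} \<rightarrow> carrier B \<and>
    (\<forall>x\<in>carrier B. \<exists>k::nat. \<exists>c\<in>{..<r} \<rightarrow> carrier A. s [^] k \<odot>\<^bsub>B\<^esub> x = (\<Oplus>\<^bsub>B\<^esub> j\<in>{..<r}. c j \<odot>\<^bsub>B\<^esub> b j)) \<and>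
    (\<forall>c\<in>{..<r} \<rightarrow> carrier A. (\<Oplus>\<^bsub>B\<^esub> j\<in>{..<r}. c j \<odot>\<^bsub>B\<^esub> b j) = \<zero>\<^bsub>B\<^esub> \<longrightarrow> (\<exists>k::nat. \<forall>j<r. s [^] k \<otimes> c j = \<zero>))"

lemma local_basis_span:
  assumes "local_basis s r b" "x \<in> carrier B"
  obtains k :: nat and c where "c \<in> {..<r} \<rightarrow> carrier A" "s [^] k \<odot>\<^bsub>B\<^esub> x = (\<Oplus>\<^bsub>B\<^esub> j\<in>{..<r}. c j \<odot>\<^bsub>B\<^esub> b j)"
  using assms unfolding local_basis_def by blast

lemma local_basis_independent:
  assumes "local_basis s r b" "c \<in> {..<r} \<rightarrow> carrier A" "(\<Oplus>\<^bsub>B\<^esub> j\<in>{..<r}. c j \<odot>\<^bsub>B\<^esub> b j) = \<zero>\<^bsub>B\<^esub>"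
  obtains k :: nat where "\<And>j. j < r \<Longrightarrow> s [^] k \<otimes> c j = \<zero>"
  using assms unfolding local_basis_def by blast

lemma local_basis_closed: "local_basis s r b \<Longrightarrow> b \<in> {..<r} \<rightarrow> carrier B"
  by (simp add: local_basis_def)

end

lemma (in cring) pow_uniform: "s \<in> carrier R \<Longrightarrow> a \<in> carrier R \<Longrightarrow> s [^] k \<otimes> a = \<zero> \<Longrightarrow> s [^] (k + l) \<otimes> a = \<zero>" for k l :: nat
proof -
  assume *: "s \<in> carrier R" "a \<in> carrier R" "s [^] k \<otimes> a = \<zero>"
  have "s [^] (k + l) \<otimes> a = s [^] l \<otimes> (s [^] k \<otimes> a)"
    using *(1,2) by (simp add: m_ac flip: nat_pow_mult)
  then show ?thesis
    using * by simp
qed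

section \<open>The algebra B over A[1/s]\<close>

locale localized_algebra = localized_ring A s + B: projective_algebra A B n e f
  for A (structure) and s and B and n and e and f
begin

sublocale BC: two_algebras A L B
  by (rule two_algebras.intro) (rule localization_algebra, rule B.algebra_axioms)

abbreviation "E \<equiv> base_change A L B"
abbreviation "pt k x \<equiv> pure_tensor A L B (fr \<one> k) x"

lemma E_algebra: "algebra L E"
  by (rule BC.base_change_algebra)

sublocale E: algebra L E
  by (rule E_algebra)

lemma pt_closed [simp, intro]: "x \<in> carrier B \<Longrightarrow> pt k x \<in> carrier E"
  by (simp add: BC.base_change_simps)

lemma pure_eq_pt:
  assumes "a \<in> carrier A" "x \<in> carrier B"
  shows "pure_tensor A L B (fr a m) x = pt m (a \<odot>\<^bsub>B\<^esub> x)"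
proof -
  have "fr a m = a \<odot>\<^bsub>L\<^esub> fr \<one> m"
    using assms by (simp add: frac_smult)
  then show ?thesis
    using assms by (simp add: BC.pure_smult_left BC.pure_smult_right)
qed

lemma pt_expand:
  assumes "x \<in> carrier B"
  shows "pt (k + m) (s [^] k \<odot>\<^bsub>B\<^esub> x) = pt m x"
  using pure_eq_pt[of "s [^] k" x "k + m"] frac_expand[of \<one> k m] assms by simp

lemma pt_expand_right: "x \<in> carrier B \<Longrightarrow> pt (m + k) (s [^] k \<odot>\<^bsub>B\<^esub> x) = pt m x"
  using pt_expand[of x k m] by (simp add: add.commute)

lemma pt_add: "x \<in> carrier B \<Longrightarrow> y \<in> carrier B \<Longrightarrow> pt k (x \<oplus>\<^bsub>B\<^esub> y) = pt k x \<oplus>\<^bsub>E\<^esub> pt k y"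
  by (simp add: BC.pure_add_right BC.base_change_simps)

lemma pt_mult:
  "x \<in> carrier B \<Longrightarrow> y \<in> carrier B \<Longrightarrow> pt k x \<otimes>\<^bsub>E\<^esub> pt m y = pt (k + m) (x \<otimes>\<^bsub>B\<^esub> y)"
  by (simp add: BC.base_change_simps BC.pure_mult frac_mult)

lemma pt_smult:
  assumes "a \<in> carrier A" "x \<in> carrier B"
  shows "fr a m \<odot>\<^bsub>E\<^esub> pt k x = pt (m + k) (a \<odot>\<^bsub>B\<^esub> x)"
  using assms by (simp add: BC.base_change_simps BC.pure_mult frac_mult pure_eq_pt[OF assms])

text \<open>\<open>A[1/s] \<otimes> B\<close> is the localization of \<open>B\<close>: scalars move
  into the right component, and over a common denominator a sum of pure tensors is again
  pure.\<close>

lemma pt_elem: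
  assumes "t \<in> carrier E"
  obtains k x where "x \<in> carrier B" "t = pt k x"
proof -
  have "t \<in> carrier BC.T"
    using assms by (simp add: BC.base_change_simps)
  then have "\<exists>k x. x \<in> carrier B \<and> t = pt k x"
  proof (induction rule: BC.tensor_induct)
    case (pure c b)
    from pure(1) obtain a m where "a \<in> carrier A" "c = fr a m"
      by (rule localization_elem)
    then show ?case
      using pure(2) pure_eq_pt[of a b m] by blast
  next
    case (add t u)
    then obtain k x m y where *: "x \<in> carrier B" "t = pt k x" "y \<in> carrier B" "u = pt m y"
      by blast
    then have "t \<oplus>\<^bsub>BC.T\<^esub> u = pt (k + m) (s [^] m \<odot>\<^bsub>B\<^esub> x \<oplus>\<^bsub>B\<^esub> s [^] k \<odot>\<^bsub>B\<^esub> y)"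
      by (simp add: pt_add pt_expand pt_expand_right) (simp add: BC.base_change_simps)
    then show ?case
      using * by (metis B.M.a_closed B.smult_closed nat_pow_closed s)
  qed
  then show thesis
    using that by blast
qed

lemma pt_lin_comb:
  assumes "a \<in> I \<rightarrow> carrier A" "x \<in> I \<rightarrow> carrier B"
  shows "(\<Oplus>\<^bsub>E\<^esub> i\<in>I. fr (a i) m \<odot>\<^bsub>E\<^esub> pt k (x i)) = pt (m + k) (\<Oplus>\<^bsub>B\<^esub> i\<in>I. a i \<odot>\<^bsub>B\<^esub> x i)"
proof -
  have "pt (m + k) (\<Oplus>\<^bsub>B\<^esub> i\<in>I. a i \<odot>\<^bsub>B\<^esub> x i) = (\<Oplus>\<^bsub>E\<^esub> i\<in>I. pt (m + k) (a i \<odot>\<^bsub>B\<^esub> x i))"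
    using assms by (intro additive_finsum) (auto simp: pt_add Pi_iff B.abelian_groups E.abelian_groups)
  also have "\<dots> = (\<Oplus>\<^bsub>E\<^esub> i\<in>I. fr (a i) m \<odot>\<^bsub>E\<^esub> pt k (x i))"
    using assms by (intro E.M.finsum_cong') (auto simp: pt_smult Pi_iff)
  finally show ?thesis ..
qed

lemma pt_zero: "pt k \<zero>\<^bsub>B\<^esub> = \<zero>\<^bsub>E\<^esub>"
  using pt_add[of "\<zero>\<^bsub>B\<^esub>" "\<zero>\<^bsub>B\<^esub>" k] by (metis B.M.zero_closed B.M.l_zero E.M.add.l_cancel_one' pt_closed)

text \<open>The forms \<open>id \<otimes> f_l\<close> take \<open>1/s^k \<otimes> x\<close> to
  \<open>f_l x / s^k\<close>, so some power of \<open>s\<close> kills \<open>f_l x\<close>. One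
  power serves for all \<open>l\<close>, and \<open>x\<close> is recovered from its
  coordinates.\<close>

lemma pt_eq_zeroD:
  assumes x: "x \<in> carrier B" and "pt k x = \<zero>\<^bsub>E\<^esub>"
  shows "\<exists>m::nat. s [^] m \<odot>\<^bsub>B\<^esub> x = \<zero>\<^bsub>B\<^esub>"
proof -
  obtain f' where f': "dual_basis L E n (\<lambda>l. pure_tensor A L B \<one>\<^bsub>L\<^esub> (e l)) f'"
    "\<And>l c b. l < n \<Longrightarrow> c \<in> carrier L \<Longrightarrow> b \<in> carrier B \<Longrightarrow> f' l (pure_tensor A L B c b) = f l b \<odot>\<^bsub>L\<^esub> c"
    using BC.base_change_dual_basis[OF B.db] by blast
  have "\<exists>m::nat. s [^] m \<otimes> f l x = \<zero>" if l: "l < n" for l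
  proof -
    have "f' l \<zero>\<^bsub>E\<^esub> = \<zero>\<^bsub>L\<^esub>"
      using linear_formD(3)[OF dual_basisD(2)[OF f'(1) l], of "\<zero>\<^bsub>L\<^esub>" "\<zero>\<^bsub>E\<^esub>"]
        linear_formD(1)[OF dual_basisD(2)[OF f'(1) l], of "\<zero>\<^bsub>E\<^esub>"] by simp
    moreover have "f' l (pt k x) = fr (f l x) k"
      using l x B.dbD by (simp add: f'(2) frac_smult)
    ultimately have "fr (f l x) k = \<zero>\<^bsub>L\<^esub>"
      using assms(2) by simp
    then show ?thesis
      using frac_eq_zero_iff B.dbD(3) l x by blast
  qed
  then have "\<exists>m::nat. \<forall>l\<in>{..<n}. s [^] m \<otimes> f l x = \<zero>"
    by (intro uniform_exponent) (use x B.dbD in \<open>auto intro: pow_uniform\<close>)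
  then obtain m :: nat where m: "\<forall>l\<in>{..<n}. s [^] m \<otimes> f l x = \<zero>"
    by blast
  have "s [^] m \<odot>\<^bsub>B\<^esub> x = s [^] m \<odot>\<^bsub>B\<^esub> (\<Oplus>\<^bsub>B\<^esub> l\<in>{..<n}. f l x \<odot>\<^bsub>B\<^esub> e l)"
    using x by (simp add: B.dbD(4))
  also have "\<dots> = (\<Oplus>\<^bsub>B\<^esub> l\<in>{..<n}. (s [^] m \<otimes> f l x) \<odot>\<^bsub>B\<^esub> e l)"
    using x B.dbD by (intro B.smult_lin_comb) auto
  also have "\<dots> = (\<Oplus>\<^bsub>B\<^esub> l\<in>{..<n}. \<zero>\<^bsub>B\<^esub>)"
    using x B.dbD m by (intro B.M.finsum_cong') auto
  finally show ?thesis
    by (auto simp: B.M.finsum_zero)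
qed

lemma pt_eqD:
  assumes x: "x \<in> carrier B" "y \<in> carrier B" and "pt k x = pt k y"
  shows "\<exists>m::nat. s [^] m \<odot>\<^bsub>B\<^esub> (x \<ominus>\<^bsub>B\<^esub> y) = \<zero>\<^bsub>B\<^esub>"
proof (rule pt_eq_zeroD)
  have "pt k (x \<ominus>\<^bsub>B\<^esub> y) \<oplus>\<^bsub>E\<^esub> pt k y = pt k x"
    using x by (simp add: B.M.minus_eq B.M.a_assoc B.M.l_neg flip: pt_add)
  then show "pt k (x \<ominus>\<^bsub>B\<^esub> y) = \<zero>\<^bsub>E\<^esub>"
    using x assms(3) by (metis B.M.minus_closed E.M.add.r_cancel_one' pt_closed)
qed (use x in auto)

lemma trace_pt: "x \<in> carrier B \<Longrightarrow> algebra_trace L E (pt k x) = fr (B.Tr x) k"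
  by (simp add: BC.base_change_trace[OF B.db] frac_smult B.traceD)

lemma norm_pt: "x \<in> carrier B \<Longrightarrow> algebra_norm L E (pt 0 x) = fr (algebra_norm A B x) 0"
  by (simp add: BC.base_change_norm[OF B.db] structure_map B.norm_closed flip: localization_one)

end

context localized_algebra
begin

lemma smult_diff_eq:
  assumes "x \<in> carrier B" "y \<in> carrier B" "a \<in> carrier A" "a \<odot>\<^bsub>B\<^esub> (x \<ominus>\<^bsub>B\<^esub> y) = \<zero>\<^bsub>B\<^esub>"
  shows "a \<odot>\<^bsub>B\<^esub> x = a \<odot>\<^bsub>B\<^esub> y"
proof -
  have "a \<odot>\<^bsub>B\<^esub> x \<ominus>\<^bsub>B\<^esub> a \<odot>\<^bsub>B\<^esub> y = \<zero>\<^bsub>B\<^esub>"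
    using assms by (simp add: B.M.minus_eq B.smult_r_distr B.smult_r_minus)
  then show ?thesis
    using assms by (simp add: B.M.diff_eq_zero_iff)
qed

lemma common_denominator_family:
  assumes "finite J" "c \<in> J \<rightarrow> carrier L"
  obtains a M where "a \<in> J \<rightarrow> carrier A" "\<And>j. j \<in> J \<Longrightarrow> c j = fr (a j) M"
proof -
  have "\<exists>M. \<forall>j\<in>J. \<exists>a\<in>carrier A. c j = fr a M"
  proof (rule uniform_exponent[OF assms(1)])
    fix j assume "j \<in> J"
    then have "c j \<in> carrier L"
      using assms(2) by auto
    then show "\<exists>M. \<exists>a\<in>carrier A. c j = fr a M"
      by (rule localization_elem) auto
  next
    fix k l j assume "\<exists>a\<in>carrier A. c j = fr a k"
    then show "\<exists>a\<in>carrier A. c j = fr a (k + l)"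
      by (metis frac_expand_right m_closed nat_pow_closed s)
  qed
  then obtain M where "\<forall>j\<in>J. \<exists>a\<in>carrier A. c j = fr a M" ..
  then obtain a where "\<forall>j\<in>J. a j \<in> carrier A \<and> c j = fr (a j) M"
    by metis
  then show thesis
    using that[of a M] by auto
qed

text \<open>One denominator \<open>s^K\<close> is chosen for the whole basis and the numerators are
  taken as local basis. Equations between tensors descend to \<open>B\<close> at the cost of a
  further power of \<open>s\<close>, by \<open>pt_eqD\<close> and
  \<open>frac_eq_zero_iff\<close>.\<close>

lemma module_basis_local_basis:
  assumes "module_basis L E r b'"
  obtains b K where "B.local_basis s r b" "\<And>i. i < r \<Longrightarrow> b' i = pt K (b i)"
proof -
  have b': "b' \<in> {..<r} \<rightarrow> carrier E"
    and ex1: "\<And>x. x \<in> carrier E \<Longrightarrow> \<exists>!c. c \<in> {..<r} \<rightarrow>\<^sub>E carrier L \<and> x = (\<Oplus>\<^bsub>E\<^esub> i\<in>{..<r}. c i \<odot>\<^bsub>E\<^esub> b' i)"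
    using assms unfolding module_basis_def by auto
  have "\<exists>K. \<forall>i\<in>{..<r}. \<exists>x\<in>carrier B. b' i = pt K x"
  proof (rule uniform_exponent)
    fix i assume "i \<in> {..<r}"
    then have "b' i \<in> carrier E"
      using b' by auto
    then show "\<exists>K. \<exists>x\<in>carrier B. b' i = pt K x"
      by (rule pt_elem) auto
  next
    fix k l i assume "\<exists>x\<in>carrier B. b' i = pt k x"
    then show "\<exists>x\<in>carrier B. b' i = pt (k + l) x"
      by (metis pt_expand_right B.smult_closed nat_pow_closed s)
  qed simp
  then obtain K where "\<forall>i\<in>{..<r}. \<exists>x\<in>carrier B. b' i = pt K x" ..
  then obtain b where "\<forall>i\<in>{..<r}. b i \<in> carrier B \<and> b' i = pt K (b i)"
    by metis
  then have b: "b \<in> {..<r} \<rightarrow> carrier B" "\<And>i. i < r \<Longrightarrow> b i \<in> carrier B" "\<And>i. i < r \<Longrightarrow> b' i = pt K (b i)"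
    by auto
  have comb: "(\<Oplus>\<^bsub>E\<^esub> i\<in>{..<r}. c i \<odot>\<^bsub>E\<^esub> b' i) = pt (M + K) (\<Oplus>\<^bsub>B\<^esub> i\<in>{..<r}. a i \<odot>\<^bsub>B\<^esub> b i)"
    if a: "a \<in> {..<r} \<rightarrow> carrier A" "\<And>i. i < r \<Longrightarrow> c i = fr (a i) M" for a c M
  proof -
    have "(\<Oplus>\<^bsub>E\<^esub> i\<in>{..<r}. c i \<odot>\<^bsub>E\<^esub> b' i) = (\<Oplus>\<^bsub>E\<^esub> i\<in>{..<r}. fr (a i) M \<odot>\<^bsub>E\<^esub> pt K (b i))"
    proof (intro E.M.finsum_cong' refl Pi_I)
      fix i assume "i \<in> {..<r}"
      then have "fr (a i) M \<in> carrier L" "i < r"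
        using a(1) by auto
      then show "fr (a i) M \<odot>\<^bsub>E\<^esub> pt K (b i) \<in> carrier E"
        using b by auto
    qed (use a b in auto)
    then show ?thesis
      using pt_lin_comb[OF a(1) b(1)] by simp
  qed
  have span: "\<exists>k::nat. \<exists>c\<in>{..<r} \<rightarrow> carrier A. s [^] k \<odot>\<^bsub>B\<^esub> x = (\<Oplus>\<^bsub>B\<^esub> j\<in>{..<r}. c j \<odot>\<^bsub>B\<^esub> b j)"
    if x: "x \<in> carrier B" for x
  proof -
    obtain c where c: "c \<in> {..<r} \<rightarrow>\<^sub>E carrier L" "pt 0 x = (\<Oplus>\<^bsub>E\<^esub> i\<in>{..<r}. c i \<odot>\<^bsub>E\<^esub> b' i)"
      using ex1[of "pt 0 x"] x by auto
    obtain a M where a: "a \<in> {..<r} \<rightarrow> carrier A" "\<And>j. j \<in> {..<r} \<Longrightarrow> c j = fr (a j) M"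
      using common_denominator_family[of "{..<r}" c] c(1) by (metis PiE_iff Pi_I finite_lessThan)
    define y where "y = (\<Oplus>\<^bsub>B\<^esub> i\<in>{..<r}. a i \<odot>\<^bsub>B\<^esub> b i)"
    have y: "y \<in> carrier B"
      unfolding y_def using a b by (intro B.M.finsum_closed) auto
    have "pt (M + K) (s [^] (M + K) \<odot>\<^bsub>B\<^esub> x) = pt (M + K) y"
      using c(2) comb[of a c M] a pt_expand_right[OF x, of 0 "M + K"] by (simp add: y_def)
    then obtain m :: nat where "s [^] m \<odot>\<^bsub>B\<^esub> ((s [^] (M + K) \<odot>\<^bsub>B\<^esub> x) \<ominus>\<^bsub>B\<^esub> y) = \<zero>\<^bsub>B\<^esub>"
      using pt_eqD x y by (metis B.smult_closed nat_pow_closed s)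
    then have "s [^] m \<odot>\<^bsub>B\<^esub> (s [^] (M + K) \<odot>\<^bsub>B\<^esub> x) = s [^] m \<odot>\<^bsub>B\<^esub> y"
      using x y by (intro smult_diff_eq) auto
    then have "s [^] (m + (M + K)) \<odot>\<^bsub>B\<^esub> x = (\<Oplus>\<^bsub>B\<^esub> i\<in>{..<r}. (s [^] m \<otimes> a i) \<odot>\<^bsub>B\<^esub> b i)"
      using x a b unfolding y_def by (simp add: B.smult_lin_comb flip: nat_pow_mult B.smult_assoc1)
    then show ?thesis
      using a(1) by (intro exI[of _ "m + (M + K)"] bexI[of _ "\<lambda>i. s [^] m \<otimes> a i"]) auto
  qed
  have indep: "\<exists>k::nat. \<forall>j<r. s [^] k \<otimes> c j = \<zero>"
    if c: "c \<in> {..<r} \<rightarrow> carrier A" and zero: "(\<Oplus>\<^bsub>B\<^esub> j\<in>{..<r}. c j \<odot>\<^bsub>B\<^esub> b j) = \<zero>\<^bsub>B\<^esub>" for c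
  proof -
    \<comment> \<open>Independence has to come from uniqueness of the coordinates of zero. Both
      \<open>c\<close> and the zero family represent zero, so the two are treated together.\<close>
    have sum: "(\<Oplus>\<^bsub>E\<^esub> i\<in>{..<r}. d i \<odot>\<^bsub>E\<^esub> b' i) = \<zero>\<^bsub>E\<^esub>"
      if "\<And>i. i < r \<Longrightarrow> d i = fr (a i) 0" "a = c \<or> a = (\<lambda>_. \<zero>)" for d a
    proof -
      have a: "a \<in> {..<r} \<rightarrow> carrier A" "(\<Oplus>\<^bsub>B\<^esub> j\<in>{..<r}. a j \<odot>\<^bsub>B\<^esub> b j) = \<zero>\<^bsub>B\<^esub>"
      proof -
        have "(\<Oplus>\<^bsub>B\<^esub> j\<in>{..<r}. \<zero> \<odot>\<^bsub>B\<^esub> b j) = (\<Oplus>\<^bsub>B\<^esub> j\<in>{..<r}. \<zero>\<^bsub>B\<^esub>)"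
          using b by (intro B.M.finsum_cong') auto
        then show "a \<in> {..<r} \<rightarrow> carrier A" "(\<Oplus>\<^bsub>B\<^esub> j\<in>{..<r}. a j \<odot>\<^bsub>B\<^esub> b j) = \<zero>\<^bsub>B\<^esub>"
          using that(2) c zero by (auto simp: B.M.finsum_zero)
      qed
      then show ?thesis
        using comb[of a d 0] that(1) by (simp add: pt_zero)
    qed
    let ?c = "restrict (\<lambda>i. fr (c i) 0) {..<r}" and ?z = "restrict (\<lambda>i. fr \<zero> 0) {..<r}"
    obtain u where u: "\<forall>d. d \<in> {..<r} \<rightarrow>\<^sub>E carrier L \<and> \<zero>\<^bsub>E\<^esub> = (\<Oplus>\<^bsub>E\<^esub> i\<in>{..<r}. d i \<odot>\<^bsub>E\<^esub> b' i) \<longrightarrow> d = u"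
      using ex1[OF E.M.zero_closed] by (elim ex1E)
    have "?c \<in> {..<r} \<rightarrow>\<^sub>E carrier L" "?z \<in> {..<r} \<rightarrow>\<^sub>E carrier L"
      using c by auto
    then have "?c = u" "?z = u"
      using u[rule_format, of ?c] u[rule_format, of ?z] sum[of ?c c] sum[of ?z "\<lambda>_. \<zero>"] by simp_all
    then have "?c = ?z"
      by simp
    then have "fr (c j) 0 = fr \<zero> 0" if "j < r" for j
      using \<open>?c = ?z\<close> that by (auto dest!: fun_cong[of ?c ?z j])
    then have "\<exists>k::nat. s [^] k \<otimes> c j = \<zero>" if "j < r" for j
      using that c frac_eq_zero_iff[of "c j" 0] by (auto simp: localization_zero[of 0])
    then have "\<exists>k::nat. \<forall>j\<in>{..<r}. s [^] k \<otimes> c j = \<zero>"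
      by (intro uniform_exponent) (use c in \<open>auto intro: pow_uniform\<close>)
    then show ?thesis
      by auto
  qed
  have "B.local_basis s r b"
    unfolding B.local_basis_def using b span indep by auto
  then show thesis
    using that b(3) by blast
qed

text \<open>The images of the \<open>b_i\<close> serve without denominators. Uniqueness is checked
  on the difference of two coordinate families, written over a common denominator.\<close>

lemma local_basis_module_basis:
  assumes "B.local_basis s r b"
  shows "module_basis L E r (\<lambda>i. pt 0 (b i))"
  unfolding module_basis_def
proof (intro conjI ballI)
  have b: "b \<in> {..<r} \<rightarrow> carrier B" "\<And>i. i < r \<Longrightarrow> b i \<in> carrier B"
    using assms by (auto simp: B.local_basis_def)
  show "(\<lambda>i. pt 0 (b i)) \<in> {..<r} \<rightarrow> carrier E"
    using b by auto
  have comb: "(\<Oplus>\<^bsub>E\<^esub> i\<in>{..<r}. c i \<odot>\<^bsub>E\<^esub> pt 0 (b i)) = pt M (\<Oplus>\<^bsub>B\<^esub> i\<in>{..<r}. a i \<odot>\<^bsub>B\<^esub> b i)"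
    if a: "a \<in> {..<r} \<rightarrow> carrier A" "\<And>i. i < r \<Longrightarrow> c i = fr (a i) M" for a c M
  proof -
    have "(\<Oplus>\<^bsub>E\<^esub> i\<in>{..<r}. c i \<odot>\<^bsub>E\<^esub> pt 0 (b i)) = (\<Oplus>\<^bsub>E\<^esub> i\<in>{..<r}. fr (a i) M \<odot>\<^bsub>E\<^esub> pt 0 (b i))"
    proof (intro E.M.finsum_cong' refl Pi_I)
      fix i assume "i \<in> {..<r}"
      then have "fr (a i) M \<in> carrier L" "i < r"
        using a(1) by auto
      then show "fr (a i) M \<odot>\<^bsub>E\<^esub> pt 0 (b i) \<in> carrier E"
        using b by auto
    qed (use a b in auto)
    then show ?thesis
      using pt_lin_comb[OF a(1) b(1), of M 0] by simp
  qed
  fix t assume "t \<in> carrier E"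
  then obtain k x where x: "x \<in> carrier B" "t = pt k x"
    by (rule pt_elem)
  show "\<exists>!c. c \<in> {..<r} \<rightarrow>\<^sub>E carrier L \<and> t = (\<Oplus>\<^bsub>E\<^esub> i\<in>{..<r}. c i \<odot>\<^bsub>E\<^esub> pt 0 (b i))"
  proof (rule ex_ex1I)
    obtain m :: nat and a where a: "a \<in> {..<r} \<rightarrow> carrier A" "s [^] m \<odot>\<^bsub>B\<^esub> x = (\<Oplus>\<^bsub>B\<^esub> j\<in>{..<r}. a j \<odot>\<^bsub>B\<^esub> b j)"
      using B.local_basis_span[OF assms x(1)] by blast
    let ?c = "restrict (\<lambda>i. fr (a i) (k + m)) {..<r}"
    have "t = (\<Oplus>\<^bsub>E\<^esub> i\<in>{..<r}. ?c i \<odot>\<^bsub>E\<^esub> pt 0 (b i))"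
      using comb[of a ?c "k + m"] a pt_expand_right[OF x(1), of k m] x(2) by simp
    moreover have "?c \<in> {..<r} \<rightarrow>\<^sub>E carrier L"
      using a by auto
    ultimately show "\<exists>c. c \<in> {..<r} \<rightarrow>\<^sub>E carrier L \<and> t = (\<Oplus>\<^bsub>E\<^esub> i\<in>{..<r}. c i \<odot>\<^bsub>E\<^esub> pt 0 (b i))"
      by blast
  next
    fix c d
    assume *: "c \<in> {..<r} \<rightarrow>\<^sub>E carrier L \<and> t = (\<Oplus>\<^bsub>E\<^esub> i\<in>{..<r}. c i \<odot>\<^bsub>E\<^esub> pt 0 (b i))"
      "d \<in> {..<r} \<rightarrow>\<^sub>E carrier L \<and> t = (\<Oplus>\<^bsub>E\<^esub> i\<in>{..<r}. d i \<odot>\<^bsub>E\<^esub> pt 0 (b i))"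
    let ?diff = "\<lambda>i. c i \<ominus>\<^bsub>L\<^esub> d i"
    have cd: "c i \<in> carrier L" "d i \<in> carrier L" if "i < r" for i
      using * that by auto
    then have diff: "?diff \<in> {..<r} \<rightarrow> carrier L"
      by auto
    then obtain a M where a: "a \<in> {..<r} \<rightarrow> carrier A" "\<And>j. j \<in> {..<r} \<Longrightarrow> ?diff j = fr (a j) M"
      using common_denominator_family[of "{..<r}" ?diff] by blast
    have "(\<Oplus>\<^bsub>E\<^esub> i\<in>{..<r}. ?diff i \<odot>\<^bsub>E\<^esub> pt 0 (b i)) \<oplus>\<^bsub>E\<^esub> (\<Oplus>\<^bsub>E\<^esub> i\<in>{..<r}. d i \<odot>\<^bsub>E\<^esub> pt 0 (b i)) =
        (\<Oplus>\<^bsub>E\<^esub> i\<in>{..<r}. (?diff i \<oplus>\<^bsub>L\<^esub> d i) \<odot>\<^bsub>E\<^esub> pt 0 (b i))"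
      using cd diff b by (intro E.add_lin_comb) auto
    also have "\<dots> = (\<Oplus>\<^bsub>E\<^esub> i\<in>{..<r}. c i \<odot>\<^bsub>E\<^esub> pt 0 (b i))"
      using cd b by (intro E.M.finsum_cong') (auto simp: L.M.minus_eq L.M.a_assoc L.M.l_neg)
    also have "\<dots> = (\<Oplus>\<^bsub>E\<^esub> i\<in>{..<r}. d i \<odot>\<^bsub>E\<^esub> pt 0 (b i))"
      using * by simp
    finally have "(\<Oplus>\<^bsub>E\<^esub> i\<in>{..<r}. ?diff i \<odot>\<^bsub>E\<^esub> pt 0 (b i)) = \<zero>\<^bsub>E\<^esub>"
      using cd diff b by (subst (asm) E.M.add.r_cancel_one) (auto intro!: E.M.finsum_closed)
    then have "pt M (\<Oplus>\<^bsub>B\<^esub> i\<in>{..<r}. a i \<odot>\<^bsub>B\<^esub> b i) = \<zero>\<^bsub>E\<^esub>"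
      using comb[of a ?diff M] a by simp
    moreover have sum_closed: "(\<Oplus>\<^bsub>B\<^esub> i\<in>{..<r}. a i \<odot>\<^bsub>B\<^esub> b i) \<in> carrier B"
      using a b by (intro B.M.finsum_closed) auto
    ultimately obtain m :: nat where "s [^] m \<odot>\<^bsub>B\<^esub> (\<Oplus>\<^bsub>B\<^esub> i\<in>{..<r}. a i \<odot>\<^bsub>B\<^esub> b i) = \<zero>\<^bsub>B\<^esub>"
      using pt_eq_zeroD by blast
    then have "(\<Oplus>\<^bsub>B\<^esub> i\<in>{..<r}. (s [^] m \<otimes> a i) \<odot>\<^bsub>B\<^esub> b i) = \<zero>\<^bsub>B\<^esub>"
      using a b by (simp add: B.smult_lin_comb)
    moreover have "(\<lambda>i. s [^] m \<otimes> a i) \<in> {..<r} \<rightarrow> carrier A"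
      using a by auto
    ultimately obtain k :: nat where k: "\<And>j. j < r \<Longrightarrow> s [^] k \<otimes> (s [^] m \<otimes> a j) = \<zero>"
      using B.local_basis_independent[OF assms] by blast
    have "c i = d i" if i: "i < r" for i
    proof -
      have ai: "a i \<in> carrier A"
        using a i by auto
      then have "s [^] (k + m) \<otimes> a i = \<zero>"
        using k i by (simp add: pow_mult_assoc)
      then have "?diff i = \<zero>\<^bsub>L\<^esub>"
        using a(2)[of i] i frac_eq_zero_iff[OF ai] by auto
      then show ?thesis
        using cd i by (simp add: L.M.diff_eq_zero_iff)
    qed
    then show "c = d"
      using * by (intro PiE_ext[of c "{..<r}" "\<lambda>_. carrier L" d]) auto
  qed
qed

lemma frac_pow: "(fr \<one> k) [^]\<^bsub>L\<^esub> m = fr \<one> (k * m)" for m :: nat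
  by (induction m) (simp_all add: localization_one frac_mult L.nat_pow_Suc add.commute)

text \<open>Origin of the exponent: a product of two basis elements carries the denominator
  \<open>s^(K + K)\<close>, and pulling this factor out of \<open>r\<close> rows of the trace matrix
  multiplies the exponent by \<open>r\<close>.\<close>

lemma basis_discriminant_pt:
  assumes b: "b \<in> {..<r} \<rightarrow> carrier B" and b': "\<And>i. i < r \<Longrightarrow> b' i = pt K (b i)"
  shows "basis_discriminant L E r b' = fr (B.disc r b) ((K + K) * r)"
proof -
  have t: "B.Tr (b i \<otimes>\<^bsub>B\<^esub> b j) \<in> carrier A" if "i < r" "j < r" for i j
    using b that by (intro B.traceD) auto
  have "basis_discriminant L E r b' =
      mat_det L r (\<lambda>i j. fr \<one> (K + K) \<otimes>\<^bsub>L\<^esub> (B.Tr (b i \<otimes>\<^bsub>B\<^esub> b j) \<odot>\<^bsub>L\<^esub> \<one>\<^bsub>L\<^esub>))"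
    unfolding basis_discriminant_def
  proof (rule cring.mat_det_cong[OF L_cring])
    fix i j assume ij: "i < r" "j < r"
    then have "b i \<in> carrier B" "b j \<in> carrier B"
      using b by auto
    then show "algebra_trace L E (b' i \<otimes>\<^bsub>E\<^esub> b' j) =
        fr \<one> (K + K) \<otimes>\<^bsub>L\<^esub> (B.Tr (b i \<otimes>\<^bsub>B\<^esub> b j) \<odot>\<^bsub>L\<^esub> \<one>\<^bsub>L\<^esub>)"
      using t[OF ij] by (simp add: b' ij pt_mult trace_pt structure_map frac_mult)
  qed (use t in auto)
  also have "\<dots> = (fr \<one> (K + K)) [^]\<^bsub>L\<^esub> r \<otimes>\<^bsub>L\<^esub> mat_det L r (\<lambda>i j. B.Tr (b i \<otimes>\<^bsub>B\<^esub> b j) \<odot>\<^bsub>L\<^esub> \<one>\<^bsub>L\<^esub>)"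
    using t by (intro cring.mat_det_smult[OF L_cring]) auto
  also have "mat_det L r (\<lambda>i j. B.Tr (b i \<otimes>\<^bsub>B\<^esub> b j) \<odot>\<^bsub>L\<^esub> \<one>\<^bsub>L\<^esub>) = B.disc r b \<odot>\<^bsub>L\<^esub> \<one>\<^bsub>L\<^esub>"
    unfolding B.disc_def using t by (intro mat_det_ring_hom[OF BC.structure_map_hom, symmetric])
  finally show ?thesis
    using B.disc_closed[OF b] by (simp add: frac_pow structure_map frac_mult)
qed

lemma extended_ideal_discriminant_iff:
  assumes "ideal D A" "b \<in> {..<r} \<rightarrow> carrier B" "\<And>i. i < r \<Longrightarrow> b' i = pt K (b i)"
  shows "extended_ideal A s D = Idl\<^bsub>L\<^esub> {basis_discriminant L E r b'} \<longleftrightarrow>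
    D \<subseteq> local_multiples (B.disc r b) \<and> (\<exists>k::nat. s [^] k \<otimes> B.disc r b \<in> D)"
  by (simp add: basis_discriminant_pt[OF assms(2,3)] extended_ideal_principal_iff[OF assms(1) B.disc_closed[OF assms(2)]])

text \<open>By \<open>pt_elem\<close> every element over \<open>A[1/s]\<close> is some
  \<open>x / s^k\<close>, so dividing the trace formula for \<open>x\<close> by \<open>s^k\<close>
  yields the formula that \<open>norm_multiple_of_discriminant\<close> requires.\<close>

lemma norm_in_local_discriminant:
  assumes \<beta>: "\<beta> \<in> carrier B" and c: "c \<in> {..<n} \<rightarrow> carrier B"
    and trace: "\<And>x. x \<in> carrier B \<Longrightarrow> x \<otimes>\<^bsub>B\<^esub> \<beta> = (\<Oplus>\<^bsub>B\<^esub> l\<in>{..<n}. B.Tr (x \<otimes>\<^bsub>B\<^esub> e l) \<odot>\<^bsub>B\<^esub> c l)"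
    and basis: "module_basis L E r b'"
  shows "fr (algebra_norm A B \<beta>) 0 \<in> Idl\<^bsub>L\<^esub> {basis_discriminant L E r b'}"
proof -
  have "\<exists>z\<in>carrier L. algebra_norm L E (pt 0 \<beta>) = z \<otimes>\<^bsub>L\<^esub> basis_discriminant L E r b'"
  proof (rule E.norm_multiple_of_discriminant[OF basis])
    show "pt 0 \<beta> \<in> carrier E" "(\<lambda>l. pt 0 (e l)) \<in> {..<n} \<rightarrow> carrier E" "(\<lambda>l. pt 0 (c l)) \<in> {..<n} \<rightarrow> carrier E"
      using \<beta> c B.dbD(1) by auto
    fix t assume "t \<in> carrier E"
    then obtain k x where x: "x \<in> carrier B" "t = pt k x"
      by (rule pt_elem)
    have tr: "B.Tr (x \<otimes>\<^bsub>B\<^esub> e l) \<in> carrier A" if "l < n" for l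
      using x B.dbD(1) that by (intro B.traceD) auto
    have "t \<otimes>\<^bsub>E\<^esub> pt 0 \<beta> = pt (k + 0) (\<Oplus>\<^bsub>B\<^esub> l\<in>{..<n}. B.Tr (x \<otimes>\<^bsub>B\<^esub> e l) \<odot>\<^bsub>B\<^esub> c l)"
      using x \<beta> by (simp add: pt_mult trace)
    also have "\<dots> = (\<Oplus>\<^bsub>E\<^esub> l\<in>{..<n}. fr (B.Tr (x \<otimes>\<^bsub>B\<^esub> e l)) k \<odot>\<^bsub>E\<^esub> pt 0 (c l))"
      using tr c by (intro pt_lin_comb[symmetric]) auto
    also have "\<dots> = (\<Oplus>\<^bsub>E\<^esub> l\<in>{..<n}. algebra_trace L E (t \<otimes>\<^bsub>E\<^esub> pt 0 (e l)) \<odot>\<^bsub>E\<^esub> pt 0 (c l))"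
    proof (intro E.M.finsum_cong' refl Pi_I)
      fix l assume l: "l \<in> {..<n}"
      then have "algebra_trace L E (t \<otimes>\<^bsub>E\<^esub> pt 0 (e l)) = fr (B.Tr (x \<otimes>\<^bsub>B\<^esub> e l)) k"
        using x B.dbD(1) by (simp add: pt_mult trace_pt)
      moreover have "fr (B.Tr (x \<otimes>\<^bsub>B\<^esub> e l)) k \<in> carrier L" "pt 0 (c l) \<in> carrier E"
        using l tr c by auto
      ultimately show "fr (B.Tr (x \<otimes>\<^bsub>B\<^esub> e l)) k \<odot>\<^bsub>E\<^esub> pt 0 (c l) =
          algebra_trace L E (t \<otimes>\<^bsub>E\<^esub> pt 0 (e l)) \<odot>\<^bsub>E\<^esub> pt 0 (c l)"
        "algebra_trace L E (t \<otimes>\<^bsub>E\<^esub> pt 0 (e l)) \<odot>\<^bsub>E\<^esub> pt 0 (c l) \<in> carrier E"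
        by auto
    qed
    finally show "t \<otimes>\<^bsub>E\<^esub> pt 0 \<beta> = (\<Oplus>\<^bsub>E\<^esub> l\<in>{..<n}. algebra_trace L E (t \<otimes>\<^bsub>E\<^esub> pt 0 (e l)) \<odot>\<^bsub>E\<^esub> pt 0 (c l))" .
  qed
  moreover have "basis_discriminant L E r b' \<in> carrier L"
  proof -
    obtain b K where b: "B.local_basis s r b" "\<And>i. i < r \<Longrightarrow> b' i = pt K (b i)"
      using module_basis_local_basis[OF basis] by blast
    show ?thesis
      using basis_discriminant_pt[OF B.local_basis_closed[OF b(1)] b(2)] B.disc_closed[OF B.local_basis_closed[OF b(1)]]
      by simp
  qed
  ultimately show ?thesis
    using cring.genideal_singleton[OF L_cring] norm_pt[OF \<beta>] by auto
qed

end

section \<open>The discriminant ideal\<close>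

lemma (in localized_ring) local_multiplesI:
  "a \<in> carrier A \<Longrightarrow> c \<in> carrier A \<Longrightarrow> s [^] k \<otimes> a = c \<otimes> d \<Longrightarrow> a \<in> local_multiples d" for k :: nat
  by (auto simp: local_multiples_def)

lemma (in localized_ring) local_multiples_ideal:
  assumes "d \<in> carrier A"
  shows "ideal (local_multiples d) A"
proof (rule idealI')
  show "\<zero> \<in> local_multiples d"
    using assms by (auto simp: local_multiples_def intro!: exI[of _ "0::nat"] bexI[of _ \<zero>])
next
  fix x y assume "x \<in> local_multiples d" "y \<in> local_multiples d"
  then obtain k l :: nat and c c' where *: "x \<in> carrier A" "y \<in> carrier A" "c \<in> carrier A" "c' \<in> carrier A"
    "s [^] k \<otimes> x = c \<otimes> d" "s [^] l \<otimes> y = c' \<otimes> d"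
    by (auto simp: local_multiples_def)
  have "s [^] (k + l) \<otimes> (x \<oplus> y) = s [^] l \<otimes> (s [^] k \<otimes> x) \<oplus> s [^] k \<otimes> (s [^] l \<otimes> y)"
    using *(1-4) by (simp add: r_distr m_ac flip: nat_pow_mult)
  also have "\<dots> = (s [^] l \<otimes> c \<oplus> s [^] k \<otimes> c') \<otimes> d"
    using * assms by (simp add: l_distr m_assoc)
  finally show "x \<oplus> y \<in> local_multiples d"
    using *(1-4) by (intro local_multiplesI[where c = "s [^] l \<otimes> c \<oplus> s [^] k \<otimes> c'"]) auto
next
  fix a x assume a: "a \<in> carrier A" and "x \<in> local_multiples d"
  then obtain k :: nat and c where *: "x \<in> carrier A" "c \<in> carrier A" "s [^] k \<otimes> x = c \<otimes> d"
    by (auto simp: local_multiples_def)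
  have "s [^] k \<otimes> (a \<otimes> x) = a \<otimes> (s [^] k \<otimes> x)"
    using * a by (simp add: m_lcomm)
  also have "\<dots> = (a \<otimes> c) \<otimes> d"
    using * a assms by (simp add: m_assoc)
  finally show "a \<otimes> x \<in> local_multiples d"
    using * a by (intro local_multiplesI[where c = "a \<otimes> c"]) auto
qed (auto simp: local_multiples_def)

lemma (in cring) ideal_finsum:
  assumes "ideal I R" "g \<in> J \<rightarrow> I"
  shows "(\<Oplus>j\<in>J. g j) \<in> I"
  using assms(2)
proof (induction J rule: infinite_finite_induct)
  case (insert j J)
  then show ?case
    using idealD[OF assms(1)] by (subst finsum_insert) (auto simp: Pi_iff)
qed (use idealD(2)[OF assms(1)] in auto)

section \<open>Comparison of the discriminants of two local bases\<close>

context projective_algebra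
begin

lemma localized: "s \<in> carrier A \<Longrightarrow> localized_algebra A s B n e f"
  by (intro localized_algebra.intro localized_ring.intro localized_ring_axioms.intro R.is_cring projective_algebra_axioms)

abbreviation "mults s \<equiv> localized_ring.local_multiples A s"

text \<open>Multiplying both arguments of the trace form by \<open>u\<close> gives the matrix
  identity \<open>u^2 (Tr (b_i b_j)) = X T X^t\<close>, where \<open>T\<close> is the trace matrix
  of \<open>b'\<close>; take determinants of size \<open>r\<close>.\<close>

lemma disc_change_basis:
  assumes b: "b \<in> {..<r} \<rightarrow> carrier B" and b': "b' \<in> {..<r} \<rightarrow> carrier B" and u: "u \<in> carrier A"
    and X: "\<And>i j. i < r \<Longrightarrow> j < r \<Longrightarrow> X i j \<in> carrier A"
    and eq: "\<And>i. i < r \<Longrightarrow> u \<odot>\<^bsub>B\<^esub> b i = (\<Oplus>\<^bsub>B\<^esub> j\<in>{..<r}. X i j \<odot>\<^bsub>B\<^esub> b' j)"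
  shows "(u \<otimes> u) [^] r \<otimes> disc r b = (mat_det A r X \<otimes> mat_det A r X) \<otimes> disc r b'"
proof -
  have bc: "b i \<in> carrier B" "b' i \<in> carrier B" if "i < r" for i
    using b b' that by auto
  define T where "T i j = Tr (b' i \<otimes>\<^bsub>B\<^esub> b' j)" for i j
  have T: "T i j \<in> carrier A" if "i < r" "j < r" for i j
    unfolding T_def using that bc by (intro traceD) auto
  have form: "linear_form A B (\<lambda>x. Tr (y \<otimes>\<^bsub>B\<^esub> x))" if "y \<in> carrier B" for y
    using traceD linear_mapD[OF mult_linear[OF that]] by (auto simp: linear_form_def)
  have entry: "(u \<otimes> u) \<otimes> Tr (b i \<otimes>\<^bsub>B\<^esub> b j) = (\<Oplus>p\<in>{..<r}. X i p \<otimes> (\<Oplus>q\<in>{..<r}. T p q \<otimes> X j q))"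
    if ij: "i < r" "j < r" for i j
  proof -
    have ub: "u \<odot>\<^bsub>B\<^esub> b j \<in> carrier B"
      using bc ij u by simp
    have inner: "Tr ((u \<odot>\<^bsub>B\<^esub> b j) \<otimes>\<^bsub>B\<^esub> b' p) = (\<Oplus>q\<in>{..<r}. T p q \<otimes> X j q)" if p: "p < r" for p
    proof -
      have "Tr ((u \<odot>\<^bsub>B\<^esub> b j) \<otimes>\<^bsub>B\<^esub> b' p) = Tr (b' p \<otimes>\<^bsub>B\<^esub> (\<Oplus>\<^bsub>B\<^esub> q\<in>{..<r}. X j q \<odot>\<^bsub>B\<^esub> b' q))"
        using ub bc[OF p] ij by (simp add: m_comm flip: eq)
      also have "\<dots> = (\<Oplus>q\<in>{..<r}. X j q \<otimes> T p q)"
        unfolding T_def using X ij b' bc[OF p] by (intro linear_form_lin_comb[OF form]) auto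
      also have "\<dots> = (\<Oplus>q\<in>{..<r}. T p q \<otimes> X j q)"
        using X T ij p by (intro R.finsum_cong') (auto simp: R.m_comm)
      finally show ?thesis .
    qed
    have "(u \<otimes> u) \<otimes> Tr (b i \<otimes>\<^bsub>B\<^esub> b j) = Tr ((u \<odot>\<^bsub>B\<^esub> b j) \<otimes>\<^bsub>B\<^esub> (u \<odot>\<^bsub>B\<^esub> b i))"
      using u bc ij linear_mapD(3)[OF mult_linear[OF bc(1)[OF ij(2)]]]
      by (simp add: smult_assoc2 traceD(3) R.m_assoc m_comm[of "b j" "b i"] traceD(1))
    also have "\<dots> = Tr ((u \<odot>\<^bsub>B\<^esub> b j) \<otimes>\<^bsub>B\<^esub> (\<Oplus>\<^bsub>B\<^esub> p\<in>{..<r}. X i p \<odot>\<^bsub>B\<^esub> b' p))"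
      by (simp add: eq ij)
    also have "\<dots> = (\<Oplus>p\<in>{..<r}. X i p \<otimes> Tr ((u \<odot>\<^bsub>B\<^esub> b j) \<otimes>\<^bsub>B\<^esub> b' p))"
      using X ij b' by (intro linear_form_lin_comb[OF form[OF ub]]) auto
    also have "\<dots> = (\<Oplus>p\<in>{..<r}. X i p \<otimes> (\<Oplus>q\<in>{..<r}. T p q \<otimes> X j q))"
      using X T ij inner by (intro R.finsum_cong') (auto intro!: R.finsum_closed)
    finally show ?thesis .
  qed
  have XT: "(\<Oplus>q\<in>{..<r}. T p q \<otimes> X j q) \<in> carrier A" if "p < r" "j < r" for p j
    using X T that by (intro R.finsum_closed) auto
  have "(u \<otimes> u) [^] r \<otimes> disc r b = mat_det A r (\<lambda>i j. (u \<otimes> u) \<otimes> Tr (b i \<otimes>\<^bsub>B\<^esub> b j))"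
    unfolding disc_def using u bc by (intro R.mat_det_smult[symmetric] traceD) auto
  also have "\<dots> = mat_det A r (\<lambda>i j. \<Oplus>p\<in>{..<r}. X i p \<otimes> (\<Oplus>q\<in>{..<r}. T p q \<otimes> X j q))"
    using X XT by (intro R.mat_det_cong entry R.finsum_closed) auto
  also have "\<dots> = mat_det A r X \<otimes> mat_det A r (\<lambda>p j. \<Oplus>q\<in>{..<r}. T p q \<otimes> X j q)"
    using X XT by (intro R.mat_det_mult) auto
  also have "mat_det A r (\<lambda>p j. \<Oplus>q\<in>{..<r}. T p q \<otimes> X j q) = mat_det A r T \<otimes> mat_det A r (\<lambda>i j. X j i)"
    using X T by (intro R.mat_det_mult) auto
  also have "mat_det A r (\<lambda>i j. X j i) = mat_det A r X"
    using X by (rule R.mat_det_transpose)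
  finally show ?thesis
    using R.mat_det_closed[of r X] R.mat_det_closed[of r T] X T by (simp add: disc_def T_def[symmetric] R.m_ac)
qed

lemma local_basis_expand:
  fixes m :: nat
  assumes basis: "local_basis s r b" and s: "s \<in> carrier A" and x: "x \<in> {..<m} \<rightarrow> carrier B"
  obtains k :: nat and X where "\<And>i j. i < m \<Longrightarrow> j < r \<Longrightarrow> X i j \<in> carrier A"
    "\<And>i. i < m \<Longrightarrow> s [^] k \<odot>\<^bsub>B\<^esub> x i = (\<Oplus>\<^bsub>B\<^esub> j\<in>{..<r}. X i j \<odot>\<^bsub>B\<^esub> b j)"
proof -
  have "\<exists>k::nat. \<forall>i\<in>{..<m}. \<exists>c\<in>{..<r} \<rightarrow> carrier A. s [^] k \<odot>\<^bsub>B\<^esub> x i = (\<Oplus>\<^bsub>B\<^esub> j\<in>{..<r}. c j \<odot>\<^bsub>B\<^esub> b j)"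
  proof (rule uniform_exponent)
    fix i assume "i \<in> {..<m}"
    then have "x i \<in> carrier B"
      using x by auto
    then show "\<exists>k::nat. \<exists>c\<in>{..<r} \<rightarrow> carrier A. s [^] k \<odot>\<^bsub>B\<^esub> x i = (\<Oplus>\<^bsub>B\<^esub> j\<in>{..<r}. c j \<odot>\<^bsub>B\<^esub> b j)"
      by (rule local_basis_span[OF basis]) blast
  next
    fix k l :: nat and i assume "i \<in> {..<m}"
      and "\<exists>c\<in>{..<r} \<rightarrow> carrier A. s [^] k \<odot>\<^bsub>B\<^esub> x i = (\<Oplus>\<^bsub>B\<^esub> j\<in>{..<r}. c j \<odot>\<^bsub>B\<^esub> b j)"
    then obtain c where c: "c \<in> {..<r} \<rightarrow> carrier A" "s [^] k \<odot>\<^bsub>B\<^esub> x i = (\<Oplus>\<^bsub>B\<^esub> j\<in>{..<r}. c j \<odot>\<^bsub>B\<^esub> b j)"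
      by blast
    have xi: "x i \<in> carrier B"
      using x \<open>i \<in> {..<m}\<close> by auto
    have "s [^] (k + l) \<odot>\<^bsub>B\<^esub> x i = s [^] l \<odot>\<^bsub>B\<^esub> (s [^] k \<odot>\<^bsub>B\<^esub> x i)"
      using s xi by (simp add: R.m_comm flip: R.nat_pow_mult smult_assoc1)
    also have "\<dots> = (\<Oplus>\<^bsub>B\<^esub> j\<in>{..<r}. (s [^] l \<otimes> c j) \<odot>\<^bsub>B\<^esub> b j)"
      unfolding c(2) using s c(1) local_basis_closed[OF basis] by (intro smult_lin_comb) auto
    finally show "\<exists>c\<in>{..<r} \<rightarrow> carrier A. s [^] (k + l) \<odot>\<^bsub>B\<^esub> x i = (\<Oplus>\<^bsub>B\<^esub> j\<in>{..<r}. c j \<odot>\<^bsub>B\<^esub> b j)"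
      using s c(1) by (intro bexI[of _ "\<lambda>j. s [^] l \<otimes> c j"]) auto
  qed simp
  then obtain k :: nat where "\<forall>i\<in>{..<m}. \<exists>c\<in>{..<r} \<rightarrow> carrier A. s [^] k \<odot>\<^bsub>B\<^esub> x i = (\<Oplus>\<^bsub>B\<^esub> j\<in>{..<r}. c j \<odot>\<^bsub>B\<^esub> b j)" ..
  then obtain X where X: "\<forall>i\<in>{..<m}. X i \<in> {..<r} \<rightarrow> carrier A \<and> s [^] k \<odot>\<^bsub>B\<^esub> x i = (\<Oplus>\<^bsub>B\<^esub> j\<in>{..<r}. X i j \<odot>\<^bsub>B\<^esub> b j)"
    by metis
  show thesis
    by (rule that[of X k]) (use X in auto)
qed

text \<open>After inverting \<open>s s'\<close> the two bases would be bases of the same module, so that the ring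
  becomes zero if their lengths differ.\<close>

lemma local_basis_rank:
  assumes b: "local_basis s r b" and s: "s \<in> carrier A" and b': "b' \<in> {..<r'} \<rightarrow> carrier B"
    and u: "u \<in> carrier A" and v: "v \<in> carrier A"
    and X: "\<And>i j. i < r \<Longrightarrow> j < r' \<Longrightarrow> X i j \<in> carrier A"
    and Y: "\<And>i j. i < r' \<Longrightarrow> j < r \<Longrightarrow> Y i j \<in> carrier A"
    and eqX: "\<And>i. i < r \<Longrightarrow> u \<odot>\<^bsub>B\<^esub> b i = (\<Oplus>\<^bsub>B\<^esub> j\<in>{..<r'}. X i j \<odot>\<^bsub>B\<^esub> b' j)"
    and eqY: "\<And>i. i < r' \<Longrightarrow> v \<odot>\<^bsub>B\<^esub> b' i = (\<Oplus>\<^bsub>B\<^esub> j\<in>{..<r}. Y i j \<odot>\<^bsub>B\<^esub> b j)"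
    and "r' < r"
  shows "\<exists>m::nat. (s [^] m \<otimes> (u \<otimes> v)) [^] r = \<zero>"
proof -
  have bc: "b i \<in> carrier B" if "i < r" for i
    using local_basis_closed[OF b] that by auto
  have b'c: "b' i \<in> carrier B" if "i < r'" for i
    using b' that by auto
  \<comment> \<open>\<open>P = X Y\<close> expresses \<open>u v b_i\<close> through
    \<open>b'\<close> and back through \<open>b\<close>. The scalar matrix \<open>D\<close>
    introduced below does the same trivially, so independence of \<open>b\<close> makes
    \<open>P\<close> and \<open>D\<close> agree up to a power of \<open>s\<close>.\<close>
  define P where "P i k = (\<Oplus>j\<in>{..<r'}. X i j \<otimes> Y j k)" for i k
  have P: "P i k \<in> carrier A" if "i < r" "k < r" for i k
    unfolding P_def using that X Y by (intro R.finsum_closed) auto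
  define D where "D i k = (if i = k then u \<otimes> v else \<zero>)" for i k :: nat
  have D: "D i k \<in> carrier A" for i k
    using u v by (auto simp: D_def)
  have "\<exists>m::nat. \<forall>i\<in>{..<r}. \<forall>k<r. s [^] m \<otimes> (D i k \<ominus> P i k) = \<zero>"
  proof (rule uniform_exponent)
    fix i assume "i \<in> {..<r}"
    then have i: "i < r" by simp
    have "(\<Oplus>\<^bsub>B\<^esub> k\<in>{..<r}. P i k \<odot>\<^bsub>B\<^esub> b k) = (\<Oplus>\<^bsub>B\<^esub> j\<in>{..<r'}. X i j \<odot>\<^bsub>B\<^esub> (\<Oplus>\<^bsub>B\<^esub> k\<in>{..<r}. Y j k \<odot>\<^bsub>B\<^esub> b k))"
      unfolding P_def using i X Y bc by (intro lin_comb_assoc[symmetric]) auto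
    also have "\<dots> = (\<Oplus>\<^bsub>B\<^esub> j\<in>{..<r'}. (v \<otimes> X i j) \<odot>\<^bsub>B\<^esub> b' j)"
    proof (intro M.finsum_cong' refl Pi_I)
      fix j assume "j \<in> {..<r'}"
      then have j: "j < r'" by simp
      then show "(v \<otimes> X i j) \<odot>\<^bsub>B\<^esub> b' j \<in> carrier B"
        using v X i b'c by simp
      show "X i j \<odot>\<^bsub>B\<^esub> (\<Oplus>\<^bsub>B\<^esub> k\<in>{..<r}. Y j k \<odot>\<^bsub>B\<^esub> b k) = (v \<otimes> X i j) \<odot>\<^bsub>B\<^esub> b' j"
        using v X i j b'c by (simp add: R.m_comm[of v] smult_assoc1 flip: eqY)
    qed
    also have "\<dots> = v \<odot>\<^bsub>B\<^esub> (u \<odot>\<^bsub>B\<^esub> b i)"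
      unfolding eqX[OF i] using v X i b'c by (intro smult_lin_comb[symmetric]) auto
    also have "\<dots> = (\<Oplus>\<^bsub>B\<^esub> k\<in>{..<r}. D i k \<odot>\<^bsub>B\<^esub> b k)"
    proof -
      have "(\<Oplus>\<^bsub>B\<^esub> k\<in>{..<r}. D i k \<odot>\<^bsub>B\<^esub> b k) = (\<Oplus>\<^bsub>B\<^esub> k\<in>{..<r}. if i = k then (u \<otimes> v) \<odot>\<^bsub>B\<^esub> b k else \<zero>\<^bsub>B\<^esub>)"
        using u v bc by (intro M.finsum_cong') (auto simp: D_def)
      also have "\<dots> = (u \<otimes> v) \<odot>\<^bsub>B\<^esub> b i"
        using u v bc i by (intro M.finsum_singleton) auto
      finally show ?thesis
        using u v bc[OF i] by (simp add: R.m_comm[of u] smult_assoc1)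
    qed
    finally have eq: "(\<Oplus>\<^bsub>B\<^esub> k\<in>{..<r}. P i k \<odot>\<^bsub>B\<^esub> b k) = (\<Oplus>\<^bsub>B\<^esub> k\<in>{..<r}. D i k \<odot>\<^bsub>B\<^esub> b k)" .
    have "(\<Oplus>\<^bsub>B\<^esub> k\<in>{..<r}. (D i k \<ominus> P i k) \<odot>\<^bsub>B\<^esub> b k) \<oplus>\<^bsub>B\<^esub> (\<Oplus>\<^bsub>B\<^esub> k\<in>{..<r}. P i k \<odot>\<^bsub>B\<^esub> b k) =
        (\<Oplus>\<^bsub>B\<^esub> k\<in>{..<r}. ((D i k \<ominus> P i k) \<oplus> P i k) \<odot>\<^bsub>B\<^esub> b k)"
      using D P bc i by (intro add_lin_comb) auto
    also have "\<dots> = (\<Oplus>\<^bsub>B\<^esub> k\<in>{..<r}. D i k \<odot>\<^bsub>B\<^esub> b k)"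
      using D P bc i by (intro M.finsum_cong') (auto simp: R.minus_eq R.a_assoc R.l_neg)
    finally have "(\<Oplus>\<^bsub>B\<^esub> k\<in>{..<r}. (D i k \<ominus> P i k) \<odot>\<^bsub>B\<^esub> b k) \<oplus>\<^bsub>B\<^esub> (\<Oplus>\<^bsub>B\<^esub> k\<in>{..<r}. D i k \<odot>\<^bsub>B\<^esub> b k) =
        (\<Oplus>\<^bsub>B\<^esub> k\<in>{..<r}. D i k \<odot>\<^bsub>B\<^esub> b k)"
      by (simp add: eq)
    moreover have "(\<Oplus>\<^bsub>B\<^esub> k\<in>{..<r}. (D i k \<ominus> P i k) \<odot>\<^bsub>B\<^esub> b k) \<in> carrier B" "(\<Oplus>\<^bsub>B\<^esub> k\<in>{..<r}. D i k \<odot>\<^bsub>B\<^esub> b k) \<in> carrier B"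
      using D P bc i by (auto intro!: M.finsum_closed)
    ultimately have "(\<Oplus>\<^bsub>B\<^esub> k\<in>{..<r}. (D i k \<ominus> P i k) \<odot>\<^bsub>B\<^esub> b k) = \<zero>\<^bsub>B\<^esub>"
      by (simp only: M.add.r_cancel_one)
    moreover have "(\<lambda>k. D i k \<ominus> P i k) \<in> {..<r} \<rightarrow> carrier A"
      using D P i by auto
    ultimately obtain k :: nat where "\<And>j. j < r \<Longrightarrow> s [^] k \<otimes> (D i j \<ominus> P i j) = \<zero>"
      using local_basis_independent[OF b] by blast
    then show "\<exists>m::nat. \<forall>k<r. s [^] m \<otimes> (D i k \<ominus> P i k) = \<zero>"
      by blast
  next
    fix k l :: nat and i assume "i \<in> {..<r}" "\<forall>j<r. s [^] k \<otimes> (D i j \<ominus> P i j) = \<zero>"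
    then show "\<forall>j<r. s [^] (k + l) \<otimes> (D i j \<ominus> P i j) = \<zero>"
      using s D P by (auto intro!: R.pow_uniform)
  qed simp
  then obtain m :: nat where m: "\<forall>i\<in>{..<r}. \<forall>k<r. s [^] m \<otimes> (D i k \<ominus> P i k) = \<zero>" ..
  have entry: "(s [^] m \<otimes> (u \<otimes> v)) \<otimes> (if i = k then \<one> else \<zero>) = s [^] m \<otimes> P i k" if ik: "i < r" "k < r" for i k
  proof -
    have "s [^] m \<otimes> D i k \<ominus> s [^] m \<otimes> P i k = \<zero>"
      using m ik D P s by (simp add: R.minus_eq R.r_distr R.r_minus)
    then have "s [^] m \<otimes> D i k = s [^] m \<otimes> P i k"
      using D P ik s by (simp add: R.diff_eq_zero_iff)
    then show ?thesis
      using u v s by (auto simp: D_def)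
  qed
  \<comment> \<open>The determinant of \<open>s^m D\<close> is the power in question; that of
    \<open>s^m P\<close> vanishes because \<open>P\<close> factors through \<open>r' < r\<close>
    coordinates.\<close>
  have "(s [^] m \<otimes> (u \<otimes> v)) [^] r = (s [^] m \<otimes> (u \<otimes> v)) [^] r \<otimes> mat_det A r (\<lambda>i k. if i = k then \<one> else \<zero>)"
    using s u v by (simp add: R.mat_det_identity)
  also have "\<dots> = mat_det A r (\<lambda>i k. (s [^] m \<otimes> (u \<otimes> v)) \<otimes> (if i = k then \<one> else \<zero>))"
    using s u v by (intro R.mat_det_smult[symmetric]) auto
  also have "\<dots> = mat_det A r (\<lambda>i k. s [^] m \<otimes> P i k)"
    using s P by (intro R.mat_det_cong entry) auto
  also have "\<dots> = (s [^] m) [^] r \<otimes> mat_det A r P"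
    using s P by (intro R.mat_det_smult) auto
  also have "mat_det A r P = \<zero>"
    unfolding P_def using X Y \<open>r' < r\<close> by (rule R.mat_det_low_rank)
  finally show ?thesis
    using s by auto
qed

text \<open>Over the ring in which \<open>s\<close> and \<open>s'\<close> are both inverted, the two
  families are bases of one module and the discriminants differ by the square of a unit. Only
  divisibility is recorded, with denominators cleared; the other direction is the same lemma with
  the roles exchanged.\<close>

lemma disc_compare:
  assumes b: "local_basis s r b" and s: "s \<in> carrier A" and b': "local_basis s' r' b'" and s': "s' \<in> carrier A"
  shows "\<exists>K::nat. \<exists>c\<in>carrier A. s' [^] K \<otimes> (s [^] K \<otimes> disc r b) = c \<otimes> disc r' b'"
proof -
  note bc = local_basis_closed[OF b] and b'c = local_basis_closed[OF b']
  note d = disc_closed[OF bc] and d' = disc_closed[OF b'c]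
  obtain k :: nat and X where X: "\<And>i j. i < r \<Longrightarrow> j < r' \<Longrightarrow> X i j \<in> carrier A"
    "\<And>i. i < r \<Longrightarrow> s' [^] k \<odot>\<^bsub>B\<^esub> b i = (\<Oplus>\<^bsub>B\<^esub> j\<in>{..<r'}. X i j \<odot>\<^bsub>B\<^esub> b' j)"
    using local_basis_expand[OF b' s' bc] by metis
  obtain l :: nat and Y where Y: "\<And>i j. i < r' \<Longrightarrow> j < r \<Longrightarrow> Y i j \<in> carrier A"
    "\<And>i. i < r' \<Longrightarrow> s [^] l \<odot>\<^bsub>B\<^esub> b' i = (\<Oplus>\<^bsub>B\<^esub> j\<in>{..<r}. Y i j \<odot>\<^bsub>B\<^esub> b j)"
    using local_basis_expand[OF b s b'c] by metis
  \<comment> \<open>If the ranks differ, the common localization is the zero ring: some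
    \<open>s^p s'^q\<close> vanishes, the left side is 0 for \<open>K = p + q\<close>, and
    \<open>c = 0\<close> will do.\<close>
  have zero: ?thesis if "s [^] p \<otimes> s' [^] q = \<zero>" for p q :: nat
  proof -
    have "s' [^] (p + q) \<otimes> (s [^] (p + q) \<otimes> disc r b) = (s [^] p \<otimes> s' [^] q) \<otimes> (s' [^] p \<otimes> s [^] q \<otimes> disc r b)"
      using s s' d by (simp add: R.m_ac flip: R.nat_pow_mult)
    then show ?thesis
      using s s' d d' that by (intro exI[of _ "p + q"] bexI[of _ \<zero>]) simp_all
  qed
  consider "r = r'" | "r' < r" | "r < r'"
    by linarith
  then show ?thesis
  proof cases
    case 1
    define K where "K = (k + k) * r"
    have "(s' [^] k \<otimes> s' [^] k) [^] r \<otimes> disc r b = (mat_det A r X \<otimes> mat_det A r X) \<otimes> disc r b'"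
      using X s' bc b'c 1 by (intro disc_change_basis) auto
    then have *: "s' [^] K \<otimes> disc r b = (mat_det A r X \<otimes> mat_det A r X) \<otimes> disc r b'"
      using s' by (simp add: K_def R.nat_pow_mult R.nat_pow_pow)
    have det: "mat_det A r X \<in> carrier A"
      using X 1 by (intro R.mat_det_closed) auto
    have "s' [^] K \<otimes> (s [^] K \<otimes> disc r b) = s [^] K \<otimes> (s' [^] K \<otimes> disc r b)"
      using s s' d by (simp add: R.m_lcomm)
    also have "\<dots> = (s [^] K \<otimes> (mat_det A r X \<otimes> mat_det A r X)) \<otimes> disc r' b'"
      unfolding * using s det d' 1 by (simp add: R.m_assoc)
    finally show ?thesis
      using s det by (intro exI[of _ K] bexI[of _ "s [^] K \<otimes> (mat_det A r X \<otimes> mat_det A r X)"]) auto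
  next
    case 2
    obtain m :: nat where "(s [^] m \<otimes> (s' [^] k \<otimes> s [^] l)) [^] r = \<zero>"
      using local_basis_rank[OF b s b'c _ _ X(1) Y(1) X(2) Y(2) 2] s s' by blast
    then have "s [^] ((m + l) * r) \<otimes> s' [^] (k * r) = \<zero>"
      using s s' by (simp add: R.nat_pow_distrib R.nat_pow_pow distrib_right R.m_ac flip: R.nat_pow_mult)
    then show ?thesis
      by (rule zero)
  next
    case 3
    obtain m :: nat where "(s' [^] m \<otimes> (s [^] l \<otimes> s' [^] k)) [^] r' = \<zero>"
      using local_basis_rank[OF b' s' bc _ _ Y(1) X(1) Y(2) X(2) 3] s s' by blast
    then have "s [^] (l * r') \<otimes> s' [^] ((m + k) * r') = \<zero>"
      using s s' by (simp add: R.nat_pow_distrib R.nat_pow_pow distrib_right R.m_ac flip: R.nat_pow_mult)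
    then show ?thesis
      by (rule zero)
  qed
qed

end

lemma (in cring) finsum_mult_assoc:
  assumes "finite I" "finite J" "a \<in> I \<rightarrow> carrier R" "z \<in> J \<rightarrow> carrier R"
    and P: "\<And>i j. i \<in> I \<Longrightarrow> j \<in> J \<Longrightarrow> P i j \<in> carrier R"
  shows "(\<Oplus>i\<in>I. a i \<otimes> (\<Oplus>j\<in>J. P i j \<otimes> z j)) = (\<Oplus>j\<in>J. (\<Oplus>i\<in>I. a i \<otimes> P i j) \<otimes> z j)"
proof -
  have az: "a i \<in> carrier R" "z j \<in> carrier R" if "i \<in> I" "j \<in> J" for i j
    using assms that by auto
  have "(\<Oplus>i\<in>I. a i \<otimes> (\<Oplus>j\<in>J. P i j \<otimes> z j)) = (\<Oplus>i\<in>I. \<Oplus>j\<in>J. a i \<otimes> P i j \<otimes> z j)"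
  proof (intro finsum_cong' refl Pi_I)
    fix i assume i: "i \<in> I"
    then have a: "a i \<in> carrier R"
      using assms by auto
    show "(\<Oplus>j\<in>J. a i \<otimes> P i j \<otimes> z j) \<in> carrier R"
      using i a az P by (intro finsum_closed) auto
    have "a i \<otimes> (\<Oplus>j\<in>J. P i j \<otimes> z j) = (\<Oplus>j\<in>J. a i \<otimes> (P i j \<otimes> z j))"
      using i a az P assms(2) by (intro finsum_rdistr) auto
    also have "\<dots> = (\<Oplus>j\<in>J. a i \<otimes> P i j \<otimes> z j)"
      using i a az P by (intro finsum_cong') (auto simp: m_assoc)
    finally show "a i \<otimes> (\<Oplus>j\<in>J. P i j \<otimes> z j) = (\<Oplus>j\<in>J. a i \<otimes> P i j \<otimes> z j)" .
  qed
  also have "\<dots> = (\<Oplus>j\<in>J. \<Oplus>i\<in>I. a i \<otimes> P i j \<otimes> z j)"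
    using assms az by (intro finsum_swap) auto
  also have "\<dots> = (\<Oplus>j\<in>J. (\<Oplus>i\<in>I. a i \<otimes> P i j) \<otimes> z j)"
  proof (intro finsum_cong' refl Pi_I)
    fix j assume j: "j \<in> J"
    then have z: "z j \<in> carrier R"
      using assms by auto
    show "(\<Oplus>i\<in>I. a i \<otimes> P i j) \<otimes> z j \<in> carrier R"
      using j z az P by (intro m_closed finsum_closed) auto
    show "(\<Oplus>i\<in>I. a i \<otimes> P i j \<otimes> z j) = (\<Oplus>i\<in>I. a i \<otimes> P i j) \<otimes> z j"
      using j z az P assms(1) by (intro finsum_ldistr[symmetric]) auto
  qed
  finally show ?thesis .
qed

section \<open>Local bases from minors of the idempotent matrix\<close>

context projective_algebra
begin

definition minor_matrix :: "nat set \<Rightarrow> nat \<Rightarrow> nat \<Rightarrow> 'a" where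
  "minor_matrix I k l = (if k \<in> I then f l (e k) else (if k = l then \<one> else \<zero>) \<ominus> f l (e k))"

lemma minor_matrix_closed: "k < n \<Longrightarrow> l < n \<Longrightarrow> minor_matrix I k l \<in> carrier A"
  using dbD by (auto simp: minor_matrix_def)

text \<open>By the dual basis property the column \<open>e\<close> is fixed by the matrix
  \<open>p = (f_l (e_k))\<close>, hence killed by \<open>1 - p\<close>.\<close>

lemma minor_matrix_rows:
  assumes k: "k < n"
  shows "(\<Oplus>\<^bsub>B\<^esub> l\<in>{..<n}. minor_matrix I k l \<odot>\<^bsub>B\<^esub> e l) = (if k \<in> I then e k else \<zero>\<^bsub>B\<^esub>)"
proof (cases "k \<in> I")
  case True
  then show ?thesis
    using dbD k by (simp add: minor_matrix_def)
next
  case False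
  let ?S = "\<Oplus>\<^bsub>B\<^esub> l\<in>{..<n}. minor_matrix I k l \<odot>\<^bsub>B\<^esub> e l"
  have "?S \<oplus>\<^bsub>B\<^esub> e k = ?S \<oplus>\<^bsub>B\<^esub> (\<Oplus>\<^bsub>B\<^esub> l\<in>{..<n}. f l (e k) \<odot>\<^bsub>B\<^esub> e l)"
    using dbD k by simp
  also have "\<dots> = (\<Oplus>\<^bsub>B\<^esub> l\<in>{..<n}. (minor_matrix I k l \<oplus> f l (e k)) \<odot>\<^bsub>B\<^esub> e l)"
    using dbD k minor_matrix_closed[OF k] by (intro add_lin_comb) auto
  also have "\<dots> = (\<Oplus>\<^bsub>B\<^esub> l\<in>{..<n}. if k = l then e l else \<zero>\<^bsub>B\<^esub>)"
    using dbD k False by (intro M.finsum_cong') (auto simp: minor_matrix_def R.minus_eq R.a_assoc R.l_neg)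
  also have "\<dots> = e k"
    using dbD k by (intro M.finsum_singleton) auto
  finally have "?S \<oplus>\<^bsub>B\<^esub> e k = e k" .
  moreover have "?S \<in> carrier B"
    using dbD minor_matrix_closed[OF k] by (intro M.finsum_closed) auto
  ultimately show ?thesis
    using False dbD(1)[OF k] M.add.r_cancel_one' by auto
qed

text \<open>Let \<open>G\<close> be the matrix, \<open>Z\<close> its adjugate, \<open>s\<close> its
  determinant and \<open>e' = G e\<close>, which is \<open>e\<close> on \<open>I\<close> and zero
  elsewhere. Spanning: \<open>s e = Z G e = Z e'\<close>. Independence: applying the forms
  \<open>f_m\<close> to a relation \<open>a e' = 0\<close> with \<open>a\<close> supported in
  \<open>I\<close> gives \<open>a G = 0\<close>, whence \<open>s a = a G Z = 0\<close>. The first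
  power of \<open>s\<close> suffices for both.\<close>

lemma local_basis_minor:
  assumes I: "I \<subseteq> {..<n}"
  shows "\<exists>r b. local_basis (mat_det A n (minor_matrix I)) r b"
proof -
  let ?s = "mat_det A n (minor_matrix I)"
  note G = minor_matrix_closed
  have s: "?s \<in> carrier A"
    using G by (intro R.mat_det_closed)
  obtain Z where Z: "\<And>i j. Z i j \<in> carrier A"
    "\<And>i j. i < n \<Longrightarrow> j < n \<Longrightarrow> (\<Oplus>k\<in>{..<n}. Z i k \<otimes> minor_matrix I k j) = (if i = j then ?s else \<zero>)"
    "\<And>i j. i < n \<Longrightarrow> j < n \<Longrightarrow> (\<Oplus>k\<in>{..<n}. minor_matrix I i k \<otimes> Z k j) = (if i = j then ?s else \<zero>)"
    by (rule R.mat_det_adjugate[of n "minor_matrix I"]) (erule (1) G, rule that)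
  have "finite I"
    using I finite_subset by blast
  then obtain h where h: "bij_betw h {..<card I} I"
    using ex_bij_betw_nat_finite[of I] by (auto simp: lessThan_atLeast0)
  let ?r = "card I"
  define b where "b i = e (h i)" for i
  define e' where "e' k = (if k \<in> I then e k else \<zero>\<^bsub>B\<^esub>)" for k
  have hI: "h i \<in> I" "h i < n" if "i < ?r" for i
    using h I that by (auto dest: bij_betwE)
  have b: "b \<in> {..<?r} \<rightarrow> carrier B"
    using hI dbD(1) by (auto simp: b_def)
  have e': "e' k \<in> carrier B" if "k < n" for k
    using that dbD(1) by (auto simp: e'_def)
  have reindex: "(\<Oplus>\<^bsub>B\<^esub> k\<in>{..<n}. w k \<odot>\<^bsub>B\<^esub> e' k) = (\<Oplus>\<^bsub>B\<^esub> i\<in>{..<?r}. w (h i) \<odot>\<^bsub>B\<^esub> b i)"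
    if w: "\<And>k. k < n \<Longrightarrow> w k \<in> carrier A" for w
  proof -
    have wI: "w k \<odot>\<^bsub>B\<^esub> e k \<in> carrier B" if "k \<in> I" for k
      using that I w dbD(1) by auto
    have "(\<Oplus>\<^bsub>B\<^esub> k\<in>{..<n}. w k \<odot>\<^bsub>B\<^esub> e' k) = (\<Oplus>\<^bsub>B\<^esub> k\<in>I. w k \<odot>\<^bsub>B\<^esub> e k)"
      using I w wI by (intro M.add.finprod_mono_neutral_cong_right) (auto simp: e'_def)
    also have "I = h ` {..<?r}"
      using h by (simp add: bij_betw_imp_surj_on)
    also have "(\<Oplus>\<^bsub>B\<^esub> k\<in>h ` {..<?r}. w k \<odot>\<^bsub>B\<^esub> e k) = (\<Oplus>\<^bsub>B\<^esub> i\<in>{..<?r}. w (h i) \<odot>\<^bsub>B\<^esub> b i)"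
      unfolding b_def using wI hI h by (intro M.add.finprod_reindex) (auto simp: bij_betw_def)
    finally show ?thesis .
  qed
  have span: "\<exists>k::nat. \<exists>c\<in>{..<?r} \<rightarrow> carrier A. ?s [^] k \<odot>\<^bsub>B\<^esub> x = (\<Oplus>\<^bsub>B\<^esub> j\<in>{..<?r}. c j \<odot>\<^bsub>B\<^esub> b j)"
    if x: "x \<in> carrier B" for x
  proof -
    have se: "?s \<odot>\<^bsub>B\<^esub> e l = (\<Oplus>\<^bsub>B\<^esub> k\<in>{..<n}. Z l k \<odot>\<^bsub>B\<^esub> e' k)" if l: "l < n" for l
    proof -
      have "(\<Oplus>\<^bsub>B\<^esub> k\<in>{..<n}. Z l k \<odot>\<^bsub>B\<^esub> e' k) =
          (\<Oplus>\<^bsub>B\<^esub> k\<in>{..<n}. Z l k \<odot>\<^bsub>B\<^esub> (\<Oplus>\<^bsub>B\<^esub> j\<in>{..<n}. minor_matrix I k j \<odot>\<^bsub>B\<^esub> e j))"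
        using Z(1) e' dbD(1) by (intro M.finsum_cong') (auto simp: minor_matrix_rows e'_def)
      also have "\<dots> = (\<Oplus>\<^bsub>B\<^esub> j\<in>{..<n}. (\<Oplus>k\<in>{..<n}. Z l k \<otimes> minor_matrix I k j) \<odot>\<^bsub>B\<^esub> e j)"
        using Z(1) G dbD(1) by (intro lin_comb_assoc) auto
      also have "\<dots> = (\<Oplus>\<^bsub>B\<^esub> j\<in>{..<n}. if l = j then ?s \<odot>\<^bsub>B\<^esub> e j else \<zero>\<^bsub>B\<^esub>)"
        using Z(2)[OF l] s dbD(1) by (intro M.finsum_cong') auto
      also have "\<dots> = ?s \<odot>\<^bsub>B\<^esub> e l"
        using l s dbD(1) by (intro M.finsum_singleton) auto
      finally show ?thesis ..
    qed
    define w where "w k = (\<Oplus>l\<in>{..<n}. f l x \<otimes> Z l k)" for k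
    have w: "w k \<in> carrier A" for k
      unfolding w_def using x dbD(3) Z(1) by (intro R.finsum_closed) auto
    have "?s \<odot>\<^bsub>B\<^esub> x = ?s \<odot>\<^bsub>B\<^esub> (\<Oplus>\<^bsub>B\<^esub> l\<in>{..<n}. f l x \<odot>\<^bsub>B\<^esub> e l)"
      using x by (simp add: dbD(4))
    also have "\<dots> = (\<Oplus>\<^bsub>B\<^esub> l\<in>{..<n}. (?s \<otimes> f l x) \<odot>\<^bsub>B\<^esub> e l)"
      using s x dbD by (intro smult_lin_comb) auto
    also have "\<dots> = (\<Oplus>\<^bsub>B\<^esub> l\<in>{..<n}. f l x \<odot>\<^bsub>B\<^esub> (\<Oplus>\<^bsub>B\<^esub> k\<in>{..<n}. Z l k \<odot>\<^bsub>B\<^esub> e' k))"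
    proof (intro M.finsum_cong' refl Pi_I)
      fix l assume "l \<in> {..<n}"
      then have l: "l < n" "e l \<in> carrier B" "f l x \<in> carrier A"
        using x dbD by auto
      then show "(?s \<otimes> f l x) \<odot>\<^bsub>B\<^esub> e l = f l x \<odot>\<^bsub>B\<^esub> (\<Oplus>\<^bsub>B\<^esub> k\<in>{..<n}. Z l k \<odot>\<^bsub>B\<^esub> e' k)"
        using s by (simp add: R.m_comm[of ?s] smult_assoc1 flip: se)
      show "f l x \<odot>\<^bsub>B\<^esub> (\<Oplus>\<^bsub>B\<^esub> k\<in>{..<n}. Z l k \<odot>\<^bsub>B\<^esub> e' k) \<in> carrier B"
        using l s by (simp flip: se)
    qed
    also have "\<dots> = (\<Oplus>\<^bsub>B\<^esub> k\<in>{..<n}. w k \<odot>\<^bsub>B\<^esub> e' k)"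
      unfolding w_def using x dbD(3) Z(1) e' by (intro lin_comb_assoc) auto
    also have "\<dots> = (\<Oplus>\<^bsub>B\<^esub> i\<in>{..<?r}. w (h i) \<odot>\<^bsub>B\<^esub> b i)"
      using w by (rule reindex)
    finally show ?thesis
      using w s by (intro exI[of _ "1::nat"] bexI[of _ "\<lambda>i. w (h i)"]) auto
  qed
  have indep: "\<exists>k::nat. \<forall>j<?r. ?s [^] k \<otimes> c j = \<zero>"
    if c: "c \<in> {..<?r} \<rightarrow> carrier A" and zero: "(\<Oplus>\<^bsub>B\<^esub> j\<in>{..<?r}. c j \<odot>\<^bsub>B\<^esub> b j) = \<zero>\<^bsub>B\<^esub>" for c
  proof -
    \<comment> \<open>Extension by zero: outside \<open>I\<close> the rows of \<open>G\<close> are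
      those of \<open>1 - p\<close>, and \<open>a\<close> must not involve them for
      \<open>aG\<close> to follow from the relation.\<close>
    define a where "a k = (if k \<in> I then c (inv_into {..<?r} h k) else \<zero>)" for k
    have inv: "inv_into {..<?r} h k \<in> {..<?r}" if "k \<in> I" for k
      using h that by (metis bij_betw_imp_surj_on inv_into_into)
    have a: "a k \<in> carrier A" for k
      using inv[of k] c by (auto simp: a_def)
    have ah: "a (h i) = c i" if "i < ?r" for i
      using that h hI by (auto simp: a_def bij_betw_def inv_into_f_f)
    have "(\<Oplus>\<^bsub>B\<^esub> k\<in>{..<n}. a k \<odot>\<^bsub>B\<^esub> e' k) = (\<Oplus>\<^bsub>B\<^esub> i\<in>{..<?r}. a (h i) \<odot>\<^bsub>B\<^esub> b i)"
      using a by (rule reindex)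
    also have "\<dots> = (\<Oplus>\<^bsub>B\<^esub> i\<in>{..<?r}. c i \<odot>\<^bsub>B\<^esub> b i)"
      using ah c b by (intro M.finsum_cong') (auto simp: Pi_iff)
    finally have sum: "(\<Oplus>\<^bsub>B\<^esub> k\<in>{..<n}. a k \<odot>\<^bsub>B\<^esub> e' k) = \<zero>\<^bsub>B\<^esub>"
      using zero by simp
    have aG: "(\<Oplus>k\<in>{..<n}. a k \<otimes> minor_matrix I k m) = \<zero>" if m: "m < n" for m
    proof -
      note fm = dbD(2)[OF m]
      have "f m \<zero>\<^bsub>B\<^esub> = \<zero>"
        using linear_formD(3)[OF fm, of \<zero> "\<zero>\<^bsub>B\<^esub>"] linear_formD(1)[OF fm] by simp
      then have "\<zero> = f m (\<Oplus>\<^bsub>B\<^esub> k\<in>{..<n}. a k \<odot>\<^bsub>B\<^esub> e' k)"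
        using sum by simp
      also have "\<dots> = (\<Oplus>k\<in>{..<n}. a k \<otimes> f m (e' k))"
        using a e' by (intro linear_form_lin_comb[OF fm]) auto
      also have "\<dots> = (\<Oplus>k\<in>{..<n}. a k \<otimes> minor_matrix I k m)"
        using a G m dbD by (intro R.finsum_cong') (auto simp: a_def e'_def minor_matrix_def)
      finally show ?thesis ..
    qed
    have "?s \<otimes> c j = \<zero>" if j: "j < ?r" for j
    proof -
      have hj: "h j < n"
        using hI j by auto
      have "?s \<otimes> c j = (\<Oplus>k\<in>{..<n}. if h j = k then ?s \<otimes> a k else \<zero>)"
        using a s hj ah[OF j] by (subst R.finsum_singleton) auto
      also have "\<dots> = (\<Oplus>k\<in>{..<n}. a k \<otimes> (\<Oplus>m\<in>{..<n}. minor_matrix I k m \<otimes> Z m (h j)))"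
        using a s Z(3)[OF _ hj] by (intro R.finsum_cong') (auto simp: R.m_comm)
      also have "\<dots> = (\<Oplus>m\<in>{..<n}. (\<Oplus>k\<in>{..<n}. a k \<otimes> minor_matrix I k m) \<otimes> Z m (h j))"
        using a Z(1) G by (intro R.finsum_mult_assoc) auto
      also have "\<dots> = (\<Oplus>m\<in>{..<n}. \<zero>)"
        using aG Z(1) by (intro R.finsum_cong') auto
      finally show ?thesis
        by (simp add: R.finsum_zero)
    qed
    then show ?thesis
      using s by (intro exI[of _ "1::nat"]) auto
  qed
  show ?thesis
    unfolding local_basis_def using b span indep by blast
qed

lemma local_basis_cover:
  obtains S where "finite S" "S \<subseteq> carrier A" "Idl\<^bsub>A\<^esub> S = carrier A" "\<And>s. s \<in> S \<Longrightarrow> \<exists>r b. local_basis s r b"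
proof -
  define S where "S = (\<lambda>I. mat_det A n (minor_matrix I)) ` Pow {..<n}"
  have S: "S \<subseteq> carrier A"
    unfolding S_def using minor_matrix_closed by (auto intro!: R.mat_det_closed)
  let ?X = "\<lambda>k l. f l (e k)" and ?Y = "\<lambda>k l. (if k = l then \<one> else \<zero>) \<ominus> f l (e k)"
  have "\<one> = mat_det A n (\<lambda>k l. if k = l then \<one> else \<zero>)"
    by (simp add: R.mat_det_identity)
  also have "\<dots> = mat_det A n (\<lambda>k l. ?X k l \<oplus> ?Y k l)"
    using dbD by (intro R.mat_det_cong) (auto simp: R.minus_eq R.r_neg R.a_ac R.r_neg1)
  also have "\<dots> = (\<Oplus>I\<in>Pow {..<n}. mat_det A n (\<lambda>k l. if k \<in> I then ?X k l else ?Y k l))"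
    using dbD by (intro R.mat_det_rows_plus) auto
  also have "\<dots> = (\<Oplus>I\<in>Pow {..<n}. mat_det A n (minor_matrix I))"
    by (simp add: minor_matrix_def[abs_def])
  also have "\<dots> \<in> Idl\<^bsub>A\<^esub> S"
    using R.genideal_self[OF S] by (intro R.ideal_finsum R.genideal_ideal S) (auto simp: S_def)
  finally have "Idl\<^bsub>A\<^esub> S = carrier A"
    using ideal.one_imp_carrier[OF R.genideal_ideal[OF S]] by blast
  moreover have "\<exists>r b. local_basis s r b" if "s \<in> S" for s
    using that local_basis_minor unfolding S_def by blast
  moreover have "finite S"
    by (simp add: S_def)
  ultimately show thesis
    using that[of S] S by blast
qed

section \<open>Existence and uniqueness of the discriminant ideal\<close>

definition is_discriminant_ideal where
  "is_discriminant_ideal D \<longleftrightarrow> ideal D A \<and>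
    (\<exists>S. finite S \<and> S \<subseteq> carrier A \<and> Idl\<^bsub>A\<^esub> S = carrier A \<and>
      (\<forall>s\<in>S. \<exists>n e. module_basis (localization A s) (base_change A (localization A s) B) n e \<and>
        extended_ideal A s D =
          Idl\<^bsub>localization A s\<^esub> {basis_discriminant (localization A s) (base_change A (localization A s) B) n e}))"

lemma is_discriminant_ideal_local:
  assumes "is_discriminant_ideal D"
  obtains S where "finite S" "S \<subseteq> carrier A" "Idl\<^bsub>A\<^esub> S = carrier A"
    "\<And>s. s \<in> S \<Longrightarrow> \<exists>r b. local_basis s r b \<and> D \<subseteq> mults s (disc r b) \<and> (\<exists>k::nat. s [^] k \<otimes> disc r b \<in> D)"
proof -
  obtain S where S: "finite S" "S \<subseteq> carrier A" "Idl\<^bsub>A\<^esub> S = carrier A" and D: "ideal D A"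
    and bases: "\<And>s. s \<in> S \<Longrightarrow> \<exists>n e. module_basis (localization A s) (base_change A (localization A s) B) n e \<and>
        extended_ideal A s D =
          Idl\<^bsub>localization A s\<^esub> {basis_discriminant (localization A s) (base_change A (localization A s) B) n e}"
    using assms unfolding is_discriminant_ideal_def by blast
  show thesis
  proof (rule that[OF S])
    fix s assume s: "s \<in> S"
    then interpret s: localized_algebra A s B n e f
      using S(2) by (intro localized) auto
    obtain r b' where b': "module_basis s.L s.E r b'" "extended_ideal A s D = Idl\<^bsub>s.L\<^esub> {basis_discriminant s.L s.E r b'}"
      using bases[OF s] by blast
    obtain b K where b: "local_basis s r b" "\<And>i. i < r \<Longrightarrow> b' i = s.pt K (b i)"
      using s.module_basis_local_basis[OF b'(1)] by blast
    show "\<exists>r b. local_basis s r b \<and> D \<subseteq> mults s (disc r b) \<and> (\<exists>k::nat. s [^] k \<otimes> disc r b \<in> D)"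
      using b(1) b'(2) s.extended_ideal_discriminant_iff[OF D local_basis_closed[OF b(1)] b(2)] by blast
  qed
qed

text \<open>Uniqueness follows by symmetry. The covers for \<open>D\<close> and \<open>D'\<close>
  are unrelated: near \<open>s\<close>, an element of \<open>D\<close> is a multiple of a
  discriminant, which near \<open>s'\<close> is a multiple of the discriminant of another basis by
  \<open>disc_compare\<close>, hence in \<open>D'\<close> up to powers. The local-global principle
  is applied over \<open>S'\<close> inside an application over \<open>S\<close>.\<close>

lemma is_discriminant_ideal_subset:
  assumes D: "is_discriminant_ideal D" and D': "is_discriminant_ideal D'"
  shows "D \<subseteq> D'"
proof
  fix a assume "a \<in> D"
  have I: "ideal D A" and I': "ideal D' A"
    using assms by (auto simp: is_discriminant_ideal_def)
  note I'D = R.idealD[OF I']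
  have a: "a \<in> carrier A"
    using R.idealD(1)[OF I \<open>a \<in> D\<close>] .
  obtain S where S: "finite S" "S \<subseteq> carrier A" "Idl\<^bsub>A\<^esub> S = carrier A"
    and loc: "\<And>s. s \<in> S \<Longrightarrow> \<exists>r b. local_basis s r b \<and> D \<subseteq> mults s (disc r b) \<and> (\<exists>k::nat. s [^] k \<otimes> disc r b \<in> D)"
    using is_discriminant_ideal_local[OF D] by blast
  obtain S' where S': "finite S'" "S' \<subseteq> carrier A" "Idl\<^bsub>A\<^esub> S' = carrier A"
    and loc': "\<And>s. s \<in> S' \<Longrightarrow> \<exists>r b. local_basis s r b \<and> D' \<subseteq> mults s (disc r b) \<and> (\<exists>k::nat. s [^] k \<otimes> disc r b \<in> D')"
    using is_discriminant_ideal_local[OF D'] by blast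
  show "a \<in> D'"
  proof (rule R.ideal_local_global[OF I' S(2,3) a])
    fix s assume "s \<in> S"
    then have s: "s \<in> carrier A"
      using S by auto
    then interpret s: localized_algebra A s B n e f
      by (rule localized)
    obtain r b where b: "local_basis s r b" "D \<subseteq> mults s (disc r b)"
      using loc[OF \<open>s \<in> S\<close>] by blast
    then obtain k :: nat and c where c: "c \<in> carrier A" "s [^] k \<otimes> a = c \<otimes> disc r b"
      using \<open>a \<in> D\<close> by (auto simp: s.local_multiples_def)
    \<comment> \<open>The exponent of \<open>s\<close> must not depend on \<open>s'\<close>: only
      then is \<open>s^l a\<close> a single element for which the cover \<open>S'\<close> can be
      used.\<close>
    have "\<exists>l::nat. \<forall>s'\<in>S'. \<exists>m::nat. s' [^] m \<otimes> (s [^] l \<otimes> a) \<in> D'"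
    proof (rule uniform_exponent[OF S'(1)])
      fix s' assume "s' \<in> S'"
      then have s': "s' \<in> carrier A"
        using S' by auto
      obtain r' b' m where b': "local_basis s' r' b'" "s' [^] (m::nat) \<otimes> disc r' b' \<in> D'"
        using loc'[OF \<open>s' \<in> S'\<close>] by blast
      obtain K :: nat and c' where c': "c' \<in> carrier A" "s' [^] K \<otimes> (s [^] K \<otimes> disc r b) = c' \<otimes> disc r' b'"
        using disc_compare[OF b(1) s b'(1) s'] by blast
      note d = disc_closed[OF local_basis_closed[OF b(1)]] and d' = disc_closed[OF local_basis_closed[OF b'(1)]]
      have "s' [^] (m + K) \<otimes> (s [^] (K + k) \<otimes> a) = s' [^] m \<otimes> (s' [^] K \<otimes> (s [^] K \<otimes> (s [^] k \<otimes> a)))"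
        using s s' a by (simp add: R.m_assoc flip: R.nat_pow_mult)
      also have "\<dots> = c \<otimes> (s' [^] m \<otimes> (s' [^] K \<otimes> (s [^] K \<otimes> disc r b)))"
        unfolding c(2) using s s' c(1) d by (simp add: R.m_ac)
      also have "\<dots> = (c \<otimes> c') \<otimes> (s' [^] m \<otimes> disc r' b')"
        unfolding c'(2) using s s' c(1) c'(1) d' by (simp add: R.m_ac)
      also have "\<dots> \<in> D'"
        using c(1) c'(1) by (intro I'D(4)[OF _ b'(2)]) auto
      finally show "\<exists>l::nat. \<exists>m::nat. s' [^] m \<otimes> (s [^] l \<otimes> a) \<in> D'"
        by blast
    next
      fix l j :: nat and s' assume "s' \<in> S'" "\<exists>m::nat. s' [^] m \<otimes> (s [^] l \<otimes> a) \<in> D'"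
      then obtain m :: nat where m: "s' \<in> carrier A" "s' [^] m \<otimes> (s [^] l \<otimes> a) \<in> D'"
        using S' by blast
      have "s' [^] m \<otimes> (s [^] (l + j) \<otimes> a) = s [^] j \<otimes> (s' [^] m \<otimes> (s [^] l \<otimes> a))"
        using m(1) s a by (simp add: R.m_ac flip: R.nat_pow_mult)
      then show "\<exists>m::nat. s' [^] m \<otimes> (s [^] (l + j) \<otimes> a) \<in> D'"
        using I'D(4)[OF _ m(2), of "s [^] j"] s by (intro exI[of _ m]) simp
    qed
    then obtain l :: nat where l: "\<forall>s'\<in>S'. \<exists>m::nat. s' [^] m \<otimes> (s [^] l \<otimes> a) \<in> D'" ..
    have "s [^] l \<otimes> a \<in> D'"
      by (rule R.ideal_local_global[OF I' S'(2,3)]) (use s a l in auto)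
    then show "\<exists>k::nat. s [^] k \<otimes> a \<in> D'"
      by blast
  qed
qed

text \<open>Gluing of principal ideals: \<open>D\<close> is the intersection of the contractions of
  the local discriminant ideals.\<close>

lemma is_discriminant_ideal_exists: "\<exists>D. is_discriminant_ideal D"
proof -
  obtain S where S: "finite S" "S \<subseteq> carrier A" "Idl\<^bsub>A\<^esub> S = carrier A"
    and "\<And>s. s \<in> S \<Longrightarrow> \<exists>r b. local_basis s r b"
    using local_basis_cover by blast
  then obtain r b where b: "\<And>s. s \<in> S \<Longrightarrow> local_basis s (r s) (b s)"
    by metis
  define \<delta> where "\<delta> s = disc (r s) (b s)" for s
  have \<delta>: "\<delta> s \<in> carrier A" if "s \<in> S" for s
    unfolding \<delta>_def using disc_closed[OF local_basis_closed[OF b[OF that]]] .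
  define D where "D = {a \<in> carrier A. \<forall>s\<in>S. a \<in> mults s (\<delta> s)}"
  have mults: "ideal (mults s (\<delta> s)) A" if "s \<in> S" for s
  proof -
    interpret s: localized_algebra A s B n e f
      using that S(2) by (intro localized) auto
    show ?thesis
      by (rule s.local_multiples_ideal[OF \<delta>[OF that]])
  qed
  have D: "ideal D A"
    by (rule R.idealI') (auto simp: D_def intro: R.idealD[OF mults])
  have "\<exists>n e. module_basis (localization A s) (base_change A (localization A s) B) n e \<and>
      extended_ideal A s D =
        Idl\<^bsub>localization A s\<^esub> {basis_discriminant (localization A s) (base_change A (localization A s) B) n e}"
    if sS: "s \<in> S" for s
  proof -
    have s: "s \<in> carrier A"
      using sS S by auto
    then interpret s: localized_algebra A s B n e f
      by (rule localized)
    \<comment> \<open>That \<open>D\<close> is large enough near \<open>s\<close>: a power of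
      \<open>s\<close> times \<delta>\<open>(s)\<close> lies in all contractions at once. Each of
      them is handled by \<open>disc_compare\<close>, and \<open>S\<close> is finite.\<close>
    have "\<exists>k::nat. \<forall>s'\<in>S. s [^] k \<otimes> \<delta> s \<in> mults s' (\<delta> s')"
    proof (rule uniform_exponent[OF S(1)])
      fix s' assume "s' \<in> S"
      then have s': "s' \<in> carrier A"
        using S by auto
      then interpret s': localized_algebra A s' B n e f
        by (rule localized)
      obtain K :: nat and c where "c \<in> carrier A" "s' [^] K \<otimes> (s [^] K \<otimes> \<delta> s) = c \<otimes> \<delta> s'"
        unfolding \<delta>_def using disc_compare[OF b[OF sS] s b[OF \<open>s' \<in> S\<close>] s'] by blast
      then show "\<exists>k::nat. s [^] k \<otimes> \<delta> s \<in> mults s' (\<delta> s')"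
        using s \<delta>[OF sS] by (intro exI[of _ K] s'.local_multiplesI) auto
    next
      fix k l :: nat and s' assume "s' \<in> S" and *: "s [^] k \<otimes> \<delta> s \<in> mults s' (\<delta> s')"
      have "s [^] (k + l) \<otimes> \<delta> s = s [^] l \<otimes> (s [^] k \<otimes> \<delta> s)"
        using s \<delta>[OF sS] by (simp add: R.m_ac flip: R.nat_pow_mult)
      then show "s [^] (k + l) \<otimes> \<delta> s \<in> mults s' (\<delta> s')"
        using R.idealD(4)[OF mults[OF \<open>s' \<in> S\<close>] _ *] s by simp
    qed
    then have "D \<subseteq> mults s (\<delta> s) \<and> (\<exists>k::nat. s [^] k \<otimes> \<delta> s \<in> D)"
      using sS s \<delta>[OF sS] by (auto simp: D_def)
    then show ?thesis
      using s.local_basis_module_basis[OF b[OF sS]]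
        s.extended_ideal_discriminant_iff[OF D local_basis_closed[OF b[OF sS]], of "\<lambda>i. s.pt 0 (b s i)" 0]
      by (auto simp: \<delta>_def)
  qed
  then have "is_discriminant_ideal D"
    unfolding is_discriminant_ideal_def by (intro conjI exI[of _ S] ballI D S)
  then show ?thesis ..
qed

lemma is_discriminant_ideal: "is_discriminant_ideal (discriminant_ideal A B)"
proof -
  have "\<exists>!D. is_discriminant_ideal D"
    using is_discriminant_ideal_exists is_discriminant_ideal_subset by (metis subset_antisym)
  then show ?thesis
    unfolding discriminant_ideal_def is_discriminant_ideal_def[symmetric] by (rule theI')
qed

lemma norm_in_discriminant_ideal:
  assumes \<beta>: "\<beta> \<in> carrier B" and c: "c \<in> {..<n} \<rightarrow> carrier B"
    and trace: "\<And>x. x \<in> carrier B \<Longrightarrow> x \<otimes>\<^bsub>B\<^esub> \<beta> = (\<Oplus>\<^bsub>B\<^esub> l\<in>{..<n}. Tr (x \<otimes>\<^bsub>B\<^esub> e l) \<odot>\<^bsub>B\<^esub> c l)"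
  shows "algebra_norm A B \<beta> \<in> discriminant_ideal A B"
proof -
  obtain S where S: "S \<subseteq> carrier A" "Idl\<^bsub>A\<^esub> S = carrier A" and D: "ideal (discriminant_ideal A B) A"
    and bases: "\<And>s. s \<in> S \<Longrightarrow> \<exists>n e. module_basis (localization A s) (base_change A (localization A s) B) n e \<and>
        extended_ideal A s (discriminant_ideal A B) =
          Idl\<^bsub>localization A s\<^esub> {basis_discriminant (localization A s) (base_change A (localization A s) B) n e}"
    using is_discriminant_ideal unfolding is_discriminant_ideal_def by blast
  show ?thesis
  proof (rule R.ideal_local_global[OF D S norm_closed[OF \<beta>]])
    fix s assume s: "s \<in> S"
    then interpret s: localized_algebra A s B n e f
      using S(1) by (intro localized) auto
    obtain r b' where b': "module_basis s.L s.E r b'"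
      "extended_ideal A s (discriminant_ideal A B) = Idl\<^bsub>s.L\<^esub> {basis_discriminant s.L s.E r b'}"
      using bases[OF s] by blast
    then show "\<exists>k::nat. s [^] k \<otimes> algebra_norm A B \<beta> \<in> discriminant_ideal A B"
      using s.norm_in_local_discriminant[OF \<beta> c trace b'(1)] s.frac_in_extended_ideal[OF D norm_closed[OF \<beta>]] by simp
  qed
qed

end

section \<open>A finite presentation of the differentials\<close>

context module
begin

lemma span_finite_family:
  assumes "finite I" and \<rho>: "\<rho> \<in> I \<rightarrow> carrier M"
  shows "span_submodule R M (\<rho> ` I) = {\<Oplus>\<^bsub>M\<^esub> i\<in>I. u i \<odot>\<^bsub>M\<^esub> \<rho> i | u. u \<in> I \<rightarrow> carrier R}" (is "_ = ?S")
proof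
  have S: "submodule ?S R M"
  proof (rule submoduleI')
    show "?S \<subseteq> carrier M"
      using \<rho> by (auto intro!: M.finsum_closed)
    have "(\<Oplus>\<^bsub>M\<^esub> i\<in>I. \<zero> \<odot>\<^bsub>M\<^esub> \<rho> i) = (\<Oplus>\<^bsub>M\<^esub> i\<in>I. \<zero>\<^bsub>M\<^esub>)"
      using \<rho> by (intro M.finsum_cong') (auto simp: Pi_iff)
    then have "\<zero>\<^bsub>M\<^esub> = (\<Oplus>\<^bsub>M\<^esub> i\<in>I. \<zero> \<odot>\<^bsub>M\<^esub> \<rho> i)"
      by (simp add: M.finsum_zero)
    moreover have "(\<lambda>i. \<zero>) \<in> I \<rightarrow> carrier R"
      by auto
    ultimately show "\<zero>\<^bsub>M\<^esub> \<in> ?S"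
      unfolding mem_Collect_eq by (intro exI[of _ "\<lambda>i. \<zero>"] conjI)
  next
    fix x y assume "x \<in> ?S" "y \<in> ?S"
    then obtain u v where uv: "u \<in> I \<rightarrow> carrier R" "v \<in> I \<rightarrow> carrier R"
      "x = (\<Oplus>\<^bsub>M\<^esub> i\<in>I. u i \<odot>\<^bsub>M\<^esub> \<rho> i)" "y = (\<Oplus>\<^bsub>M\<^esub> i\<in>I. v i \<odot>\<^bsub>M\<^esub> \<rho> i)"
      by blast
    then have "x \<oplus>\<^bsub>M\<^esub> y = (\<Oplus>\<^bsub>M\<^esub> i\<in>I. (u i \<oplus> v i) \<odot>\<^bsub>M\<^esub> \<rho> i)"
      using \<rho> by (simp add: add_lin_comb)
    moreover have "(\<lambda>i. u i \<oplus> v i) \<in> I \<rightarrow> carrier R"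
      using uv by auto
    ultimately show "x \<oplus>\<^bsub>M\<^esub> y \<in> ?S"
      unfolding mem_Collect_eq by (intro exI[of _ "\<lambda>i. u i \<oplus> v i"] conjI)
  next
    fix a x assume a: "a \<in> carrier R" and "x \<in> ?S"
    then obtain u where u: "u \<in> I \<rightarrow> carrier R" "x = (\<Oplus>\<^bsub>M\<^esub> i\<in>I. u i \<odot>\<^bsub>M\<^esub> \<rho> i)"
      by blast
    then have "a \<odot>\<^bsub>M\<^esub> x = (\<Oplus>\<^bsub>M\<^esub> i\<in>I. (a \<otimes> u i) \<odot>\<^bsub>M\<^esub> \<rho> i)"
      using \<rho> a by (simp add: smult_lin_comb)
    moreover have "(\<lambda>i. a \<otimes> u i) \<in> I \<rightarrow> carrier R"
      using u a by auto
    ultimately show "a \<odot>\<^bsub>M\<^esub> x \<in> ?S"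
      unfolding mem_Collect_eq by (intro exI[of _ "\<lambda>i. a \<otimes> u i"] conjI)
  qed
  have "\<rho> j \<in> ?S" if j: "j \<in> I" for j
  proof -
    have "(\<Oplus>\<^bsub>M\<^esub> i\<in>I. (if j = i then \<one> else \<zero>) \<odot>\<^bsub>M\<^esub> \<rho> i) = (\<Oplus>\<^bsub>M\<^esub> i\<in>I. if j = i then \<rho> i else \<zero>\<^bsub>M\<^esub>)"
      using \<rho> by (intro M.finsum_cong' refl Pi_I) (auto simp: Pi_iff)
    also have "\<dots> = \<rho> j"
      using j \<rho> assms(1) by (intro M.finsum_singleton) auto
    finally have "\<rho> j = (\<Oplus>\<^bsub>M\<^esub> i\<in>I. (if j = i then \<one> else \<zero>) \<odot>\<^bsub>M\<^esub> \<rho> i)" ..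
    moreover have "(\<lambda>i. if j = i then \<one> else \<zero>) \<in> I \<rightarrow> carrier R"
      by auto
    ultimately show ?thesis
      unfolding mem_Collect_eq by (intro exI[of _ "\<lambda>i. if j = i then \<one> else \<zero>"] conjI)
  qed
  then show "span_submodule R M (\<rho> ` I) \<subseteq> ?S"
    by (intro span_submodule_least[OF S]) auto
  have "\<rho> ` I \<subseteq> carrier M"
    using \<rho> by auto
  note N = span_submodule[OF this]
  have "(\<Oplus>\<^bsub>M\<^esub> i\<in>I. u i \<odot>\<^bsub>M\<^esub> \<rho> i) \<in> span_submodule R M (\<rho> ` I)" if "u \<in> I \<rightarrow> carrier R" for u
    using that by (intro submodule_finsum[OF N] Pi_I submoduleE(4)[OF N] span_submodule_base) auto
  then show "?S \<subseteq> span_submodule R M (\<rho> ` I)"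
    by blast
qed

end

section \<open>Differentials and derivations\<close>

context projective_algebra
begin

abbreviation "FB \<equiv> free_module B (carrier B)"
abbreviation "Relations \<equiv> span_submodule B FB (kaehler_relations A B)"
abbreviation "\<Omega> \<equiv> kaehler_differentials A B"

sublocale FB: module B FB
  by (rule cring.free_module_is_module[OF M_cring])

lemma FB_gen [simp]: "b \<in> carrier B \<Longrightarrow> free_gen B b \<in> carrier FB"
  by (rule cring.free_gen_closed[OF M_cring])

lemma scalar_closed [simp]: "a \<in> carrier A \<Longrightarrow> a \<odot>\<^bsub>B\<^esub> \<one>\<^bsub>B\<^esub> \<in> carrier B"
  by simp

lemma scalar_mult: "a \<in> carrier A \<Longrightarrow> b \<in> carrier B \<Longrightarrow> (a \<odot>\<^bsub>B\<^esub> \<one>\<^bsub>B\<^esub>) \<otimes>\<^bsub>B\<^esub> b = a \<odot>\<^bsub>B\<^esub> b"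
  by (simp add: smult_assoc2)

lemma kaehler_relations_induct [consumes 1, case_names add mult const]:
  assumes "r \<in> kaehler_relations A B"
    and "\<And>b b'. b \<in> carrier B \<Longrightarrow> b' \<in> carrier B \<Longrightarrow>
      P (free_gen B (b \<oplus>\<^bsub>B\<^esub> b') \<ominus>\<^bsub>FB\<^esub> (free_gen B b \<oplus>\<^bsub>FB\<^esub> free_gen B b'))"
    and "\<And>b b'. b \<in> carrier B \<Longrightarrow> b' \<in> carrier B \<Longrightarrow>
      P (free_gen B (b \<otimes>\<^bsub>B\<^esub> b') \<ominus>\<^bsub>FB\<^esub> (b \<odot>\<^bsub>FB\<^esub> free_gen B b' \<oplus>\<^bsub>FB\<^esub> b' \<odot>\<^bsub>FB\<^esub> free_gen B b))"
    and "\<And>a. a \<in> carrier A \<Longrightarrow> P (free_gen B (a \<odot>\<^bsub>B\<^esub> \<one>\<^bsub>B\<^esub>))"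
  shows "P r"
  using assms(1) unfolding kaehler_relations_def Let_def
  by (elim UnE CollectE exE conjE; simp only: assms(2-4))

lemma kaehler_relationsI:
  "b \<in> carrier B \<Longrightarrow> b' \<in> carrier B \<Longrightarrow>
    free_gen B (b \<oplus>\<^bsub>B\<^esub> b') \<ominus>\<^bsub>FB\<^esub> (free_gen B b \<oplus>\<^bsub>FB\<^esub> free_gen B b') \<in> kaehler_relations A B"
  "b \<in> carrier B \<Longrightarrow> b' \<in> carrier B \<Longrightarrow>
    free_gen B (b \<otimes>\<^bsub>B\<^esub> b') \<ominus>\<^bsub>FB\<^esub> (b \<odot>\<^bsub>FB\<^esub> free_gen B b' \<oplus>\<^bsub>FB\<^esub> b' \<odot>\<^bsub>FB\<^esub> free_gen B b) \<in> kaehler_relations A B"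
  "a \<in> carrier A \<Longrightarrow> free_gen B (a \<odot>\<^bsub>B\<^esub> \<one>\<^bsub>B\<^esub>) \<in> kaehler_relations A B"
  unfolding kaehler_relations_def Let_def by blast+

lemma kaehler_relations_carrier: "kaehler_relations A B \<subseteq> carrier FB"
proof
  fix r assume "r \<in> kaehler_relations A B"
  then show "r \<in> carrier FB"
    by (induction rule: kaehler_relations_induct)
      (intro FB.M.minus_closed FB.M.a_closed FB.smult_closed FB_gen M.a_closed m_closed scalar_closed; assumption)+
qed

lemma Relations_submodule: "submodule Relations B FB"
  by (rule FB.span_submodule[OF kaehler_relations_carrier])

sublocale Om: module_quotient B FB Relations
  rewrites "quotient_module FB Relations \<equiv> \<Omega>"
  by (rule module_quotient.intro[OF FB.module_axioms], rule module_quotient_axioms.intro, rule Relations_submodule)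
    (simp add: kaehler_differentials_def)

lemma \<Omega>_module: "module B \<Omega>"
  by (rule Om.quotient_is_module)

sublocale \<Omega>: module B \<Omega>
  by (rule \<Omega>_module)

text \<open>The universal derivation, usually written \<open>d b\<close>.\<close>

definition "kd b = Relations +>\<^bsub>FB\<^esub> free_gen B b"

lemma kd_closed [simp, intro]: "b \<in> carrier B \<Longrightarrow> kd b \<in> carrier \<Omega>"
  by (simp add: kd_def Om.coset_closed)

definition derivation where
  "derivation P D \<longleftrightarrow> D \<in> carrier B \<rightarrow> carrier P \<and>
    (\<forall>b\<in>carrier B. \<forall>b'\<in>carrier B. D (b \<oplus>\<^bsub>B\<^esub> b') = D b \<oplus>\<^bsub>P\<^esub> D b') \<and>
    (\<forall>b\<in>carrier B. \<forall>b'\<in>carrier B. D (b \<otimes>\<^bsub>B\<^esub> b') = b \<odot>\<^bsub>P\<^esub> D b' \<oplus>\<^bsub>P\<^esub> b' \<odot>\<^bsub>P\<^esub> D b) \<and>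
    (\<forall>a\<in>carrier A. D (a \<odot>\<^bsub>B\<^esub> \<one>\<^bsub>B\<^esub>) = \<zero>\<^bsub>P\<^esub>)"

lemma kd_derivation: "derivation \<Omega> kd"
proof -
  note [simp del] = free_module_simps
  have "kd (b \<oplus>\<^bsub>B\<^esub> b') = kd b \<oplus>\<^bsub>\<Omega>\<^esub> kd b'" if "b \<in> carrier B" "b' \<in> carrier B" for b b'
    using that by (simp add: kd_def Om.coset_add Om.coset_eqI kaehler_relationsI(1) FB.span_submodule_base)
  moreover have "kd (b \<otimes>\<^bsub>B\<^esub> b') = b \<odot>\<^bsub>\<Omega>\<^esub> kd b' \<oplus>\<^bsub>\<Omega>\<^esub> b' \<odot>\<^bsub>\<Omega>\<^esub> kd b" if "b \<in> carrier B" "b' \<in> carrier B" for b b'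
    using that by (simp add: kd_def Om.coset_add Om.coset_smult Om.coset_eqI kaehler_relationsI(2) FB.span_submodule_base)
  moreover have "kd (a \<odot>\<^bsub>B\<^esub> \<one>\<^bsub>B\<^esub>) = \<zero>\<^bsub>\<Omega>\<^esub>" if "a \<in> carrier A" for a
    using that by (simp add: kd_def Om.coset_eq_zero_iff kaehler_relationsI(3) FB.span_submodule_base)
  ultimately show ?thesis
    by (simp add: derivation_def)
qed

lemma kaehler_universal:
  assumes P: "module B P" and D: "derivation P D"
  obtains h where "linear_map B \<Omega> P h" "\<And>b. b \<in> carrier B \<Longrightarrow> h (kd b) = D b"
proof -
  note [simp del] = free_module_simps
  interpret P: module B P by fact
  have Dc: "D \<in> carrier B \<rightarrow> carrier P" "\<And>b. b \<in> carrier B \<Longrightarrow> D b \<in> carrier P"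
    using D by (auto simp: derivation_def)
  define l where "l = free_ext B P D"
  have lin: "linear_map B FB P l"
    unfolding l_def by (rule P.free_ext_linear[OF Dc(1)])
  have gen: "l (free_gen B b) = D b" if "b \<in> carrier B" for b
    unfolding l_def using that by (rule P.free_ext_gen[OF Dc(1)])
  note simps = linear_map_minus[OF FB.module_axioms P lin] linear_mapD[OF lin] gen FB.smult_closed FB.M.a_closed
    Dc(2) P.M.diff_eq_zero_iff
  have "l r = \<zero>\<^bsub>P\<^esub>" if "r \<in> kaehler_relations A B" for r
    using that D by (induction rule: kaehler_relations_induct) (simp_all add: simps derivation_def)
  then have "Relations \<subseteq> {x \<in> carrier FB. l x \<in> {\<zero>\<^bsub>P\<^esub>}}"
    using kaehler_relations_carrier
    by (intro FB.span_submodule_least FB.vimage_submodule[OF P lin] P.zero_submodule) auto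
  then have zero: "l x = \<zero>\<^bsub>P\<^esub>" if "x \<in> Relations" for x
    using that by auto
  show thesis
  proof (rule that)
    show "linear_map B \<Omega> P (quot_ext l)"
      using Om.quot_ext_linear[OF P lin zero] .
    show "quot_ext l (kd b) = D b" if "b \<in> carrier B" for b
      unfolding kd_def using that by (simp add: Om.quot_ext_coset[OF P lin zero] gen)
  qed
qed

text \<open>Linearity over \<open>A\<close> of a map into a \<open>B\<close>-module:
  \<open>A\<close> acts on \<open>P\<close> only through its image \<open>a 1\<close> in
  \<open>B\<close>. Unlike derivations, such maps include both sides of the Leibniz rule, seen as
  functions of one argument.\<close>

definition semilinear where
  "semilinear P D \<longleftrightarrow> D \<in> carrier B \<rightarrow> carrier P \<and>
    (\<forall>b\<in>carrier B. \<forall>b'\<in>carrier B. D (b \<oplus>\<^bsub>B\<^esub> b') = D b \<oplus>\<^bsub>P\<^esub> D b') \<and>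
    (\<forall>a\<in>carrier A. \<forall>b\<in>carrier B. D (a \<odot>\<^bsub>B\<^esub> b) = (a \<odot>\<^bsub>B\<^esub> \<one>\<^bsub>B\<^esub>) \<odot>\<^bsub>P\<^esub> D b)"

lemma derivation_semilinear:
  assumes P: "module B P" and D: "derivation P D"
  shows "semilinear P D"
proof -
  interpret P: module B P by fact
  have "D (a \<odot>\<^bsub>B\<^esub> b) = (a \<odot>\<^bsub>B\<^esub> \<one>\<^bsub>B\<^esub>) \<odot>\<^bsub>P\<^esub> D b" if ab: "a \<in> carrier A" "b \<in> carrier B" for a b
  proof -
    have "D b \<in> carrier P"
      using D ab by (auto simp: derivation_def)
    moreover have "D ((a \<odot>\<^bsub>B\<^esub> \<one>\<^bsub>B\<^esub>) \<otimes>\<^bsub>B\<^esub> b) = (a \<odot>\<^bsub>B\<^esub> \<one>\<^bsub>B\<^esub>) \<odot>\<^bsub>P\<^esub> D b \<oplus>\<^bsub>P\<^esub> b \<odot>\<^bsub>P\<^esub> D (a \<odot>\<^bsub>B\<^esub> \<one>\<^bsub>B\<^esub>)"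
      using D ab scalar_closed unfolding derivation_def by blast
    moreover have "D (a \<odot>\<^bsub>B\<^esub> \<one>\<^bsub>B\<^esub>) = \<zero>\<^bsub>P\<^esub>"
      using D ab by (simp add: derivation_def)
    ultimately show ?thesis
      using ab by (simp add: scalar_mult)
  qed
  then show ?thesis
    using D by (simp add: semilinear_def derivation_def)
qed

lemma semilinear_expand:
  assumes P: "module B P" and D: "semilinear P D" and b: "b \<in> carrier B"
  shows "D b = (\<Oplus>\<^bsub>P\<^esub> l\<in>{..<n}. (f l b \<odot>\<^bsub>B\<^esub> \<one>\<^bsub>B\<^esub>) \<odot>\<^bsub>P\<^esub> D (e l))"
proof -
  interpret P: module B P by fact
  have Dc: "D \<in> carrier B \<rightarrow> carrier P"
    using D by (simp add: semilinear_def)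
  have "D b = D (\<Oplus>\<^bsub>B\<^esub> l\<in>{..<n}. f l b \<odot>\<^bsub>B\<^esub> e l)"
    using b by (simp add: dbD(4))
  also have "\<dots> = (\<Oplus>\<^bsub>P\<^esub> l\<in>{..<n}. D (f l b \<odot>\<^bsub>B\<^esub> e l))"
    using D b dbD by (intro additive_finsum[OF abelian_groups(2) P.abelian_groups(2) Dc]) (auto simp: semilinear_def)
  also have "\<dots> = (\<Oplus>\<^bsub>P\<^esub> l\<in>{..<n}. (f l b \<odot>\<^bsub>B\<^esub> \<one>\<^bsub>B\<^esub>) \<odot>\<^bsub>P\<^esub> D (e l))"
  proof (intro P.M.finsum_cong' refl Pi_I)
    fix l assume "l \<in> {..<n}"
    then have l: "f l b \<in> carrier A" "e l \<in> carrier B"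
      using b dbD by auto
    then show "D (f l b \<odot>\<^bsub>B\<^esub> e l) = (f l b \<odot>\<^bsub>B\<^esub> \<one>\<^bsub>B\<^esub>) \<odot>\<^bsub>P\<^esub> D (e l)"
      using D by (simp add: semilinear_def)
    show "(f l b \<odot>\<^bsub>B\<^esub> \<one>\<^bsub>B\<^esub>) \<odot>\<^bsub>P\<^esub> D (e l) \<in> carrier P"
      using l Dc by (intro P.smult_closed scalar_closed) auto
  qed
  finally show ?thesis .
qed

lemma kaehler_generated:
  assumes "y \<in> carrier \<Omega>"
  obtains c where "c \<in> {..<n} \<rightarrow> carrier B" "y = (\<Oplus>\<^bsub>\<Omega>\<^esub> l\<in>{..<n}. c l \<odot>\<^bsub>\<Omega>\<^esub> kd (e l))"
proof -
  let ?\<rho> = "\<lambda>l. kd (e l)"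
  have \<rho>: "?\<rho> \<in> {..<n} \<rightarrow> carrier \<Omega>"
    using dbD by auto
  let ?N = "span_submodule B \<Omega> (?\<rho> ` {..<n})"
  have "?\<rho> ` {..<n} \<subseteq> carrier \<Omega>"
    using \<rho> by auto
  note N = \<Omega>.span_submodule[OF this]
  have kd_N: "kd b \<in> ?N" if "b \<in> carrier B" for b
    unfolding semilinear_expand[OF \<Omega>_module derivation_semilinear[OF \<Omega>_module kd_derivation] that]
    using that dbD by (intro \<Omega>.submodule_finsum[OF N] Pi_I \<Omega>.submoduleE(4)[OF N] \<Omega>.span_submodule_base) auto
  have "{x \<in> carrier FB. Relations +>\<^bsub>FB\<^esub> x \<in> ?N} = carrier FB"
    by (rule FB.free_module_spanned[OF FB.vimage_submodule[OF \<Omega>_module Om.coset_linear N]])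
      (use kd_N in \<open>auto simp: kd_def\<close>)
  moreover obtain x where "x \<in> carrier FB" "y = Relations +>\<^bsub>FB\<^esub> x"
    using assms by (rule Om.quotient_elem)
  ultimately have "y \<in> ?N"
    by blast
  then show thesis
    unfolding \<Omega>.span_finite_family[OF finite_lessThan \<rho>] using that by blast
qed

section \<open>The module presented by finitely many relations\<close>

abbreviation "P \<equiv> free_module B {..<n}"

sublocale P: module B P
  by (rule cring.free_module_is_module[OF M_cring])

text \<open>The expression for \<open>d b\<close> in symbols for the \<open>d e_l\<close>, that is,
  the coordinates \<open>f_l b\<close> placed in \<open>B\<close>.\<close>

definition "coord_diff b = (\<lambda>q. if q < n then f q b \<odot>\<^bsub>B\<^esub> \<one>\<^bsub>B\<^esub> else \<zero>\<^bsub>B\<^esub>)"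

lemma P_carrier: "c \<in> carrier P \<longleftrightarrow> (\<forall>q. c q \<in> carrier B) \<and> (\<forall>q\<ge>n. c q = \<zero>\<^bsub>B\<^esub>)"
  using cring.free_module_carrier_finite[OF M_cring, of "{..<n}" c] by (auto simp: not_less)

lemma P_gen: "l < n \<Longrightarrow> free_gen B l \<in> carrier P"
  by (rule cring.free_gen_closed[OF M_cring]) simp

lemma P_lin_comb:
  assumes "c \<in> {..<n} \<rightarrow> carrier B"
  shows "(\<Oplus>\<^bsub>P\<^esub> l\<in>{..<n}. c l \<odot>\<^bsub>P\<^esub> free_gen B l) = (\<lambda>q. if q < n then c q else \<zero>\<^bsub>B\<^esub>)"
proof -
  let ?c = "\<lambda>q. if q < n then c q else \<zero>\<^bsub>B\<^esub>"
  have c: "?c \<in> carrier P"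
    using assms by (auto simp: P_carrier)
  have "?c = free_ext B P (free_gen B) ?c"
    unfolding free_ext_def by (rule cring.free_module_decomp[OF M_cring c])
  also have "\<dots> = (\<Oplus>\<^bsub>P\<^esub> l\<in>{..<n}. ?c l \<odot>\<^bsub>P\<^esub> free_gen B l)"
    using P_gen by (intro P.free_ext_superset[OF c]) auto
  also have "\<dots> = (\<Oplus>\<^bsub>P\<^esub> l\<in>{..<n}. c l \<odot>\<^bsub>P\<^esub> free_gen B l)"
    using assms P_gen P.smult_closed by (intro P.M.finsum_cong') (auto simp: Pi_iff simp del: free_module_simps)
  finally show ?thesis ..
qed

lemma coord_diff_closed: "b \<in> carrier B \<Longrightarrow> coord_diff b \<in> carrier P"
  using dbD by (auto simp: P_carrier coord_diff_def)

lemma coord_diff_eq: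
  "b \<in> carrier B \<Longrightarrow> coord_diff b = (\<Oplus>\<^bsub>P\<^esub> l\<in>{..<n}. (f l b \<odot>\<^bsub>B\<^esub> \<one>\<^bsub>B\<^esub>) \<odot>\<^bsub>P\<^esub> free_gen B l)"
  using dbD by (subst P_lin_comb) (auto simp: coord_diff_def)

lemma coord_diff_semilinear: "semilinear P coord_diff"
  unfolding semilinear_def
  using coord_diff_closed dbD linear_formD(2,3)[OF dbD(2)]
  by (auto simp: coord_diff_def fun_eq_iff smult_l_distr smult_assoc1 smult_assoc2)

text \<open>Finitely many relations suffice for \<open>\<Omega>\<close>: with the generators \<open>g\<^sub>l = d e\<^sub>l\<close>, the formula
  \<open>d b = \<Sum>\<^sub>l f\<^sub>l b \<cdot> g\<^sub>l\<close> is additive, so that the Leibniz rule need only hold for pairs of the \<open>e\<^sub>l\<close>.\<close>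

definition rows :: "(nat \<Rightarrow> 'c) set" where
  "rows = insert (coord_diff \<one>\<^bsub>B\<^esub>) ((\<lambda>l. coord_diff (e l) \<ominus>\<^bsub>P\<^esub> free_gen B l) ` {..<n} \<union>
    (\<lambda>(l, m). coord_diff (e l \<otimes>\<^bsub>B\<^esub> e m) \<ominus>\<^bsub>P\<^esub> (e l \<odot>\<^bsub>P\<^esub> free_gen B m \<oplus>\<^bsub>P\<^esub> e m \<odot>\<^bsub>P\<^esub> free_gen B l)) ` ({..<n} \<times> {..<n}))"

lemma rows_cases:
  assumes "r \<in> rows"
  shows "r = coord_diff \<one>\<^bsub>B\<^esub> \<or> (\<exists>l. l < n \<and> r = coord_diff (e l) \<ominus>\<^bsub>P\<^esub> free_gen B l) \<or>
    (\<exists>l m. l < n \<and> m < n \<and>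
      r = coord_diff (e l \<otimes>\<^bsub>B\<^esub> e m) \<ominus>\<^bsub>P\<^esub> (e l \<odot>\<^bsub>P\<^esub> free_gen B m \<oplus>\<^bsub>P\<^esub> e m \<odot>\<^bsub>P\<^esub> free_gen B l))"
  using assms unfolding rows_def by (auto simp del: free_module_simps)

abbreviation "RowSpan \<equiv> span_submodule B P rows"

lemma rows_carrier: "rows \<subseteq> carrier P"
  unfolding rows_def
  by (auto simp del: free_module_simps intro!: P.M.minus_closed P.M.a_closed P.smult_closed P_gen coord_diff_closed dbD(1))

lemma RowSpan_submodule: "submodule RowSpan B P"
  by (rule P.span_submodule[OF rows_carrier])

sublocale PQ: module_quotient B P RowSpan
  by (rule module_quotient.intro[OF P.module_axioms], rule module_quotient_axioms.intro, rule RowSpan_submodule)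

abbreviation "PQ \<equiv> quotient_module P RowSpan"

sublocale PQm: module B PQ
  by (rule PQ.quotient_is_module)

abbreviation "\<epsilon> l \<equiv> RowSpan +>\<^bsub>P\<^esub> free_gen B l"
abbreviation "cdiff b \<equiv> RowSpan +>\<^bsub>P\<^esub> coord_diff b"

text \<open>Gives semilinearity of the right side of the Leibniz rule in one argument; the scalars
  from \<open>A\<close> commute with \<open>x\<close>.\<close>

lemma semilinear_smult_add:
  assumes Q: "module B Q" and "semilinear Q D" "semilinear Q D'" "x \<in> carrier B"
  shows "semilinear Q (\<lambda>b. x \<odot>\<^bsub>Q\<^esub> D b \<oplus>\<^bsub>Q\<^esub> D' b)"
proof -
  interpret Q: module B Q by fact
  have D: "D b \<in> carrier Q" "D' b \<in> carrier Q" if "b \<in> carrier B" for b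
    using assms that by (auto simp: semilinear_def)
  have "x \<odot>\<^bsub>Q\<^esub> ((a \<odot>\<^bsub>B\<^esub> \<one>\<^bsub>B\<^esub>) \<odot>\<^bsub>Q\<^esub> D b) = (a \<odot>\<^bsub>B\<^esub> \<one>\<^bsub>B\<^esub>) \<odot>\<^bsub>Q\<^esub> (x \<odot>\<^bsub>Q\<^esub> D b)"
    if "a \<in> carrier A" "b \<in> carrier B" for a b
    using that assms(4) D by (simp add: m_comm[of x] flip: Q.smult_assoc1)
  then show ?thesis
    using assms D unfolding semilinear_def by (auto simp: Q.smult_r_distr Q.M.a_ac)
qed

lemma cdiff_semilinear: "semilinear PQ cdiff"
  using coord_diff_semilinear coord_diff_closed PQ.coset_linear
  unfolding semilinear_def by (auto simp: PQ.coset_closed PQ.coset_add PQ.coset_smult)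

text \<open>The rows read modulo their span. The first identity is a true condition: for a dual
  basis that is not a basis, the coordinates of \<open>e_l\<close> need not be a unit vector. The
  last one forces \<open>cdiff\<close> to vanish on all constants, by semilinearity.\<close>

lemma cdiff_rows:
  "l < n \<Longrightarrow> cdiff (e l) = \<epsilon> l"
  "l < n \<Longrightarrow> m < n \<Longrightarrow> cdiff (e l \<otimes>\<^bsub>B\<^esub> e m) = e l \<odot>\<^bsub>PQ\<^esub> \<epsilon> m \<oplus>\<^bsub>PQ\<^esub> e m \<odot>\<^bsub>PQ\<^esub> \<epsilon> l"
  "cdiff \<one>\<^bsub>B\<^esub> = \<zero>\<^bsub>PQ\<^esub>"
proof -
  note [simp del] = free_module_simps
  note closed = coord_diff_closed P_gen P.smult_closed P.M.a_closed dbD(1)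
  show "cdiff (e l) = \<epsilon> l" if "l < n"
    using that by (intro PQ.coset_eqI P.span_submodule_base) (auto simp: closed rows_def)
  show "cdiff (e l \<otimes>\<^bsub>B\<^esub> e m) = e l \<odot>\<^bsub>PQ\<^esub> \<epsilon> m \<oplus>\<^bsub>PQ\<^esub> e m \<odot>\<^bsub>PQ\<^esub> \<epsilon> l" if lm: "l < n" "m < n"
  proof -
    have "coord_diff (e l \<otimes>\<^bsub>B\<^esub> e m) \<ominus>\<^bsub>P\<^esub> (e l \<odot>\<^bsub>P\<^esub> free_gen B m \<oplus>\<^bsub>P\<^esub> e m \<odot>\<^bsub>P\<^esub> free_gen B l) \<in> rows"
      unfolding rows_def using lm by force
    then have "cdiff (e l \<otimes>\<^bsub>B\<^esub> e m) = RowSpan +>\<^bsub>P\<^esub> (e l \<odot>\<^bsub>P\<^esub> free_gen B m \<oplus>\<^bsub>P\<^esub> e m \<odot>\<^bsub>P\<^esub> free_gen B l)"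
      using lm by (intro PQ.coset_eqI P.span_submodule_base) (auto simp: closed)
    then show ?thesis
      using lm by (simp add: closed PQ.coset_add PQ.coset_smult)
  qed
  show "cdiff \<one>\<^bsub>B\<^esub> = \<zero>\<^bsub>PQ\<^esub>"
    using P.span_submodule_base[of "coord_diff \<one>\<^bsub>B\<^esub>" rows]
    by (simp add: PQ.coset_eq_zero_iff coord_diff_closed) (simp add: rows_def)
qed

lemma semilinear_eqI:
  assumes Q: "module B Q" and D: "semilinear Q D" "semilinear Q D'"
    and eq: "\<And>l. l < n \<Longrightarrow> D (e l) = D' (e l)" and b: "b \<in> carrier B"
  shows "D b = D' b"
proof -
  interpret Q: module B Q by fact
  have "D' (e l) \<in> carrier Q" if "l < n" for l
    using D dbD(1)[OF that] by (auto simp: semilinear_def)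
  then show ?thesis
    unfolding semilinear_expand[OF Q D(1) b] semilinear_expand[OF Q D(2) b]
    using eq b dbD by (intro Q.M.finsum_cong') auto
qed

text \<open>Semilinear maps that agree on the \<open>e_l\<close> are equal, and both sides of the
  Leibniz rule are semilinear in the left argument. This settles products with some
  \<open>e_m\<close> on the right; after commuting the factors, the same reduction settles all
  products.\<close>

lemma cdiff_derivation: "derivation PQ cdiff"
proof -
  have c: "cdiff b \<in> carrier PQ" if "b \<in> carrier B" for b
    using cdiff_semilinear that by (auto simp: semilinear_def)
  have leibniz: "cdiff (b \<otimes>\<^bsub>B\<^esub> b') = b' \<odot>\<^bsub>PQ\<^esub> cdiff b \<oplus>\<^bsub>PQ\<^esub> b \<odot>\<^bsub>PQ\<^esub> cdiff b'"
    if gens: "\<And>l. l < n \<Longrightarrow> cdiff (e l \<otimes>\<^bsub>B\<^esub> b') = b' \<odot>\<^bsub>PQ\<^esub> cdiff (e l) \<oplus>\<^bsub>PQ\<^esub> e l \<odot>\<^bsub>PQ\<^esub> cdiff b'"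
      and b: "b \<in> carrier B" "b' \<in> carrier B" for b b'
  proof (rule semilinear_eqI[where D = "\<lambda>b. cdiff (b \<otimes>\<^bsub>B\<^esub> b')", OF PQm.module_axioms _ _ gens b(1)])
    show "semilinear PQ (\<lambda>b. cdiff (b \<otimes>\<^bsub>B\<^esub> b'))"
      using cdiff_semilinear b(2) unfolding semilinear_def by (auto simp: l_distr smult_assoc2)
    have "semilinear PQ (\<lambda>b. b \<odot>\<^bsub>PQ\<^esub> cdiff b')"
      using c[OF b(2)] PQm.smult_assoc1[OF scalar_closed _ c[OF b(2)]] unfolding semilinear_def
      by (auto simp: PQm.smult_l_distr scalar_mult)
    then show "semilinear PQ (\<lambda>b. b' \<odot>\<^bsub>PQ\<^esub> cdiff b \<oplus>\<^bsub>PQ\<^esub> b \<odot>\<^bsub>PQ\<^esub> cdiff b')"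
      by (rule semilinear_smult_add[OF PQm.module_axioms cdiff_semilinear _ b(2)])
  qed
  have e: "cdiff (b \<otimes>\<^bsub>B\<^esub> e m) = e m \<odot>\<^bsub>PQ\<^esub> cdiff b \<oplus>\<^bsub>PQ\<^esub> b \<odot>\<^bsub>PQ\<^esub> cdiff (e m)" if "b \<in> carrier B" "m < n" for b m
  proof (rule leibniz)
    fix l assume l: "l < n"
    have "e m \<odot>\<^bsub>PQ\<^esub> cdiff (e l) \<oplus>\<^bsub>PQ\<^esub> e l \<odot>\<^bsub>PQ\<^esub> cdiff (e m) =
        e l \<odot>\<^bsub>PQ\<^esub> cdiff (e m) \<oplus>\<^bsub>PQ\<^esub> e m \<odot>\<^bsub>PQ\<^esub> cdiff (e l)"
      using l that(2) by (intro PQm.M.a_comm PQm.smult_closed c dbD(1))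
    then show "cdiff (e l \<otimes>\<^bsub>B\<^esub> e m) = e m \<odot>\<^bsub>PQ\<^esub> cdiff (e l) \<oplus>\<^bsub>PQ\<^esub> e l \<odot>\<^bsub>PQ\<^esub> cdiff (e m)"
      unfolding cdiff_rows(2)[OF l that(2)] cdiff_rows(1)[OF l] cdiff_rows(1)[OF that(2)] by (rule sym)
  qed (use that dbD in auto)
  have "cdiff (b \<otimes>\<^bsub>B\<^esub> b') = b' \<odot>\<^bsub>PQ\<^esub> cdiff b \<oplus>\<^bsub>PQ\<^esub> b \<odot>\<^bsub>PQ\<^esub> cdiff b'" if b: "b \<in> carrier B" "b' \<in> carrier B" for b b'
  proof (rule leibniz[OF _ b])
    fix l assume l: "l < n"
    have "cdiff (e l \<otimes>\<^bsub>B\<^esub> b') = cdiff (b' \<otimes>\<^bsub>B\<^esub> e l)"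
      using b dbD(1)[OF l] by (simp add: m_comm)
    also have "\<dots> = e l \<odot>\<^bsub>PQ\<^esub> cdiff b' \<oplus>\<^bsub>PQ\<^esub> b' \<odot>\<^bsub>PQ\<^esub> cdiff (e l)"
      by (rule e[OF b(2) l])
    also have "\<dots> = b' \<odot>\<^bsub>PQ\<^esub> cdiff (e l) \<oplus>\<^bsub>PQ\<^esub> e l \<odot>\<^bsub>PQ\<^esub> cdiff b'"
      using b l by (intro PQm.M.a_comm PQm.smult_closed c dbD(1))
    finally show "cdiff (e l \<otimes>\<^bsub>B\<^esub> b') = b' \<odot>\<^bsub>PQ\<^esub> cdiff (e l) \<oplus>\<^bsub>PQ\<^esub> e l \<odot>\<^bsub>PQ\<^esub> cdiff b'" .
  qed
  then have "cdiff (b \<otimes>\<^bsub>B\<^esub> b') = b \<odot>\<^bsub>PQ\<^esub> cdiff b' \<oplus>\<^bsub>PQ\<^esub> b' \<odot>\<^bsub>PQ\<^esub> cdiff b" if "b \<in> carrier B" "b' \<in> carrier B" for b b'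
    using that PQm.M.a_comm[OF PQm.smult_closed[OF that(1) c[OF that(2)]] PQm.smult_closed[OF that(2) c[OF that(1)]]]
    by simp
  moreover have "cdiff (a \<odot>\<^bsub>B\<^esub> \<one>\<^bsub>B\<^esub>) = \<zero>\<^bsub>PQ\<^esub>" if "a \<in> carrier A" for a
    using that cdiff_semilinear by (simp add: semilinear_def cdiff_rows(3))
  ultimately show ?thesis
    using cdiff_semilinear unfolding semilinear_def derivation_def by blast
qed

text \<open>The two modules map to each other. The universal property for \<open>cdiff\<close> sends
  \<open>d e_l\<close> to the class of the \<open>l\<close>-th generator, so a relation in \<Omega>
  becomes one modulo \<open>RowSpan\<close>. Conversely the map \<open>g\<close> from the free
  module to \<Omega> kills each row, because \<open>d\<close> satisfies the corresponding
  identity.\<close>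

lemma kd_relation_iff:
  assumes c: "c \<in> {..<n} \<rightarrow> carrier B"
  shows "(\<Oplus>\<^bsub>\<Omega>\<^esub> l\<in>{..<n}. c l \<odot>\<^bsub>\<Omega>\<^esub> kd (e l)) = \<zero>\<^bsub>\<Omega>\<^esub> \<longleftrightarrow> (\<lambda>q. if q < n then c q else \<zero>\<^bsub>B\<^esub>) \<in> RowSpan"
proof
  note [simp del] = free_module_simps
  have sum: "(\<Oplus>\<^bsub>P\<^esub> l\<in>{..<n}. c l \<odot>\<^bsub>P\<^esub> free_gen B l) \<in> carrier P"
    using c P_gen by (intro P.M.finsum_closed) auto
  {
    assume zero: "(\<Oplus>\<^bsub>\<Omega>\<^esub> l\<in>{..<n}. c l \<odot>\<^bsub>\<Omega>\<^esub> kd (e l)) = \<zero>\<^bsub>\<Omega>\<^esub>"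
    obtain h where h: "linear_map B \<Omega> PQ h" "\<And>b. b \<in> carrier B \<Longrightarrow> h (kd b) = cdiff b"
      using kaehler_universal[OF PQm.module_axioms cdiff_derivation] by blast
    have "\<zero>\<^bsub>PQ\<^esub> = h (\<Oplus>\<^bsub>\<Omega>\<^esub> l\<in>{..<n}. c l \<odot>\<^bsub>\<Omega>\<^esub> kd (e l))"
      using zero linear_map_zero[OF \<Omega>_module PQm.module_axioms h(1)] by simp
    also have "\<dots> = (\<Oplus>\<^bsub>PQ\<^esub> l\<in>{..<n}. c l \<odot>\<^bsub>PQ\<^esub> h (kd (e l)))"
      using c dbD by (intro \<Omega>.linear_map_lin_comb[OF PQm.module_axioms h(1)]) auto
    also have "\<dots> = (\<Oplus>\<^bsub>PQ\<^esub> l\<in>{..<n}. c l \<odot>\<^bsub>PQ\<^esub> \<epsilon> l)"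
      using c dbD P_gen by (intro PQm.M.finsum_cong') (auto simp: h(2) cdiff_rows(1) PQ.coset_closed Pi_iff)
    also have "\<dots> = RowSpan +>\<^bsub>P\<^esub> (\<Oplus>\<^bsub>P\<^esub> l\<in>{..<n}. c l \<odot>\<^bsub>P\<^esub> free_gen B l)"
      using c P_gen by (intro P.linear_map_lin_comb[OF PQm.module_axioms PQ.coset_linear, symmetric]) auto
    finally have "(\<Oplus>\<^bsub>P\<^esub> l\<in>{..<n}. c l \<odot>\<^bsub>P\<^esub> free_gen B l) \<in> RowSpan"
      using PQ.coset_eq_zero_iff[OF sum] by simp
    then show "(\<lambda>q. if q < n then c q else \<zero>\<^bsub>B\<^esub>) \<in> RowSpan"
      by (simp add: P_lin_comb[OF c])
  }
  assume R: "(\<lambda>q. if q < n then c q else \<zero>\<^bsub>B\<^esub>) \<in> RowSpan"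
  have kde: "(\<lambda>l. kd (e l)) \<in> {..<n} \<rightarrow> carrier \<Omega>"
    using dbD by auto
  define g where "g = free_ext B \<Omega> (\<lambda>l. kd (e l))"
  have g: "linear_map B P \<Omega> g"
    unfolding g_def by (rule \<Omega>.free_ext_linear[OF kde])
  have g_gen: "g (free_gen B l) = kd (e l)" if "l < n" for l
    unfolding g_def using that by (intro \<Omega>.free_ext_gen[OF kde]) simp
  have g_comb: "g (\<Oplus>\<^bsub>P\<^esub> l\<in>{..<n}. c l \<odot>\<^bsub>P\<^esub> free_gen B l) = (\<Oplus>\<^bsub>\<Omega>\<^esub> l\<in>{..<n}. c l \<odot>\<^bsub>\<Omega>\<^esub> kd (e l))"
    if c: "c \<in> {..<n} \<rightarrow> carrier B" for c
  proof -
    have "g (\<Oplus>\<^bsub>P\<^esub> l\<in>{..<n}. c l \<odot>\<^bsub>P\<^esub> free_gen B l) = (\<Oplus>\<^bsub>\<Omega>\<^esub> l\<in>{..<n}. c l \<odot>\<^bsub>\<Omega>\<^esub> g (free_gen B l))"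
      using c P_gen by (intro P.linear_map_lin_comb[OF \<Omega>_module g]) auto
    also have "\<dots> = (\<Oplus>\<^bsub>\<Omega>\<^esub> l\<in>{..<n}. c l \<odot>\<^bsub>\<Omega>\<^esub> kd (e l))"
      using c dbD by (intro \<Omega>.M.finsum_cong') (auto simp: g_gen Pi_iff)
    finally show ?thesis .
  qed
  have g_diff: "g (coord_diff b) = kd b" if b: "b \<in> carrier B" for b
    unfolding coord_diff_eq[OF b] semilinear_expand[OF \<Omega>_module derivation_semilinear[OF \<Omega>_module kd_derivation] b]
    using b dbD by (intro g_comb) auto
  have kd_mult: "kd (b \<otimes>\<^bsub>B\<^esub> b') = b \<odot>\<^bsub>\<Omega>\<^esub> kd b' \<oplus>\<^bsub>\<Omega>\<^esub> b' \<odot>\<^bsub>\<Omega>\<^esub> kd b" if "b \<in> carrier B" "b' \<in> carrier B" for b b'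
    using kd_derivation that by (simp add: derivation_def)
  have "kd (\<one> \<odot>\<^bsub>B\<^esub> \<one>\<^bsub>B\<^esub>) = \<zero>\<^bsub>\<Omega>\<^esub>"
    using kd_derivation R.one_closed unfolding derivation_def by blast
  then have kd_one: "kd \<one>\<^bsub>B\<^esub> = \<zero>\<^bsub>\<Omega>\<^esub>"
    by simp
  note simps = linear_map_minus[OF P.module_axioms \<Omega>_module g] linear_mapD[OF g] g_gen g_diff kd_mult kd_one
    coord_diff_closed P_gen P.smult_closed P.M.a_closed dbD(1) \<Omega>.M.diff_eq_zero_iff
  have "g r = \<zero>\<^bsub>\<Omega>\<^esub>" if "r \<in> rows" for r
    using rows_cases[OF that] by (elim disjE exE conjE) (simp_all add: simps)
  then have "RowSpan \<subseteq> {x \<in> carrier P. g x \<in> {\<zero>\<^bsub>\<Omega>\<^esub>}}"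
    using rows_carrier by (intro P.span_submodule_least P.vimage_submodule[OF \<Omega>_module g] \<Omega>.zero_submodule) auto
  then have "g (\<Oplus>\<^bsub>P\<^esub> l\<in>{..<n}. c l \<odot>\<^bsub>P\<^esub> free_gen B l) = \<zero>\<^bsub>\<Omega>\<^esub>"
    using R unfolding P_lin_comb[OF c] by auto
  then show "(\<Oplus>\<^bsub>\<Omega>\<^esub> l\<in>{..<n}. c l \<odot>\<^bsub>\<Omega>\<^esub> kd (e l)) = \<zero>\<^bsub>\<Omega>\<^esub>"
    by (simp add: g_comb[OF c])
qed

theorem kaehler_finitely_presented: "finitely_presented B \<Omega>"
proof -
  have "finite rows"
    by (simp add: rows_def)
  then obtain \<rho> and k :: nat where \<rho>: "rows = \<rho> ` {i. i < k}"
    using finite_imp_nat_seg_image_inj_on by metis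
  have \<rho>c: "\<rho> \<in> {..<k} \<rightarrow> carrier P"
    using rows_carrier \<rho> by auto
  have "rows = \<rho> ` {..<k}"
    using \<rho> by auto
  then have span: "RowSpan = {\<Oplus>\<^bsub>P\<^esub> i\<in>{..<k}. u i \<odot>\<^bsub>P\<^esub> \<rho> i | u. u \<in> {..<k} \<rightarrow> carrier B}"
    using P.span_finite_family[OF finite_lessThan \<rho>c] by simp
  have \<rho>B: "\<rho> i j \<in> carrier B" if "i < k" for i j
    using \<rho>c that by (auto simp: P_carrier Pi_iff)
  have coord: "(\<Oplus>\<^bsub>P\<^esub> i\<in>{..<k}. u i \<odot>\<^bsub>P\<^esub> \<rho> i) j = (\<Oplus>\<^bsub>B\<^esub> i\<in>{..<k}. u i \<otimes>\<^bsub>B\<^esub> \<rho> i j)"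
    if "u \<in> {..<k} \<rightarrow> carrier B" for u j
  proof -
    have "(\<lambda>i. u i \<odot>\<^bsub>P\<^esub> \<rho> i) \<in> {..<k} \<rightarrow> carrier P"
      using that \<rho>c by (intro Pi_I P.smult_closed) auto
    from cring.free_module_finsum_apply[OF M_cring this] show ?thesis
      by simp
  qed
  have zero: "(\<Oplus>\<^bsub>P\<^esub> i\<in>{..<k}. u i \<odot>\<^bsub>P\<^esub> \<rho> i) j = \<zero>\<^bsub>B\<^esub>" if "u \<in> {..<k} \<rightarrow> carrier B" "j \<ge> n" for u j
  proof -
    have "(\<Oplus>\<^bsub>P\<^esub> i\<in>{..<k}. u i \<odot>\<^bsub>P\<^esub> \<rho> i) \<in> carrier P"
      using that(1) \<rho>c by (intro P.M.finsum_closed Pi_I P.smult_closed) auto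
    then show ?thesis
      using that(2) by (simp add: P_carrier)
  qed
  have "presentation B \<Omega> n (\<lambda>l. kd (e l)) k \<rho>"
    unfolding presentation_def
  proof (intro conjI ballI allI impI)
    show "(\<lambda>l. kd (e l)) \<in> {..<n} \<rightarrow> carrier \<Omega>"
      using dbD by auto
    show "\<rho> i j \<in> carrier B" if "i < k" for i j
      using \<rho>B[OF that] .
    show "\<exists>c\<in>{..<n} \<rightarrow> carrier B. y = (\<Oplus>\<^bsub>\<Omega>\<^esub> j\<in>{..<n}. c j \<odot>\<^bsub>\<Omega>\<^esub> kd (e j))" if "y \<in> carrier \<Omega>" for y
      using kaehler_generated[OF that] by blast
    fix c assume c: "c \<in> {..<n} \<rightarrow> carrier B"
    have "(\<Oplus>\<^bsub>\<Omega>\<^esub> j\<in>{..<n}. c j \<odot>\<^bsub>\<Omega>\<^esub> kd (e j)) = \<zero>\<^bsub>\<Omega>\<^esub> \<longleftrightarrow>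
        (\<exists>u\<in>{..<k} \<rightarrow> carrier B. (\<lambda>q. if q < n then c q else \<zero>\<^bsub>B\<^esub>) = (\<Oplus>\<^bsub>P\<^esub> i\<in>{..<k}. u i \<odot>\<^bsub>P\<^esub> \<rho> i))"
      unfolding kd_relation_iff[OF c] span by blast
    also have "\<dots> \<longleftrightarrow> (\<exists>u\<in>{..<k} \<rightarrow> carrier B. \<forall>j<n. c j = (\<Oplus>\<^bsub>B\<^esub> i\<in>{..<k}. u i \<otimes>\<^bsub>B\<^esub> \<rho> i j))"
    proof (intro bex_cong refl)
      fix u assume u: "u \<in> {..<k} \<rightarrow> carrier B"
      show "(\<lambda>q. if q < n then c q else \<zero>\<^bsub>B\<^esub>) = (\<Oplus>\<^bsub>P\<^esub> i\<in>{..<k}. u i \<odot>\<^bsub>P\<^esub> \<rho> i) \<longleftrightarrow>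
          (\<forall>j<n. c j = (\<Oplus>\<^bsub>B\<^esub> i\<in>{..<k}. u i \<otimes>\<^bsub>B\<^esub> \<rho> i j))"
        unfolding coord[OF u, symmetric] using zero[OF u]
        by (simp add: fun_eq_iff del: free_module_simps)
    qed
    finally show "(\<Oplus>\<^bsub>\<Omega>\<^esub> j\<in>{..<n}. c j \<odot>\<^bsub>\<Omega>\<^esub> kd (e j)) = \<zero>\<^bsub>\<Omega>\<^esub> \<longleftrightarrow>
        (\<exists>u\<in>{..<k} \<rightarrow> carrier B. \<forall>j<n. c j = (\<Oplus>\<^bsub>B\<^esub> i\<in>{..<k}. u i \<otimes>\<^bsub>B\<^esub> \<rho> i j))" .
  qed
  then show ?thesis
    using \<Omega>_module unfolding finitely_presented_def by blast
qed

end

section \<open>The Noether different\<close>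

lemma (in abelian_monoid) finsum_lessThan_add:
  fixes m n :: nat
  assumes "g \<in> {..<m + n} \<rightarrow> carrier G"
  shows "(\<Oplus>i\<in>{..<m + n}. g i) = (\<Oplus>i\<in>{..<m}. g i) \<oplus> (\<Oplus>i\<in>{..<n}. g (m + i))"
  using assms
proof (induction n)
  case (Suc n)
  have g: "g i \<in> carrier G" if "i < m + Suc n" for i
    using Suc.prems that by auto
  have "(\<Oplus>i\<in>{..<m + Suc n}. g i) = g (m + n) \<oplus> (\<Oplus>i\<in>{..<m + n}. g i)"
    using g by (simp add: lessThan_Suc Pi_iff)
  also have "\<dots> = g (m + n) \<oplus> ((\<Oplus>i\<in>{..<m}. g i) \<oplus> (\<Oplus>i\<in>{..<n}. g (m + i)))"
    using Suc.IH g by (simp add: Pi_iff)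
  also have "\<dots> = (\<Oplus>i\<in>{..<m}. g i) \<oplus> (g (m + n) \<oplus> (\<Oplus>i\<in>{..<n}. g (m + i)))"
    using g by (intro a_lcomm finsum_closed) (auto simp: Pi_iff)
  finally show ?case
    using g by (simp add: lessThan_Suc Pi_iff)
qed simp

lemma (in abelian_group) add_cancel_middle:
  "x \<in> carrier G \<Longrightarrow> y \<in> carrier G \<Longrightarrow> z \<in> carrier G \<Longrightarrow> x \<oplus> (y \<oplus> (\<ominus> x \<oplus> z)) = y \<oplus> z"
  by (simp add: a_lcomm[of x y] r_neg2)

lemma (in abelian_group) finsum_uminus:
  assumes "g \<in> I \<rightarrow> carrier G"
  shows "(\<Oplus>i\<in>I. \<ominus> g i) = \<ominus> (\<Oplus>i\<in>I. g i)"
  by (rule additive_finsum[OF abelian_group_axioms abelian_group_axioms _ _ assms, symmetric])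
    (auto simp: minus_add)

section \<open>The ring B \<otimes> B and its multiplication map\<close>

context projective_algebra
begin

lemma two_algebras_self: "two_algebras A B B"
  by (rule two_algebras.intro) (rule algebra_axioms)+

sublocale TT: two_algebras A B B
  by (rule two_algebras_self)

abbreviation "T2 \<equiv> tensor_product A B B"
abbreviation "E2 \<equiv> base_change A B B"
abbreviation "pure2 \<equiv> pure_tensor A B B"

sublocale E2: algebra B E2
  by (rule TT.base_change_algebra)

lemma pure2_closed [simp, intro]: "u \<in> carrier B \<Longrightarrow> v \<in> carrier B \<Longrightarrow> pure2 u v \<in> carrier E2"
  by (simp add: TT.base_change_simps)

lemma pure2_simps:
  "u \<in> carrier B \<Longrightarrow> v \<in> carrier B \<Longrightarrow> u' \<in> carrier B \<Longrightarrow> v' \<in> carrier B \<Longrightarrow>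
    pure2 u v \<otimes>\<^bsub>E2\<^esub> pure2 u' v' = pure2 (u \<otimes>\<^bsub>B\<^esub> u') (v \<otimes>\<^bsub>B\<^esub> v')"
  "u \<in> carrier B \<Longrightarrow> v \<in> carrier B \<Longrightarrow> u' \<in> carrier B \<Longrightarrow> pure2 (u \<oplus>\<^bsub>B\<^esub> u') v = pure2 u v \<oplus>\<^bsub>E2\<^esub> pure2 u' v"
  "u \<in> carrier B \<Longrightarrow> v \<in> carrier B \<Longrightarrow> v' \<in> carrier B \<Longrightarrow> pure2 u (v \<oplus>\<^bsub>B\<^esub> v') = pure2 u v \<oplus>\<^bsub>E2\<^esub> pure2 u v'"
  "b \<in> carrier B \<Longrightarrow> u \<in> carrier B \<Longrightarrow> v \<in> carrier B \<Longrightarrow> b \<odot>\<^bsub>E2\<^esub> pure2 u v = pure2 (b \<otimes>\<^bsub>B\<^esub> u) v"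
  "a \<in> carrier A \<Longrightarrow> u \<in> carrier B \<Longrightarrow> v \<in> carrier B \<Longrightarrow> pure2 u (a \<odot>\<^bsub>B\<^esub> v) = pure2 (a \<odot>\<^bsub>B\<^esub> u) v"
  "\<one>\<^bsub>E2\<^esub> = pure2 \<one>\<^bsub>B\<^esub> \<one>\<^bsub>B\<^esub>"
  by (simp_all add: TT.base_change_simps TT.pure_mult TT.pure_add_left TT.pure_add_right TT.tensor_one
      TT.pure_smult_left TT.pure_smult_right)

lemma E2_smult: "b \<odot>\<^bsub>E2\<^esub> t = pure2 b \<one>\<^bsub>B\<^esub> \<otimes>\<^bsub>E2\<^esub> t"
  by (simp add: TT.base_change_simps)

lemma E2_induct [consumes 1, case_names pure add]:
  assumes "t \<in> carrier E2" and "\<And>u v. u \<in> carrier B \<Longrightarrow> v \<in> carrier B \<Longrightarrow> Q (pure2 u v)"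
    and "\<And>t t'. t \<in> carrier E2 \<Longrightarrow> t' \<in> carrier E2 \<Longrightarrow> Q t \<Longrightarrow> Q t' \<Longrightarrow> Q (t \<oplus>\<^bsub>E2\<^esub> t')"
  shows "Q t"
  using assms TT.tensor_induct[of t Q] by (simp add: TT.base_change_simps)

text \<open>Additivity suffices to compare maps on pure tensors. Linearity over \<open>B\<close>
  would ask too much: \<open>E2\<close> carries the action on the left component, for which
  \<open>f_l \<otimes> id\<close> is not linear.\<close>

definition additive2 where
  "additive2 \<phi> \<longleftrightarrow> \<phi> \<in> carrier E2 \<rightarrow> carrier B \<and>
    (\<forall>t\<in>carrier E2. \<forall>t'\<in>carrier E2. \<phi> (t \<oplus>\<^bsub>E2\<^esub> t') = \<phi> t \<oplus>\<^bsub>B\<^esub> \<phi> t')"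

lemma additive2_eqI:
  assumes "additive2 \<phi>" "additive2 \<psi>" "t \<in> carrier E2"
    and "\<And>u v. u \<in> carrier B \<Longrightarrow> v \<in> carrier B \<Longrightarrow> \<phi> (pure2 u v) = \<psi> (pure2 u v)"
  shows "\<phi> t = \<psi> t"
  using assms(3) by (induction rule: E2_induct) (use assms in \<open>auto simp: additive2_def\<close>)

lemma additive2_sum:
  assumes "\<And>l. l < n \<Longrightarrow> additive2 (g l)"
  shows "additive2 (\<lambda>t. \<Oplus>\<^bsub>B\<^esub> l\<in>{..<n}. g l t)"
  unfolding additive2_def
proof (intro conjI ballI Pi_I)
  have g: "g l t \<in> carrier B" if "l < n" "t \<in> carrier E2" for l t
    using assms that by (auto simp: additive2_def)
  then show "(\<Oplus>\<^bsub>B\<^esub> l\<in>{..<n}. g l t) \<in> carrier B" if "t \<in> carrier E2" for t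
    using that by (intro M.finsum_closed) auto
  fix t t' assume t: "t \<in> carrier E2" "t' \<in> carrier E2"
  then have "(\<Oplus>\<^bsub>B\<^esub> l\<in>{..<n}. g l (t \<oplus>\<^bsub>E2\<^esub> t')) = (\<Oplus>\<^bsub>B\<^esub> l\<in>{..<n}. g l t \<oplus>\<^bsub>B\<^esub> g l t')"
    using assms g by (intro M.finsum_cong') (auto simp: additive2_def)
  also have "\<dots> = (\<Oplus>\<^bsub>B\<^esub> l\<in>{..<n}. g l t) \<oplus>\<^bsub>B\<^esub> (\<Oplus>\<^bsub>B\<^esub> l\<in>{..<n}. g l t')"
    using g t by (intro M.finsum_addf) auto
  finally show "(\<Oplus>\<^bsub>B\<^esub> l\<in>{..<n}. g l (t \<oplus>\<^bsub>E2\<^esub> t')) = (\<Oplus>\<^bsub>B\<^esub> l\<in>{..<n}. g l t) \<oplus>\<^bsub>B\<^esub> (\<Oplus>\<^bsub>B\<^esub> l\<in>{..<n}. g l t')" .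
qed

lemma additive2_mult: "additive2 \<phi> \<Longrightarrow> w \<in> carrier E2 \<Longrightarrow> additive2 (\<lambda>t. \<phi> (t \<otimes>\<^bsub>E2\<^esub> w))"
  unfolding additive2_def by (auto simp: E2.l_distr)

lemma additive2_smult: "additive2 \<phi> \<Longrightarrow> a \<in> carrier A \<Longrightarrow> additive2 (\<lambda>t. a \<odot>\<^bsub>B\<^esub> \<phi> t)"
  unfolding additive2_def by (auto simp: smult_r_distr Pi_iff)

lemma additive2_mult_B: "additive2 \<phi> \<Longrightarrow> x \<in> carrier B \<Longrightarrow> additive2 (\<lambda>t. \<phi> t \<otimes>\<^bsub>B\<^esub> x)"
  unfolding additive2_def by (auto simp: l_distr Pi_iff)

lemma linear_map_additive2: "linear_map A T2 B \<phi> \<Longrightarrow> additive2 \<phi>"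
  by (auto simp: additive2_def linear_map_def TT.base_change_simps)

lemma multiplication_exists:
  "\<exists>\<mu>. additive2 \<mu> \<and> (\<forall>u\<in>carrier B. \<forall>v\<in>carrier B. \<mu> (pure2 u v) = u \<otimes>\<^bsub>B\<^esub> v)"
proof -
  obtain L where "linear_map A T2 B L" "\<And>u v. u \<in> carrier B \<Longrightarrow> v \<in> carrier B \<Longrightarrow> L (pure2 u v) = u \<otimes>\<^bsub>B\<^esub> v"
    by (rule TT.tensor_lift[where P = B and \<beta> = "\<lambda>u v. u \<otimes>\<^bsub>B\<^esub> v"])
      (auto simp: module_axioms l_distr r_distr smult_assoc2 linear_mapD(3)[OF mult_linear])
  then show ?thesis
    using linear_map_additive2 by blast
qed

definition "\<mu> = (SOME \<mu>. additive2 \<mu> \<and> (\<forall>u\<in>carrier B. \<forall>v\<in>carrier B. \<mu> (pure2 u v) = u \<otimes>\<^bsub>B\<^esub> v))"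

lemma \<mu>_additive: "additive2 \<mu>" and \<mu>_pure: "u \<in> carrier B \<Longrightarrow> v \<in> carrier B \<Longrightarrow> \<mu> (pure2 u v) = u \<otimes>\<^bsub>B\<^esub> v"
  using someI_ex[OF multiplication_exists] by (auto simp: \<mu>_def)

lemma \<mu>_closed: "t \<in> carrier E2 \<Longrightarrow> \<mu> t \<in> carrier B"
  and \<mu>_add: "t \<in> carrier E2 \<Longrightarrow> t' \<in> carrier E2 \<Longrightarrow> \<mu> (t \<oplus>\<^bsub>E2\<^esub> t') = \<mu> t \<oplus>\<^bsub>B\<^esub> \<mu> t'"
  using \<mu>_additive by (auto simp: additive2_def)

lemma \<mu>_mult:
  assumes "t \<in> carrier E2" "t' \<in> carrier E2"
  shows "\<mu> (t \<otimes>\<^bsub>E2\<^esub> t') = \<mu> t \<otimes>\<^bsub>B\<^esub> \<mu> t'"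
  using assms(1)
proof (induction rule: E2_induct)
  case (pure u v)
  from assms(2) pure show ?case
    by (induction rule: E2_induct) (simp_all add: pure2_simps \<mu>_pure \<mu>_add \<mu>_closed E2.r_distr r_distr m_ac)
qed (simp_all add: assms E2.l_distr \<mu>_add \<mu>_closed l_distr)

lemma \<mu>_hom: "ring_hom_cring E2 B \<mu>"
proof (intro ring_hom_cring.intro ring_hom_cring_axioms.intro)
  show "\<mu> \<in> ring_hom E2 B"
    by (rule ring_hom_memI) (auto simp: \<mu>_closed \<mu>_mult \<mu>_add \<mu>_pure pure2_simps)
qed (rule E2.M_cring M_cring)+

sublocale \<mu>: ring_hom_cring E2 B \<mu>
  by (rule \<mu>_hom)

text \<open>The map \<open>\<phi> \<otimes> id\<close> followed by the action of \<open>A\<close> on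
  \<open>B\<close>; it is used for the coordinate forms \<open>f_l\<close> and for the
  trace.\<close>

lemma functional_exists:
  assumes "linear_form A B \<phi>"
  shows "\<exists>L. additive2 L \<and> (\<forall>u\<in>carrier B. \<forall>v\<in>carrier B. L (pure2 u v) = \<phi> u \<odot>\<^bsub>B\<^esub> v)"
proof -
  note \<phi> = linear_formD[OF assms]
  have lcomm: "\<phi> u \<odot>\<^bsub>B\<^esub> (a \<odot>\<^bsub>B\<^esub> v) = a \<odot>\<^bsub>B\<^esub> (\<phi> u \<odot>\<^bsub>B\<^esub> v)"
    if "a \<in> carrier A" "u \<in> carrier B" "v \<in> carrier B" for a u v
    using that \<phi>(1) by (simp add: R.m_comm flip: smult_assoc1)
  obtain L where "linear_map A T2 B L" "\<And>u v. u \<in> carrier B \<Longrightarrow> v \<in> carrier B \<Longrightarrow> L (pure2 u v) = \<phi> u \<odot>\<^bsub>B\<^esub> v"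
    by (rule TT.tensor_lift[where P = B and \<beta> = "\<lambda>u v. \<phi> u \<odot>\<^bsub>B\<^esub> v"])
      (auto simp: \<phi> module_axioms smult_l_distr smult_r_distr smult_assoc1 lcomm)
  then show ?thesis
    using linear_map_additive2 by blast
qed

text \<open>An element \<open>z\<close> of \<open>B \<otimes> B\<close> on which the two actions of \<open>B\<close> agree turns the identity
  \<open>Tr = (\<Sum>l. e\<^sub>l f\<^sub>l)\<close> into \<open>(\<Sum>l. z (1 \<otimes> e\<^sub>l) f\<^sub>l) = \<mu> z\<close>.\<close>

lemma noether_different_trace:
  assumes z: "z \<in> carrier E2"
    and sym: "\<And>l. l < n \<Longrightarrow> z \<otimes>\<^bsub>E2\<^esub> pure2 \<one>\<^bsub>B\<^esub> (e l) = z \<otimes>\<^bsub>E2\<^esub> pure2 (e l) \<one>\<^bsub>B\<^esub>"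
  obtains c where "c \<in> {..<n} \<rightarrow> carrier B"
    "\<And>x. x \<in> carrier B \<Longrightarrow> x \<otimes>\<^bsub>B\<^esub> \<mu> z = (\<Oplus>\<^bsub>B\<^esub> l\<in>{..<n}. Tr (x \<otimes>\<^bsub>B\<^esub> e l) \<odot>\<^bsub>B\<^esub> c l)"
proof -
  define functional where
    "functional \<phi> = (SOME L. additive2 L \<and> (\<forall>u\<in>carrier B. \<forall>v\<in>carrier B. L (pure2 u v) = \<phi> u \<odot>\<^bsub>B\<^esub> v))" for \<phi>
  have functional: "additive2 (functional \<phi>)"
    "\<And>u v. u \<in> carrier B \<Longrightarrow> v \<in> carrier B \<Longrightarrow> functional \<phi> (pure2 u v) = \<phi> u \<odot>\<^bsub>B\<^esub> v"
    if "linear_form A B \<phi>" for \<phi>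
    using someI_ex[OF functional_exists[OF that]] by (auto simp: functional_def)
  define \<Lambda> where "\<Lambda> l = functional (f l)" for l
  define \<Theta> where "\<Theta> = functional Tr"
  have \<Lambda>: "additive2 (\<Lambda> l)" if "l < n" for l
    unfolding \<Lambda>_def by (rule functional(1)[OF dbD(2)[OF that]])
  have \<Lambda>_pure: "\<Lambda> l (pure2 u v) = f l u \<odot>\<^bsub>B\<^esub> v" if "l < n" "u \<in> carrier B" "v \<in> carrier B" for l u v
    unfolding \<Lambda>_def by (rule functional(2)[OF dbD(2)[OF that(1)] that(2,3)])
  note \<Theta> = functional[OF trace_linear[OF db], folded \<Theta>_def]
  have \<Lambda>c: "\<Lambda> l t \<in> carrier B" if "l < n" "t \<in> carrier E2" for l t
    using \<Lambda> that by (auto simp: additive2_def)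
  have "x \<otimes>\<^bsub>B\<^esub> \<mu> z = (\<Oplus>\<^bsub>B\<^esub> l\<in>{..<n}. Tr (x \<otimes>\<^bsub>B\<^esub> e l) \<odot>\<^bsub>B\<^esub> \<Lambda> l z)" if x: "x \<in> carrier B" for x
  proof -
    have tr: "Tr (x \<otimes>\<^bsub>B\<^esub> e l) \<in> carrier A" if "l < n" for l
      using x dbD that by (intro traceD) auto
    \<comment> \<open>True for every tensor: for \<open>u \<otimes> v\<close> the sum is
      \<open>v\<close> times the dual basis expansion of \<open>u x\<close>. The symmetry of
      \<open>z\<close> enters in the next step, where \<open>e_l\<close> moves to the left
      component.\<close>
    have "\<mu> z \<otimes>\<^bsub>B\<^esub> x = (\<Oplus>\<^bsub>B\<^esub> l\<in>{..<n}. \<Lambda> l (z \<otimes>\<^bsub>E2\<^esub> pure2 x (e l)))"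
    proof (rule additive2_eqI[OF _ _ z])
      fix u v assume uv: "u \<in> carrier B" "v \<in> carrier B"
      have "(\<Oplus>\<^bsub>B\<^esub> l\<in>{..<n}. \<Lambda> l (pure2 u v \<otimes>\<^bsub>E2\<^esub> pure2 x (e l))) =
          (\<Oplus>\<^bsub>B\<^esub> l\<in>{..<n}. f l (u \<otimes>\<^bsub>B\<^esub> x) \<odot>\<^bsub>B\<^esub> (v \<otimes>\<^bsub>B\<^esub> e l))"
        using uv x dbD by (intro M.finsum_cong') (auto simp: pure2_simps \<Lambda>_pure)
      also have "\<dots> = v \<otimes>\<^bsub>B\<^esub> (\<Oplus>\<^bsub>B\<^esub> l\<in>{..<n}. f l (u \<otimes>\<^bsub>B\<^esub> x) \<odot>\<^bsub>B\<^esub> e l)"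
        using uv x dbD by (intro linear_map_lin_comb[OF module_axioms mult_linear, symmetric]) auto
      also have "\<dots> = \<mu> (pure2 u v) \<otimes>\<^bsub>B\<^esub> x"
        using uv x by (simp add: dbD(4) \<mu>_pure m_ac)
      finally show "\<mu> (pure2 u v) \<otimes>\<^bsub>B\<^esub> x = (\<Oplus>\<^bsub>B\<^esub> l\<in>{..<n}. \<Lambda> l (pure2 u v \<otimes>\<^bsub>E2\<^esub> pure2 x (e l)))" ..
    qed (use x dbD \<Lambda> \<mu>_additive in \<open>auto intro!: additive2_sum additive2_mult additive2_mult_B\<close>)
    also have "\<dots> = (\<Oplus>\<^bsub>B\<^esub> l\<in>{..<n}. \<Lambda> l (z \<otimes>\<^bsub>E2\<^esub> pure2 (x \<otimes>\<^bsub>B\<^esub> e l) \<one>\<^bsub>B\<^esub>))"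
    proof (intro M.finsum_cong' refl Pi_I)
      fix l assume "l \<in> {..<n}"
      then have l: "l < n" "e l \<in> carrier B"
        using dbD by auto
      have "z \<otimes>\<^bsub>E2\<^esub> pure2 x (e l) = pure2 x \<one>\<^bsub>B\<^esub> \<otimes>\<^bsub>E2\<^esub> (z \<otimes>\<^bsub>E2\<^esub> pure2 \<one>\<^bsub>B\<^esub> (e l))"
        using z x l by (subst E2.m_lcomm) (auto simp: pure2_simps)
      also have "\<dots> = z \<otimes>\<^bsub>E2\<^esub> pure2 (x \<otimes>\<^bsub>B\<^esub> e l) \<one>\<^bsub>B\<^esub>"
        unfolding sym[OF l(1)] using z x l by (subst E2.m_lcomm) (auto simp: pure2_simps)
      finally show "\<Lambda> l (z \<otimes>\<^bsub>E2\<^esub> pure2 x (e l)) = \<Lambda> l (z \<otimes>\<^bsub>E2\<^esub> pure2 (x \<otimes>\<^bsub>B\<^esub> e l) \<one>\<^bsub>B\<^esub>)"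
        by simp
      show "\<Lambda> l (z \<otimes>\<^bsub>E2\<^esub> pure2 (x \<otimes>\<^bsub>B\<^esub> e l) \<one>\<^bsub>B\<^esub>) \<in> carrier B"
        using z x l by (intro \<Lambda>c) auto
    qed
    \<comment> \<open>With \<open>e_l\<close> on the left, the coefficients add up to
      \<open>\<Sum>_l f_l (u x e_l)\<close>, which is the trace of \<open>u x\<close>.\<close>
    also have "\<dots> = \<Theta> (z \<otimes>\<^bsub>E2\<^esub> pure2 x \<one>\<^bsub>B\<^esub>)"
    proof (rule additive2_eqI[OF _ _ z])
      fix u v assume uv: "u \<in> carrier B" "v \<in> carrier B"
      have "(\<Oplus>\<^bsub>B\<^esub> l\<in>{..<n}. \<Lambda> l (pure2 u v \<otimes>\<^bsub>E2\<^esub> pure2 (x \<otimes>\<^bsub>B\<^esub> e l) \<one>\<^bsub>B\<^esub>)) =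
          (\<Oplus>\<^bsub>B\<^esub> l\<in>{..<n}. f l ((u \<otimes>\<^bsub>B\<^esub> x) \<otimes>\<^bsub>B\<^esub> e l) \<odot>\<^bsub>B\<^esub> v)"
        using uv x dbD by (intro M.finsum_cong') (auto simp: pure2_simps \<Lambda>_pure m_assoc)
      also have "\<dots> = Tr (u \<otimes>\<^bsub>B\<^esub> x) \<odot>\<^bsub>B\<^esub> v"
        using uv x dbD by (subst finsum_smult_rdistr[symmetric]) (auto simp: trace_eq[OF db])
      finally show "(\<Oplus>\<^bsub>B\<^esub> l\<in>{..<n}. \<Lambda> l (pure2 u v \<otimes>\<^bsub>E2\<^esub> pure2 (x \<otimes>\<^bsub>B\<^esub> e l) \<one>\<^bsub>B\<^esub>)) =
          \<Theta> (pure2 u v \<otimes>\<^bsub>E2\<^esub> pure2 x \<one>\<^bsub>B\<^esub>)"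
        using uv x by (simp add: pure2_simps \<Theta>(2))
    qed (use x dbD \<Lambda> \<Theta> in \<open>auto intro!: additive2_sum additive2_mult\<close>)
    \<comment> \<open>Expanding \<open>u\<close> itself in the dual basis separates \<open>x\<close>
      from \<open>z\<close>: the coefficients \<open>\<Lambda>_l z\<close> are the same for all
      \<open>x\<close>.\<close>
    also have "\<dots> = (\<Oplus>\<^bsub>B\<^esub> l\<in>{..<n}. Tr (x \<otimes>\<^bsub>B\<^esub> e l) \<odot>\<^bsub>B\<^esub> \<Lambda> l z)"
    proof (rule additive2_eqI[OF _ _ z])
      fix u v assume uv: "u \<in> carrier B" "v \<in> carrier B"
      have form: "linear_form A B (\<lambda>y. Tr (x \<otimes>\<^bsub>B\<^esub> y))"
        using traceD linear_mapD[OF mult_linear[OF x]] by (auto simp: linear_form_def)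
      have "(\<Oplus>\<^bsub>B\<^esub> l\<in>{..<n}. Tr (x \<otimes>\<^bsub>B\<^esub> e l) \<odot>\<^bsub>B\<^esub> \<Lambda> l (pure2 u v)) =
          (\<Oplus>\<^bsub>B\<^esub> l\<in>{..<n}. (f l u \<otimes> Tr (x \<otimes>\<^bsub>B\<^esub> e l)) \<odot>\<^bsub>B\<^esub> v)"
        using uv tr dbD by (intro M.finsum_cong') (auto simp: \<Lambda>_pure R.m_comm simp flip: smult_assoc1)
      also have "\<dots> = (\<Oplus>l\<in>{..<n}. f l u \<otimes> Tr (x \<otimes>\<^bsub>B\<^esub> e l)) \<odot>\<^bsub>B\<^esub> v"
        using uv tr dbD by (intro finsum_smult_rdistr[symmetric]) auto
      also have "(\<Oplus>l\<in>{..<n}. f l u \<otimes> Tr (x \<otimes>\<^bsub>B\<^esub> e l)) = Tr (x \<otimes>\<^bsub>B\<^esub> (\<Oplus>\<^bsub>B\<^esub> l\<in>{..<n}. f l u \<odot>\<^bsub>B\<^esub> e l))"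
        using uv dbD by (intro linear_form_lin_comb[OF form, symmetric]) auto
      also have "\<dots> = Tr (u \<otimes>\<^bsub>B\<^esub> x)"
        using uv x by (simp add: dbD(4) m_comm)
      finally show "\<Theta> (pure2 u v \<otimes>\<^bsub>E2\<^esub> pure2 x \<one>\<^bsub>B\<^esub>) =
          (\<Oplus>\<^bsub>B\<^esub> l\<in>{..<n}. Tr (x \<otimes>\<^bsub>B\<^esub> e l) \<odot>\<^bsub>B\<^esub> \<Lambda> l (pure2 u v))"
        using uv x by (simp add: pure2_simps \<Theta>(2))
    qed (use x tr \<Lambda> \<Theta> in \<open>auto intro!: additive2_sum additive2_mult additive2_smult\<close>)
    finally show ?thesis
      using x \<mu>_closed[OF z] by (simp add: m_comm)
  qed
  moreover have "(\<lambda>l. \<Lambda> l z) \<in> {..<n} \<rightarrow> carrier B"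
    using \<Lambda>c z by auto
  ultimately show thesis
    using that by blast
qed

section \<open>The ideal J and its square\<close>

definition "\<delta> b = pure2 \<one>\<^bsub>B\<^esub> b \<ominus>\<^bsub>E2\<^esub> pure2 b \<one>\<^bsub>B\<^esub>"

definition "J = {t \<in> carrier E2. \<mu> t = \<zero>\<^bsub>B\<^esub>}"

text \<open>The square of \<open>J\<close>, since the \<open>\<delta> (e_l)\<close> generate
  \<open>J\<close>. The shape is chosen for the determinant trick, where members of it are rewritten
  as combinations of the \<open>\<delta> (e_l)\<close> with coefficients in
  \<open>J\<close>.\<close>

definition "Jsquare = {\<Oplus>\<^bsub>E2\<^esub> l\<in>{..<n}. w l \<otimes>\<^bsub>E2\<^esub> \<delta> (e l) | w. w \<in> {..<n} \<rightarrow> J}"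

lemma \<delta>_closed [simp, intro]: "b \<in> carrier B \<Longrightarrow> \<delta> b \<in> carrier E2"
  by (simp add: \<delta>_def)

lemma \<delta>_in_J: "b \<in> carrier B \<Longrightarrow> \<delta> b \<in> J"
  by (simp add: J_def \<delta>_def E2.M.minus_eq \<mu>_pure M.r_neg)

lemma \<delta>_semilinear: "semilinear E2 \<delta>"
proof -
  have "\<delta> (a \<odot>\<^bsub>B\<^esub> b) = (a \<odot>\<^bsub>B\<^esub> \<one>\<^bsub>B\<^esub>) \<odot>\<^bsub>E2\<^esub> \<delta> b" if ab: "a \<in> carrier A" "b \<in> carrier B" for a b
  proof -
    have "(a \<odot>\<^bsub>B\<^esub> \<one>\<^bsub>B\<^esub>) \<odot>\<^bsub>E2\<^esub> \<delta> b = pure2 ((a \<odot>\<^bsub>B\<^esub> \<one>\<^bsub>B\<^esub>) \<otimes>\<^bsub>B\<^esub> \<one>\<^bsub>B\<^esub>) b \<ominus>\<^bsub>E2\<^esub> pure2 ((a \<odot>\<^bsub>B\<^esub> \<one>\<^bsub>B\<^esub>) \<otimes>\<^bsub>B\<^esub> b) \<one>\<^bsub>B\<^esub>"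
      using ab by (simp add: \<delta>_def E2.M.minus_eq E2.smult_r_distr E2.smult_r_minus pure2_simps(4))
    then show ?thesis
      using ab by (simp add: \<delta>_def scalar_mult pure2_simps(5))
  qed
  then show ?thesis
    by (auto simp: semilinear_def \<delta>_def pure2_simps(2,3) E2.M.minus_eq E2.M.minus_add E2.M.a_ac)
qed

lemma J_ideal:
  "t \<in> J \<Longrightarrow> t \<in> carrier E2" "t \<in> J \<Longrightarrow> t' \<in> J \<Longrightarrow> t \<oplus>\<^bsub>E2\<^esub> t' \<in> J"
  "t \<in> J \<Longrightarrow> w \<in> carrier E2 \<Longrightarrow> t \<otimes>\<^bsub>E2\<^esub> w \<in> J" "\<zero>\<^bsub>E2\<^esub> \<in> J"
  by (auto simp: J_def \<mu>_closed)

text \<open>On a pure tensor this is \<open>u \<otimes> v - u v \<otimes> 1 = u \<delta>(v)\<close>.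
  Subtracting \<open>\<mu> t \<otimes> 1\<close> makes the claim meaningful for all tensors and thus
  accessible to induction: the pure tensors that sum up to an element of \<open>J\<close> need not
  lie in \<open>J\<close> themselves.\<close>

lemma J_generated:
  assumes "t \<in> carrier E2"
  shows "\<exists>w\<in>{..<n} \<rightarrow> carrier E2. t \<ominus>\<^bsub>E2\<^esub> pure2 (\<mu> t) \<one>\<^bsub>B\<^esub> = (\<Oplus>\<^bsub>E2\<^esub> l\<in>{..<n}. w l \<otimes>\<^bsub>E2\<^esub> \<delta> (e l))"
  using assms
proof (induction rule: E2_induct)
  case (pure u v)
  have fv: "f l v \<odot>\<^bsub>B\<^esub> \<one>\<^bsub>B\<^esub> \<in> carrier B" if "l < n" for l
    using dbD that pure by simp
  have "pure2 u v \<ominus>\<^bsub>E2\<^esub> pure2 (\<mu> (pure2 u v)) \<one>\<^bsub>B\<^esub> = u \<odot>\<^bsub>E2\<^esub> \<delta> v"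
    using pure by (simp add: \<mu>_pure \<delta>_def E2.M.minus_eq E2.smult_r_distr E2.smult_r_minus pure2_simps(4))
  also have "\<delta> v = (\<Oplus>\<^bsub>E2\<^esub> l\<in>{..<n}. (f l v \<odot>\<^bsub>B\<^esub> \<one>\<^bsub>B\<^esub>) \<odot>\<^bsub>E2\<^esub> \<delta> (e l))"
    by (rule semilinear_expand[OF E2.module_axioms \<delta>_semilinear pure(2)])
  also have "u \<odot>\<^bsub>E2\<^esub> \<dots> = (\<Oplus>\<^bsub>E2\<^esub> l\<in>{..<n}. (u \<otimes>\<^bsub>B\<^esub> (f l v \<odot>\<^bsub>B\<^esub> \<one>\<^bsub>B\<^esub>)) \<odot>\<^bsub>E2\<^esub> \<delta> (e l))"
    using pure dbD fv by (intro E2.smult_lin_comb) auto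
  also have "\<dots> = (\<Oplus>\<^bsub>E2\<^esub> l\<in>{..<n}. pure2 (u \<otimes>\<^bsub>B\<^esub> (f l v \<odot>\<^bsub>B\<^esub> \<one>\<^bsub>B\<^esub>)) \<one>\<^bsub>B\<^esub> \<otimes>\<^bsub>E2\<^esub> \<delta> (e l))"
    by (simp add: E2_smult)
  finally show ?case
    using pure fv by (intro bexI[of _ "\<lambda>l. pure2 (u \<otimes>\<^bsub>B\<^esub> (f l v \<odot>\<^bsub>B\<^esub> \<one>\<^bsub>B\<^esub>)) \<one>\<^bsub>B\<^esub>"]) auto
next
  case (add t t')
  then obtain w w' where w: "w \<in> {..<n} \<rightarrow> carrier E2" "w' \<in> {..<n} \<rightarrow> carrier E2"
    "t \<ominus>\<^bsub>E2\<^esub> pure2 (\<mu> t) \<one>\<^bsub>B\<^esub> = (\<Oplus>\<^bsub>E2\<^esub> l\<in>{..<n}. w l \<otimes>\<^bsub>E2\<^esub> \<delta> (e l))"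
    "t' \<ominus>\<^bsub>E2\<^esub> pure2 (\<mu> t') \<one>\<^bsub>B\<^esub> = (\<Oplus>\<^bsub>E2\<^esub> l\<in>{..<n}. w' l \<otimes>\<^bsub>E2\<^esub> \<delta> (e l))"
    by blast
  have wc: "w l \<in> carrier E2" "w' l \<in> carrier E2" if "l < n" for l
    using w that by auto
  have "(t \<oplus>\<^bsub>E2\<^esub> t') \<ominus>\<^bsub>E2\<^esub> pure2 (\<mu> (t \<oplus>\<^bsub>E2\<^esub> t')) \<one>\<^bsub>B\<^esub> =
      (t \<ominus>\<^bsub>E2\<^esub> pure2 (\<mu> t) \<one>\<^bsub>B\<^esub>) \<oplus>\<^bsub>E2\<^esub> (t' \<ominus>\<^bsub>E2\<^esub> pure2 (\<mu> t') \<one>\<^bsub>B\<^esub>)"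
    using add \<mu>_closed by (simp add: \<mu>_add pure2_simps(2) E2.M.minus_eq E2.M.minus_add E2.M.a_ac)
  also have "\<dots> = (\<Oplus>\<^bsub>E2\<^esub> l\<in>{..<n}. w l \<otimes>\<^bsub>E2\<^esub> \<delta> (e l) \<oplus>\<^bsub>E2\<^esub> w' l \<otimes>\<^bsub>E2\<^esub> \<delta> (e l))"
    unfolding w(3,4) using wc dbD by (intro E2.M.finsum_addf[symmetric]) auto
  also have "\<dots> = (\<Oplus>\<^bsub>E2\<^esub> l\<in>{..<n}. (w l \<oplus>\<^bsub>E2\<^esub> w' l) \<otimes>\<^bsub>E2\<^esub> \<delta> (e l))"
    using wc dbD by (intro E2.M.finsum_cong') (auto simp: E2.l_distr)
  finally show ?case
    using wc by (intro bexI[of _ "\<lambda>l. w l \<oplus>\<^bsub>E2\<^esub> w' l"]) auto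
qed

lemma Jsquare_mult:
  assumes "t \<in> J" "t' \<in> J"
  shows "t \<otimes>\<^bsub>E2\<^esub> t' \<in> Jsquare"
proof -
  note c = J_ideal(1)[OF assms(1)] J_ideal(1)[OF assms(2)]
  obtain w where w: "w \<in> {..<n} \<rightarrow> carrier E2"
    "t' \<ominus>\<^bsub>E2\<^esub> pure2 (\<mu> t') \<one>\<^bsub>B\<^esub> = (\<Oplus>\<^bsub>E2\<^esub> l\<in>{..<n}. w l \<otimes>\<^bsub>E2\<^esub> \<delta> (e l))"
    using J_generated[OF c(2)] by blast
  have wc: "w l \<in> carrier E2" if "l < n" for l
    using w that by auto
  have "pure2 \<zero>\<^bsub>B\<^esub> \<one>\<^bsub>B\<^esub> = \<zero>\<^bsub>E2\<^esub>"
    by (simp add: TT.base_change_simps)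
  then have "t' = (\<Oplus>\<^bsub>E2\<^esub> l\<in>{..<n}. w l \<otimes>\<^bsub>E2\<^esub> \<delta> (e l))"
    using w(2) assms(2) c(2) by (simp add: J_def)
  then have "t \<otimes>\<^bsub>E2\<^esub> t' = (\<Oplus>\<^bsub>E2\<^esub> l\<in>{..<n}. t \<otimes>\<^bsub>E2\<^esub> (w l \<otimes>\<^bsub>E2\<^esub> \<delta> (e l)))"
    using wc dbD c by (simp add: E2.finsum_rdistr Pi_iff)
  also have "\<dots> = (\<Oplus>\<^bsub>E2\<^esub> l\<in>{..<n}. (t \<otimes>\<^bsub>E2\<^esub> w l) \<otimes>\<^bsub>E2\<^esub> \<delta> (e l))"
    using wc dbD c by (intro E2.M.finsum_cong') (auto simp: E2.m_assoc)
  finally show ?thesis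
    unfolding Jsquare_def using J_ideal(3)[OF assms(1) wc]
    by (intro CollectI exI[of _ "\<lambda>l. t \<otimes>\<^bsub>E2\<^esub> w l"]) auto
qed

lemma Jsquare_submodule: "submodule Jsquare B E2"
proof (rule E2.submoduleI')
  have c: "w l \<otimes>\<^bsub>E2\<^esub> \<delta> (e l) \<in> carrier E2" if "w \<in> {..<n} \<rightarrow> J" "l < n" for w l
    using that J_ideal(1) dbD(1) by (intro E2.m_closed \<delta>_closed) auto
  show "Jsquare \<subseteq> carrier E2"
    unfolding Jsquare_def using c by (auto intro!: E2.M.finsum_closed)
  show "\<zero>\<^bsub>E2\<^esub> \<in> Jsquare"
    using Jsquare_mult[OF J_ideal(4,4)] by simp
  fix x y assume "x \<in> Jsquare" "y \<in> Jsquare"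
  then obtain w w' where w: "w \<in> {..<n} \<rightarrow> J" "w' \<in> {..<n} \<rightarrow> J"
    "x = (\<Oplus>\<^bsub>E2\<^esub> l\<in>{..<n}. w l \<otimes>\<^bsub>E2\<^esub> \<delta> (e l))" "y = (\<Oplus>\<^bsub>E2\<^esub> l\<in>{..<n}. w' l \<otimes>\<^bsub>E2\<^esub> \<delta> (e l))"
    by (auto simp: Jsquare_def)
  then have wc: "w l \<in> J" "w' l \<in> J" if "l < n" for l
    using that by auto
  note wE = J_ideal(1)[OF wc(1)] J_ideal(1)[OF wc(2)]
  have "x \<oplus>\<^bsub>E2\<^esub> y = (\<Oplus>\<^bsub>E2\<^esub> l\<in>{..<n}. w l \<otimes>\<^bsub>E2\<^esub> \<delta> (e l) \<oplus>\<^bsub>E2\<^esub> w' l \<otimes>\<^bsub>E2\<^esub> \<delta> (e l))"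
    unfolding w(3,4) using c w(1,2) by (intro E2.M.finsum_addf[symmetric]) auto
  also have "\<dots> = (\<Oplus>\<^bsub>E2\<^esub> l\<in>{..<n}. (w l \<oplus>\<^bsub>E2\<^esub> w' l) \<otimes>\<^bsub>E2\<^esub> \<delta> (e l))"
    using wE dbD by (intro E2.M.finsum_cong') (auto simp: E2.l_distr)
  finally show "x \<oplus>\<^bsub>E2\<^esub> y \<in> Jsquare"
    unfolding Jsquare_def using J_ideal(2) wc by (intro CollectI exI[of _ "\<lambda>l. w l \<oplus>\<^bsub>E2\<^esub> w' l"]) auto
next
  fix b x assume b: "b \<in> carrier B" and "x \<in> Jsquare"
  then obtain w where w: "w \<in> {..<n} \<rightarrow> J" "x = (\<Oplus>\<^bsub>E2\<^esub> l\<in>{..<n}. w l \<otimes>\<^bsub>E2\<^esub> \<delta> (e l))"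
    by (auto simp: Jsquare_def)
  then have wc: "w l \<in> J" if "l < n" for l
    using that by auto
  note wE = J_ideal(1)[OF wc]
  have "b \<odot>\<^bsub>E2\<^esub> x = (\<Oplus>\<^bsub>E2\<^esub> l\<in>{..<n}. b \<odot>\<^bsub>E2\<^esub> (w l \<otimes>\<^bsub>E2\<^esub> \<delta> (e l)))"
    unfolding w(2) using b wE dbD by (intro E2.smult_finsum) auto
  also have "\<dots> = (\<Oplus>\<^bsub>E2\<^esub> l\<in>{..<n}. (w l \<otimes>\<^bsub>E2\<^esub> pure2 b \<one>\<^bsub>B\<^esub>) \<otimes>\<^bsub>E2\<^esub> \<delta> (e l))"
    using b wE dbD by (intro E2.M.finsum_cong') (auto simp: E2_smult E2.m_ac)
  finally show "b \<odot>\<^bsub>E2\<^esub> x \<in> Jsquare"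
    unfolding Jsquare_def using J_ideal(3) wc b by (intro CollectI exI[of _ "\<lambda>l. w l \<otimes>\<^bsub>E2\<^esub> pure2 b \<one>\<^bsub>B\<^esub>"]) auto
qed

section \<open>From differentials to J modulo its square\<close>

sublocale JQ: module_quotient B E2 Jsquare
  by (rule module_quotient.intro[OF E2.module_axioms], rule module_quotient_axioms.intro, rule Jsquare_submodule)

abbreviation "Q2 \<equiv> quotient_module E2 Jsquare"

lemma Q2_module: "module B Q2"
  by (rule JQ.quotient_is_module)

text \<open>In \<open>B \<otimes> B\<close> the defect of the Leibniz rule is exactly the product of
  \<delta>\<open>(b)\<close> and \<delta>\<open>(b')\<close>, an element of
  \<open>J^2\<close>.\<close>

lemma \<delta>_derivation: "derivation Q2 (\<lambda>b. Jsquare +>\<^bsub>E2\<^esub> \<delta> b)"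
proof -
  have "Jsquare +>\<^bsub>E2\<^esub> \<delta> (b \<otimes>\<^bsub>B\<^esub> b') =
      b \<odot>\<^bsub>Q2\<^esub> (Jsquare +>\<^bsub>E2\<^esub> \<delta> b') \<oplus>\<^bsub>Q2\<^esub> b' \<odot>\<^bsub>Q2\<^esub> (Jsquare +>\<^bsub>E2\<^esub> \<delta> b)"
    if b: "b \<in> carrier B" "b' \<in> carrier B" for b b'
  proof -
    define p q p' q' where pq: "p = pure2 b \<one>\<^bsub>B\<^esub>" "q = pure2 \<one>\<^bsub>B\<^esub> b" "p' = pure2 b' \<one>\<^bsub>B\<^esub>" "q' = pure2 \<one>\<^bsub>B\<^esub> b'"
    have c: "p \<in> carrier E2" "q \<in> carrier E2" "p' \<in> carrier E2" "q' \<in> carrier E2"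
      using b by (auto simp: pq)
    have "\<delta> (b \<otimes>\<^bsub>B\<^esub> b') = q \<otimes>\<^bsub>E2\<^esub> q' \<ominus>\<^bsub>E2\<^esub> p \<otimes>\<^bsub>E2\<^esub> p'" "\<delta> b = q \<ominus>\<^bsub>E2\<^esub> p" "\<delta> b' = q' \<ominus>\<^bsub>E2\<^esub> p'"
      using b by (simp_all add: \<delta>_def pq pure2_simps)
    moreover have "q \<otimes>\<^bsub>E2\<^esub> q' \<ominus>\<^bsub>E2\<^esub> p \<otimes>\<^bsub>E2\<^esub> p' \<ominus>\<^bsub>E2\<^esub>
        (p \<otimes>\<^bsub>E2\<^esub> (q' \<ominus>\<^bsub>E2\<^esub> p') \<oplus>\<^bsub>E2\<^esub> p' \<otimes>\<^bsub>E2\<^esub> (q \<ominus>\<^bsub>E2\<^esub> p)) =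
        (q \<ominus>\<^bsub>E2\<^esub> p) \<otimes>\<^bsub>E2\<^esub> (q' \<ominus>\<^bsub>E2\<^esub> p')"
      using c by (simp add: E2.M.minus_eq E2.l_distr E2.r_distr E2.l_minus E2.r_minus E2.M.minus_add E2.m_comm E2.M.a_ac
          E2.M.add_cancel_middle)
    ultimately have "\<delta> (b \<otimes>\<^bsub>B\<^esub> b') \<ominus>\<^bsub>E2\<^esub> (b \<odot>\<^bsub>E2\<^esub> \<delta> b' \<oplus>\<^bsub>E2\<^esub> b' \<odot>\<^bsub>E2\<^esub> \<delta> b) = \<delta> b \<otimes>\<^bsub>E2\<^esub> \<delta> b'"
      by (simp add: E2_smult pq)
    then have "Jsquare +>\<^bsub>E2\<^esub> \<delta> (b \<otimes>\<^bsub>B\<^esub> b') = Jsquare +>\<^bsub>E2\<^esub> (b \<odot>\<^bsub>E2\<^esub> \<delta> b' \<oplus>\<^bsub>E2\<^esub> b' \<odot>\<^bsub>E2\<^esub> \<delta> b)"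
      using b by (intro JQ.coset_eqI) (auto simp: Jsquare_mult \<delta>_in_J)
    then show ?thesis
      using b by (simp add: JQ.coset_add JQ.coset_smult)
  qed
  moreover have "\<delta> (a \<odot>\<^bsub>B\<^esub> \<one>\<^bsub>B\<^esub>) = \<zero>\<^bsub>E2\<^esub>" if "a \<in> carrier A" for a
    using that by (simp add: \<delta>_def pure2_simps(5) E2.M.minus_eq E2.M.r_neg)
  ultimately show ?thesis
    using \<delta>_semilinear unfolding derivation_def semilinear_def
    by (auto simp: JQ.coset_closed JQ.coset_add JQ.coset_zero)
qed

text \<open>The images of a generating system of \<open>\<Omega>\<close> in \<open>J / J\<^sup>2\<close> are lifted to \<open>J\<close> and extended by the
  generators \<open>\<delta> e\<^sub>l\<close> of \<open>J\<close>. Their relations modulo \<open>J\<^sup>2\<close> become relations in \<open>J\<close> after a change of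
  the coefficients by elements of \<open>J\<close>; the determinant of these relations annihilates \<open>J\<close>.\<close>

lemma minor_lifts_to_annihilator:
  assumes pres: "presentation B \<Omega> m x k W" and r: "r ` {..<m} \<subseteq> {..<k}"
  obtains z where "z \<in> carrier E2" "\<mu> z = mat_det B m (\<lambda>i j. W (r i) j)"
    "\<And>l. l < n \<Longrightarrow> z \<otimes>\<^bsub>E2\<^esub> \<delta> (e l) = \<zero>\<^bsub>E2\<^esub>"
proof -
  interpret Q2: module B Q2
    by (rule Q2_module)
  note pres = pres[unfolded presentation_def]
  note xc = conjunct1[OF pres]
  note rest = conjunct2[OF conjunct2[OF pres]]
  have W: "W i j \<in> carrier B" if "i < k" "j < m" for i j
    using conjunct1[OF conjunct2[OF pres]] that by simp
  have gen: "\<exists>c\<in>{..<m} \<rightarrow> carrier B. y = (\<Oplus>\<^bsub>\<Omega>\<^esub> j\<in>{..<m}. c j \<odot>\<^bsub>\<Omega>\<^esub> x j)" if "y \<in> carrier \<Omega>" for y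
    by (rule bspec[OF conjunct1[OF rest] that])
  have rel: "(\<Oplus>\<^bsub>\<Omega>\<^esub> j\<in>{..<m}. c j \<odot>\<^bsub>\<Omega>\<^esub> x j) = \<zero>\<^bsub>\<Omega>\<^esub>"
    if c: "c \<in> {..<m} \<rightarrow> carrier B" and u: "u \<in> {..<k} \<rightarrow> carrier B"
      and cu: "\<And>j. j < m \<Longrightarrow> c j = (\<Oplus>\<^bsub>B\<^esub> i\<in>{..<k}. u i \<otimes>\<^bsub>B\<^esub> W i j)" for c u
    by (rule bspec[OF conjunct2[OF rest] c, THEN iffD2]) (rule bexI[of _ u], intro allI impI, rule cu, assumption, rule u)
  have rk: "r i < k" if "i < m" for i
    using r that by auto
  have Wr: "W (r i) j \<in> carrier B" if "i < m" "j < m" for i j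
    using W rk that by blast
  have row: "(\<Oplus>\<^bsub>\<Omega>\<^esub> j\<in>{..<m}. W (r i) j \<odot>\<^bsub>\<Omega>\<^esub> x j) = \<zero>\<^bsub>\<Omega>\<^esub>" if i: "i < m" for i
  proof (rule rel[of _ "\<lambda>i'. if r i = i' then \<one>\<^bsub>B\<^esub> else \<zero>\<^bsub>B\<^esub>"])
    fix j assume j: "j < m"
    have "(\<Oplus>\<^bsub>B\<^esub> i'\<in>{..<k}. (if r i = i' then \<one>\<^bsub>B\<^esub> else \<zero>\<^bsub>B\<^esub>) \<otimes>\<^bsub>B\<^esub> W i' j) =
        (\<Oplus>\<^bsub>B\<^esub> i'\<in>{..<k}. if r i = i' then W i' j else \<zero>\<^bsub>B\<^esub>)"
      using W j by (intro M.finsum_cong') auto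
    also have "\<dots> = W (r i) j"
      using W j rk[OF i] by (intro M.finsum_singleton) auto
    finally show "W (r i) j = (\<Oplus>\<^bsub>B\<^esub> i'\<in>{..<k}. (if r i = i' then \<one>\<^bsub>B\<^esub> else \<zero>\<^bsub>B\<^esub>) \<otimes>\<^bsub>B\<^esub> W i' j)" ..
  qed (use Wr i in auto)
  obtain h where h: "linear_map B \<Omega> Q2 h" "\<And>b. b \<in> carrier B \<Longrightarrow> h (kd b) = Jsquare +>\<^bsub>E2\<^esub> \<delta> b"
    using kaehler_universal[OF Q2_module \<delta>_derivation] by blast
  have "\<exists>t. t \<in> carrier E2 \<and> h (x j) = Jsquare +>\<^bsub>E2\<^esub> t" if "j < m" for j
  proof -
    have "h (x j) \<in> carrier Q2"
      using linear_mapD(1)[OF h(1)] xc that by auto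
    then show ?thesis
      by (rule JQ.quotient_elem) auto
  qed
  then obtain X where X: "\<And>j. j < m \<Longrightarrow> X j \<in> carrier E2" "\<And>j. j < m \<Longrightarrow> h (x j) = Jsquare +>\<^bsub>E2\<^esub> X j"
    by metis
  have comb_closed: "(\<Oplus>\<^bsub>E2\<^esub> j\<in>{..<m}. c j \<odot>\<^bsub>E2\<^esub> X j) \<in> carrier E2" if "c \<in> {..<m} \<rightarrow> carrier B" for c
    using that X(1) by (intro E2.M.finsum_closed) auto
  have h_comb: "h (\<Oplus>\<^bsub>\<Omega>\<^esub> j\<in>{..<m}. c j \<odot>\<^bsub>\<Omega>\<^esub> x j) = Jsquare +>\<^bsub>E2\<^esub> (\<Oplus>\<^bsub>E2\<^esub> j\<in>{..<m}. c j \<odot>\<^bsub>E2\<^esub> X j)"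
    if c: "c \<in> {..<m} \<rightarrow> carrier B" for c
  proof -
    have "h (\<Oplus>\<^bsub>\<Omega>\<^esub> j\<in>{..<m}. c j \<odot>\<^bsub>\<Omega>\<^esub> x j) = (\<Oplus>\<^bsub>Q2\<^esub> j\<in>{..<m}. c j \<odot>\<^bsub>Q2\<^esub> h (x j))"
      by (rule \<Omega>.linear_map_lin_comb[OF Q2_module h(1) c xc])
    also have "\<dots> = (\<Oplus>\<^bsub>Q2\<^esub> j\<in>{..<m}. c j \<odot>\<^bsub>Q2\<^esub> (Jsquare +>\<^bsub>E2\<^esub> X j))"
      using c X by (intro Q2.M.finsum_cong') (auto simp: JQ.coset_closed Pi_iff)
    also have "\<dots> = Jsquare +>\<^bsub>E2\<^esub> (\<Oplus>\<^bsub>E2\<^esub> j\<in>{..<m}. c j \<odot>\<^bsub>E2\<^esub> X j)"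
      using c X by (intro E2.linear_map_lin_comb[OF Q2_module JQ.coset_linear, symmetric]) auto
    finally show ?thesis .
  qed
  \<comment> \<open>A relation in \<Omega> says only that the same combination of the lifts lies in
    \<open>Jsquare\<close>; \<open>w\<close> holds the coefficients in \<open>J\<close> of this
    error term.\<close>
  define P1 where "P1 i w \<longleftrightarrow> w \<in> {..<n} \<rightarrow> J \<and>
      (\<Oplus>\<^bsub>E2\<^esub> j\<in>{..<m}. W (r i) j \<odot>\<^bsub>E2\<^esub> X j) = (\<Oplus>\<^bsub>E2\<^esub> l\<in>{..<n}. w l \<otimes>\<^bsub>E2\<^esub> \<delta> (e l))" for i w
  have "\<exists>w. P1 i w"
    if i: "i < m" for i
  proof -
    have Wi: "W (r i) \<in> {..<m} \<rightarrow> carrier B"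
      using Wr i by auto
    have "Jsquare +>\<^bsub>E2\<^esub> (\<Oplus>\<^bsub>E2\<^esub> j\<in>{..<m}. W (r i) j \<odot>\<^bsub>E2\<^esub> X j) = \<zero>\<^bsub>Q2\<^esub>"
      using h_comb[OF Wi] row[OF i] linear_map_zero[OF \<Omega>_module Q2_module h(1)] by simp
    then have "(\<Oplus>\<^bsub>E2\<^esub> j\<in>{..<m}. W (r i) j \<odot>\<^bsub>E2\<^esub> X j) \<in> Jsquare"
      using JQ.coset_eq_zero_iff[OF comb_closed[OF Wi]] by blast
    then show ?thesis
      by (auto simp: Jsquare_def P1_def)
  qed
  then obtain N1 where P1: "\<And>i. i < m \<Longrightarrow> P1 i (N1 i)"
    by metis
  note N1 = P1[unfolded P1_def, THEN conjunct1] P1[unfolded P1_def, THEN conjunct2]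
  \<comment> \<open>The \<open>x_j\<close> generate \<Omega>, so \<open>d e_l\<close> is a
    combination of them. In \<open>B \<otimes> B\<close> this expresses
    \<open>\<delta> (e_l)\<close> through the \<open>X_j\<close>, again up to an error with
    coefficients in \<open>J\<close>.\<close>
  define P2 where "P2 l c w \<longleftrightarrow> c \<in> {..<m} \<rightarrow> carrier B \<and> w \<in> {..<n} \<rightarrow> J \<and>
      \<delta> (e l) \<ominus>\<^bsub>E2\<^esub> (\<Oplus>\<^bsub>E2\<^esub> j\<in>{..<m}. c j \<odot>\<^bsub>E2\<^esub> X j) = (\<Oplus>\<^bsub>E2\<^esub> l'\<in>{..<n}. w l' \<otimes>\<^bsub>E2\<^esub> \<delta> (e l'))" for l c w
  have "\<exists>c w. P2 l c w"
    if l: "l < n" for l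
  proof -
    note el = dbD(1)[OF l]
    obtain c where c: "c \<in> {..<m} \<rightarrow> carrier B" "kd (e l) = (\<Oplus>\<^bsub>\<Omega>\<^esub> j\<in>{..<m}. c j \<odot>\<^bsub>\<Omega>\<^esub> x j)"
      using gen[OF kd_closed[OF el]] by blast
    have "Jsquare +>\<^bsub>E2\<^esub> \<delta> (e l) = Jsquare +>\<^bsub>E2\<^esub> (\<Oplus>\<^bsub>E2\<^esub> j\<in>{..<m}. c j \<odot>\<^bsub>E2\<^esub> X j)"
      using h(2)[OF el] h_comb[OF c(1)] c(2) by simp
    then have "\<delta> (e l) \<ominus>\<^bsub>E2\<^esub> (\<Oplus>\<^bsub>E2\<^esub> j\<in>{..<m}. c j \<odot>\<^bsub>E2\<^esub> X j) \<in> Jsquare"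
      using JQ.coset_eq_iff[OF \<delta>_closed[OF el] comb_closed[OF c(1)]] by blast
    then show ?thesis
      using c(1) by (auto simp: Jsquare_def P2_def)
  qed
  then obtain C N2 where CN: "\<And>l. l < n \<Longrightarrow> P2 l (C l) (N2 l)"
    by metis
  note C = CN[unfolded P2_def, THEN conjunct1]
  note N2 = CN[unfolded P2_def, THEN conjunct2, THEN conjunct1] CN[unfolded P2_def, THEN conjunct2, THEN conjunct2]
  have Cc: "C l j \<in> carrier B" if "l < n" "j < m" for l j
    using C that by auto
  have N1J: "N1 i l \<in> J" if "i < m" "l < n" for i l
    using N1(1) that by auto
  have N2J: "N2 i l \<in> J" if "i < n" "l < n" for i l
    using N2(1) that by auto
  note Nc = J_ideal(1)[OF N1J] J_ideal(1)[OF N2J]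
  \<comment> \<open>The relations \<open>P1\<close> and \<open>P2\<close> with all terms on one
    side, as a block matrix with rows \<open>(W \<otimes> 1, - N1)\<close> and
    \<open>(- C \<otimes> 1, 1 - N2)\<close>. It kills the column \<open>V\<close> made of the
    \<open>X_j\<close> followed by the \<open>\<delta> (e_l)\<close>.\<close>
  define Q where "Q i j =
    (if i < m then if j < m then pure2 (W (r i) j) \<one>\<^bsub>B\<^esub> else \<ominus>\<^bsub>E2\<^esub> N1 i (j - m)
     else if j < m then \<ominus>\<^bsub>E2\<^esub> pure2 (C (i - m) j) \<one>\<^bsub>B\<^esub>
     else (if i = j then \<one>\<^bsub>E2\<^esub> else \<zero>\<^bsub>E2\<^esub>) \<ominus>\<^bsub>E2\<^esub> N2 (i - m) (j - m))" for i j
  define V where "V j = (if j < m then X j else \<delta> (e (j - m)))" for j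
  have Q: "Q i j \<in> carrier E2" if "i < m + n" "j < m + n" for i j
    using that Wr Cc Nc by (auto simp: Q_def)
  have V: "V j \<in> carrier E2" if "j < m + n" for j
    using that X(1) dbD(1) by (auto simp: V_def)
  have QV: "(\<Oplus>\<^bsub>E2\<^esub> j\<in>{..<m + n}. Q i j \<otimes>\<^bsub>E2\<^esub> V j) = \<zero>\<^bsub>E2\<^esub>" if i: "i < m + n" for i
  proof -
    have "(\<Oplus>\<^bsub>E2\<^esub> j\<in>{..<m + n}. Q i j \<otimes>\<^bsub>E2\<^esub> V j) =
        (\<Oplus>\<^bsub>E2\<^esub> j\<in>{..<m}. Q i j \<otimes>\<^bsub>E2\<^esub> X j) \<oplus>\<^bsub>E2\<^esub> (\<Oplus>\<^bsub>E2\<^esub> l\<in>{..<n}. Q i (m + l) \<otimes>\<^bsub>E2\<^esub> \<delta> (e l))"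
    proof -
      have "(\<Oplus>\<^bsub>E2\<^esub> j\<in>{..<m + n}. Q i j \<otimes>\<^bsub>E2\<^esub> V j) =
          (\<Oplus>\<^bsub>E2\<^esub> j\<in>{..<m}. Q i j \<otimes>\<^bsub>E2\<^esub> V j) \<oplus>\<^bsub>E2\<^esub> (\<Oplus>\<^bsub>E2\<^esub> l\<in>{..<n}. Q i (m + l) \<otimes>\<^bsub>E2\<^esub> V (m + l))"
        using Q[OF i] V by (intro E2.M.finsum_lessThan_add) auto
      also have "(\<Oplus>\<^bsub>E2\<^esub> j\<in>{..<m}. Q i j \<otimes>\<^bsub>E2\<^esub> V j) = (\<Oplus>\<^bsub>E2\<^esub> j\<in>{..<m}. Q i j \<otimes>\<^bsub>E2\<^esub> X j)"
        using Q[OF i] X(1) by (intro E2.M.finsum_cong') (auto simp: V_def)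
      also have "(\<Oplus>\<^bsub>E2\<^esub> l\<in>{..<n}. Q i (m + l) \<otimes>\<^bsub>E2\<^esub> V (m + l)) = (\<Oplus>\<^bsub>E2\<^esub> l\<in>{..<n}. Q i (m + l) \<otimes>\<^bsub>E2\<^esub> \<delta> (e l))"
        using Q[OF i] dbD(1) by (intro E2.M.finsum_cong') (auto simp: V_def)
      finally show ?thesis .
    qed
    also have "\<dots> = \<zero>\<^bsub>E2\<^esub>"
    proof (cases "i < m")
      case True
      let ?S = "\<Oplus>\<^bsub>E2\<^esub> l\<in>{..<n}. N1 i l \<otimes>\<^bsub>E2\<^esub> \<delta> (e l)"
      have S: "?S \<in> carrier E2"
        using True Nc dbD(1) by (intro E2.M.finsum_closed) auto
      have "(\<Oplus>\<^bsub>E2\<^esub> j\<in>{..<m}. Q i j \<otimes>\<^bsub>E2\<^esub> X j) = (\<Oplus>\<^bsub>E2\<^esub> j\<in>{..<m}. W (r i) j \<odot>\<^bsub>E2\<^esub> X j)"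
        using True Wr X(1) by (intro E2.M.finsum_cong') (auto simp: Q_def E2_smult)
      also have "\<dots> = ?S"
        by (rule N1(2)[OF True])
      finally have left: "(\<Oplus>\<^bsub>E2\<^esub> j\<in>{..<m}. Q i j \<otimes>\<^bsub>E2\<^esub> X j) = ?S" .
      have "(\<Oplus>\<^bsub>E2\<^esub> l\<in>{..<n}. Q i (m + l) \<otimes>\<^bsub>E2\<^esub> \<delta> (e l)) = (\<Oplus>\<^bsub>E2\<^esub> l\<in>{..<n}. \<ominus>\<^bsub>E2\<^esub> (N1 i l \<otimes>\<^bsub>E2\<^esub> \<delta> (e l)))"
        using True Nc dbD(1) by (intro E2.M.finsum_cong') (auto simp: Q_def E2.l_minus)
      also have "\<dots> = \<ominus>\<^bsub>E2\<^esub> ?S"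
        using True Nc dbD(1) by (intro E2.M.finsum_uminus) auto
      finally show ?thesis
        using S unfolding left by (simp add: E2.M.r_neg)
    next
      case False
      define l where "l = i - m"
      have l: "l < n" "i = m + l"
        using False i by (auto simp: l_def)
      note el = dbD(1)[OF l(1)]
      let ?D = "\<Oplus>\<^bsub>E2\<^esub> j\<in>{..<m}. C l j \<odot>\<^bsub>E2\<^esub> X j"
      let ?S = "\<Oplus>\<^bsub>E2\<^esub> l'\<in>{..<n}. N2 l l' \<otimes>\<^bsub>E2\<^esub> \<delta> (e l')"
      have D: "?D \<in> carrier E2"
        using Cc l X(1) by (intro E2.M.finsum_closed) auto
      have S: "?S \<in> carrier E2"
        using l Nc dbD(1) by (intro E2.M.finsum_closed) auto
      have "(\<Oplus>\<^bsub>E2\<^esub> j\<in>{..<m}. Q i j \<otimes>\<^bsub>E2\<^esub> X j) = (\<Oplus>\<^bsub>E2\<^esub> j\<in>{..<m}. \<ominus>\<^bsub>E2\<^esub> (C l j \<odot>\<^bsub>E2\<^esub> X j))"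
        using l Cc X(1) by (intro E2.M.finsum_cong') (auto simp: Q_def E2_smult E2.l_minus)
      also have "\<dots> = \<ominus>\<^bsub>E2\<^esub> ?D"
        using l Cc X(1) by (intro E2.M.finsum_uminus) auto
      finally have left: "(\<Oplus>\<^bsub>E2\<^esub> j\<in>{..<m}. Q i j \<otimes>\<^bsub>E2\<^esub> X j) = \<ominus>\<^bsub>E2\<^esub> ?D" .
      have "(\<Oplus>\<^bsub>E2\<^esub> l'\<in>{..<n}. Q i (m + l') \<otimes>\<^bsub>E2\<^esub> \<delta> (e l')) =
          (\<Oplus>\<^bsub>E2\<^esub> l'\<in>{..<n}. (if l = l' then \<delta> (e l') else \<zero>\<^bsub>E2\<^esub>) \<oplus>\<^bsub>E2\<^esub> \<ominus>\<^bsub>E2\<^esub> (N2 l l' \<otimes>\<^bsub>E2\<^esub> \<delta> (e l')))"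
        using l Nc dbD(1) by (intro E2.M.finsum_cong') (auto simp: Q_def E2.l_minus E2.M.minus_eq E2.l_distr)
      also have "\<dots> = (\<Oplus>\<^bsub>E2\<^esub> l'\<in>{..<n}. if l = l' then \<delta> (e l') else \<zero>\<^bsub>E2\<^esub>) \<oplus>\<^bsub>E2\<^esub>
          (\<Oplus>\<^bsub>E2\<^esub> l'\<in>{..<n}. \<ominus>\<^bsub>E2\<^esub> (N2 l l' \<otimes>\<^bsub>E2\<^esub> \<delta> (e l')))"
        using l Nc dbD(1) by (intro E2.M.finsum_addf) auto
      also have "(\<Oplus>\<^bsub>E2\<^esub> l'\<in>{..<n}. if l = l' then \<delta> (e l') else \<zero>\<^bsub>E2\<^esub>) = \<delta> (e l)"
        using l dbD(1) by (intro E2.M.finsum_singleton) auto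
      also have "(\<Oplus>\<^bsub>E2\<^esub> l'\<in>{..<n}. \<ominus>\<^bsub>E2\<^esub> (N2 l l' \<otimes>\<^bsub>E2\<^esub> \<delta> (e l'))) = \<ominus>\<^bsub>E2\<^esub> ?S"
        using l Nc dbD(1) by (intro E2.M.finsum_uminus) auto
      finally have right: "(\<Oplus>\<^bsub>E2\<^esub> l'\<in>{..<n}. Q i (m + l') \<otimes>\<^bsub>E2\<^esub> \<delta> (e l')) = \<delta> (e l) \<oplus>\<^bsub>E2\<^esub> \<ominus>\<^bsub>E2\<^esub> ?S" .
      have "\<ominus>\<^bsub>E2\<^esub> ?D \<oplus>\<^bsub>E2\<^esub> (\<delta> (e l) \<oplus>\<^bsub>E2\<^esub> \<ominus>\<^bsub>E2\<^esub> ?S) = (\<delta> (e l) \<ominus>\<^bsub>E2\<^esub> ?D) \<oplus>\<^bsub>E2\<^esub> \<ominus>\<^bsub>E2\<^esub> ?S"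
        using D S el by (simp add: E2.M.minus_eq E2.M.a_ac)
      also have "\<dots> = \<zero>\<^bsub>E2\<^esub>"
        unfolding N2(2)[OF l(1)] using S by (rule E2.M.r_neg)
      finally show ?thesis
        unfolding left right .
    qed
    finally show ?thesis .
  qed
  define z where "z = mat_det E2 (m + n) Q"
  have z: "z \<in> carrier E2"
    unfolding z_def using Q by (intro cring.mat_det_closed[OF E2.M_cring])
  obtain Z where Z: "\<And>i j. Z i j \<in> carrier E2"
    "\<And>i j. i < m + n \<Longrightarrow> j < m + n \<Longrightarrow> (\<Oplus>\<^bsub>E2\<^esub> k\<in>{..<m + n}. Z i k \<otimes>\<^bsub>E2\<^esub> Q k j) = (if i = j then z else \<zero>\<^bsub>E2\<^esub>)"
  proof (rule cring.mat_det_adjugate[OF E2.M_cring, of "m + n" Q])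
    fix Z assume Z: "\<And>i j. Z i j \<in> carrier E2" "\<And>i j. i < m + n \<Longrightarrow> j < m + n \<Longrightarrow>
      (\<Oplus>\<^bsub>E2\<^esub> k\<in>{..<m + n}. Z i k \<otimes>\<^bsub>E2\<^esub> Q k j) = (if i = j then mat_det E2 (m + n) Q else \<zero>\<^bsub>E2\<^esub>)"
    show thesis
      by (rule that[of Z]) (simp_all add: Z z_def)
  qed (rule Q)
  \<comment> \<open>The determinant trick: multiply \<open>Q V = 0\<close> by the adjugate of
    \<open>Q\<close>.\<close>
  have zV: "z \<otimes>\<^bsub>E2\<^esub> V j = \<zero>\<^bsub>E2\<^esub>" if j: "j < m + n" for j
  proof -
    have "z \<otimes>\<^bsub>E2\<^esub> V j = (\<Oplus>\<^bsub>E2\<^esub> k\<in>{..<m + n}. if j = k then z \<otimes>\<^bsub>E2\<^esub> V k else \<zero>\<^bsub>E2\<^esub>)"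
      using j z V by (intro E2.M.finsum_singleton[symmetric]) auto
    also have "\<dots> = (\<Oplus>\<^bsub>E2\<^esub> k\<in>{..<m + n}. (\<Oplus>\<^bsub>E2\<^esub> i\<in>{..<m + n}. Z j i \<otimes>\<^bsub>E2\<^esub> Q i k) \<otimes>\<^bsub>E2\<^esub> V k)"
      using Z(2)[OF j] z V by (intro E2.M.finsum_cong') auto
    also have "\<dots> = (\<Oplus>\<^bsub>E2\<^esub> i\<in>{..<m + n}. Z j i \<otimes>\<^bsub>E2\<^esub> (\<Oplus>\<^bsub>E2\<^esub> k\<in>{..<m + n}. Q i k \<otimes>\<^bsub>E2\<^esub> V k))"
      using Z(1) Q V by (intro cring.finsum_mult_assoc[OF E2.M_cring, symmetric]) auto
    also have "\<dots> = (\<Oplus>\<^bsub>E2\<^esub> i\<in>{..<m + n}. \<zero>\<^bsub>E2\<^esub>)"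
      using Z(1) QV by (intro E2.M.finsum_cong') auto
    finally show ?thesis
      by (simp add: E2.M.finsum_zero)
  qed
  have \<mu>N: "\<mu> (N1 i l) = \<zero>\<^bsub>B\<^esub>" if "i < m" "l < n" for i l
    using N1J[OF that] by (simp add: J_def)
  have \<mu>N2: "\<mu> (N2 i l) = \<zero>\<^bsub>B\<^esub>" if "i < n" "l < n" for i l
    using N2J[OF that] by (simp add: J_def)
  have "\<mu> z = mat_det B (m + n) (\<lambda>i j. \<mu> (Q i j))"
    unfolding z_def using Q by (intro mat_det_ring_hom[OF \<mu>_hom])
  \<comment> \<open>Entries in \<open>J\<close> vanish under \<mu>, so the right-hand blocks become
    zero and the identity, and only the corner block \<open>W\<close> contributes.\<close>
  also have "\<dots> = mat_det B m (\<lambda>i j. \<mu> (Q i j))"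
  proof (rule cring.mat_det_unit_block[OF M_cring])
    fix i j assume ij: "m \<le> i" "i < m + n" "m \<le> j" "j < m + n"
    then have *: "i - m < n" "j - m < n"
      by auto
    show "\<mu> (Q i j) = (if i = j then \<one>\<^bsub>B\<^esub> else \<zero>\<^bsub>B\<^esub>)"
      using ij Nc(2)[OF *] \<mu>N2[OF *] by (auto simp: Q_def E2.M.minus_eq)
  qed (use Q \<mu>_closed Nc \<mu>N in \<open>auto simp: Q_def\<close>)
  also have "\<dots> = mat_det B m (\<lambda>i j. W (r i) j)"
    using Wr by (intro cring.mat_det_cong[OF M_cring]) (auto simp: Q_def \<mu>_pure)
  finally have "\<mu> z = mat_det B m (\<lambda>i j. W (r i) j)" .
  moreover have "z \<otimes>\<^bsub>E2\<^esub> \<delta> (e l) = \<zero>\<^bsub>E2\<^esub>" if "l < n" for l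
    using zV[of "m + l"] that by (simp add: V_def)
  ultimately show thesis
    using z that by blast
qed

text \<open>The elements that satisfy the trace formula, rather than the Noether different itself,
  the image under \<mu> of the annihilator of \<open>J\<close>; the latter is contained in it by
  \<open>noether_different_trace\<close>. The formula is linear in \<beta>, so it extends from
  minors to the ideal they generate, which a condition on the norm would not.\<close>

definition noether where
  "noether = {\<beta> \<in> carrier B. \<exists>c\<in>{..<n} \<rightarrow> carrier B. \<forall>x\<in>carrier B.
    x \<otimes>\<^bsub>B\<^esub> \<beta> = (\<Oplus>\<^bsub>B\<^esub> l\<in>{..<n}. Tr (x \<otimes>\<^bsub>B\<^esub> e l) \<odot>\<^bsub>B\<^esub> c l)}"

lemma noetherI:
  assumes "\<beta> \<in> carrier B" "c \<in> {..<n} \<rightarrow> carrier B"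
    and "\<And>x. x \<in> carrier B \<Longrightarrow> x \<otimes>\<^bsub>B\<^esub> \<beta> = (\<Oplus>\<^bsub>B\<^esub> l\<in>{..<n}. Tr (x \<otimes>\<^bsub>B\<^esub> e l) \<odot>\<^bsub>B\<^esub> c l)"
  shows "\<beta> \<in> noether"
  unfolding noether_def using assms by blast

lemma noetherE:
  assumes "\<beta> \<in> noether"
  obtains c where "\<beta> \<in> carrier B" "c \<in> {..<n} \<rightarrow> carrier B"
    "\<forall>x\<in>carrier B. x \<otimes>\<^bsub>B\<^esub> \<beta> = (\<Oplus>\<^bsub>B\<^esub> l\<in>{..<n}. Tr (x \<otimes>\<^bsub>B\<^esub> e l) \<odot>\<^bsub>B\<^esub> c l)"
  using assms unfolding noether_def by blast

lemma noether_ideal: "ideal noether B"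
proof (rule cring.idealI'[OF M_cring])
  have tr: "Tr (x \<otimes>\<^bsub>B\<^esub> e l) \<in> carrier A" if "x \<in> carrier B" "l < n" for x l
    using that dbD(1) by (intro traceD) auto
  show "noether \<subseteq> carrier B"
    by (auto simp: noether_def)
  show "\<zero>\<^bsub>B\<^esub> \<in> noether"
  proof (rule noetherI[of _ "\<lambda>_. \<zero>\<^bsub>B\<^esub>"])
    fix x assume x: "x \<in> carrier B"
    then have "(\<Oplus>\<^bsub>B\<^esub> l\<in>{..<n}. Tr (x \<otimes>\<^bsub>B\<^esub> e l) \<odot>\<^bsub>B\<^esub> \<zero>\<^bsub>B\<^esub>) = (\<Oplus>\<^bsub>B\<^esub> l\<in>{..<n}. \<zero>\<^bsub>B\<^esub>)"
      using tr by (intro M.finsum_cong') auto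
    then show "x \<otimes>\<^bsub>B\<^esub> \<zero>\<^bsub>B\<^esub> = (\<Oplus>\<^bsub>B\<^esub> l\<in>{..<n}. Tr (x \<otimes>\<^bsub>B\<^esub> e l) \<odot>\<^bsub>B\<^esub> \<zero>\<^bsub>B\<^esub>)"
      using x by (simp add: M.finsum_zero)
  qed auto
  fix \<beta> \<gamma> assume "\<beta> \<in> noether"
  then obtain c where c: "\<beta> \<in> carrier B" "c \<in> {..<n} \<rightarrow> carrier B"
    "\<forall>x\<in>carrier B. x \<otimes>\<^bsub>B\<^esub> \<beta> = (\<Oplus>\<^bsub>B\<^esub> l\<in>{..<n}. Tr (x \<otimes>\<^bsub>B\<^esub> e l) \<odot>\<^bsub>B\<^esub> c l)"
    by (rule noetherE)
  have cc: "c l \<in> carrier B" if "l < n" for l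
    using c(2) that by auto
  {
    assume "\<gamma> \<in> noether"
    then obtain d where d: "\<gamma> \<in> carrier B" "d \<in> {..<n} \<rightarrow> carrier B"
      "\<forall>x\<in>carrier B. x \<otimes>\<^bsub>B\<^esub> \<gamma> = (\<Oplus>\<^bsub>B\<^esub> l\<in>{..<n}. Tr (x \<otimes>\<^bsub>B\<^esub> e l) \<odot>\<^bsub>B\<^esub> d l)"
      by (rule noetherE)
    have dc: "d l \<in> carrier B" if "l < n" for l
      using d(2) that by auto
    show "\<beta> \<oplus>\<^bsub>B\<^esub> \<gamma> \<in> noether"
    proof (rule noetherI[of _ "\<lambda>l. c l \<oplus>\<^bsub>B\<^esub> d l"])
      fix x assume x: "x \<in> carrier B"
      have "x \<otimes>\<^bsub>B\<^esub> (\<beta> \<oplus>\<^bsub>B\<^esub> \<gamma>) = (\<Oplus>\<^bsub>B\<^esub> l\<in>{..<n}. Tr (x \<otimes>\<^bsub>B\<^esub> e l) \<odot>\<^bsub>B\<^esub> c l \<oplus>\<^bsub>B\<^esub> Tr (x \<otimes>\<^bsub>B\<^esub> e l) \<odot>\<^bsub>B\<^esub> d l)"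
        unfolding r_distr[OF c(1) d(1) x] bspec[OF c(3) x] bspec[OF d(3) x]
        using tr[OF x] cc dc by (intro M.finsum_addf[symmetric]) auto
      also have "\<dots> = (\<Oplus>\<^bsub>B\<^esub> l\<in>{..<n}. Tr (x \<otimes>\<^bsub>B\<^esub> e l) \<odot>\<^bsub>B\<^esub> (c l \<oplus>\<^bsub>B\<^esub> d l))"
        using tr[OF x] cc dc by (intro M.finsum_cong') (auto simp: smult_r_distr)
      finally show "x \<otimes>\<^bsub>B\<^esub> (\<beta> \<oplus>\<^bsub>B\<^esub> \<gamma>) = (\<Oplus>\<^bsub>B\<^esub> l\<in>{..<n}. Tr (x \<otimes>\<^bsub>B\<^esub> e l) \<odot>\<^bsub>B\<^esub> (c l \<oplus>\<^bsub>B\<^esub> d l))" .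
    qed (use c(1) d(1) cc dc in auto)
  }
  assume \<gamma>: "\<gamma> \<in> carrier B"
  show "\<gamma> \<otimes>\<^bsub>B\<^esub> \<beta> \<in> noether"
  proof (rule noetherI[of _ "\<lambda>l. \<gamma> \<otimes>\<^bsub>B\<^esub> c l"])
    fix x assume x: "x \<in> carrier B"
    have "x \<otimes>\<^bsub>B\<^esub> (\<gamma> \<otimes>\<^bsub>B\<^esub> \<beta>) = \<gamma> \<otimes>\<^bsub>B\<^esub> (x \<otimes>\<^bsub>B\<^esub> \<beta>)"
      using x \<gamma> c(1) by (rule m_lcomm)
    also have "\<dots> = (\<Oplus>\<^bsub>B\<^esub> l\<in>{..<n}. Tr (x \<otimes>\<^bsub>B\<^esub> e l) \<odot>\<^bsub>B\<^esub> (\<gamma> \<otimes>\<^bsub>B\<^esub> c l))"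
      unfolding bspec[OF c(3) x] using tr[OF x] c(2) by (intro linear_map_lin_comb[OF module_axioms mult_linear[OF \<gamma>]]) auto
    finally show "x \<otimes>\<^bsub>B\<^esub> (\<gamma> \<otimes>\<^bsub>B\<^esub> \<beta>) = (\<Oplus>\<^bsub>B\<^esub> l\<in>{..<n}. Tr (x \<otimes>\<^bsub>B\<^esub> e l) \<odot>\<^bsub>B\<^esub> (\<gamma> \<otimes>\<^bsub>B\<^esub> c l))" .
  qed (use c(1) \<gamma> cc in auto)
qed

text \<open>The Fitting ideal is defined as a union over all presentations, so the minors of an
  arbitrary one have to be lifted, not just those of the presentation built from the dual
  basis.\<close>

lemma fitting_ideal_subset_noether: "fitting_ideal_0 B \<Omega> \<subseteq> noether"
proof -
  have "Idl\<^bsub>B\<^esub> (maximal_minors B k m W) \<subseteq> noether" if pres: "presentation B \<Omega> m x k W" for m x k W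
  proof (rule ring.genideal_minimal[OF cring.axioms(1)[OF M_cring] noether_ideal], rule subsetI)
    fix \<beta> assume "\<beta> \<in> maximal_minors B k m W"
    then obtain r where r: "\<beta> = mat_det B m (\<lambda>i j. W (r i) j)" "r ` {..<m} \<subseteq> {..<k}"
      by (auto simp: maximal_minors_def)
    obtain z where z: "z \<in> carrier E2" "\<mu> z = \<beta>" "\<And>l. l < n \<Longrightarrow> z \<otimes>\<^bsub>E2\<^esub> \<delta> (e l) = \<zero>\<^bsub>E2\<^esub>"
      using minor_lifts_to_annihilator[OF pres r(2)] r(1) by metis
    have sym: "z \<otimes>\<^bsub>E2\<^esub> pure2 \<one>\<^bsub>B\<^esub> (e l) = z \<otimes>\<^bsub>E2\<^esub> pure2 (e l) \<one>\<^bsub>B\<^esub>" if "l < n" for l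
    proof -
      have "z \<otimes>\<^bsub>E2\<^esub> pure2 \<one>\<^bsub>B\<^esub> (e l) \<ominus>\<^bsub>E2\<^esub> z \<otimes>\<^bsub>E2\<^esub> pure2 (e l) \<one>\<^bsub>B\<^esub> = \<zero>\<^bsub>E2\<^esub>"
        using z(3)[OF that] z(1) dbD(1)[OF that] by (simp add: \<delta>_def E2.M.minus_eq E2.r_distr E2.r_minus)
      then show ?thesis
        using z(1) dbD(1)[OF that] by (simp add: E2.M.diff_eq_zero_iff)
    qed
    obtain c where "c \<in> {..<n} \<rightarrow> carrier B"
      "\<And>x. x \<in> carrier B \<Longrightarrow> x \<otimes>\<^bsub>B\<^esub> \<mu> z = (\<Oplus>\<^bsub>B\<^esub> l\<in>{..<n}. Tr (x \<otimes>\<^bsub>B\<^esub> e l) \<odot>\<^bsub>B\<^esub> c l)"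
      using noether_different_trace[OF z(1) sym] by blast
    then show "\<beta> \<in> noether"
      using z(2) \<mu>_closed[OF z(1)] by (intro noetherI) auto
  qed
  then show ?thesis
    unfolding fitting_ideal_0_def by blast
qed

section \<open>Norms and the unramified case\<close>

lemma norm_fitting_ideal:
  assumes "b \<in> fitting_ideal_0 B \<Omega>"
  shows "algebra_norm A B b \<in> discriminant_ideal A B"
proof -
  have "b \<in> noether"
    using assms fitting_ideal_subset_noether by blast
  then show ?thesis
    by (rule noetherE) (rule norm_in_discriminant_ideal, assumption+, erule (1) bspec)
qed

lemma norm_one: "algebra_norm A B \<one>\<^bsub>B\<^esub> = \<one>"
proof -
  have "algebra_norm A B \<one>\<^bsub>B\<^esub> = mat_det A n (\<lambda>k l. (free_gen A l k \<ominus> f k (e l)) \<oplus> f k (\<one>\<^bsub>B\<^esub> \<otimes>\<^bsub>B\<^esub> e l))"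
    unfolding algebra_norm_def by (rule endo_det_eq[OF db mult_linear[OF one_closed]])
  also have "\<dots> = mat_det A n (\<lambda>k l. if k = l then \<one> else \<zero>)"
    using dbD by (intro R.mat_det_cong) (auto simp: free_gen_def R.minus_eq R.a_assoc R.l_neg)
  finally show ?thesis
    by (simp add: R.mat_det_identity)
qed

lemma unramified_discriminant:
  assumes "carrier \<Omega> = {\<zero>\<^bsub>\<Omega>\<^esub>}"
  shows "discriminant_ideal A B = carrier A"
proof -
  have "presentation B \<Omega> 0 (\<lambda>_. \<zero>\<^bsub>\<Omega>\<^esub>) 0 (\<lambda>_ _. \<zero>\<^bsub>B\<^esub>)"
    using assms by (auto simp: presentation_def)
  then have "Idl\<^bsub>B\<^esub> (maximal_minors B 0 0 (\<lambda>_ _. \<zero>\<^bsub>B\<^esub>)) \<subseteq> fitting_ideal_0 B \<Omega>"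
    unfolding fitting_ideal_0_def by blast
  moreover have minors: "maximal_minors B 0 0 (\<lambda>_ _. \<zero>\<^bsub>B\<^esub>) = {\<one>\<^bsub>B\<^esub>}"
    by (auto simp: maximal_minors_def cring.mat_det_0[OF M_cring] intro!: exI[of _ id] strict_mono_onI)
  have "\<one>\<^bsub>B\<^esub> \<in> Idl\<^bsub>B\<^esub> {\<one>\<^bsub>B\<^esub>}"
    using ring.genideal_self[OF cring.axioms(1)[OF M_cring], of "{\<one>\<^bsub>B\<^esub>}"] by auto
  ultimately have "\<one>\<^bsub>B\<^esub> \<in> fitting_ideal_0 B \<Omega>"
    by (auto simp: minors)
  then have "\<one> \<in> discriminant_ideal A B"
    using norm_fitting_ideal norm_one by metis
  moreover have "ideal (discriminant_ideal A B) A"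
    using is_discriminant_ideal by (simp add: is_discriminant_ideal_def)
  ultimately show ?thesis
    by (rule ideal.one_imp_carrier[rotated])
qed

end

theorem mainTheorem2:
  fixes A :: "('a, 'k) ring_scheme" and B :: "('a, 'b, 'm) module_scheme"
  assumes "algebra A B" and "fg_projective A B"
  shows "(finitely_presented B (kaehler_differentials A B) \<and>
          (\<forall>b \<in> fitting_ideal_0 B (kaehler_differentials A B).
             algebra_norm A B b \<in> discriminant_ideal A B)) \<and>
         (carrier (kaehler_differentials A B) = {\<zero>\<^bsub>kaehler_differentials A B\<^esub>} \<longrightarrow>
            discriminant_ideal A B = carrier A)"
proof -
  interpret algebra A B
    by fact
  obtain n i p where "direct_summand A B n i p"
    using assms(2) unfolding fg_projective_def by blast
  then have "dual_basis A B n (\<lambda>l. p (free_gen A l)) (\<lambda>l x. i x l)"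
    by (rule direct_summand_dual_basis)
  then interpret projective_algebra A B n "\<lambda>l. p (free_gen A l)" "\<lambda>l x. i x l"
    by (intro projective_algebra.intro projective_algebra_axioms.intro assms(1))
  show ?thesis
    using kaehler_finitely_presented norm_fitting_ideal unramified_discriminant by blast
qed

end
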